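(* Let $p\ge1$ be an integer, $\gamma\ge1$, and let the solution $u$ of the fractional diffusion problem satisfy the regularity property $$\|u^{(j)}(t)\|_1\le M\,t^{\sigma-j}\qquad\text{for all }1\le j\le p+1,\ t\in(0,T],$$ for some positive constants $M$ and $\sigma$. Let $\mathcal M_\gamma$ be the graded mesh $t_n=(nk)^\gamma$, $0\le n\le N$, with $k=T^{1/\gamma}/N$, and let $\mathbf p=(1,p,\dots,p)$ (degree $1$ on the first subinterval, degree $p$ on all others). Let $U\in\mathcal W(\mathcal M_\gamma,\mathbf p)$ be the DG approximation with $U^0_-=u_0$. Then $$\|U-u\|_{L_\infty(L_2)}\le C\times\begin{cases}k^{\min\{\gamma(\sigma+\frac{\alpha}{2}),\,2+\frac{\alpha}{2}\}}&\text{for }p=1,\\[2pt] k^{\min\{\gamma(\sigma+\frac{\alpha}{2}),\,p+1+\frac{\alpha}{2}\}-\frac12}&\text{for }p\ge2,\end{cases}$$ where $C$ is a constant that depends only on $T$, $\alpha$, $\gamma$, $\sigma$ and $p$ (and on $M$ and the fixed data $\Omega$, $K$); in particular it is independent of $N$.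
   Context: Fix $-1<\alpha<0$, $T>0$, a bounded polyhedral domain $\Omega$, and a constant $K>0$ (the diffusivity). $\langle\cdot,\cdot\rangle$ and $\|\cdot\|$ are the inner product and norm of $L_2(\Omega)$; $\|\cdot\|_1$ is the norm of $H^1(\Omega)$; $u^{(j)}=\partial^ju/\partial t^j$. The operator $Au=-\mathrm{div}(K\nabla u)$ with homogeneous Dirichlet boundary conditions has a complete orthonormal eigensystem $\{\phi_m\}_{m\ge1}$ in $L_2(\Omega)$ with eigenvalues $0<\lambda_1\le\lambda_2\le\cdots$. The associated bilinear form on $H^1_0(\Omega)\times H^1_0(\Omega)$ is $A(v,w)=K\langle\nabla v,\nabla w\rangle=\sum_{m\ge1}\lambda_m\langle v,\phi_m\rangle\langle w,\phi_m\rangle$. With $\omega_{\alpha+1}(t)=t^{\alpha}/\Gamma(\alpha+1)$, the Riemann–Liouville fractional derivative of order $-\alpha$ is $\mathcal B_\alpha v(t)=\frac{\partial}{\partial t}\int_0^t\omega_{\alpha+1}(t-s)v(s)\,ds$. The fractional diffusion problem is $u'+\mathcal B_\alpha Au=f$ on $\Omega\times(0,T]$, $u|_{t=0}=u_0$, with homogeneous Dirichlet boundary conditions. For a partition $\mathcal M$: $0=t_0<t_1<\cdots<t_N=T$ with $I_n=(t_{n-1},t_n)$ and a degree vector $\mathbf p=(p_1,\dots,p_N)$, $\mathbb P_{p_n}$ is the space of polynomials in $t$ of degree $\le p_n$ with coefficients in $H^1_0(\Omega)$, and $\mathcal W(\mathcal M,\mathbf p)=\{v:[0,T]\to H^1_0(\Omega):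 v|_{I_n}\in\mathbb P_{p_n},\ 1\le n\le N\}$. One writes $v^n_-=v(t_n^-)$, $v^n_+=v(t_n^+)$ for one-sided limits, and $\|\phi\|_{L_\infty(L_2)}:=\max_{1\le n\le N}\sup_{t\in I_n}\|\phi(t)\|$. The DG approximation $U\in\mathcal W(\mathcal M,\mathbf p)$, with prescribed starting value $U^0_-$, is determined by: for every $1\le n\le N$ and every $X\in\mathbb P_{p_n}$, $$\langle U^{n-1}_+-U^{n-1}_-,X^{n-1}_+\rangle+\int_{t_{n-1}}^{t_n}\Big(\langle U',X\rangle+A(\mathcal B_\alpha U,X)\Big)\,dt=\int_{t_{n-1}}^{t_n}\langle f,X\rangle\,dt .$$ *)

theory Defs
  imports "HOL-Analysis.Analysis"
begin

section \<open>The Hilbert space of square-integrable functions\<close>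

definition square_integrable :: "('a::euclidean_space \<Rightarrow> real) \<Rightarrow> bool" where
  "square_integrable f \<longleftrightarrow>
     f \<in> borel_measurable lebesgue \<and> integrable lebesgue (\<lambda>x. (f x)\<^sup>2)"

definition l2_rel :: "('a::euclidean_space \<Rightarrow> real) \<Rightarrow> ('a \<Rightarrow> real) \<Rightarrow> bool" where
  "l2_rel f g \<longleftrightarrow>
     square_integrable f \<and> square_integrable g \<and> (AE x in lebesgue. f x = g x)"

lemma square_integrable_mult:
  assumes "square_integrable f" "square_integrable g"
  shows "integrable lebesgue (\<lambda>x. f x * g x)"
proof (rule Bochner_Integration.integrable_bound)
  show "integrable lebesgue (\<lambda>x. (f x)\<^sup>2 + (g x)\<^sup>2)"
    using assms by (auto simp: square_integrable_def)
  show "(\<lambda>x. f x * g x) \<in> borel_measurable lebesgue"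
    using assms by (auto simp: square_integrable_def)
  have "\<bar>f x * g x\<bar> \<le> (f x)\<^sup>2 + (g x)\<^sup>2" for x
    using sum_squares_bound[of "\<bar>f x\<bar>" "\<bar>g x\<bar>"] mult_nonneg_nonneg[of "\<bar>f x\<bar>" "\<bar>g x\<bar>"]
    unfolding abs_mult power2_abs by linarith
  then show "AE x in lebesgue. norm (f x * g x) \<le> norm ((f x)\<^sup>2 + (g x)\<^sup>2)"
    by simp
qed

lemma square_integrable_zero [simp]: "square_integrable (\<lambda>x. 0)"
  by (simp add: square_integrable_def)

lemma square_integrable_scale:
  "square_integrable f \<Longrightarrow> square_integrable (\<lambda>x. c * f x)"
  by (auto simp: square_integrable_def power_mult_distrib intro!: borel_measurable_times)

lemma square_integrable_add:
  assumes "square_integrable f" "square_integrable g"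
  shows "square_integrable (\<lambda>x. f x + g x)"
  using assms square_integrable_mult[OF assms]
  by (auto simp: square_integrable_def power2_sum mult.assoc)

lemma square_integrable_minus:
  "square_integrable f \<Longrightarrow> square_integrable (\<lambda>x. - f x)"
  using square_integrable_scale[of f "-1"] by simp

lemma square_integrable_diff:
  "square_integrable f \<Longrightarrow> square_integrable g \<Longrightarrow> square_integrable (\<lambda>x. f x - g x)"
  using square_integrable_add[of f "\<lambda>x. - g x"] square_integrable_minus[of g] by simp

quotient_type (overloaded) 'a l2 = "'a::euclidean_space \<Rightarrow> real" / partial: l2_rel
proof (rule part_equivpI)
  show "\<exists>f::'a \<Rightarrow> real. l2_rel f f"
    by (rule exI[of _ "\<lambda>x. 0"]) (simp add: l2_rel_def)
  show "symp (l2_rel :: ('a \<Rightarrow> real) \<Rightarrow> _)"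
    by (rule sympI) (auto simp: l2_rel_def elim: AE_mp)
  show "transp (l2_rel :: ('a \<Rightarrow> real) \<Rightarrow> _)"
    by (rule transpI) (auto simp: l2_rel_def elim: AE_mp)
qed

instantiation l2 :: (euclidean_space) real_vector
begin

lift_definition zero_l2 :: "'a l2" is "\<lambda>x. 0"
  by (simp add: l2_rel_def)

lift_definition plus_l2 :: "'a l2 \<Rightarrow> 'a l2 \<Rightarrow> 'a l2" is "\<lambda>f g x. f x + g x"
  by (auto simp: l2_rel_def square_integrable_add)

lift_definition minus_l2 :: "'a l2 \<Rightarrow> 'a l2 \<Rightarrow> 'a l2" is "\<lambda>f g x. f x - g x"
  by (auto simp: l2_rel_def square_integrable_diff)

lift_definition uminus_l2 :: "'a l2 \<Rightarrow> 'a l2" is "\<lambda>f x. - f x"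
  by (auto simp: l2_rel_def square_integrable_minus)

lift_definition scaleR_l2 :: "real \<Rightarrow> 'a l2 \<Rightarrow> 'a l2" is "\<lambda>c f x. c * f x"
  by (auto simp: l2_rel_def square_integrable_scale)

instance
  by standard
    (transfer; auto simp: l2_rel_def algebra_simps square_integrable_add
       square_integrable_diff square_integrable_minus square_integrable_scale;
     fail)+

end

instantiation l2 :: (euclidean_space) real_inner
begin

lift_definition inner_l2 :: "'a l2 \<Rightarrow> 'a l2 \<Rightarrow> real"
  is "\<lambda>f g. integral\<^sup>L lebesgue (\<lambda>x. f x * g x)"
  by (rule integral_cong_AE) (auto simp: l2_rel_def square_integrable_def)

definition norm_l2 :: "'a l2 \<Rightarrow> real" where
  "norm_l2 v = sqrt (inner v v)"

definition dist_l2 :: "'a l2 \<Rightarrow> 'a l2 \<Rightarrow> real" where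
  "dist_l2 v w = norm (v - w)"

definition sgn_l2 :: "'a l2 \<Rightarrow> 'a l2" where
  "sgn_l2 v = v /\<^sub>R norm v"

definition uniformity_l2 :: "('a l2 \<times> 'a l2) filter" where
  "uniformity_l2 = (INF e\<in>{0<..}. principal {(v, w). dist v w < e})"

definition open_l2 :: "'a l2 set \<Rightarrow> bool" where
  "open_l2 S \<longleftrightarrow> (\<forall>v\<in>S. \<forall>\<^sub>F (v', w) in uniformity. v' = v \<longrightarrow> w \<in> S)"

instance
proof
  fix u v w :: "'a l2" and r :: real
  show "dist u v = norm (u - v)" by (fact dist_l2_def)
  show "sgn u = u /\<^sub>R norm u" by (fact sgn_l2_def)
  show "uniformity = (INF e\<in>{0<..}. principal {(v::'a l2, w). dist v w < e})"
    by (fact uniformity_l2_def)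
  show "open S \<longleftrightarrow> (\<forall>v\<in>S. \<forall>\<^sub>F (v', w) in uniformity. v' = v \<longrightarrow> w \<in> S)" for S :: "'a l2 set"
    by (fact open_l2_def)
  show "norm u = sqrt (inner u u)" by (fact norm_l2_def)
  show "inner u v = inner v u"
    by transfer (simp add: mult.commute)
  show "inner (u + v) w = inner u w + inner v w"
    by transfer (simp add: l2_rel_def distrib_right square_integrable_mult)
  show "inner (r *\<^sub>R u) v = r * inner u v"
    by transfer (simp add: mult.assoc)
  show "0 \<le> inner u u"
    by transfer simp
  show "inner u u = 0 \<longleftrightarrow> u = 0"
  proof transfer
    fix f :: "'a \<Rightarrow> real"
    assume "l2_rel f f"
    then have f: "square_integrable f" by (simp add: l2_rel_def)
    have "integral\<^sup>L lebesgue (\<lambda>x. f x * f x) = 0 \<longleftrightarrow> (AE x in lebesgue. f x * f x = 0)"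
      by (rule integral_nonneg_eq_0_iff_AE) (use square_integrable_mult[OF f f] in auto)
    then show "integral\<^sup>L lebesgue (\<lambda>x. f x * f x) = 0 \<longleftrightarrow> l2_rel f (\<lambda>x. 0)"
      using f by (simp add: l2_rel_def)
  qed
qed

end

text \<open>
  \<open>L\<^sub>2(\<Omega>)\<close> is identified, through extension by zero, with the subspace of those classes that
  vanish almost everywhere outside \<open>\<Omega>\<close>; on it, \<^const>\<open>inner\<close> and \<^const>\<open>norm\<close> are those of
  \<open>L\<^sub>2(\<Omega>)\<close>.
\<close>

lift_definition vanishes_outside :: "'a::euclidean_space set \<Rightarrow> 'a l2 \<Rightarrow> bool"
  is "\<lambda>\<Omega> f. AE x in lebesgue. x \<notin> \<Omega> \<longrightarrow> f x = 0"
  by (rule iffI) (auto simp: l2_rel_def elim: AE_mp)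

definition L2 :: "'a::euclidean_space set \<Rightarrow> 'a l2 set" where
  "L2 \<Omega> = {v. vanishes_outside \<Omega> v}"


section \<open>Sobolev spaces\<close>

text \<open>Infinitely differentiable: every iterated partial derivative exists and is Frechet
  differentiable at every point.\<close>

coinductive smooth :: "('a::euclidean_space \<Rightarrow> real) \<Rightarrow> bool" where
  "\<lbrakk>\<forall>x. f differentiable (at x);
    \<forall>i\<in>Basis. smooth (\<lambda>x. frechet_derivative f (at x) i)\<rbrakk> \<Longrightarrow> smooth f"

definition test_functions :: "'a::euclidean_space set \<Rightarrow> ('a \<Rightarrow> real) set" where
  "test_functions \<Omega> = {\<phi>. smooth \<phi> \<and> compact (closure {x. \<phi> x \<noteq> 0}) \<and>
     closure {x. \<phi> x \<noteq> 0} \<subseteq> \<Omega>}"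

definition is_weak_partial ::
  "'a::euclidean_space set \<Rightarrow> 'a \<Rightarrow> 'a l2 \<Rightarrow> 'a l2 \<Rightarrow> bool" where
  "is_weak_partial \<Omega> i v g \<longleftrightarrow> g \<in> L2 \<Omega> \<and>
     (\<forall>\<phi>\<in>test_functions \<Omega>.
        inner v (abs_l2 (\<lambda>x. frechet_derivative \<phi> (at x) i)) = - inner g (abs_l2 \<phi>))"

definition weak_partial :: "'a::euclidean_space set \<Rightarrow> 'a \<Rightarrow> 'a l2 \<Rightarrow> 'a l2" where
  "weak_partial \<Omega> i v = (THE g. is_weak_partial \<Omega> i v g)"

definition H1 :: "'a::euclidean_space set \<Rightarrow> 'a l2 set" where
  "H1 \<Omega> = {v \<in> L2 \<Omega>. \<forall>i\<in>Basis. \<exists>g. is_weak_partial \<Omega> i v g}"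

definition grad_inner :: "'a::euclidean_space set \<Rightarrow> 'a l2 \<Rightarrow> 'a l2 \<Rightarrow> real" where
  "grad_inner \<Omega> v w = (\<Sum>i\<in>Basis. inner (weak_partial \<Omega> i v) (weak_partial \<Omega> i w))"

definition H1_norm :: "'a::euclidean_space set \<Rightarrow> 'a l2 \<Rightarrow> real" where
  "H1_norm \<Omega> v = sqrt ((norm v)\<^sup>2 + grad_inner \<Omega> v v)"

definition H10 :: "'a::euclidean_space set \<Rightarrow> 'a l2 set" where
  "H10 \<Omega> = {v \<in> H1 \<Omega>. \<exists>\<phi>. (\<forall>n. \<phi> n \<in> test_functions \<Omega>) \<and>
     (\<lambda>n. H1_norm \<Omega> (v - abs_l2 (\<phi> n))) \<longlonglongrightarrow> 0}"

definition polyhedral_domain :: "'a::euclidean_space set \<Rightarrow> bool" where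
  "polyhedral_domain \<Omega> \<longleftrightarrow> \<Omega> \<noteq> {} \<and> connected \<Omega> \<and>
     (\<exists>\<P>. finite \<P> \<and> (\<forall>P\<in>\<P>. polytope P) \<and> \<Omega> = interior (\<Union>\<P>))"


section \<open>The fractional diffusion problem\<close>

definition omega :: "real \<Rightarrow> real \<Rightarrow> real" where
  "omega \<beta> t = t powr (\<beta> - 1) / Gamma \<beta>"

text \<open>Functions of time live on \<open>[0,T]\<close>, so time derivatives are taken relative to the time
  interval; they are two-sided in its interior and one-sided at \<open>T\<close>.\<close>

definition frac_integral :: "real \<Rightarrow> (real \<Rightarrow> 'b::real_normed_vector) \<Rightarrow> real \<Rightarrow> 'b" where
  "frac_integral \<alpha> v t = integral {0..t} (\<lambda>s. omega (\<alpha> + 1) (t - s) *\<^sub>R v s)"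

definition frac_deriv ::
  "real \<Rightarrow> real \<Rightarrow> (real \<Rightarrow> 'b::real_normed_vector) \<Rightarrow> real \<Rightarrow> 'b" where
  "frac_deriv T \<alpha> v t = vector_derivative (frac_integral \<alpha> v) (at t within {0..T})"

primrec time_deriv :: "real \<Rightarrow> nat \<Rightarrow> (real \<Rightarrow> 'b::real_normed_vector) \<Rightarrow> real \<Rightarrow> 'b" where
  "time_deriv T 0 u = u"
| "time_deriv T (Suc j) u =
     (\<lambda>t. vector_derivative (time_deriv T j u) (at t within {0<..T}))"

definition diff_form :: "'a::euclidean_space set \<Rightarrow> real \<Rightarrow> 'a l2 \<Rightarrow> 'a l2 \<Rightarrow> real" where
  "diff_form \<Omega> K v w = K * grad_inner \<Omega> v w"

text \<open>The equation \<open>u' + \<B>\<^sub>\<alpha> A u = f\<close> is read variationally: \<open>A u(t)\<close> is the functional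
  \<open>w \<mapsto> A(u(t), w)\<close> on \<open>H\<^sup>1\<^sub>0(\<Omega>)\<close>, to which \<open>\<B>\<^sub>\<alpha>\<close> is applied for each fixed \<open>w\<close>. No
  regularity such as \<open>A u(t) \<in> L\<^sub>2(\<Omega>)\<close> is required.\<close>

definition fractional_diffusion_solution ::
  "'a::euclidean_space set \<Rightarrow> real \<Rightarrow> real \<Rightarrow> real \<Rightarrow> (real \<Rightarrow> 'a l2) \<Rightarrow> 'a l2 \<Rightarrow> (real \<Rightarrow> 'a l2) \<Rightarrow> bool"
where
  "fractional_diffusion_solution \<Omega> K T \<alpha> f u0 u \<longleftrightarrow>
     continuous_on {0..T} u \<and> u 0 = u0 \<and> u0 \<in> L2 \<Omega> \<and>
     (\<forall>t\<in>{0<..T}.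
        f t \<in> L2 \<Omega> \<and> u t \<in> H10 \<Omega> \<and>
        u differentiable (at t within {0<..T}) \<and>
        (\<forall>w\<in>H10 \<Omega>.
           (\<lambda>s. omega (\<alpha> + 1) (t - s) * diff_form \<Omega> K (u s) w) integrable_on {0..t} \<and>
           frac_integral \<alpha> (\<lambda>s. diff_form \<Omega> K (u s) w) differentiable (at t within {0..T}) \<and>
           inner (time_deriv T 1 u t) w + frac_deriv T \<alpha> (\<lambda>s. diff_form \<Omega> K (u s) w) t
             = inner (f t) w))"

definition regularity ::
  "'a::euclidean_space set \<Rightarrow> real \<Rightarrow> nat \<Rightarrow> real \<Rightarrow> real \<Rightarrow> (real \<Rightarrow> 'a l2) \<Rightarrow> bool" where
  "regularity \<Omega> T p M \<sigma> u \<longleftrightarrow>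
     (\<forall>j\<in>{1..p+1}. \<forall>t\<in>{0<..T}.
        time_deriv T (j - 1) u differentiable (at t within {0<..T}) \<and>
        time_deriv T j u t \<in> H1 \<Omega> \<and>
        H1_norm \<Omega> (time_deriv T j u t) \<le> M * t powr (\<sigma> - real j))"


section \<open>The discontinuous Galerkin scheme\<close>

definition time_polys :: "'b::real_normed_vector set \<Rightarrow> nat \<Rightarrow> (real \<Rightarrow> 'b) set" where
  "time_polys V d = {X. \<exists>c. (\<forall>j\<le>d. c j \<in> V) \<and> X = (\<lambda>t. \<Sum>j\<le>d. t ^ j *\<^sub>R c j)}"

text \<open>A mesh \<open>0 = t\<^sub>0 < \<dots> < t\<^sub>N = T\<close> is given by its nodes \<open>\<tau> n\<close> for \<open>n \<le> N\<close>, a degree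
  vector by \<open>d n\<close> for \<open>1 \<le> n \<le> N\<close>.\<close>

definition mesh_interval :: "(nat \<Rightarrow> real) \<Rightarrow> nat \<Rightarrow> real set" where
  "mesh_interval \<tau> n = {\<tau> (n - 1)<..<\<tau> n}"

definition dg_space ::
  "'a::euclidean_space set \<Rightarrow> (nat \<Rightarrow> real) \<Rightarrow> nat \<Rightarrow> (nat \<Rightarrow> nat) \<Rightarrow> (real \<Rightarrow> 'a l2) set" where
  "dg_space \<Omega> \<tau> N d = {v. (\<forall>t\<in>{0..\<tau> N}. v t \<in> H10 \<Omega>) \<and>
     (\<forall>n\<in>{1..N}. \<exists>X\<in>time_polys (H10 \<Omega>) (d n). \<forall>t\<in>mesh_interval \<tau> n. v t = X t)}"

definition left_value :: "'b::t2_space \<Rightarrow> (nat \<Rightarrow> real) \<Rightarrow> (real \<Rightarrow> 'b) \<Rightarrow> nat \<Rightarrow> 'b" where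
  "left_value u0 \<tau> v n = (if n = 0 then u0 else Lim (at_left (\<tau> n)) v)"

definition right_value :: "(nat \<Rightarrow> real) \<Rightarrow> (real \<Rightarrow> 'b::t2_space) \<Rightarrow> nat \<Rightarrow> 'b" where
  "right_value \<tau> v n = Lim (at_right (\<tau> n)) v"

definition dg_solution ::
  "'a::euclidean_space set \<Rightarrow> real \<Rightarrow> real \<Rightarrow> (nat \<Rightarrow> real) \<Rightarrow> nat \<Rightarrow> (nat \<Rightarrow> nat) \<Rightarrow>
   (real \<Rightarrow> 'a l2) \<Rightarrow> 'a l2 \<Rightarrow> (real \<Rightarrow> 'a l2) \<Rightarrow> bool"
where
  "dg_solution \<Omega> K \<alpha> \<tau> N d f u0 U \<longleftrightarrow>
     U \<in> dg_space \<Omega> \<tau> N d \<and>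
     (\<forall>n\<in>{1..N}. \<forall>X\<in>time_polys (H10 \<Omega>) (d n).
        inner (right_value \<tau> U (n - 1) - left_value u0 \<tau> U (n - 1)) (right_value \<tau> X (n - 1))
        + integral {\<tau> (n - 1)..\<tau> n} (\<lambda>t. inner (vector_derivative U (at t)) (X t)
            + diff_form \<Omega> K (frac_deriv (\<tau> N) \<alpha> U t) (X t))
        = integral {\<tau> (n - 1)..\<tau> n} (\<lambda>t. inner (f t) (X t)))"

definition graded_mesh :: "real \<Rightarrow> real \<Rightarrow> nat \<Rightarrow> nat \<Rightarrow> real" where
  "graded_mesh T \<gamma> N n = (real n * (T powr (1 / \<gamma>) / real N)) powr \<gamma>"

definition graded_degrees :: "nat \<Rightarrow> nat \<Rightarrow> nat" where
  "graded_degrees p n = (if n = 1 then 1 else p)"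

definition Linf_L2_norm :: "(nat \<Rightarrow> real) \<Rightarrow> nat \<Rightarrow> (real \<Rightarrow> 'b::real_normed_vector) \<Rightarrow> real" where
  "Linf_L2_norm \<tau> N \<phi> = Max ((\<lambda>n. SUP t\<in>mesh_interval \<tau> n. norm (\<phi> t)) ` {1..N})"

end

theory Submission
  imports Defs "Jordan_Normal_Form.Determinant" "HOL-Computational_Algebra.Polynomial"
begin

text \<open>
  Write \<open>\<theta> = U - P\<close> and \<open>\<eta> = P - u\<close>, where on every cell \<open>P\<close> interpolates \<open>u\<close> at the right end point
  and has the same moments up to degree \<open>d\<^sub>n - 1\<close>. Testing the error equation with \<open>\<theta>\<close> gives an energy
  identity. Integration by parts in time turns the memory term \<open>A(\<B>\<^sub>\<alpha>\<theta>, \<theta>)\<close> into weighted double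
  integrals of \<open>\<bar>\<theta>(s) - \<theta>(t)\<bar>\<^sup>2\<close>, because \<open>\<omega>\<^sub>\<alpha>\<^sub>+\<^sub>1\<close> is positive and decreasing; by inverse inequalities
  these control \<open>\<theta>\<close> on each pair of neighbouring cells with weight \<open>k\<^sub>n\<^sup>1\<^sup>+\<^sup>\<alpha>\<close>. As \<open>\<eta>\<close> has (nearly)
  vanishing mean on every cell, its fractional integral is smaller than \<open>\<eta>\<close> by a factor \<open>k\<^sub>n\<^sup>1\<^sup>+\<^sup>\<alpha>\<close>, and
  Cauchy--Schwarz over the cells closes the estimate: if \<open>\<eta>\<close> is of size \<open>\<delta> k\<^sub>n\<^sup>-\<^sup>\<alpha>\<^sup>/\<^sup>2\<close>, the nodal errors
  are \<open>O(\<delta>)\<close>. For \<open>p = 1\<close> they control \<open>\<theta>\<close> on the whole cell; for \<open>p \<ge> 2\<close> the energy does,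
  at the cost of \<open>(t\<^sub>n / k\<^sub>n)\<^sup>1\<^sup>/\<^sup>2 \<le> N\<^sup>1\<^sup>/\<^sup>2\<close>. On the graded mesh \<open>\<delta>\<close> is \<open>O(k\<^sup>q)\<close> with
  \<open>q = min (\<gamma> (\<sigma> + \<alpha>/2)) (p + 1 + \<alpha>/2)\<close>.

  No Bochner integral on \<open>L\<^sub>2\<close> is needed: the moments of \<open>u\<close> in \<open>P\<close> are replaced by Riemann sums on a
  subdivision so fine that the resulting moments of \<open>\<eta>\<close> are negligible.
\<close>

section \<open>Polynomials in time\<close>

text \<open>\<open>u\<close> is differentiable in time only in the \<open>L2\<close> norm, while the
  memory term needs gradient bounds. Against a test function the gradient pairing is an
  \<open>L2\<close> pairing with minus the Laplacian, so scalar calculus applies; density of test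
  functions carries the bounds to \<open>H10\<close>. The kernel is singular at 0, so positivity is
  proved for the shifted kernels \<open>omega (\<alpha> + 1) (x + h)\<close> before h tends to 0.
  The derivative of a discrete memory term may blow up at nodes, so the equation is used with the
  time derivative on the test function (\<open>bracket\<close>). The weights match: the energy
  controls squared neighbour differences with weight k^(1+\<alpha>), and the residual carries
  \<delta> k^(1+\<alpha>/2) = \<delta> k^(1/2) k^((1+\<alpha>)/2), so Cauchy-Schwarz leaves only the
  sum of the steps. The estimate is run on the mesh cut off at each node, which makes every node a
  final one. Taylor expansion fails at t = 0, but a constant approximates well enough on the small
  first cell; hence degree 1 there.\<close>

lemma square_system_inverse:
 fixes A :: "nat \<Rightarrow> nat \<Rightarrow> real"
 assumes inj: "!!x. (!!i. i < n ==> (\<Sum>j<n. A i j * x j) = 0) ==> (!!j. j < n ==> x j = 0)"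
 shows "\<exists>B. \<forall>i<n. \<forall>k<n. (\<Sum>j<n. B i j * A j k) = (if i = k then 1 else 0) \<and>
  (\<Sum>j<n. A i j * B j k) = (if i = k then 1 else 0)"
proof -
 define M where "M = mat n n (\<lambda>(i, j). A i j)"
 have M: "M \<in> carrier_mat n n" by (simp add: M_def)
 have mult: "(X * Y) $$ (i, k) = (\<Sum>j<n. X $$ (i, j) * Y $$ (j, k))"
  if "X \<in> carrier_mat n n" "Y \<in> carrier_mat n n" "i < n" "k < n" for X Y :: "real mat" and i k
  using that by (simp add: scalar_prod_def atLeast0LessThan)
 have "det M \<noteq> 0"
 proof
  assume "det M = 0"
  then obtain v where v: "v \<in> carrier_vec n" "v \<noteq> 0\<^sub>v n" "M *\<^sub>v v = 0\<^sub>v n"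
   using det_0_iff_vec_prod_zero_field[OF M] by blast
  have "(\<Sum>j<n. A i j * vec_index v j) = 0" if "i < n" for i
  proof -
   have "vec_index (M *\<^sub>v v) i = (\<Sum>j<n. A i j * vec_index v j)"
    using that v(1) by (simp add: M_def scalar_prod_def atLeast0LessThan)
   then show ?thesis using v(3) that by simp
  qed
  then have "vec_index v j = 0" if "j < n" for j using inj that by blast
  then have "v = 0\<^sub>v n" using v(1) by (intro eq_vecI) auto
  with v(2) show False by simp
 qed
 from det_non_zero_imp_unit[OF M this, of "()"]
 obtain N where N: "N \<in> carrier_mat n n" "N * M = 1\<^sub>m n" "M * N = 1\<^sub>m n"
  unfolding Units_def ring_mat_def by auto
 have "(\<Sum>j<n. N $$ (i, j) * A j k) = (if i = k then 1 else 0) \<and>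
  (\<Sum>j<n. A i j * N $$ (j, k)) = (if i = k then 1 else 0)" if ik: "i < n" "k < n" for i k
 proof
  show "(\<Sum>j<n. N $$ (i, j) * A j k) = (if i = k then 1 else 0)"
   using mult[OF N(1) M ik] N(2) ik by (simp add: M_def)
  show "(\<Sum>j<n. A i j * N $$ (j, k)) = (if i = k then 1 else 0)"
   using mult[OF M N(1) ik] N(3) ik by (simp add: M_def)
 qed
 then show ?thesis by (intro exI[of _ "\<lambda>i j. N $$ (i, j)"]) blast
qed

lemma poly_eq_sum:
 fixes q :: "real poly"
 assumes "degree q \<le> d"
 shows "poly q x = (\<Sum>i\<le>d. coeff q i * x ^ i)"
proof -
 have "poly q x = (\<Sum>i\<le>degree q. coeff q i * x ^ i)" by (rule poly_altdef)
 also have "\<dots> = (\<Sum>i\<le>d. coeff q i * x ^ i)"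
  using assms by (intro sum.mono_neutral_left) (auto simp: coeff_eq_0)
 finally show ?thesis .
qed

lemma integrable_poly: "poly (q::real poly) integrable_on {a..b}"
 by (intro integrable_continuous_real continuous_intros)

lemma poly_sq_integral_0:
 fixes q :: "real poly"
 assumes "integral {0..1} (\<lambda>x. (poly q x)^2) = 0"
 shows "q = 0"
proof -
 have "\<forall>x\<in>{0..1}. (poly q x)^2 = 0"
  using assms
  by (subst (asm) integral_eq_0_iff) (auto intro!: continuous_intros)
 then have "infinite {x. poly q x = 0}"
  using infinite_Icc[of 0 "1::real"] finite_subset[of "{0..1}" "{x. poly q x = 0}"] by fastforce
 then show ?thesis using poly_roots_finite by blast
qed

text \<open>The moments of a polynomial on [0,1] are its coefficients multiplied by the Gram matrix
  of the monomials. That matrix is injective, since a polynomial with vanishing moments is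
  orthogonal to itself. Its inverse recovers the coefficients from the moments, each of which is at
  most the L1 norm.\<close>

lemma poly_coeff_bound:
 obtains C where "C > 0" "!!(q::real poly) i. degree q \<le> d ==> \<bar>coeff q i\<bar> \<le> C * integral {0..1} (\<lambda>x. \<bar>poly q x\<bar>)"
proof -
 define A where "A i j = integral {0..1::real} (\<lambda>x. x ^ i * x ^ j)" for i j :: nat
 have moment: "integral {0..1} (\<lambda>x. x ^ i * poly q x) = (\<Sum>j<Suc d. A i j * coeff q j)"
  if "degree q \<le> d" for q :: "real poly" and i
 proof -
  have "integral {0..1} (\<lambda>x. x ^ i * poly q x) = integral {0..1} (\<lambda>x. \<Sum>j<Suc d. (x ^ i * x ^ j) * coeff q j)"
   by (intro integral_cong) (simp add: poly_eq_sum[OF that] sum_distrib_left lessThan_Suc_atMost mult_ac)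
  also have "\<dots> = (\<Sum>j<Suc d. integral {0..1} (\<lambda>x. (x ^ i * x ^ j) * coeff q j))"
   by (intro integral_sum integrable_continuous_real continuous_intros) auto
  finally show ?thesis by (simp add: A_def)
 qed
 have inj: "x j = 0" if x: "!!i. i < Suc d ==> (\<Sum>j<Suc d. A i j * x j) = 0" and j: "j < Suc d" for x j
 proof -
  define q where "q = (\<Sum>j\<le>d. monom (x j) j)"
  have cq: "coeff q j = (if j \<le> d then x j else 0)" for j
   by (simp add: q_def coeff_sum if_distrib cong: if_cong)
  have dq: "degree q \<le> d" by (rule degree_le) (simp add: cq)
  have m0: "integral {0..1} (\<lambda>x. x ^ i * poly q x) = 0" if "i \<le> d" for i
   using moment[OF dq, of i] x[of i] that by (simp add: cq less_Suc_eq_le)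
  have "integral {0..1} (\<lambda>x. (poly q x)^2) = integral {0..1} (\<lambda>x. \<Sum>i\<le>d. coeff q i * (x ^ i * poly q x))"
   by (intro integral_cong) (simp add: power2_eq_square poly_eq_sum[OF dq] sum_distrib_right mult_ac)
  also have "\<dots> = (\<Sum>i\<le>d. integral {0..1} (\<lambda>x. coeff q i * (x ^ i * poly q x)))"
   by (intro integral_sum integrable_continuous_real continuous_intros) auto
  also have "\<dots> = 0" by (simp add: m0)
  finally have "q = 0" by (rule poly_sq_integral_0)
  then show ?thesis using cq[of j] j by auto
 qed
 have "\<exists>B. \<forall>i<Suc d. \<forall>k<Suc d. (\<Sum>j<Suc d. B i j * A j k) = (if i = k then 1 else 0) \<and>
  (\<Sum>j<Suc d. A i j * B j k) = (if i = k then 1 else 0)"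
  by (rule square_system_inverse) (rule inj)
 then obtain B where B: "!!i k. i < Suc d ==> k < Suc d ==> (\<Sum>j<Suc d. B i j * A j k) = (if i = k then 1 else 0)"
  by blast
 \<comment> \<open>Summing all entries of the inverse gives one constant for every row; adding 1
   makes it positive.\<close>
 define C where "C = (\<Sum>i<Suc d. \<Sum>j<Suc d. \<bar>B i j\<bar>) + 1"
 show ?thesis
 proof (rule that)
  show "C > 0" unfolding C_def by (smt (verit) sum_nonneg abs_ge_zero)
  fix q :: "real poly" and i
  assume q: "degree q \<le> d"
  let ?I = "integral {0..1} (\<lambda>x. \<bar>poly q x\<bar>)"
  have I0: "?I \<ge> 0" by (intro integral_nonneg integrable_continuous_real continuous_intros) auto
  show "\<bar>coeff q i\<bar> \<le> C * ?I"
  proof (cases "i \<le> d")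
   case False
   then have "coeff q i = 0" using q by (intro coeff_eq_0) auto
   then show ?thesis using I0 \<open>C > 0\<close> by simp
  next
   case True
   have m: "\<bar>integral {0..1} (\<lambda>x. x ^ j * poly q x)\<bar> \<le> ?I" for j
    by (rule integral_norm_bound_integral[where f="\<lambda>x. x ^ j * poly q x" and g="\<lambda>x. \<bar>poly q x\<bar>", unfolded real_norm_def])
      (auto intro!: integrable_continuous_real continuous_intros simp: abs_mult power_le_one mult_left_le_one_le)
   have "(\<Sum>j<Suc d. B i j * integral {0..1} (\<lambda>x. x ^ j * poly q x))
     = (\<Sum>k<Suc d. (\<Sum>j<Suc d. B i j * A j k) * coeff q k)"
    by (subst moment[OF q], simp only: sum_distrib_left sum_distrib_right mult.assoc) (rule sum.swap)
   also have "\<dots> = coeff q i"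
    using True by (simp add: B less_Suc_eq_le if_distrib[of "\<lambda>z. z * _"] cong: if_cong del: sum.lessThan_Suc)
   finally have "\<bar>coeff q i\<bar> = \<bar>\<Sum>j<Suc d. B i j * integral {0..1} (\<lambda>x. x ^ j * poly q x)\<bar>"
    by (rule arg_cong[OF sym])
   also have "\<dots> \<le> (\<Sum>j<Suc d. \<bar>B i j * integral {0..1} (\<lambda>x. x ^ j * poly q x)\<bar>)"
    by (rule sum_abs)
   also have "\<dots> \<le> (\<Sum>j<Suc d. \<bar>B i j\<bar> * ?I)"
    unfolding abs_mult by (intro sum_mono mult_left_mono m abs_ge_zero)
   also have "\<dots> = (\<Sum>j<Suc d. \<bar>B i j\<bar>) * ?I" by (simp only: sum_distrib_right)
   also have "\<dots> \<le> C * ?I"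
   proof (rule mult_right_mono[OF _ I0])
    have "(\<Sum>j<Suc d. \<bar>B i j\<bar>) \<le> (\<Sum>i<Suc d. \<Sum>j<Suc d. \<bar>B i j\<bar>)"
     by (rule member_le_sum[where f="\<lambda>i. \<Sum>j<Suc d. \<bar>B i j\<bar>"]) (use True in \<open>auto intro!: sum_nonneg\<close>)
    then show "(\<Sum>j<Suc d. \<bar>B i j\<bar>) \<le> C" unfolding C_def by linarith
   qed
   finally show ?thesis .
  qed
 qed
qed

text \<open>The value at the right end point and the moments up to degree \<open>d - 1\<close> form
  a square linear system for the coefficients. The \<open>\<pi> i\<close> are the columns of its
  inverse that are dual to the moments. The last property is the reproduction formula behind the
  quasi-optimality of the projection.\<close>

lemma dg_projection_basis:
 obtains \<pi> :: "nat \<Rightarrow> real poly" where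
  "!!i. i < d ==> degree (\<pi> i) \<le> d"
  "!!i. i < d ==> poly (\<pi> i) 1 = 0"
  "!!i j. i < d ==> j < d ==> integral {0..1} (\<lambda>x. x ^ j * poly (\<pi> i) x) = (if i = j then 1 else 0)"
  "!!q x. degree q \<le> d ==> poly q 1 = 0 ==>
    poly q x = (\<Sum>i<d. poly (\<pi> i) x * integral {0..1} (\<lambda>y. y ^ i * poly q y))"
proof -
 define A where "A i j = (if i < d then integral {0..1::real} (\<lambda>x. x ^ i * x ^ j) else 1)" for i j :: nat
 have moment: "(\<Sum>j<Suc d. A i j * coeff q j) = (if i < d then integral {0..1} (\<lambda>x. x ^ i * poly q x) else poly q 1)"
  if "degree q \<le> d" for q :: "real poly" and i
 proof (cases "i < d")
  case True
  have "integral {0..1} (\<lambda>x. x ^ i * poly q x) = integral {0..1} (\<lambda>x. \<Sum>j<Suc d. (x ^ i * x ^ j) * coeff q j)"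
   by (intro integral_cong) (simp add: poly_eq_sum[OF that] sum_distrib_left lessThan_Suc_atMost mult_ac)
  also have "\<dots> = (\<Sum>j<Suc d. integral {0..1} (\<lambda>x. (x ^ i * x ^ j) * coeff q j))"
   by (intro integral_sum integrable_continuous_real continuous_intros) auto
  finally show ?thesis using True by (simp add: A_def)
 next
  case False
  then show ?thesis by (simp add: A_def poly_eq_sum[OF that] lessThan_Suc_atMost)
 qed
 have poly_of: "degree (\<Sum>j\<le>d. monom (x j) j) \<le> d"
   "coeff (\<Sum>j\<le>d. monom (x j) j) i = (if i \<le> d then x i else 0)" for x :: "nat \<Rightarrow> real" and i
 proof -
  have *: "coeff (\<Sum>j\<le>d. monom (x j) j) i = (if i \<le> d then x i else 0)" for i
   by (simp add: coeff_sum if_distrib cong: if_cong)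
  show "coeff (\<Sum>j\<le>d. monom (x j) j) i = (if i \<le> d then x i else 0)" by (rule *)
  show "degree (\<Sum>j\<le>d. monom (x j) j) \<le> d" by (rule degree_le) (simp add: *)
 qed
 \<comment> \<open>As q(1) = 0, q = (x - 1) r with deg r < d, so r is an admissible test polynomial.
   The integral of (1 - x) r^2 then vanishes and r = 0 on [0,1), hence everywhere.\<close>
 have zero: "q = 0" if q: "degree q \<le> d" "poly q 1 = 0" "!!i. i < d ==> integral {0..1} (\<lambda>x. x ^ i * poly q x) = 0"
  for q :: "real poly"
 proof (rule ccontr)
  assume "q \<noteq> 0"
  from q(2) obtain r where r: "q = [:-1, 1:] * r" by (metis poly_eq_0_iff_dvd dvdE)
  have "r \<noteq> 0" using \<open>q \<noteq> 0\<close> r by auto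
  then have "degree q = Suc (degree r)" unfolding r by (subst degree_mult_eq) auto
  then have dr: "degree r < d" using q(1) by simp
  have dr': "degree r \<le> d - 1" using dr by simp
  have "integral {0..1} (\<lambda>x. (1 - x) * (poly r x)\<^sup>2) = - integral {0..1} (\<lambda>x. poly r x * poly q x)"
   by (subst integral_neg[symmetric], rule integral_cong) (simp add: r algebra_simps power2_eq_square)
  also have "integral {0..1} (\<lambda>x. poly r x * poly q x) = integral {0..1} (\<lambda>x. \<Sum>i\<le>d-1. coeff r i * (x ^ i * poly q x))"
   by (rule integral_cong) (simp add: poly_eq_sum[OF dr'] sum_distrib_right sum_distrib_left mult_ac)
  also have "\<dots> = (\<Sum>i\<le>d-1. integral {0..1} (\<lambda>x. coeff r i * (x ^ i * poly q x)))"
   by (intro integral_sum integrable_continuous_real continuous_intros) auto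
  also have "\<dots> = 0" using dr by (intro sum.neutral) (auto simp: q(3))
  finally have *: "integral {0..1} (\<lambda>x. (1 - x) * (poly r x)\<^sup>2) = 0" by simp
  have "\<forall>x\<in>{0..1}. (1 - x) * (poly r x)\<^sup>2 = 0"
   using * by (subst (asm) integral_eq_0_iff) (auto intro!: continuous_intros)
  then have "poly r x = 0" if "x \<in> {0..<1}" for x using that by (auto dest!: bspec[of _ _ x])
  then have "{0..<1} \<subseteq> {x. poly r x = 0}" by blast
  then have "infinite {x. poly r x = 0}"
   by (rule infinite_super) (rule infinite_Ico, simp)
  then show False using poly_roots_finite[OF \<open>r \<noteq> 0\<close>] by simp
 qed
 have inj: "x j = 0" if x: "!!i. i < Suc d ==> (\<Sum>j<Suc d. A i j * x j) = 0" and j: "j < Suc d" for x j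
 proof -
  define q where "q = (\<Sum>j\<le>d. monom (x j) j)"
  have dq: "degree q \<le> d" and cq: "!!i. coeff q i = (if i \<le> d then x i else 0)"
   unfolding q_def using poly_of by auto
  have "(\<Sum>j<Suc d. A i j * coeff q j) = (\<Sum>j<Suc d. A i j * x j)" for i
   by (rule sum.cong) (auto simp: cq)
  then have m: "(if i < d then integral {0..1} (\<lambda>x. x ^ i * poly q x) else poly q 1) = 0" if "i \<le> d" for i
   using moment[OF dq, of i] x[of i] that by simp
  have "q = 0"
  proof (rule zero[OF dq])
   show "poly q 1 = 0" using m[of d] by simp
   show "integral {0..1} (\<lambda>x. x ^ i * poly q x) = 0" if "i < d" for i using m[of i] that by simp
  qed
  then show ?thesis using cq[of j] j by auto
 qed
 have "\<exists>B. \<forall>i<Suc d. \<forall>k<Suc d. (\<Sum>j<Suc d. B i j * A j k) = (if i = k then 1 else 0) \<and>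
  (\<Sum>j<Suc d. A i j * B j k) = (if i = k then 1 else 0)"
  by (rule square_system_inverse) (rule inj)
 then obtain B where B:
  "!!i k. i < Suc d ==> k < Suc d ==> (\<Sum>j<Suc d. A i j * B j k) = (if i = k then 1 else 0)"
  by blast
 define \<pi> where "\<pi> i = (\<Sum>j\<le>d. monom (B j i) j)" for i
 have d\<pi>: "degree (\<pi> i) \<le> d" and c\<pi>: "coeff (\<pi> i) j = (if j \<le> d then B j i else 0)" for i j
  unfolding \<pi>_def using poly_of[of "\<lambda>j. B j i"] by auto
 have m\<pi>: "(if j < d then integral {0..1} (\<lambda>x. x ^ j * poly (\<pi> i) x) else poly (\<pi> i) 1) = (if i = j then 1 else 0)"
  if "i \<le> d" "j \<le> d" for i j
 proof -
  have "(\<Sum>l<Suc d. A j l * coeff (\<pi> i) l) = (\<Sum>l<Suc d. A j l * B l i)"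
   by (rule sum.cong) (auto simp: c\<pi>)
  then show ?thesis using B[of j i] that moment[OF d\<pi>, of j i] by auto
 qed
 show ?thesis
 proof (rule that)
  fix i assume i: "i < d"
  show "degree (\<pi> i) \<le> d" by (rule d\<pi>)
  show p1: "poly (\<pi> i) 1 = 0" using m\<pi>[of i d] i by simp
  fix j assume j: "j < d"
  show mm: "integral {0..1} (\<lambda>x. x ^ j * poly (\<pi> i) x) = (if i = j then 1 else 0)"
   using m\<pi>[of i j] i j by simp
 next
  fix q :: "real poly" and x assume q: "degree q \<le> d" "poly q 1 = 0"
  let ?c = "\<lambda>i. integral {0..1} (\<lambda>y. y ^ i * poly q y)"
  have "q - (\<Sum>i<d. Polynomial.smult (?c i) (\<pi> i)) = 0"
  proof (rule zero)
   show "degree (q - (\<Sum>i<d. Polynomial.smult (?c i) (\<pi> i))) \<le> d"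
    by (intro degree_diff_le q(1) degree_sum_le) (auto simp: d\<pi>)
   have p1: "poly (\<pi> i) 1 = 0" if "i < d" for i using m\<pi>[of i d] that by simp
   show "poly (q - (\<Sum>i<d. Polynomial.smult (?c i) (\<pi> i))) 1 = 0"
    using q(2) by (simp add: poly_sum p1)
   fix j assume j: "j < d"
   have "integral {0..1} (\<lambda>x. x ^ j * poly (q - (\<Sum>i<d. Polynomial.smult (?c i) (\<pi> i))) x)
     = integral {0..1} (\<lambda>x. x ^ j * poly q x - (\<Sum>i<d. ?c i * (x ^ j * poly (\<pi> i) x)))"
    by (rule integral_cong) (simp add: poly_sum algebra_simps sum_distrib_left)
   also have "\<dots> = ?c j - integral {0..1} (\<lambda>x. \<Sum>i<d. ?c i * (x ^ j * poly (\<pi> i) x))"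
    by (intro integral_diff integrable_continuous_real continuous_intros)
   also have "integral {0..1} (\<lambda>x. \<Sum>i<d. ?c i * (x ^ j * poly (\<pi> i) x))
     = (\<Sum>i<d. integral {0..1} (\<lambda>x. ?c i * (x ^ j * poly (\<pi> i) x)))"
    by (intro integral_sum integrable_continuous_real continuous_intros) auto
   also have "\<dots> = (\<Sum>i<d. if i = j then ?c i else 0)"
    using m\<pi>[of _ j] j by (intro sum.cong) auto
   also have "\<dots> = ?c j" using j by simp
   finally show "integral {0..1} (\<lambda>x. x ^ j * poly (q - (\<Sum>i<d. Polynomial.smult (?c i) (\<pi> i))) x) = 0" by simp
  qed
  then have "q = (\<Sum>i<d. Polynomial.smult (?c i) (\<pi> i))" by simp
  then have "poly q x = poly (\<Sum>i<d. Polynomial.smult (?c i) (\<pi> i)) x" by (rule arg_cong)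
  then show "poly q x = (\<Sum>i<d. poly (\<pi> i) x * ?c i)" by (simp add: poly_sum mult.commute)
 qed
qed

section \<open>Semi-definite forms\<close>

text \<open>Common interface for the \<open>L2\<close> inner product and the gradient form. Only
  semi-definiteness is asked for, because the gradient form will be extended to the whole space,
  where it need not be definite.\<close>

locale psd_form =
 fixes a :: "'v::real_vector \<Rightarrow> 'v \<Rightarrow> real"
 assumes add_left: "a (u + v) w = a u w + a v w"
  and scale_left: "a (r *\<^sub>R u) w = r * a u w"
  and sym: "a u v = a v u"
  and nonneg: "a u u \<ge> 0"
begin

definition nrm :: "'v \<Rightarrow> real" where "nrm v = sqrt (a v v)"

lemma add_right: "a w (u + v) = a w u + a w v" by (metis add_left sym)

lemma scale_right: "a w (r *\<^sub>R u) = r * a w u" by (metis scale_left sym)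

lemma zero_left [simp]: "a 0 w = 0" using scale_left[of 0 0 w] by simp

lemma zero_right [simp]: "a w 0 = 0" by (metis zero_left sym)

lemma minus_left: "a (- u) w = - a u w" using scale_left[of "-1" u w] by simp

lemma minus_right: "a w (- u) = - a w u" by (metis minus_left sym)

lemma diff_left: "a (u - v) w = a u w - a v w"
 using add_left[of u "- v" w] by (simp add: minus_left)

lemma diff_right: "a w (u - v) = a w u - a w v" by (metis diff_left sym)

lemma sum_left: "a (\<Sum>i\<in>I. f i) w = (\<Sum>i\<in>I. a (f i) w)"
 by (induction I rule: infinite_finite_induct) (simp_all add: add_left)

lemma sum_right: "a w (\<Sum>i\<in>I. f i) = (\<Sum>i\<in>I. a w (f i))"
 by (simp add: sym[of w] sum_left)

lemmas linear_simps = add_left add_right scale_left scale_right minus_left minus_right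
 diff_left diff_right sum_left sum_right

lemma nrm_nonneg [simp]: "nrm v \<ge> 0" by (simp add: nrm_def nonneg)

lemma nrm_square: "(nrm v)\<^sup>2 = a v v" by (simp add: nrm_def nonneg)

lemma nrm_zero [simp]: "nrm 0 = 0" by (simp add: nrm_def)

lemma cauchy_schwarz: "\<bar>a u v\<bar> \<le> nrm u * nrm v"
proof -
 have main: "(a u v)\<^sup>2 \<le> a u u * a v v"
 proof (cases "a v v = 0")
  case True
  have "a u v = 0"
  proof (rule ccontr)
   assume n: "a u v \<noteq> 0"
   \<comment> \<open>With \<open>a v v = 0\<close> the quadratic in the parameter is affine, and
     this choice gives it the value -1.\<close>
   define r where "r = - (a u u + 1) / (2 * a u v)"
   have "0 \<le> a (u + r *\<^sub>R v) (u + r *\<^sub>R v)" by (rule nonneg)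
   also have "\<dots> = a u u + 2 * r * a u v"
    using True by (simp add: linear_simps sym[of v u])
   also have "2 * r * a u v = - (a u u + 1)" using n by (simp add: r_def)
   finally show False by simp
  qed
  then show ?thesis using True by simp
 next
  case False
  then have pos: "a v v > 0" using nonneg[of v] by linarith
  define r where "r = - a u v / a v v"
  have "0 \<le> a (u + r *\<^sub>R v) (u + r *\<^sub>R v)" by (rule nonneg)
  also have "\<dots> = a u u - (a u v)\<^sup>2 / a v v"
   using pos by (simp add: linear_simps sym[of v u] r_def power2_eq_square field_simps)
  finally show ?thesis using pos by (simp add: field_simps)
 qed
 have "\<bar>a u v\<bar> = sqrt ((a u v)\<^sup>2)" by simp
 also have "\<dots> \<le> sqrt (a u u * a v v)" using main by (rule real_sqrt_le_mono)
 finally show ?thesis by (simp add: nrm_def real_sqrt_mult)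
qed

lemma nrm_triangle: "nrm (u + v) \<le> nrm u + nrm v"
proof (rule power2_le_imp_le)
 have "(nrm (u + v))\<^sup>2 = (nrm u)\<^sup>2 + (nrm v)\<^sup>2 + 2 * a u v"
  by (simp add: nrm_square linear_simps sym[of v u])
 also have "\<dots> \<le> (nrm u + nrm v)\<^sup>2"
  using cauchy_schwarz[of u v] by (simp add: power2_sum)
 finally show "(nrm (u + v))\<^sup>2 \<le> (nrm u + nrm v)\<^sup>2" .
qed simp

lemma nrm_scale: "nrm (r *\<^sub>R v) = \<bar>r\<bar> * nrm v"
 by (simp add: nrm_def linear_simps real_sqrt_mult flip: mult.assoc)

lemma nrm_minus: "nrm (- v) = nrm v" using nrm_scale[of "-1" v] by simp

lemma nrm_triangle_diff: "nrm (u - v) \<le> nrm u + nrm v"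
 using nrm_triangle[of u "- v"] by (simp add: nrm_minus)

lemma nrm_minus_commute: "nrm (u - v) = nrm (v - u)"
 using nrm_minus[of "u - v"] by simp

lemma nrm_le_of_form:
 assumes "a v v \<le> B * nrm v" "B \<ge> 0"
 shows "nrm v \<le> B"
proof (cases "nrm v = 0")
 case False
 then have "nrm v > 0" using nrm_nonneg[of v] by linarith
 then show ?thesis using assms(1) by (simp add: power2_eq_square flip: nrm_square)
qed (use assms in simp)

end

interpretation inner_form: psd_form "inner :: 'v::real_inner \<Rightarrow> 'v \<Rightarrow> real"
 rewrites "inner_form.nrm = norm"
proof -
 show *: "psd_form (inner :: 'v \<Rightarrow> 'v \<Rightarrow> real)"
  by unfold_locales (auto simp: inner_add_left intro: inner_commute)
 show "psd_form.nrm (inner :: 'v \<Rightarrow> 'v \<Rightarrow> real) = norm"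
  by (rule ext) (simp add: psd_form.nrm_def[OF *] norm_eq_sqrt_inner)
qed

text \<open>Weak partial derivatives are linear on \<open>H1\<close> only. A linear extension to the
  whole type turns the gradient form into a \<open>psd_form\<close>, so that the algebra of forms
  carries no membership conditions.\<close>

lemma subspace_linear_extension:
 fixes f :: "'v::real_vector \<Rightarrow> 'w::real_vector"
 assumes S: "subspace S"
  and lin: "!!u v r. u \<in> S ==> v \<in> S ==> f (u + r *\<^sub>R v) = f u + r *\<^sub>R f v"
 shows "\<exists>g. linear g \<and> (\<forall>v\<in>S. g v = f v)"
proof -
 obtain B where B: "B \<subseteq> S" "independent B" "S \<subseteq> span B"
  using maximal_independent_subset[of S] by blast
 obtain g where g: "linear g" "\<forall>x\<in>B. g x = f x"
  using linear_independent_extend[OF B(2), of f] by blast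
 have f0: "f 0 = 0" using lin[of 0 0 1] subspace_0[OF S] by simp
 have "v \<in> S \<and> g v = f v" if "v \<in> span B" for v
  using that
 proof (induction rule: span_induct_alt)
  case base
  then show ?case using f0 g(1) subspace_0[OF S] by (simp add: linear_0)
 next
  case (step c x y)
  then have "x \<in> S" using B by auto
  then show ?case using step g lin[of y x c] S
   by (auto simp: linear_add linear_scale subspace_add subspace_scale add.commute)
 qed
 then show ?thesis using g B by blast
qed

text \<open>The derivative bound may be unbounded at 0 but is integrable there. Comparison with its
  primitive \<open>B / \<sigma> * t powr \<sigma>\<close> gives a modulus of continuity that remains
  valid down to 0.\<close>

lemma derivative_chain_increment:
 fixes g :: "nat \<Rightarrow> real \<Rightarrow> real"
 assumes D: "!!t. t \<in> {0<..T} ==> (g 0 has_real_derivative g 1 t) (at t within {0<..T})"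
  and B: "!!t. t \<in> {0<..T} ==> \<bar>g 1 t\<bar> \<le> B * t powr (\<sigma> - 1)" and "\<sigma> > 0"
  and st: "0 < s" "s \<le> t" "t \<le> T"
 shows "\<bar>g 0 t - g 0 s\<bar> \<le> B / \<sigma> * (t powr \<sigma> - s powr \<sigma>)"
proof -
 have 1: "(g 1 has_integral (g 0 t - g 0 s)) {s..t}"
 proof (rule fundamental_theorem_of_calculus[OF st(2)])
  fix x assume "x \<in> {s..t}"
  then show "(g 0 has_vector_derivative g 1 x) (at x within {s..t})"
   using DERIV_subset[OF D[of x], of "{s..t}"] st
   by (force simp: has_real_derivative_iff_has_vector_derivative)
 qed
 have 2: "((\<lambda>x. B * x powr (\<sigma> - 1)) has_integral (B / \<sigma> * t powr \<sigma> - B / \<sigma> * s powr \<sigma>)) {s..t}"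
 proof (rule fundamental_theorem_of_calculus[OF st(2)])
  fix x assume "x \<in> {s..t}"
  then have "x > 0" using st by simp
  then have "((\<lambda>x. B / \<sigma> * x powr \<sigma>) has_real_derivative B * x powr (\<sigma> - 1)) (at x within {s..t})"
   using \<open>\<sigma> > 0\<close> by (auto intro!: derivative_eq_intros)
  then show "((\<lambda>x. B / \<sigma> * x powr \<sigma>) has_vector_derivative B * x powr (\<sigma> - 1)) (at x within {s..t})"
   by (simp add: has_real_derivative_iff_has_vector_derivative)
 qed
 have b: "\<bar>g 1 x\<bar> \<le> B * x powr (\<sigma> - 1)" if "x \<in> {s..t}" for x using B[of x] that st by auto
 have "g 0 t - g 0 s \<le> B / \<sigma> * t powr \<sigma> - B / \<sigma> * s powr \<sigma>"
  by (rule has_integral_le[OF 1 2]) (use b in force)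
 moreover have "- (g 0 t - g 0 s) \<le> B / \<sigma> * t powr \<sigma> - B / \<sigma> * s powr \<sigma>"
  by (rule has_integral_le[OF has_integral_neg[OF 1] 2]) (use b in force)
 ultimately show ?thesis by (simp add: right_diff_distrib abs_le_iff)
qed

text \<open>Integral form of the remainder: the weight is at most (t - c)^p and the interval has
  length t - c, which together give the power p + 1.\<close>

lemma derivative_chain_taylor:
 fixes g :: "nat \<Rightarrow> real \<Rightarrow> real"
 assumes D: "!!j t. j \<le> p ==> t \<in> {0<..T} ==> (g j has_real_derivative g (Suc j) t) (at t within {0<..T})"
  and c: "0 < c" "c \<le> t" "t \<le> T"
  and G: "!!x. x \<in> {c..t} ==> \<bar>g (Suc p) x\<bar> \<le> G"
 shows "\<bar>g 0 t - (\<Sum>i\<le>p. (t - c) ^ i / fact i * g i c)\<bar> \<le> (t - c) ^ (p + 1) * G"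
proof -
 have "G \<ge> 0" using G[of c] c by auto
 have I: "((\<lambda>x. ((t - x) ^ (Suc p - 1) / fact (Suc p - 1)) *\<^sub>R g (Suc p) x) has_integral
   g 0 t - (\<Sum>i<Suc p. ((t - c) ^ i / fact i) *\<^sub>R g i c)) {c..t}"
 proof (rule Taylor_has_integral)
  fix m x assume "m < Suc p" "c \<le> x" "x \<le> t"
  then show "(g m has_vector_derivative g (Suc m) x) (at x within {c..t})"
   using DERIV_subset[OF D[of m x], of "{c..t}"] c
   by (force simp: has_real_derivative_iff_has_vector_derivative)
 qed (use c in auto)
 have "norm (g 0 t - (\<Sum>i<Suc p. ((t - c) ^ i / fact i) *\<^sub>R g i c)) \<le> ((t - c) ^ p * G) * measure lborel {c..t}"
 proof (rule has_integral_bound_real[OF _ _ I, of _ "{}"])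
  show "norm (((t - x) ^ (Suc p - 1) / fact (Suc p - 1)) *\<^sub>R g (Suc p) x) \<le> (t - c) ^ p * G"
   if "x \<in> {c..t} - {}" for x
  proof -
   have r: "(t - x) ^ p / fact p \<le> (t - c) ^ p / 1"
    using that by (intro frac_le power_mono) auto
   then show ?thesis using mult_mono[OF r G[of x]] that \<open>G \<ge> 0\<close> c by (simp add: abs_mult)
  qed
 qed (use c \<open>G \<ge> 0\<close> in auto)
 then show ?thesis using c by (simp add: lessThan_Suc_atMost mult_ac)
qed

section \<open>Sobolev spaces\<close>

definition flat :: "real \<Rightarrow> nat \<Rightarrow> real \<Rightarrow> real" where
 "flat c m y = (if y > 0 then (1 / y) ^ m * exp (- c / y) else 0)"

lemma flat_tendsto_0:
 assumes "c > 0"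
 shows "(flat c m \<longlongrightarrow> 0) (at 0)"
proof -
 have "filterlim (\<lambda>y. c / y) at_top (at_right (0::real))"
  using filterlim_tendsto_pos_mult_at_top[OF tendsto_const[of c] assms filterlim_inverse_at_top_right]
  by (simp add: divide_inverse)
 from filterlim_compose[OF tendsto_power_div_exp_0[of m] this]
 have "((\<lambda>y. (c / y) ^ m / exp (c / y)) \<longlongrightarrow> 0) (at_right 0)" .
 from tendsto_mult_right_zero[OF this, of "(1 / c) ^ m"]
 have "((\<lambda>y. (1 / c) ^ m * ((c / y) ^ m / exp (c / y))) \<longlongrightarrow> 0) (at_right 0)" by simp
 then have R: "(flat c m \<longlongrightarrow> 0) (at_right 0)"
 proof (rule Lim_transform_eventually)
  show "\<forall>\<^sub>F y in at_right 0. (1 / c) ^ m * ((c / y) ^ m / exp (c / y)) = flat c m y"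
   using assms by (auto simp: eventually_at_filter flat_def power_divide exp_minus field_simps)
 qed
 have L: "(flat c m \<longlongrightarrow> 0) (at_left 0)"
  by (rule tendsto_eventually) (auto simp: eventually_at_filter flat_def)
 show ?thesis using L R by (simp add: filterlim_at_split)
qed

text \<open>Differentiation stays within the family: it only raises the power of 1/y, and at y = 0
  the exponential beats every such power.\<close>

lemma flat_has_derivative:
 assumes "c > 0"
 shows "(flat c m has_real_derivative c * flat c (m + 2) y - m * flat c (m + 1) y) (at y)"
proof (cases "y = 0")
 case True
 have "((\<lambda>h. (flat c m (0 + h) - flat c m 0) / h) \<longlongrightarrow> 0) (at 0)"
 proof (rule Lim_transform_eventually[OF flat_tendsto_0[OF assms, of "m + 1"]])
  show "\<forall>\<^sub>F h in at 0. flat c (m + 1) h = (flat c m (0 + h) - flat c m 0) / h"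
   by (auto simp: eventually_at_filter flat_def)
 qed
 then show ?thesis using True by (simp add: DERIV_def flat_def)
next
 case False
 then consider "y > 0" | "y < 0" by linarith
 then show ?thesis
 proof cases
  case 1
  have d1: "((\<lambda>y. 1 / y) has_real_derivative - ((1 / y)\<^sup>2)) (at y)"
   using 1 by (auto intro!: derivative_eq_intros simp: power2_eq_square)
  have "real m * (- ((1 / y)\<^sup>2) * (1 / y) ^ (m - Suc 0)) = - real m * (1 / y) ^ (m + 1)"
   by (cases m) (simp_all add: power2_eq_square divide_inverse algebra_simps)
  with DERIV_power[OF d1, of m]
  have d2: "((\<lambda>y. (1 / y) ^ m) has_real_derivative - real m * (1 / y) ^ (m + 1)) (at y)" by simp
  have d3: "((\<lambda>y. exp (- c / y)) has_real_derivative exp (- c / y) * (c * (1 / y)\<^sup>2)) (at y)"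
   using 1 by (auto intro!: derivative_eq_intros simp: power2_eq_square)
  have "((\<lambda>y. (1 / y) ^ m * exp (- c / y)) has_real_derivative c * flat c (m + 2) y - m * flat c (m + 1) y) (at y)"
   by (rule DERIV_cong[OF DERIV_mult[OF d2 d3]])
    (use 1 in \<open>simp add: flat_def power_add power2_eq_square algebra_simps\<close>)
  then show ?thesis
   by (rule has_field_derivative_transform_within[OF _ 1]) (use 1 in \<open>auto simp: flat_def dist_real_def\<close>)
 next
  case 2
  have "((\<lambda>y. 0) has_real_derivative c * flat c (m + 2) y - m * flat c (m + 1) y) (at y)"
   using 2 by (simp add: flat_def)
  then show ?thesis
   by (rule has_field_derivative_transform_within[where d="- y"]) (use 2 in \<open>auto simp: flat_def dist_real_def\<close>)
 qed
qed

text \<open>A class closed under directional derivatives, which is exactly the invariant that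
  coinduction for \<open>smooth\<close> asks for.\<close>

inductive flat_algebra :: "('a::euclidean_space \<Rightarrow> real) \<Rightarrow> bool" where
 const: "flat_algebra (\<lambda>x. r)"
| flat: "c > 0 ==> flat_algebra (\<lambda>x. flat c m (inner x b + r))"
| add: "flat_algebra f ==> flat_algebra g ==> flat_algebra (\<lambda>x. f x + g x)"
| mult: "flat_algebra f ==> flat_algebra g ==> flat_algebra (\<lambda>x. f x * g x)"

lemma flat_algebra_has_derivative:
 assumes "flat_algebra f"
 shows "\<exists>D. (\<forall>x. (f has_derivative D x) (at x)) \<and> (\<forall>i. flat_algebra (\<lambda>x. D x i))"
 using assms
proof induction
 case (const r)
 then show ?case by (intro exI[of _ "\<lambda>x i. 0"]) (auto intro: flat_algebra.const)
next
 case (flat c m b r)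
 let ?F = "\<lambda>x. c * flat c (m + 2) (inner x b + r) + (- real m) * flat c (m + 1) (inner x b + r)"
 have 1: "((\<lambda>x. flat c m (inner x b + r)) has_derivative (\<lambda>h. ?F x * inner h b)) (at x)" for x
 proof -
  have "(flat c m has_derivative (\<lambda>h. ?F x * h)) (at (inner x b + r))"
   using flat_has_derivative[OF flat, of m "inner x b + r"]
   by (simp add: has_field_derivative_def)
  moreover have "((\<lambda>x. inner x b + r) has_derivative (\<lambda>h. inner h b)) (at x)"
   by (auto intro!: derivative_eq_intros)
  ultimately show ?thesis
   using has_derivative_compose[of "\<lambda>x. inner x b + r" "\<lambda>h. inner h b" x UNIV "flat c m" "\<lambda>h. ?F x * h"]
   by simp
 qed
 have 2: "flat_algebra (\<lambda>x. ?F x * inner h b)" for h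
  by (intro flat_algebra.mult flat_algebra.add flat_algebra.const flat_algebra.flat flat)
 show ?case by (intro exI[of _ "\<lambda>x h. ?F x * inner h b"]) (use 1 2 in auto)
next
 case (add f g)
 then obtain D E where "!!x. (f has_derivative D x) (at x)" "!!i. flat_algebra (\<lambda>x. D x i)"
  "!!x. (g has_derivative E x) (at x)" "!!i. flat_algebra (\<lambda>x. E x i)" by blast
 then show ?case
  by (intro exI[of _ "\<lambda>x i. D x i + E x i"]) (auto intro: flat_algebra.add has_derivative_add)
next
 case (mult f g)
 then obtain D E where "!!x. (f has_derivative D x) (at x)" "!!i. flat_algebra (\<lambda>x. D x i)"
  "!!x. (g has_derivative E x) (at x)" "!!i. flat_algebra (\<lambda>x. E x i)" by blast
 then show ?case
  by (intro exI[of _ "\<lambda>x i. f x * E x i + D x i * g x"])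
   (auto intro!: flat_algebra.add flat_algebra.mult mult.hyps has_derivative_mult)
qed

lemma smooth_flat_algebra: "flat_algebra f ==> smooth f"
proof (coinduction arbitrary: f)
 case smooth
 obtain D where D: "!!x. (f has_derivative D x) (at x)" "!!i. flat_algebra (\<lambda>x. D x i)"
  using flat_algebra_has_derivative[OF smooth] by blast
 have "frechet_derivative f (at x) = D x" for x
  using frechet_derivative_at[OF D(1)] by simp
 then show ?case using D by (auto simp: differentiable_def)
qed

lemma smooth_has_derivative:
 "smooth f ==> (f has_derivative frechet_derivative f (at x)) (at x)"
 by (erule smooth.cases) (simp add: frechet_derivative_works)

lemma smooth_partial:
 "smooth f ==> i \<in> Basis ==> smooth (\<lambda>x. frechet_derivative f (at x) i)"
 by (erule smooth.cases) simp

lemma smooth_continuous: "smooth f ==> continuous_on S f"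
 by (meson continuous_at_imp_continuous_on has_derivative_continuous smooth_has_derivative)

lemma smooth_add_scale:
 "smooth f ==> smooth g ==> smooth (\<lambda>x. f x + c * g x)"
proof (coinduction arbitrary: f g)
 case smooth
 have D: "((\<lambda>x. f x + c * g x) has_derivative
   (\<lambda>h. frechet_derivative f (at x) h + c * frechet_derivative g (at x) h)) (at x)" for x
  using smooth_has_derivative[OF smooth(1), of x] smooth_has_derivative[OF smooth(2), of x]
  by (auto intro!: derivative_eq_intros)
 have E: "frechet_derivative (\<lambda>x. f x + c * g x) (at x) =
   (\<lambda>h. frechet_derivative f (at x) h + c * frechet_derivative g (at x) h)" for x
  using frechet_derivative_at[OF D] by simp
 show ?case
 proof (intro exI conjI)
  show "(\<lambda>x. f x + c * g x) = (\<lambda>x. f x + c * g x)" ..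
  show "\<forall>x. (\<lambda>x. f x + c * g x) differentiable at x" using D by (auto simp: differentiable_def)
  show "\<forall>i\<in>Basis. (\<exists>f' g'. (\<lambda>x. frechet_derivative (\<lambda>x. f x + c * g x) (at x) i)
    = (\<lambda>x. f' x + c * g' x) \<and> smooth f' \<and> smooth g') \<or>
    smooth (\<lambda>x. frechet_derivative (\<lambda>x. f x + c * g x) (at x) i)"
   unfolding E using smooth smooth_partial by fastforce
 qed
qed

lemma test_functions_add_scale:
 assumes "f \<in> test_functions \<Omega>" "g \<in> test_functions \<Omega>"
 shows "(\<lambda>x. f x + c * g x) \<in> test_functions \<Omega>"
proof -
 let ?S = "\<lambda>f. closure {x. f x \<noteq> (0::real)}"
 have sub: "?S (\<lambda>x. f x + c * g x) \<subseteq> ?S f \<union> ?S g"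
  unfolding closure_Un[symmetric] by (rule closure_mono) auto
 moreover have "compact (?S f \<union> ?S g)" using assms by (auto simp: test_functions_def)
 ultimately have "compact (?S (\<lambda>x. f x + c * g x))"
  by (meson bounded_subset compact_eq_bounded_closed closed_closure)
 then show ?thesis using assms sub by (auto simp: test_functions_def intro: smooth_add_scale)
qed

lemma zero_test_function: "(\<lambda>x. 0) \<in> test_functions \<Omega>"
 by (auto simp: test_functions_def intro!: smooth_flat_algebra flat_algebra.const)

lemma test_function_partial:
 assumes "f \<in> test_functions \<Omega>" "i \<in> Basis"
 shows "(\<lambda>x. frechet_derivative f (at x) i) \<in> test_functions \<Omega>"
proof -
 let ?S = "closure {x. f x \<noteq> 0}"
 have zero: "frechet_derivative f (at x) i = 0" if "x \<notin> ?S" for x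
 proof -
  have "((\<lambda>x. 0) has_derivative (\<lambda>h. 0)) (at x)" by simp
  then have "(f has_derivative (\<lambda>h. 0)) (at x)"
  proof (rule has_derivative_transform_within_open)
   show "open (- ?S)" by (simp add: open_Compl)
   show "x \<in> - ?S" using that by simp
   show "0 = f y" if "y \<in> - ?S" for y using that closure_subset[of "{x. f x \<noteq> 0}"] by auto
  qed
  from frechet_derivative_at[OF this] have "frechet_derivative f (at x) = (\<lambda>h. 0)" by (rule sym)
  then show ?thesis by simp
 qed
 then have sub: "closure {x. frechet_derivative f (at x) i \<noteq> 0} \<subseteq> ?S"
  by (intro closure_minimal) auto
 moreover have "compact ?S" using assms by (simp add: test_functions_def)
 ultimately have "compact (closure {x. frechet_derivative f (at x) i \<noteq> 0})"
  by (meson bounded_subset compact_eq_bounded_closed closed_closure)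
 then show ?thesis using assms sub smooth_partial by (auto simp: test_functions_def)
qed

text \<open>The bumps are products over the coordinates of exp(-c/y), y being the distance to either
  face. The parameter c = 1/(n+1) tends to 0, so inside the box every factor tends to 1, while each
  single bump is smooth and vanishes off the box.\<close>

lemma box_bump:
 fixes a b :: "'a::euclidean_space"
 assumes "cbox a b \<subseteq> \<Omega>"
 obtains \<phi> where "!!n::nat. \<phi> n \<in> test_functions \<Omega>" "!!n x. 0 \<le> \<phi> n x \<and> \<phi> n x \<le> 1"
  "!!n x. x \<notin> box a b ==> \<phi> n x = 0" "!!x. x \<in> box a b ==> (\<lambda>n. \<phi> n x) \<longlonglongrightarrow> 1"
proof -
 define \<phi> where "\<phi> n x = (\<Prod>i\<in>Basis. flat (1 / real (Suc n)) 0 (inner x i + - inner a i) *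
   flat (1 / real (Suc n)) 0 (inner x (- i) + inner b i))" for n and x :: 'a
 have alg: "flat_algebra (\<lambda>x. \<Prod>i\<in>I. F i x)" if "finite I" "!!i. flat_algebra (F i)"
  for I :: "'a set" and F :: "'a \<Rightarrow> 'a \<Rightarrow> real"
  using that by (induction I) (auto intro: flat_algebra.intros)
 have smooth: "smooth (\<phi> n)" for n
  unfolding \<phi>_def by (intro smooth_flat_algebra alg finite_Basis flat_algebra.intros) auto
 have f01: "0 \<le> flat (1 / real (Suc n)) 0 y \<and> flat (1 / real (Suc n)) 0 y \<le> 1" for n y
  by (auto simp: flat_def)
 have zero: "\<phi> n x = 0" if "x \<notin> box a b" for n x
 proof -
  obtain i where i: "i \<in> Basis" "\<not> (inner a i < inner x i \<and> inner x i < inner b i)"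
   using \<open>x \<notin> box a b\<close> by (auto simp: mem_box)
  then show ?thesis unfolding \<phi>_def by (intro prod_zero bexI[of _ i]) (auto simp: flat_def)
 qed
 have supp: "closure {x. \<phi> n x \<noteq> 0} \<subseteq> cbox a b" for n
 proof (rule closure_minimal)
  show "{x. \<phi> n x \<noteq> 0} \<subseteq> cbox a b" using zero[of _ n] box_subset_cbox[of a b] by blast
 qed (rule closed_cbox)
 show ?thesis
 proof (rule that)
  show "\<phi> n \<in> test_functions \<Omega>" for n
  proof -
   have "compact (closure {x. \<phi> n x \<noteq> 0})"
    using supp[of n] by (meson bounded_cbox bounded_subset compact_eq_bounded_closed closed_closure)
   then show ?thesis using smooth supp[of n] assms by (auto simp: test_functions_def)
  qed
  show "0 \<le> \<phi> n x \<and> \<phi> n x \<le> 1" for n x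
  proof -
   have g: "0 \<le> flat (1 / real (Suc n)) 0 y * flat (1 / real (Suc n)) 0 z \<and>
     flat (1 / real (Suc n)) 0 y * flat (1 / real (Suc n)) 0 z \<le> 1" for y z
    using f01[of n y] f01[of n z] by (simp add: mult_le_one)
   show ?thesis
    unfolding \<phi>_def by (intro conjI prod_nonneg prod_le_1 ballI) (use g in blast)+
  qed
  show "\<phi> n x = 0" if "x \<notin> box a b" for n x by (rule zero[OF that])
  show "(\<lambda>n. \<phi> n x) \<longlonglongrightarrow> 1" if "x \<in> box a b" for x
  proof -
   have l: "(\<lambda>n. flat (1 / real (Suc n)) 0 y) \<longlonglongrightarrow> 1" if "y > 0" for y
   proof -
    have "(\<lambda>n. exp (- (1 / real (Suc n)) / y)) \<longlonglongrightarrow> exp (- 0 / y)"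
     by (intro tendsto_intros LIMSEQ_Suc[OF lim_1_over_n]) (use that in auto)
    then show ?thesis using that by (simp add: flat_def)
   qed
   have "(\<lambda>n. \<phi> n x) \<longlonglongrightarrow> (\<Prod>i\<in>(Basis::'a set). 1 * 1)"
    unfolding \<phi>_def by (intro tendsto_prod tendsto_mult l) (use that in \<open>auto simp: mem_box\<close>)
   then show ?thesis by simp
  qed
 qed
qed

section \<open>Representatives of L2 classes and weak derivatives of test functions\<close>

lemma abs_l2_cases:
 obtains f where "square_integrable f" "v = abs_l2 f"
proof
 show "square_integrable (rep_l2 v)"
  using Quotient_rep_reflp[OF Quotient_l2, of v] by (simp add: l2_rel_def)
 show "v = abs_l2 (rep_l2 v)" using Quotient_abs_rep[OF Quotient_l2, of v] by simp
qed

lemma inner_abs_l2: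
 assumes "square_integrable f" "square_integrable g"
 shows "inner (abs_l2 f) (abs_l2 g) = integral\<^sup>L lebesgue (\<lambda>x. f x * g x)"
 by (rule inner_l2.abs_eq) (use assms in \<open>simp_all add: l2_rel_def\<close>)

lemma abs_l2_add_scale:
 assumes "square_integrable f" "square_integrable g"
 shows "abs_l2 (\<lambda>x. f x + c * g x) = abs_l2 f + c *\<^sub>R abs_l2 g"
proof -
 have "c *\<^sub>R abs_l2 g = abs_l2 (\<lambda>x. c * g x)"
  by (rule scaleR_l2.abs_eq) (use assms in \<open>simp add: l2_rel_def\<close>)
 moreover have "abs_l2 f + abs_l2 (\<lambda>x. c * g x) = abs_l2 (\<lambda>x. f x + c * g x)"
  by (rule plus_l2.abs_eq) (use assms square_integrable_scale in \<open>simp_all add: l2_rel_def\<close>)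
 ultimately show ?thesis by simp
qed

lemma abs_l2_zero: "abs_l2 (\<lambda>x. 0) = 0"
 by (simp add: zero_l2_def)

lemma L2_abs_iff:
 "square_integrable f ==> abs_l2 f \<in> L2 \<Omega> \<longleftrightarrow> (AE x in lebesgue. x \<notin> \<Omega> \<longrightarrow> f x = 0)"
 unfolding L2_def mem_Collect_eq
 by (rule vanishes_outside.abs_eq) (simp add: l2_rel_def)

lemma L2_add_scale:
 assumes "v \<in> L2 \<Omega>" "w \<in> L2 \<Omega>"
 shows "v + c *\<^sub>R w \<in> L2 \<Omega>"
proof -
 obtain f where f: "square_integrable f" "v = abs_l2 f" by (rule abs_l2_cases)
 obtain g where g: "square_integrable g" "w = abs_l2 g" by (rule abs_l2_cases)
 have "AE x in lebesgue. x \<notin> \<Omega> \<longrightarrow> f x = 0" "AE x in lebesgue. x \<notin> \<Omega> \<longrightarrow> g x = 0"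
  using assms f g L2_abs_iff by auto
 then have "AE x in lebesgue. x \<notin> \<Omega> \<longrightarrow> f x + c * g x = 0" by eventually_elim auto
 then have "abs_l2 (\<lambda>x. f x + c * g x) \<in> L2 \<Omega>"
  by (subst L2_abs_iff) (use f g square_integrable_add square_integrable_scale in auto)
 then show ?thesis using abs_l2_add_scale[OF f(1) g(1), of c] f g by simp
qed

lemma zero_L2: "0 \<in> L2 \<Omega>"
 unfolding abs_l2_zero[symmetric] by (subst L2_abs_iff) simp_all

text \<open>Translation invariance is used for \<open>lborel\<close>, whereas the L2 classes are
  defined through \<open>lebesgue\<close>; for such functions both integrals agree.\<close>

lemma compact_support_integrable:
 fixes f :: "'a::euclidean_space \<Rightarrow> real"
 assumes "continuous_on UNIV f" "compact S" "!!x. x \<notin> S ==> f x = 0"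
 shows "integrable lborel f" "integrable lebesgue f" "integral\<^sup>L lebesgue f = integral\<^sup>L lborel f"
  "f \<in> borel_measurable lebesgue"
proof -
 have "integrable lborel (\<lambda>x. indicator S x *\<^sub>R f x)"
  using assms by (intro borel_integrable_compact) (auto intro: continuous_on_subset)
 also have "(\<lambda>x. indicator S x *\<^sub>R f x) = f"
  by (rule ext) (metis assms(3) indicator_simps scaleR_one scaleR_zero_left)
 finally show i: "integrable lborel f" .
 have m: "f \<in> borel_measurable lborel" using assms(1) by (simp add: borel_measurable_continuous_onI)
 show "integrable lebesgue f" using i integrable_completion[OF m] by simp
 show "integral\<^sup>L lebesgue f = integral\<^sup>L lborel f" by (rule integral_completion[OF m])
 show "f \<in> borel_measurable lebesgue" using m by (simp add: measurable_completion)
qed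

lemma compact_support_square_integrable:
 fixes f :: "'a::euclidean_space \<Rightarrow> real"
 assumes "continuous_on UNIV f" "compact S" "!!x. x \<notin> S ==> f x = 0"
 shows "square_integrable f"
 unfolding square_integrable_def
 using compact_support_integrable[OF assms] compact_support_integrable[of "\<lambda>x. (f x)\<^sup>2" S] assms
 by (auto intro!: continuous_intros)

lemma test_function_props:
 assumes "f \<in> test_functions \<Omega>"
 obtains S where "continuous_on UNIV f" "compact S" "S \<subseteq> \<Omega>" "!!x. x \<notin> S ==> f x = 0"
proof
 show "continuous_on UNIV f" using assms smooth_continuous by (auto simp: test_functions_def)
 show "compact (closure {x. f x \<noteq> 0})" "closure {x. f x \<noteq> 0} \<subseteq> \<Omega>"
  using assms by (auto simp: test_functions_def)
 show "f x = 0" if "x \<notin> closure {x. f x \<noteq> 0}" for x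
  using that closure_subset[of "{x. f x \<noteq> 0}"] by auto
qed

lemma test_function_square_integrable: "f \<in> test_functions \<Omega> ==> square_integrable f"
 by (metis test_function_props compact_support_square_integrable)

lemma test_function_L2:
 assumes "f \<in> test_functions \<Omega>"
 shows "abs_l2 f \<in> L2 \<Omega>"
proof -
 obtain S where "continuous_on UNIV f" "compact S" "S \<subseteq> \<Omega>" "!!x. x \<notin> S ==> f x = 0" using test_function_props[OF assms] by blast
 then show ?thesis
  by (subst L2_abs_iff[OF test_function_square_integrable[OF assms]]) auto
qed

lemma lborel_integral_translate:
 fixes f :: "'a::euclidean_space \<Rightarrow> real"
 assumes "f \<in> borel_measurable borel"
 shows "integral\<^sup>L lborel (\<lambda>x. f (a + x)) = integral\<^sup>L lborel f"
 using integral_distr[of "(+) a" lborel borel f] assms by (simp add: lborel_distr_plus)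

text \<open>Difference quotients in direction \<open>i\<close> have integral 0 by translation
  invariance. The mean value theorem bounds them, and steps of length at most 1 keep their supports
  in a fixed ball, so dominated convergence applies.\<close>

lemma integral_partial_derivative_0:
 fixes f :: "'a::euclidean_space \<Rightarrow> real"
 assumes D: "!!x. (f has_derivative D x) (at x)" and i: "i \<in> Basis"
  and cont: "continuous_on UNIV (\<lambda>x. D x i)"
  and S: "compact S" "!!x. x \<notin> S ==> f x = 0" "!!x. x \<notin> S ==> D x i = 0"
 shows "integral\<^sup>L lborel (\<lambda>x. D x i) = 0"
proof -
 have cf: "continuous_on UNIV f"
  by (meson D continuous_at_imp_continuous_on has_derivative_continuous)
 then have mf: "f \<in> borel_measurable borel" by (simp add: borel_measurable_continuous_onI)
 have intf: "integrable lborel f" by (rule compact_support_integrable[OF cf S(1,2)])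
 obtain R where "\<forall>x\<in>S. norm x \<le> R" using compact_imp_bounded[OF S(1)] unfolding bounded_iff by blast
 then have R: "S \<subseteq> cball 0 R" by auto
 have "compact ((\<lambda>x. D x i) ` S)"
  by (rule compact_continuous_image[OF continuous_on_subset[OF cont] S(1)]) simp
 from compact_imp_bounded[OF this] obtain B0 where B0: "!!x. x \<in> S ==> \<bar>D x i\<bar> \<le> B0"
  unfolding bounded_iff by auto
 define B where "B = max B0 0"
 have B: "\<bar>D x i\<bar> \<le> B" for x using B0[of x] S(3)[of x] by (cases "x \<in> S") (auto simp: B_def)
 define h where "h n = 1 / real (Suc n)" for n
 have h: "0 < h n" "h n \<le> 1" for n by (auto simp: h_def)
 define s where "s n x = (f (h n *\<^sub>R i + x) - f x) / h n" for n x
 have line: "((\<lambda>t. f (t *\<^sub>R i + x)) has_real_derivative D (t *\<^sub>R i + x) i) (at t)" for t x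
 proof -
  interpret L: bounded_linear "D (t *\<^sub>R i + x)" using D by (rule has_derivative_bounded_linear)
  have "((\<lambda>t. t *\<^sub>R i + x) has_derivative (\<lambda>y. y *\<^sub>R i)) (at t)"
   by (auto intro!: derivative_eq_intros)
  from has_derivative_compose[OF this, of f "D (t *\<^sub>R i + x)"] D
  have "((\<lambda>t. f (t *\<^sub>R i + x)) has_derivative (\<lambda>y. D (t *\<^sub>R i + x) (y *\<^sub>R i))) (at t)" by simp
  moreover have "(\<lambda>y. D (t *\<^sub>R i + x) (y *\<^sub>R i)) = (*) (D (t *\<^sub>R i + x) i)"
   by (rule ext) (simp add: L.scaleR)
  ultimately show ?thesis by (simp only: has_field_derivative_def)
 qed
 have bound: "\<bar>s n x\<bar> \<le> B * indicator (cball 0 (R + 1)) x" for n x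
 proof (cases "x \<in> cball 0 (R + 1)")
  case True
  obtain z where "f (h n *\<^sub>R i + x) - f (0 *\<^sub>R i + x) = (h n - 0) * D (z *\<^sub>R i + x) i"
   using MVT2[OF h(1)[of n], of "\<lambda>t. f (t *\<^sub>R i + x)" "\<lambda>t. D (t *\<^sub>R i + x) i", OF line] by blast
  then have "s n x = D (z *\<^sub>R i + x) i" using h(1)[of n] by (simp add: s_def)
  then show ?thesis using B True by simp
 next
  case False
  have n1: "norm (h n *\<^sub>R i) \<le> 1" using h[of n] i by simp
  have "x \<notin> S" "h n *\<^sub>R i + x \<notin> S"
  proof -
   show "x \<notin> S" using False R by auto
   have "norm x \<le> norm (h n *\<^sub>R i + x) + norm (h n *\<^sub>R i)"
    using norm_triangle_ineq4[of "h n *\<^sub>R i + x" "h n *\<^sub>R i"] by simp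
   then have "norm (h n *\<^sub>R i + x) > R" using False n1 by auto
   then show "h n *\<^sub>R i + x \<notin> S" using R by auto
  qed
  then show ?thesis using False S(2) by (simp add: s_def)
 qed
 have lim: "(\<lambda>n. s n x) \<longlonglongrightarrow> D x i" for x
 proof -
  have "((\<lambda>e. (f ((0 + e) *\<^sub>R i + x) - f (0 *\<^sub>R i + x)) / e) \<longlongrightarrow> D x i) (at 0)"
   using line[of x 0] by (simp add: DERIV_def)
  moreover have "filterlim h (at 0) sequentially"
  proof (rule filterlim_atI)
   show "h \<longlonglongrightarrow> 0" unfolding h_def by (rule LIMSEQ_Suc[OF lim_1_over_n])
   show "\<forall>\<^sub>F n in sequentially. h n \<noteq> 0" by (simp add: h_def)
  qed
  ultimately show ?thesis by (auto simp: s_def[abs_def] dest: filterlim_compose)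
 qed
 have ints: "integral\<^sup>L lborel (s n) = 0" for n
 proof -
  have "integrable lborel (\<lambda>x. f (h n *\<^sub>R i + x))"
   using integrable_distr[of "(+) (h n *\<^sub>R i)" lborel borel f] intf by (simp add: lborel_distr_plus)
  then show ?thesis
   using intf unfolding s_def by (simp add: lborel_integral_translate[OF mf])
 qed
 have "(\<lambda>n. integral\<^sup>L lborel (s n)) \<longlonglongrightarrow> integral\<^sup>L lborel (\<lambda>x. D x i)"
 proof (rule integral_dominated_convergence[where w="\<lambda>x. B * indicator (cball 0 (R + 1)) x"])
  show "(\<lambda>x. D x i) \<in> borel_measurable lborel" using cont by (simp add: borel_measurable_continuous_onI)
  show "s n \<in> borel_measurable lborel" for n
   unfolding s_def using mf by measurable
  show "integrable lborel (\<lambda>x. B * indicator (cball 0 (R + 1)) x)"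
   by (intro integrable_mult_right integrable_real_indicator)
    (use emeasure_bounded_finite[OF bounded_cball] in \<open>auto simp: infinity_ennreal_def\<close>)
 qed (use lim bound in auto)
 then show ?thesis using ints LIMSEQ_unique[of "\<lambda>n. 0::real"] by auto
qed

text \<open>Integration by parts: the partial derivative of the product of two test functions has
  integral 0.\<close>

lemma test_function_weak_partial:
 fixes \<phi> \<psi> :: "'a::euclidean_space \<Rightarrow> real"
 assumes \<phi>: "\<phi> \<in> test_functions \<Omega>" and i: "i \<in> Basis"
 shows "is_weak_partial \<Omega> i (abs_l2 \<phi>) (abs_l2 (\<lambda>x. frechet_derivative \<phi> (at x) i))"
 unfolding is_weak_partial_def
proof (intro conjI ballI)
 let ?d = "\<lambda>\<phi> x. frechet_derivative \<phi> (at x) i"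
 show "abs_l2 (?d \<phi>) \<in> L2 \<Omega>" by (intro test_function_L2 test_function_partial assms)
 fix \<psi> :: "'a \<Rightarrow> real" assume \<psi>: "\<psi> \<in> test_functions \<Omega>"
 have d\<phi>: "?d \<phi> \<in> test_functions \<Omega>" and d\<psi>: "?d \<psi> \<in> test_functions \<Omega>"
  using test_function_partial \<phi> \<psi> i by auto
 obtain S where S: "continuous_on UNIV \<phi>" "compact S" "S \<subseteq> \<Omega>" "!!x. x \<notin> S ==> \<phi> x = 0"
  using test_function_props[OF \<phi>] by blast
 obtain S' where S': "continuous_on UNIV (?d \<phi>)" "compact S'" "S' \<subseteq> \<Omega>" "!!x. x \<notin> S' ==> ?d \<phi> x = 0"
  using test_function_props[OF d\<phi>] by blast
 have c: "continuous_on UNIV \<psi>" "continuous_on UNIV (?d \<psi>)"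
  using test_function_props[OF \<psi>] test_function_props[OF d\<psi>] by blast+
 have D: "((\<lambda>x. \<phi> x * \<psi> x) has_derivative
   (\<lambda>h. \<phi> x * frechet_derivative \<psi> (at x) h + frechet_derivative \<phi> (at x) h * \<psi> x)) (at x)" for x
  using \<phi> \<psi> by (intro has_derivative_mult smooth_has_derivative) (auto simp: test_functions_def)
 have "integral\<^sup>L lborel (\<lambda>x. \<phi> x * ?d \<psi> x + ?d \<phi> x * \<psi> x) = 0"
 proof (rule integral_partial_derivative_0[OF D i])
  show "continuous_on UNIV (\<lambda>x. \<phi> x * ?d \<psi> x + ?d \<phi> x * \<psi> x)"
   using S S' c by (intro continuous_intros)
  show "compact (S \<union> S')" using S S' by auto
 qed (use S S' in auto)
 also have "integral\<^sup>L lborel (\<lambda>x. \<phi> x * ?d \<psi> x + ?d \<phi> x * \<psi> x) =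
   integral\<^sup>L lebesgue (\<lambda>x. \<phi> x * ?d \<psi> x) + integral\<^sup>L lebesgue (\<lambda>x. ?d \<phi> x * \<psi> x)"
  using compact_support_integrable[of "\<lambda>x. \<phi> x * ?d \<psi> x" S] compact_support_integrable[of "\<lambda>x. ?d \<phi> x * \<psi> x" S'] S S' c
  by (simp add: continuous_on_mult)
 finally show "inner (abs_l2 \<phi>) (abs_l2 (?d \<psi>)) = - inner (abs_l2 (?d \<phi>)) (abs_l2 \<psi>)"
  using \<phi> \<psi> d\<phi> d\<psi> by (simp add: inner_abs_l2 test_function_square_integrable)
qed

lemma small_cube_subset:
 fixes x :: "'a::euclidean_space"
 assumes "open \<Omega>" "x \<in> \<Omega>"
 obtains r where "r > 0" "!!h. 0 < h ==> h < r ==> cbox x (x + h *\<^sub>R One) \<subseteq> \<Omega>"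
proof -
 obtain e where e: "e > 0" "ball x e \<subseteq> \<Omega>" using assms openE by blast
 show ?thesis
 proof (rule that[of "e / DIM('a)"])
  show "e / DIM('a) > 0" using e by simp
  fix h assume h: "0 < h" "h < e / DIM('a)"
  show "cbox x (x + h *\<^sub>R One) \<subseteq> \<Omega>"
  proof
   fix y assume y: "y \<in> cbox x (x + h *\<^sub>R One)"
   have "norm (y - x) \<le> (\<Sum>i\<in>Basis. \<bar>inner (y - x) i\<bar>)" by (rule norm_le_l1)
   also have "\<dots> \<le> (\<Sum>i\<in>(Basis::'a set). h)"
    using y by (intro sum_mono) (auto simp: mem_box inner_diff_left inner_add_left)
   also have "\<dots> < e" using h e by (simp add: field_simps)
   finally show "y \<in> \<Omega>" using e by (auto simp: dist_norm norm_minus_commute)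
  qed
 qed
qed

text \<open>The fundamental lemma of the calculus of variations. Bumps tending to the indicator of a
  box show that the integral over every closed box inside \<Omega> vanishes; differentiation along
  shrinking cubes then gives 0 almost everywhere. It provides the uniqueness that makes the definite
  description in \<open>weak_partial\<close> meaningful.\<close>

lemma test_function_annihilator:
 fixes \<Omega> :: "'a::euclidean_space set"
 assumes \<Omega>: "open \<Omega>" "bounded \<Omega>" and v: "v \<in> L2 \<Omega>"
  and ann: "!!\<phi>. \<phi> \<in> test_functions \<Omega> ==> inner v (abs_l2 \<phi>) = 0"
 shows "v = 0"
proof -
 obtain f where f: "square_integrable f" "v = abs_l2 f" by (rule abs_l2_cases)
 have f0: "AE x in lebesgue. x \<notin> \<Omega> \<longrightarrow> f x = 0" using v f L2_abs_iff by blast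
 \<comment> \<open>The cut-off makes the representative integrable: a bounded set has finite measure
   and |f| <= 1 + f^2.\<close>
 define F where "F x = indicator \<Omega> x * f x" for x
 have m\<Omega>: "\<Omega> \<in> sets lebesgue" using \<Omega>(1) by (simp add: borel_open sets_completionI_sets)
 have mf: "f \<in> borel_measurable lebesgue" using f(1) by (simp add: square_integrable_def)
 have mF: "F \<in> borel_measurable lebesgue" unfolding F_def using m\<Omega> mf by measurable
 have fin: "emeasure lebesgue \<Omega> < \<infinity>"
  using emeasure_bounded_finite[OF \<Omega>(2)] \<Omega>(1) by (simp add: borel_open)
 have "integrable lebesgue (\<lambda>x. indicator \<Omega> x + (f x)\<^sup>2)"
  using f(1) fin m\<Omega> by (auto simp: square_integrable_def intro!: integrable_add integrable_real_indicator)
 then have intF: "integrable lebesgue F"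
 proof (rule Bochner_Integration.integrable_bound[OF _ mF])
  have "\<bar>f x\<bar> \<le> 1 + (f x)\<^sup>2" for x
   using zero_le_power2[of "\<bar>f x\<bar> - 1"] unfolding power2_diff by simp
  then show "AE x in lebesgue. norm (F x) \<le> norm (indicator \<Omega> x + (f x)\<^sup>2)"
   by (auto simp: F_def indicator_def)
 qed
 have intcube: "F integrable_on cbox c d" "set_lebesgue_integral lebesgue (cbox c d) F = integral (cbox c d) F"
  "set_lebesgue_integral lebesgue (box c d) F = integral (box c d) F" for c d
 proof -
  have "set_integrable lebesgue (cbox c d) F" "set_integrable lebesgue (box c d) F"
   unfolding set_integrable_def
   by (rule integrable_mult_indicator[OF _ intF]; simp)+
  then show "F integrable_on cbox c d" "set_lebesgue_integral lebesgue (cbox c d) F = integral (cbox c d) F"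
   "set_lebesgue_integral lebesgue (box c d) F = integral (box c d) F"
   using set_lebesgue_integral_eq_integral by blast+
 qed
 have zero: "integral (cbox c d) F = 0" if sub: "cbox c d \<subseteq> \<Omega>" for c d
 proof -
  obtain \<phi> where \<phi>: "!!n::nat. \<phi> n \<in> test_functions \<Omega>" "!!n x. 0 \<le> \<phi> n x \<and> \<phi> n x \<le> 1"
   "!!n x. x \<notin> box c d ==> \<phi> n x = 0" "!!x. x \<in> box c d ==> (\<lambda>n. \<phi> n x) \<longlonglongrightarrow> 1"
   using box_bump[OF sub] by blast
  have sq: "square_integrable (\<phi> n)" for n using \<phi>(1) by (rule test_function_square_integrable)
  have "(\<lambda>n. integral\<^sup>L lebesgue (\<lambda>x. F x * \<phi> n x)) \<longlonglongrightarrow> integral\<^sup>L lebesgue (\<lambda>x. indicator (box c d) x *\<^sub>R F x)"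
  proof (rule integral_dominated_convergence[where w="\<lambda>x. norm (F x)"])
   show "(\<lambda>x. indicator (box c d) x *\<^sub>R F x) \<in> borel_measurable lebesgue"
    using mF by (intro borel_measurable_scaleR borel_measurable_indicator) (auto simp: borel_open sets_completionI_sets)
   show "(\<lambda>x. F x * \<phi> n x) \<in> borel_measurable lebesgue" for n
    using mF sq[of n] by (auto simp: square_integrable_def)
   show "integrable lebesgue (\<lambda>x. norm (F x))" using intF by simp
   show "AE x in lebesgue. (\<lambda>n. F x * \<phi> n x) \<longlonglongrightarrow> indicator (box c d) x *\<^sub>R F x"
   proof (rule AE_I2)
    fix x
    show "(\<lambda>n. F x * \<phi> n x) \<longlonglongrightarrow> indicator (box c d) x *\<^sub>R F x"
    proof (cases "x \<in> box c d")
     case True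
     then show ?thesis using tendsto_mult[OF tendsto_const[of "F x"] \<phi>(4)[OF True]] by simp
    next
     case False
     then show ?thesis using \<phi>(3) by simp
    qed
   qed
   show "AE x in lebesgue. norm (F x * \<phi> n x) \<le> norm (F x)" for n
    using \<phi>(2)[of n] by (auto simp: abs_mult mult_left_le)
  qed
  moreover have "integral\<^sup>L lebesgue (\<lambda>x. F x * \<phi> n x) = 0" for n
  proof -
   have "integral\<^sup>L lebesgue (\<lambda>x. F x * \<phi> n x) = integral\<^sup>L lebesgue (\<lambda>x. f x * \<phi> n x)"
    using \<phi>(3)[of _ n] box_subset_cbox[of c d] sub
    by (intro Bochner_Integration.integral_cong) (auto simp: F_def indicator_def)
   then show ?thesis using ann[OF \<phi>(1)] inner_abs_l2[OF f(1) sq] f(2) by simp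
  qed
  ultimately have "integral\<^sup>L lebesgue (\<lambda>x. indicator (box c d) x *\<^sub>R F x) = 0"
   using LIMSEQ_unique[of "\<lambda>n. 0::real"] by auto
  then show ?thesis using intcube(3)[of c d] by (simp add: set_lebesgue_integral_def integral_open_interval)
 qed
 \<comment> \<open>Lebesgue differentiation with cubes whose lower corner is x. For x in \<Omega>
   small cubes lie in \<Omega>, where the integrals are 0.\<close>
 obtain N where N: "negligible N" "!!x e. x \<notin> N ==> 0 < e ==>
   \<exists>d>0. \<forall>h. 0 < h \<and> h < d \<longrightarrow> norm (integral (cbox x (x + h *\<^sub>R One)) F /\<^sub>R h ^ DIM('a) - F x) < e"
  using integrable_ccontinuous_explicit[of F] intcube(1) by blast
 have F0: "F x = 0" if x: "x \<notin> N" for x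
 proof (cases "x \<in> \<Omega>")
  case True
  obtain r where r: "r > 0" "!!h. 0 < h ==> h < r ==> cbox x (x + h *\<^sub>R One) \<subseteq> \<Omega>"
   using small_cube_subset[OF \<Omega>(1) True] by blast
  have "norm (F x) < e" if "e > 0" for e
  proof -
   obtain d where d: "d > 0" "!!h. 0 < h ==> h < d ==> norm (integral (cbox x (x + h *\<^sub>R One)) F /\<^sub>R h ^ DIM('a) - F x) < e"
    using N(2)[OF x \<open>e > 0\<close>] by blast
   have "0 < min d r / 2" "min d r / 2 < d" "min d r / 2 < r" using d(1) r(1) by auto
   then show ?thesis using d(2)[of "min d r / 2"] zero[OF r(2)[of "min d r / 2"]] by simp
  qed
  then show ?thesis by (metis norm_le_zero_iff not_le order_less_irrefl)
 qed (simp add: F_def)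
 have "AE x in lebesgue. x \<notin> N" using N(1) by (simp add: negligible_iff_null_sets AE_not_in)
 then have "AE x in lebesgue. f x = 0"
  using f0 by eventually_elim (use F0 in \<open>force simp: F_def\<close>)
 then have "l2_rel f (\<lambda>x. 0)" using f(1) by (simp add: l2_rel_def)
 then have "abs_l2 f = abs_l2 (\<lambda>x. 0)" using Quotient_rel_abs[OF Quotient_l2] by blast
 then show ?thesis using f(2) by (simp add: abs_l2_zero)
qed

section \<open>The gradient form and the space H10 on a bounded open set\<close>

locale bounded_open_set =
 fixes \<Omega> :: "'a::euclidean_space set"
 assumes open_set: "open \<Omega>" and bounded_set: "bounded \<Omega>"
begin

lemma weak_partial_unique:
 assumes "is_weak_partial \<Omega> i v g" "is_weak_partial \<Omega> i v g'"
 shows "g = g'"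
proof -
 have "g + (-1) *\<^sub>R g' = 0"
 proof (rule test_function_annihilator[OF open_set bounded_set])
  show "g + (-1) *\<^sub>R g' \<in> L2 \<Omega>" using assms L2_add_scale[of g \<Omega> g' "-1"] by (simp add: is_weak_partial_def)
  show "inner (g + (-1) *\<^sub>R g') (abs_l2 \<phi>) = 0" if "\<phi> \<in> test_functions \<Omega>" for \<phi>
   using assms that by (simp add: is_weak_partial_def inner_diff_left)
 qed
 then show ?thesis by simp
qed

lemma weak_partial_eq: "is_weak_partial \<Omega> i v g ==> weak_partial \<Omega> i v = g"
 unfolding weak_partial_def using weak_partial_unique by blast

lemma is_weak_partial_add_scale:
 assumes "is_weak_partial \<Omega> i v g" "is_weak_partial \<Omega> i w h"
 shows "is_weak_partial \<Omega> i (v + c *\<^sub>R w) (g + c *\<^sub>R h)"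
 using assms L2_add_scale by (auto simp: is_weak_partial_def inner_add_left)

lemma is_weak_partial_zero: "is_weak_partial \<Omega> i 0 0"
 by (simp add: is_weak_partial_def zero_L2)

lemma H1_is_weak_partial:
 "v \<in> H1 \<Omega> ==> i \<in> Basis ==> is_weak_partial \<Omega> i v (weak_partial \<Omega> i v)"
 using weak_partial_eq by (force simp: H1_def)

lemma subspaceI_add_scale:
 fixes S :: "'v::real_vector set"
 assumes "0 \<in> S" "!!u v r. u \<in> S ==> v \<in> S ==> u + r *\<^sub>R v \<in> S"
 shows "subspace S"
 using assms(1) assms(2)[of _ _ 1] assms(2)[of 0] by (auto simp: subspace_def)

lemma subspace_H1: "subspace (H1 \<Omega>)"
proof (rule subspaceI_add_scale)
 show "0 \<in> H1 \<Omega>" using is_weak_partial_zero zero_L2 by (auto simp: H1_def)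
 show "u + r *\<^sub>R v \<in> H1 \<Omega>" if "u \<in> H1 \<Omega>" "v \<in> H1 \<Omega>" for u v r
  using that L2_add_scale is_weak_partial_add_scale unfolding H1_def by blast
qed

lemma weak_partial_add_scale:
 assumes "u \<in> H1 \<Omega>" "v \<in> H1 \<Omega>" "i \<in> Basis"
 shows "weak_partial \<Omega> i (u + r *\<^sub>R v) = weak_partial \<Omega> i u + r *\<^sub>R weak_partial \<Omega> i v"
 by (intro weak_partial_eq is_weak_partial_add_scale H1_is_weak_partial assms)

definition ext_partial :: "'a \<Rightarrow> 'a l2 \<Rightarrow> 'a l2" where
 "ext_partial i = (SOME D. linear D \<and> (\<forall>v\<in>H1 \<Omega>. D v = weak_partial \<Omega> i v))"

lemma ext_partial:
 assumes "i \<in> Basis"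
 shows "linear (ext_partial i)" "!!v. v \<in> H1 \<Omega> ==> ext_partial i v = weak_partial \<Omega> i v"
proof -
 have "\<exists>D. linear D \<and> (\<forall>v\<in>H1 \<Omega>. D v = weak_partial \<Omega> i v)"
  by (rule subspace_linear_extension[OF subspace_H1]) (rule weak_partial_add_scale, use assms in auto)
 from someI_ex[OF this] show "linear (ext_partial i)" "!!v. v \<in> H1 \<Omega> ==> ext_partial i v = weak_partial \<Omega> i v"
  unfolding ext_partial_def by auto
qed

definition grad_form :: "'a l2 \<Rightarrow> 'a l2 \<Rightarrow> real" where
 "grad_form v w = (\<Sum>i\<in>Basis. inner (ext_partial i v) (ext_partial i w))"

sublocale grad: psd_form grad_form
proof
 fix u v w :: "'a l2" and r :: real
 show "grad_form (u + v) w = grad_form u w + grad_form v w"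
  unfolding grad_form_def sum.distrib[symmetric]
  by (rule sum.cong) (auto simp: linear_add[OF ext_partial(1)] inner_add_left)
 show "grad_form (r *\<^sub>R u) w = r * grad_form u w"
  unfolding grad_form_def sum_distrib_left
  by (rule sum.cong) (auto simp: linear_scale[OF ext_partial(1)])
 show "grad_form u v = grad_form v u" unfolding grad_form_def by (simp add: inner_commute)
 show "0 \<le> grad_form u u" unfolding grad_form_def by (intro sum_nonneg) simp
qed

lemma grad_inner_eq: "v \<in> H1 \<Omega> ==> w \<in> H1 \<Omega> ==> grad_inner \<Omega> v w = grad_form v w"
 unfolding grad_inner_def grad_form_def by (rule sum.cong) (auto simp: ext_partial)

lemma H1_norm_eq: "v \<in> H1 \<Omega> ==> (H1_norm \<Omega> v)\<^sup>2 = (norm v)\<^sup>2 + (grad.nrm v)\<^sup>2"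
 unfolding H1_norm_def by (simp add: grad_inner_eq grad.nrm_square grad.nonneg)

lemma H1_norm_bounds:
 assumes "v \<in> H1 \<Omega>"
 shows "norm v \<le> H1_norm \<Omega> v" "grad.nrm v \<le> H1_norm \<Omega> v" "H1_norm \<Omega> v \<le> norm v + grad.nrm v"
proof -
 have n: "H1_norm \<Omega> v \<ge> 0" unfolding H1_norm_def
  using grad_inner_eq[OF assms assms] grad.nonneg[of v] by simp
 show "norm v \<le> H1_norm \<Omega> v"
  by (rule power2_le_imp_le[OF _ n]) (simp add: H1_norm_eq[OF assms])
 show "grad.nrm v \<le> H1_norm \<Omega> v"
  by (rule power2_le_imp_le[OF _ n]) (simp add: H1_norm_eq[OF assms])
 show "H1_norm \<Omega> v \<le> norm v + grad.nrm v"
  by (rule power2_le_imp_le) (simp_all add: H1_norm_eq[OF assms] power2_sum)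
qed

lemma test_function_H1:
 assumes "\<phi> \<in> test_functions \<Omega>"
 shows "abs_l2 \<phi> \<in> H1 \<Omega>"
 using test_function_L2[OF assms] test_function_weak_partial[OF assms] by (auto simp: H1_def)

lemma test_function_H10:
 assumes "\<phi> \<in> test_functions \<Omega>"
 shows "abs_l2 \<phi> \<in> H10 \<Omega>"
proof -
 have "H1_norm \<Omega> 0 = 0" using H1_norm_bounds(3)[of 0] H1_norm_bounds(1)[of 0] subspace_0[OF subspace_H1] by simp
 then show ?thesis using test_function_H1[OF assms] assms
  unfolding H10_def by (auto intro!: exI[of _ "\<lambda>n. \<phi>"])
qed

lemma ext_partial_test_function:
 assumes "\<phi> \<in> test_functions \<Omega>" "i \<in> Basis"
 shows "ext_partial i (abs_l2 \<phi>) = abs_l2 (\<lambda>x. frechet_derivative \<phi> (at x) i)"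
 using ext_partial(2)[OF assms(2) test_function_H1[OF assms(1)]]
  weak_partial_eq[OF test_function_weak_partial[OF assms]] by simp

text \<open>Closeness in \<open>H1_norm\<close> is separated into its \<open>L2\<close> and gradient
  parts, in the epsilon form that the density arguments use.\<close>

lemma H10_iff:
 "v \<in> H10 \<Omega> \<longleftrightarrow> v \<in> H1 \<Omega> \<and>
  (\<forall>e>0. \<exists>\<phi>\<in>test_functions \<Omega>. norm (v - abs_l2 \<phi>) < e \<and> grad.nrm (v - abs_l2 \<phi>) < e)"
proof (intro iffI conjI allI impI)
 fix e :: real assume v: "v \<in> H10 \<Omega>" and e: "e > 0"
 then obtain \<phi> where \<phi>: "!!n::nat. \<phi> n \<in> test_functions \<Omega>" "(\<lambda>n. H1_norm \<Omega> (v - abs_l2 (\<phi> n))) \<longlonglongrightarrow> 0"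
  by (auto simp: H10_def)
 from order_tendstoD(2)[OF \<phi>(2) e] obtain n where n: "H1_norm \<Omega> (v - abs_l2 (\<phi> n)) < e"
  by (auto dest: eventually_happens)
 have "v - abs_l2 (\<phi> n) \<in> H1 \<Omega>"
  using v test_function_H1[OF \<phi>(1)] subspace_H1 by (auto simp: H10_def subspace_diff)
 from H1_norm_bounds[OF this] n \<phi>(1)[of n]
 show "\<exists>\<phi>\<in>test_functions \<Omega>. norm (v - abs_l2 \<phi>) < e \<and> grad.nrm (v - abs_l2 \<phi>) < e"
  by (intro bexI[of _ "\<phi> n"]) auto
next
 assume v: "v \<in> H1 \<Omega> \<and>
  (\<forall>e>0. \<exists>\<phi>\<in>test_functions \<Omega>. norm (v - abs_l2 \<phi>) < e \<and> grad.nrm (v - abs_l2 \<phi>) < e)"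
 then have "\<forall>n. \<exists>\<phi>\<in>test_functions \<Omega>. norm (v - abs_l2 \<phi>) < 1 / real (Suc n) \<and> grad.nrm (v - abs_l2 \<phi>) < 1 / real (Suc n)"
  by simp
 then obtain \<phi> where \<phi>: "!!n. \<phi> n \<in> test_functions \<Omega>"
  "!!n. norm (v - abs_l2 (\<phi> n)) < 1 / real (Suc n)" "!!n. grad.nrm (v - abs_l2 (\<phi> n)) < 1 / real (Suc n)"
  by metis
 have h: "v - abs_l2 (\<phi> n) \<in> H1 \<Omega>" for n
  using v test_function_H1[OF \<phi>(1)] subspace_H1 by (auto simp: subspace_diff)
 have "(\<lambda>n. H1_norm \<Omega> (v - abs_l2 (\<phi> n))) \<longlonglongrightarrow> 0"
 proof (rule tendsto_sandwich[of "\<lambda>n. 0" _ _ "\<lambda>n. 2 * (1 / real (Suc n))"])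
  show "\<forall>\<^sub>F n in sequentially. 0 \<le> H1_norm \<Omega> (v - abs_l2 (\<phi> n))"
   using H1_norm_bounds(1)[OF h] by (auto intro!: always_eventually intro: order_trans[OF norm_ge_zero])
  show "\<forall>\<^sub>F n in sequentially. H1_norm \<Omega> (v - abs_l2 (\<phi> n)) \<le> 2 * (1 / real (Suc n))"
  proof (intro always_eventually allI)
   fix n show "H1_norm \<Omega> (v - abs_l2 (\<phi> n)) \<le> 2 * (1 / real (Suc n))"
    using H1_norm_bounds(3)[OF h[of n]] \<phi>(2)[of n] \<phi>(3)[of n] by linarith
  qed
  show "(\<lambda>n. 2 * (1 / real (Suc n))) \<longlonglongrightarrow> 0"
   using tendsto_mult_right_zero[OF LIMSEQ_Suc[OF lim_1_over_n], of 2] by simp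
 qed simp
 then show "v \<in> H10 \<Omega>" using v \<phi>(1) by (auto simp: H10_def)
qed (auto simp: H10_def)

lemma subspace_H10: "subspace (H10 \<Omega>)"
proof (rule subspaceI_add_scale)
 show "0 \<in> H10 \<Omega>" using test_function_H10[OF zero_test_function] by (simp add: abs_l2_zero)
 fix u v r assume u: "u \<in> H10 \<Omega>" and v: "v \<in> H10 \<Omega>"
 show "u + r *\<^sub>R v \<in> H10 \<Omega>"
  unfolding H10_iff
 proof (intro conjI allI impI)
  show "u + r *\<^sub>R v \<in> H1 \<Omega>" using u v subspace_H1 by (auto simp: H10_def intro: subspace_add subspace_scale)
  fix e :: real assume e: "e > 0"
  define d where "d = e / (1 + \<bar>r\<bar>)"
  have d: "d > 0" "(1 + \<bar>r\<bar>) * d = e" using e by (auto simp: d_def)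
  obtain \<phi> where \<phi>: "\<phi> \<in> test_functions \<Omega>" "norm (u - abs_l2 \<phi>) < d" "grad.nrm (u - abs_l2 \<phi>) < d"
   using u d H10_iff by blast
  obtain \<psi> where \<psi>: "\<psi> \<in> test_functions \<Omega>" "norm (v - abs_l2 \<psi>) < d" "grad.nrm (v - abs_l2 \<psi>) < d"
   using v d H10_iff by blast
  have eq: "u + r *\<^sub>R v - abs_l2 (\<lambda>x. \<phi> x + r * \<psi> x) = (u - abs_l2 \<phi>) + r *\<^sub>R (v - abs_l2 \<psi>)"
   using \<phi> \<psi> by (simp add: abs_l2_add_scale test_function_square_integrable algebra_simps)
  have lt: "x + \<bar>r\<bar> * y < e" if "x < d" "y < d" for x y
  proof -
   have "\<bar>r\<bar> * y \<le> \<bar>r\<bar> * d" using that by (intro mult_left_mono) auto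
   then show ?thesis using that d(2) by (simp add: algebra_simps)
  qed
  show "\<exists>\<phi>\<in>test_functions \<Omega>. norm (u + r *\<^sub>R v - abs_l2 \<phi>) < e \<and> grad.nrm (u + r *\<^sub>R v - abs_l2 \<phi>) < e"
  proof (intro bexI conjI)
   show "norm (u + r *\<^sub>R v - abs_l2 (\<lambda>x. \<phi> x + r * \<psi> x)) < e"
    unfolding eq using norm_triangle_ineq[of "u - abs_l2 \<phi>" "r *\<^sub>R (v - abs_l2 \<psi>)"] lt[OF \<phi>(2) \<psi>(2)] by simp
   show "grad.nrm (u + r *\<^sub>R v - abs_l2 (\<lambda>x. \<phi> x + r * \<psi> x)) < e"
    unfolding eq using grad.nrm_triangle[of "u - abs_l2 \<phi>" "r *\<^sub>R (v - abs_l2 \<psi>)"] lt[OF \<phi>(3) \<psi>(3)]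
    by (simp add: grad.nrm_scale)
   show "(\<lambda>x. \<phi> x + r * \<psi> x) \<in> test_functions \<Omega>" using \<phi> \<psi> by (simp add: test_functions_add_scale)
  qed
 qed
qed

text \<open>Both derivatives are moved to the test function: \<open>\<psi>\<close> is minus the
  Laplacian of \<open>\<phi>\<close>. The gradient pairing thereby becomes continuous in the
  \<open>L2\<close> norm, the norm in which \<open>u\<close> is differentiable in time.\<close>

lemma grad_form_test_function:
 assumes "\<phi> \<in> test_functions \<Omega>"
 obtains \<psi> where "!!v. v \<in> H1 \<Omega> ==> grad_form v (abs_l2 \<phi>) = inner v \<psi>"
proof
 fix v assume v: "v \<in> H1 \<Omega>"
 let ?d = "\<lambda>i \<phi> x. frechet_derivative \<phi> (at x) i"
 have "inner (ext_partial i v) (ext_partial i (abs_l2 \<phi>)) = - inner v (abs_l2 (?d i (?d i \<phi>)))" if "i \<in> Basis" for i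
  using H1_is_weak_partial[OF v that] test_function_partial[OF assms that]
  by (simp add: ext_partial_test_function[OF assms that] ext_partial(2)[OF that v] is_weak_partial_def)
 then show "grad_form v (abs_l2 \<phi>) = inner v (- (\<Sum>i\<in>Basis. abs_l2 (?d i (?d i \<phi>))))"
  by (simp add: grad_form_def inner_sum_right sum_negf)
qed

text \<open>Density of test functions in the gradient seminorm. It lifts to \<open>H10\<close> the
  bounds that \<open>grad_form_test_function\<close> makes accessible.\<close>

lemma form_bound_test_functions:
 assumes bnd: "!!\<phi>. \<phi> \<in> test_functions \<Omega> ==> \<bar>grad_form x (abs_l2 \<phi>)\<bar> \<le> B * grad.nrm (abs_l2 \<phi>)"
  and w: "w \<in> H10 \<Omega>" and B: "B \<ge> 0"
 shows "\<bar>grad_form x w\<bar> \<le> B * grad.nrm w"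
proof (rule field_le_epsilon)
 fix e :: real assume "e > 0"
 \<comment> \<open>Chosen so that the two approximation errors, \<open>B * d\<close> and
   \<open>grad.nrm x * d\<close>, add up to at most \<open>e\<close>.\<close>
 define d where "d = e / (B + grad.nrm x + 1)"
 have pos: "B + grad.nrm x + 1 > 0" using B grad.nrm_nonneg[of x] by linarith
 then have d: "d > 0" "d * (B + grad.nrm x + 1) = e" using \<open>e > 0\<close> by (auto simp: d_def)
 obtain \<phi> where \<phi>: "\<phi> \<in> test_functions \<Omega>" "grad.nrm (w - abs_l2 \<phi>) < d"
  using w d H10_iff by blast
 have "grad.nrm (abs_l2 \<phi>) \<le> grad.nrm w + d"
  using grad.nrm_triangle_diff[of w "w - abs_l2 \<phi>"] \<phi>(2) by simp
 then have 1: "B * grad.nrm (abs_l2 \<phi>) \<le> B * (grad.nrm w + d)" using B by (rule mult_left_mono)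
 have "\<bar>grad_form x (w - abs_l2 \<phi>)\<bar> \<le> grad.nrm x * d"
  using grad.cauchy_schwarz[of x "w - abs_l2 \<phi>"] \<phi>(2) mult_left_mono[of "grad.nrm (w - abs_l2 \<phi>)" d "grad.nrm x"] by simp
 moreover have "grad_form x w = grad_form x (abs_l2 \<phi>) + grad_form x (w - abs_l2 \<phi>)"
  by (simp add: grad.diff_right)
 ultimately have "\<bar>grad_form x w\<bar> \<le> B * (grad.nrm w + d) + grad.nrm x * d" using bnd[OF \<phi>(1)] 1 by linarith
 also have "\<dots> \<le> B * grad.nrm w + e" using d by (simp add: algebra_simps)
 finally show "\<bar>grad_form x w\<bar> \<le> B * grad.nrm w + e" .
qed

end

context bounded_open_set
begin

text \<open>For a test function the i-th partial derivative of x_i \<phi>^2 integrates to 0, so the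
  square of the norm of \<phi> is -2 times the integral of x_i \<phi> \<partial>_i \<phi>. With
  |x_i| <= R, Young's inequality absorbs half of it and leaves the constant 2R. Density extends the
  bound to \<open>H10\<close>.\<close>

lemma poincare:
 obtains C where "C > 0" "!!v. v \<in> H10 \<Omega> ==> norm v \<le> C * grad.nrm v"
proof -
 obtain R where R: "R > 0" "!!x. x \<in> \<Omega> ==> norm x \<le> R"
  using bounded_set by (auto simp: bounded_pos)
 define i :: 'a where "i = (SOME i. i \<in> Basis)"
 have i: "i \<in> Basis" unfolding i_def by (rule SOME_Basis)
 have test: "norm (abs_l2 \<phi>) \<le> 2 * R * grad.nrm (abs_l2 \<phi>)" if \<phi>: "\<phi> \<in> test_functions \<Omega>" for \<phi>
 proof -
  let ?d = "\<lambda>x. frechet_derivative \<phi> (at x) i"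
  have d\<phi>: "?d \<in> test_functions \<Omega>" by (rule test_function_partial[OF \<phi> i])
  obtain S where S: "continuous_on UNIV \<phi>" "compact S" "S \<subseteq> \<Omega>" "!!x. x \<notin> S ==> \<phi> x = 0"
   using test_function_props[OF \<phi>] by blast
  obtain S' where S': "continuous_on UNIV ?d" "compact S'" "S' \<subseteq> \<Omega>" "!!x. x \<notin> S' ==> ?d x = 0"
   using test_function_props[OF d\<phi>] by blast
  have D: "((\<lambda>x. inner x i * (\<phi> x * \<phi> x)) has_derivative
    (\<lambda>h. inner x i * (\<phi> x * frechet_derivative \<phi> (at x) h + frechet_derivative \<phi> (at x) h * \<phi> x) + inner h i * (\<phi> x * \<phi> x))) (at x)" for x
   using \<phi> by (intro has_derivative_mult smooth_has_derivative) (auto simp: test_functions_def intro!: derivative_eq_intros)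
  have "integral\<^sup>L lborel (\<lambda>x. inner x i * (\<phi> x * ?d x + ?d x * \<phi> x) + inner i i * (\<phi> x * \<phi> x)) = 0"
   by (rule integral_partial_derivative_0[OF D i _ S(2)]) (use S S' in \<open>auto intro!: continuous_intros\<close>)
  then have 0: "integral\<^sup>L lborel (\<lambda>x. 2 * (inner x i * \<phi> x * ?d x) + \<phi> x * \<phi> x) = 0"
   using i by (simp add: algebra_simps inner_Basis)
  have i1: "integrable lborel (\<lambda>x. 2 * (inner x i * \<phi> x * ?d x))"
   by (rule compact_support_integrable[OF _ S(2)]) (use S S' in \<open>auto intro!: continuous_intros\<close>)
  have i2: "integrable lborel (\<lambda>x. \<phi> x * \<phi> x)" "integral\<^sup>L lebesgue (\<lambda>x. \<phi> x * \<phi> x) = integral\<^sup>L lborel (\<lambda>x. \<phi> x * \<phi> x)"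
   by (rule compact_support_integrable[OF _ S(2)]; use S S' in \<open>auto intro!: continuous_intros\<close>)+
  have i3: "integrable lborel (\<lambda>x. ?d x * ?d x)" "integral\<^sup>L lebesgue (\<lambda>x. ?d x * ?d x) = integral\<^sup>L lborel (\<lambda>x. ?d x * ?d x)"
   by (rule compact_support_integrable[OF _ S'(2)]; use S S' in \<open>auto intro!: continuous_intros\<close>)+
  have "integral\<^sup>L lborel (\<lambda>x. \<phi> x * \<phi> x) = integral\<^sup>L lborel (\<lambda>x. - (2 * (inner x i * \<phi> x * ?d x)))"
   using 0 i1 i2 by simp
  also have "\<dots> \<le> integral\<^sup>L lborel (\<lambda>x. 1 / 2 * (\<phi> x * \<phi> x) + 2 * R\<^sup>2 * (?d x * ?d x))"
  proof (rule Bochner_Integration.integral_mono)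
   fix x
   show "- (2 * (inner x i * \<phi> x * ?d x)) \<le> 1 / 2 * (\<phi> x * \<phi> x) + 2 * R\<^sup>2 * (?d x * ?d x)"
   proof (cases "x \<in> S")
    case True
    then have "\<bar>inner x i\<bar> \<le> R" using Basis_le_norm[OF i, of x] R(2)[of x] S(3) by auto
    then have "(inner x i)\<^sup>2 \<le> R\<^sup>2" by (rule abs_le_square_iff[THEN iffD1, of _ R, simplified abs_of_pos[OF R(1)]])
    then have "2 * (inner x i)\<^sup>2 * (?d x)\<^sup>2 \<le> 2 * R\<^sup>2 * (?d x)\<^sup>2" by (intro mult_right_mono) auto
    moreover have "0 \<le> (\<phi> x + 2 * inner x i * ?d x)\<^sup>2 / 2" by simp
    ultimately show ?thesis by (simp add: power2_eq_square algebra_simps)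
   qed (use S in simp)
  qed (use i1 i2 i3 in auto)
  also have "\<dots> = 1 / 2 * integral\<^sup>L lborel (\<lambda>x. \<phi> x * \<phi> x) + 2 * R\<^sup>2 * integral\<^sup>L lborel (\<lambda>x. ?d x * ?d x)"
   using i2 i3 by simp
  finally have "integral\<^sup>L lborel (\<lambda>x. \<phi> x * \<phi> x) \<le> 4 * R\<^sup>2 * integral\<^sup>L lborel (\<lambda>x. ?d x * ?d x)" by simp
  then have "inner (abs_l2 \<phi>) (abs_l2 \<phi>) \<le> 4 * R\<^sup>2 * inner (abs_l2 ?d) (abs_l2 ?d)"
   using i2 i3 \<phi> d\<phi> by (simp add: inner_abs_l2 test_function_square_integrable)
  also have "inner (abs_l2 ?d) (abs_l2 ?d) \<le> grad_form (abs_l2 \<phi>) (abs_l2 \<phi>)"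
   unfolding grad_form_def
   using member_le_sum[of i Basis "\<lambda>i. inner (ext_partial i (abs_l2 \<phi>)) (ext_partial i (abs_l2 \<phi>))"] i
   by (simp add: ext_partial_test_function[OF \<phi> i])
  finally have "inner (abs_l2 \<phi>) (abs_l2 \<phi>) \<le> 4 * R\<^sup>2 * grad_form (abs_l2 \<phi>) (abs_l2 \<phi>)" using R by simp
  then have "(norm (abs_l2 \<phi>))\<^sup>2 \<le> (2 * R * grad.nrm (abs_l2 \<phi>))\<^sup>2"
   by (simp add: power_mult_distrib grad.nrm_square power2_norm_eq_inner)
  then show ?thesis by (rule power2_le_imp_le) (use R in simp)
 qed
 show ?thesis
 proof (rule that[of "2 * R"])
  fix v assume v: "v \<in> H10 \<Omega>"
  show "norm v \<le> 2 * R * grad.nrm v"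
  proof (rule field_le_epsilon)
   fix e :: real assume "e > 0"
   define d where "d = e / (1 + 2 * R)"
   have "d > 0" "d * (1 + 2 * R) = e" using \<open>e > 0\<close> R by (auto simp: d_def)
   then have d: "d > 0" "d + 2 * R * d = e" by (auto simp: algebra_simps)
   obtain \<phi> where \<phi>: "\<phi> \<in> test_functions \<Omega>" "norm (v - abs_l2 \<phi>) < d" "grad.nrm (v - abs_l2 \<phi>) < d"
    using v d H10_iff by blast
   have "grad.nrm (abs_l2 \<phi>) \<le> grad.nrm v + d"
    using grad.nrm_triangle_diff[of v "v - abs_l2 \<phi>"] \<phi>(3) by simp
   then have "2 * R * grad.nrm (abs_l2 \<phi>) \<le> 2 * R * (grad.nrm v + d)" using R by (intro mult_left_mono) auto
   moreover have "norm v \<le> norm (abs_l2 \<phi>) + norm (v - abs_l2 \<phi>)"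
    using norm_triangle_ineq[of "abs_l2 \<phi>" "v - abs_l2 \<phi>"] by simp
   ultimately have "norm v \<le> 2 * R * (grad.nrm v + d) + d" using test[OF \<phi>(1)] \<phi>(2) by linarith
   also have "\<dots> = 2 * R * grad.nrm v + e" using d by (simp add: algebra_simps)
   finally show "norm v \<le> 2 * R * grad.nrm v + e" .
  qed
 qed (use R in simp)
qed

section \<open>Increment and Taylor bounds for a regular solution in both forms\<close>

lemma inner_has_real_derivative:
 fixes f :: "real \<Rightarrow> 'v::real_inner"
 assumes "(f has_vector_derivative f') F"
 shows "((\<lambda>t. inner (f t) \<psi>) has_real_derivative inner f' \<psi>) F"
 using bounded_linear.has_vector_derivative[OF bounded_linear_inner_left assms]
 by (simp add: has_real_derivative_iff_has_vector_derivative)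

context
 fixes T M \<sigma> :: real and p :: nat and u :: "real \<Rightarrow> 'a l2"
 assumes reg: "regularity \<Omega> T p M \<sigma> u" and uH: "!!t. t \<in> {0<..T} ==> u t \<in> H10 \<Omega>"
begin

text \<open>The regularity property starts at order 1; for order 0 membership is inherited from
  \<open>H10\<close>.\<close>

lemma time_deriv_H1:
 assumes "j \<le> Suc p" "t \<in> {0<..T}"
 shows "time_deriv T j u t \<in> H1 \<Omega>"
proof (cases j)
 case 0
 then show ?thesis using uH[OF assms(2)] by (simp add: H10_def)
next
 case (Suc k)
 then show ?thesis using reg assms unfolding regularity_def by (auto dest!: bspec[of _ _ j])
qed

lemma time_deriv_bound:
 assumes "j \<in> {1..Suc p}" "t \<in> {0<..T}"
 shows "norm (time_deriv T j u t) \<le> M * t powr (\<sigma> - real j)"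
  "grad.nrm (time_deriv T j u t) \<le> M * t powr (\<sigma> - real j)"
proof -
 have "H1_norm \<Omega> (time_deriv T j u t) \<le> M * t powr (\<sigma> - real j)"
  using reg assms unfolding regularity_def by (auto dest!: bspec[of _ _ j])
 with H1_norm_bounds[OF time_deriv_H1, of j t] assms
 show "norm (time_deriv T j u t) \<le> M * t powr (\<sigma> - real j)"
  "grad.nrm (time_deriv T j u t) \<le> M * t powr (\<sigma> - real j)" by auto
qed

lemma time_deriv_has_derivative:
 assumes "j \<le> p" "t \<in> {0<..T}"
 shows "(time_deriv T j u has_vector_derivative time_deriv T (Suc j) u t) (at t within {0<..T})"
proof -
 have "time_deriv T (Suc j - 1) u differentiable (at t within {0<..T})"
  using reg assms unfolding regularity_def by (auto dest!: bspec[of _ _ "Suc j"])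
 then show ?thesis by (simp add: vector_derivative_works)
qed

lemma chain_inner:
 assumes "j \<le> p" "t \<in> {0<..T}"
 shows "((\<lambda>t. inner (time_deriv T j u t) \<psi>) has_real_derivative inner (time_deriv T (Suc j) u t) \<psi>) (at t within {0<..T})"
 by (rule inner_has_real_derivative[OF time_deriv_has_derivative[OF assms]])

text \<open>Along the solution the pairing coincides with \<open>inner\<close> against the
  \<open>\<psi>\<close> of \<open>grad_form_test_function\<close>, and that pairing is
  differentiable because \<open>u\<close> and its derivatives are so in \<open>L2\<close>.\<close>

lemma chain_grad:
 assumes \<phi>: "\<phi> \<in> test_functions \<Omega>" and jt: "j \<le> p" "t \<in> {0<..T}"
 shows "((\<lambda>t. grad_form (time_deriv T j u t) (abs_l2 \<phi>)) has_real_derivative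
  grad_form (time_deriv T (Suc j) u t) (abs_l2 \<phi>)) (at t within {0<..T})"
proof -
 obtain \<psi> where \<psi>: "!!v. v \<in> H1 \<Omega> ==> grad_form v (abs_l2 \<phi>) = inner v \<psi>"
  using grad_form_test_function[OF \<phi>] by blast
 have "((\<lambda>t. grad_form (time_deriv T j u t) (abs_l2 \<phi>)) has_real_derivative
  inner (time_deriv T (Suc j) u t) \<psi>) (at t within {0<..T})"
  by (rule has_field_derivative_transform_within[where d = 1, OF chain_inner[OF jt] _ jt(2)])
   (use \<psi> time_deriv_H1 jt in auto)
 then show ?thesis using \<psi>[OF time_deriv_H1[of "Suc j" t]] jt by simp
qed

lemma time_deriv_pairing_bound:
 assumes "j \<in> {1..Suc p}" "t \<in> {0<..T}"
 shows "\<bar>inner (time_deriv T j u t) w\<bar> \<le> M * norm w * t powr (\<sigma> - real j)"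
  "\<bar>grad_form (time_deriv T j u t) w\<bar> \<le> M * grad.nrm w * t powr (\<sigma> - real j)"
 using order_trans[OF Cauchy_Schwarz_ineq2 mult_right_mono[OF time_deriv_bound(1)[OF assms] norm_ge_zero], of w]
  order_trans[OF grad.cauchy_schwarz mult_right_mono[OF time_deriv_bound(2)[OF assms] grad.nrm_nonneg], of w]
 by (simp_all add: mult_ac)

text \<open>The gradient bound is proved against test functions, where the pairing is
  differentiable, and then extended by density. The Taylor bound below follows the same
  pattern.\<close>

lemma regular_increment:
 assumes "\<sigma> > 0" "M > 0" "w \<in> H10 \<Omega>" "0 < s" "s \<le> t" "t \<le> T"
 shows "\<bar>inner (u t - u s) w\<bar> \<le> M / \<sigma> * (t powr \<sigma> - s powr \<sigma>) * norm w"
  "\<bar>grad_form (u t - u s) w\<bar> \<le> M / \<sigma> * (t powr \<sigma> - s powr \<sigma>) * grad.nrm w"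
proof -
 have mono: "M / \<sigma> * (t powr \<sigma> - s powr \<sigma>) \<ge> 0" using assms by (simp add: powr_mono2)
 have "\<bar>inner (u t) w - inner (u s) w\<bar> \<le> (M * norm w) / \<sigma> * (t powr \<sigma> - s powr \<sigma>)"
  by (rule derivative_chain_increment[of T "\<lambda>j t. inner (time_deriv T j u t) w", simplified time_deriv.simps(1)])
   (use chain_inner[of 0] time_deriv_pairing_bound(1)[of 1] assms in auto)
 then show "\<bar>inner (u t - u s) w\<bar> \<le> M / \<sigma> * (t powr \<sigma> - s powr \<sigma>) * norm w"
  by (simp add: inner_diff_left mult_ac)
 show "\<bar>grad_form (u t - u s) w\<bar> \<le> M / \<sigma> * (t powr \<sigma> - s powr \<sigma>) * grad.nrm w"
 proof (rule form_bound_test_functions[OF _ assms(3) mono])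
  fix \<phi> assume \<phi>: "\<phi> \<in> test_functions \<Omega>"
  have "\<bar>grad_form (u t) (abs_l2 \<phi>) - grad_form (u s) (abs_l2 \<phi>)\<bar> \<le> (M * grad.nrm (abs_l2 \<phi>)) / \<sigma> * (t powr \<sigma> - s powr \<sigma>)"
   by (rule derivative_chain_increment[of T "\<lambda>j t. grad_form (time_deriv T j u t) (abs_l2 \<phi>)", simplified time_deriv.simps(1)])
    (use chain_grad[OF \<phi>, of 0] time_deriv_pairing_bound(2)[of 1] assms in auto)
  then show "\<bar>grad_form (u t - u s) (abs_l2 \<phi>)\<bar> \<le> M / \<sigma> * (t powr \<sigma> - s powr \<sigma>) * grad.nrm (abs_l2 \<phi>)"
   by (simp add: grad.diff_left mult_ac)
 qed
qed

lemma regular_taylor: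
 assumes "w \<in> H10 \<Omega>" "0 < c" "c \<le> t" "t \<le> T"
  and G: "!!x. x \<in> {c..t} ==> M * x powr (\<sigma> - real (p + 1)) \<le> G" "G \<ge> 0"
 defines "R \<equiv> u t - (\<Sum>i\<le>p. ((t - c) ^ i / fact i) *\<^sub>R time_deriv T i u c)"
 shows "\<bar>inner R w\<bar> \<le> (t - c) ^ (p + 1) * G * norm w"
  "\<bar>grad_form R w\<bar> \<le> (t - c) ^ (p + 1) * G * grad.nrm w"
proof -
 have "\<bar>inner (u t) w - (\<Sum>i\<le>p. (t - c) ^ i / fact i * inner (time_deriv T i u c) w)\<bar> \<le> (t - c) ^ (p + 1) * (G * norm w)"
 proof (rule derivative_chain_taylor[of p T "\<lambda>j t. inner (time_deriv T j u t) w", simplified time_deriv.simps(1)])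
  show "\<bar>inner (time_deriv T (Suc p) u x) w\<bar> \<le> G * norm w" if "x \<in> {c..t}" for x
   using time_deriv_pairing_bound(1)[of "Suc p" x w] mult_right_mono[OF G(1)[OF that] norm_ge_zero[of w]] that assms
   by (simp add: mult_ac)
 qed (use chain_inner assms in auto)
 then show "\<bar>inner R w\<bar> \<le> (t - c) ^ (p + 1) * G * norm w"
  by (simp add: R_def inner_diff_left inner_sum_left mult.assoc)
 show "\<bar>grad_form R w\<bar> \<le> (t - c) ^ (p + 1) * G * grad.nrm w"
 proof (rule form_bound_test_functions[OF _ assms(1)])
  fix \<phi> assume \<phi>: "\<phi> \<in> test_functions \<Omega>"
  have "\<bar>grad_form (u t) (abs_l2 \<phi>) - (\<Sum>i\<le>p. (t - c) ^ i / fact i * grad_form (time_deriv T i u c) (abs_l2 \<phi>))\<bar>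
    \<le> (t - c) ^ (p + 1) * (G * grad.nrm (abs_l2 \<phi>))"
  proof (rule derivative_chain_taylor[of p T "\<lambda>j t. grad_form (time_deriv T j u t) (abs_l2 \<phi>)", simplified time_deriv.simps(1)])
   show "\<bar>grad_form (time_deriv T (Suc p) u x) (abs_l2 \<phi>)\<bar> \<le> G * grad.nrm (abs_l2 \<phi>)" if "x \<in> {c..t}" for x
    using time_deriv_pairing_bound(2)[of "Suc p" x "abs_l2 \<phi>"] mult_right_mono[OF G(1)[OF that] grad.nrm_nonneg[of "abs_l2 \<phi>"]] that assms
    by (simp add: mult_ac)
  qed (use chain_grad[OF \<phi>] assms in auto)
  then show "\<bar>grad_form R (abs_l2 \<phi>)\<bar> \<le> (t - c) ^ (p + 1) * G * grad.nrm (abs_l2 \<phi>)"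
   by (simp add: R_def grad.linear_simps mult.assoc)
 qed (use assms in simp)
qed

end

end

section \<open>Fractional integrals\<close>

lemma omega_eq: "omega (\<alpha> + 1) t = t powr \<alpha> / Gamma (\<alpha> + 1)"
 by (simp add: omega_def)

lemma omega_nonneg: "-1 < \<alpha> ==> omega (\<alpha> + 1) t \<ge> 0"
 by (simp add: omega_eq Gamma_real_nonneg)

lemma omega_antimono:
 assumes "-1 < \<alpha>" "\<alpha> < 0" "0 < s" "s \<le> t"
 shows "omega (\<alpha> + 1) t \<le> omega (\<alpha> + 1) s"
 using assms powr_mono2'[of \<alpha> s t] by (auto simp: omega_eq intro!: divide_right_mono Gamma_real_nonneg)

text \<open>The fundamental theorem is applied with derivatives in the open interval only, since the
  kernel is singular at s = t when b = t.\<close>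

lemma omega_integral:
 assumes "-1 < \<alpha>" "a \<le> b" "b \<le> t"
 shows "((\<lambda>s. omega (\<alpha> + 1) (t - s)) has_integral
  ((t - a) powr (\<alpha> + 1) - (t - b) powr (\<alpha> + 1)) / Gamma (\<alpha> + 2)) {a..b}"
proof -
 have G: "Gamma (\<alpha> + 2) = (\<alpha> + 1) * Gamma (\<alpha> + 1)"
  using Gamma_plus1[of "\<alpha> + 1"] assms by (auto simp: nonpos_Ints_def add.assoc)
 have pos: "Gamma (\<alpha> + 1) > 0" and G2: "Gamma (\<alpha> + 2) > 0" using assms by (simp_all add: Gamma_real_pos)
 have "((\<lambda>s. omega (\<alpha> + 1) (t - s)) has_integral
   (- ((t - b) powr (\<alpha> + 1) / Gamma (\<alpha> + 2)) - - ((t - a) powr (\<alpha> + 1) / Gamma (\<alpha> + 2)))) {a..b}"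
 proof (rule fundamental_theorem_of_calculus_interior[OF assms(2)])
  show "continuous_on {a..b} (\<lambda>s. - ((t - s) powr (\<alpha> + 1) / Gamma (\<alpha> + 2)))"
   using assms less_imp_neq[OF G2] by (intro continuous_on_minus continuous_on_divide continuous_on_powr' continuous_intros) auto
  fix s assume s: "s \<in> {a<..<b}"
  have "((\<lambda>s. - ((t - s) powr (\<alpha> + 1) / Gamma (\<alpha> + 2))) has_real_derivative omega (\<alpha> + 1) (t - s)) (at s)"
   using s assms pos less_imp_neq[OF pos] by (auto intro!: derivative_eq_intros simp: G omega_eq)
  then show "((\<lambda>s. - ((t - s) powr (\<alpha> + 1) / Gamma (\<alpha> + 2))) has_vector_derivative omega (\<alpha> + 1) (t - s)) (at s)"
   by (simp add: has_real_derivative_iff_has_vector_derivative)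
 qed
 then show ?thesis by (simp add: diff_divide_distrib)
qed

lemma omega_times_bounded:
 assumes \<alpha>: "-1 < \<alpha>" and ab: "a \<le> b" "b \<le> t"
  and m: "g \<in> borel_measurable (lebesgue_on {a..b})" and B: "!!s. s \<in> {a..b} ==> \<bar>g s\<bar> \<le> B"
 shows "(\<lambda>s. omega (\<alpha> + 1) (t - s) * g s) absolutely_integrable_on {a..b}"
  "\<bar>integral {a..b} (\<lambda>s. omega (\<alpha> + 1) (t - s) * g s)\<bar>
   \<le> B * (((t - a) powr (\<alpha> + 1) - (t - b) powr (\<alpha> + 1)) / Gamma (\<alpha> + 2))"
proof -
 have I: "((\<lambda>s. omega (\<alpha> + 1) (t - s) * B) has_integral
  ((t - a) powr (\<alpha> + 1) - (t - b) powr (\<alpha> + 1)) / Gamma (\<alpha> + 2) * B) {a..b}"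
  by (rule has_integral_mult_left[OF omega_integral[OF \<alpha> ab]])
 have le: "norm (omega (\<alpha> + 1) (t - s) * g s) \<le> omega (\<alpha> + 1) (t - s) * B" if "s \<in> {a..b}" for s
  using B[OF that] omega_nonneg[OF \<alpha>] by (simp add: abs_mult mult_left_mono)
 have m1: "(\<lambda>s. omega (\<alpha> + 1) (t - s)) \<in> borel_measurable (lebesgue_on {a..b})"
  unfolding omega_eq by (intro measurable_restrict_space1 measurable_completion) measurable
 show ai: "(\<lambda>s. omega (\<alpha> + 1) (t - s) * g s) absolutely_integrable_on {a..b}"
  by (rule measurable_bounded_by_integrable_imp_absolutely_integrable[where g="\<lambda>s. omega (\<alpha> + 1) (t - s) * B"])
   (use m m1 le I in \<open>auto intro!: borel_measurable_times\<close>)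
 have "norm (integral {a..b} (\<lambda>s. omega (\<alpha> + 1) (t - s) * g s)) \<le> integral {a..b} (\<lambda>s. omega (\<alpha> + 1) (t - s) * B)"
  by (rule integral_norm_bound_integral) (use ai I le in \<open>auto dest: set_lebesgue_integral_eq_integral(1)\<close>)
 then show "\<bar>integral {a..b} (\<lambda>s. omega (\<alpha> + 1) (t - s) * g s)\<bar>
   \<le> B * (((t - a) powr (\<alpha> + 1) - (t - b) powr (\<alpha> + 1)) / Gamma (\<alpha> + 2))"
  using integral_unique[OF I] by (simp add: mult.commute)
qed

text \<open>Subtracting the constant \<open>omega (\<alpha> + 1) (t - a)\<close> replaces the kernel
  by its oscillation on [a,b], and the constant meets only the mean of \<open>g\<close>. The
  oscillation is a difference of kernel values at the end points, so the bounds telescope when cells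
  are summed.\<close>

lemma omega_times_small_mean:
 assumes \<alpha>: "-1 < \<alpha>" "\<alpha> < 0" and ab: "a \<le> b" "b < t"
  and m: "g \<in> borel_measurable (lebesgue_on {a..b})" and B: "!!s. s \<in> {a..b} ==> \<bar>g s\<bar> \<le> B"
  and \<kappa>: "\<bar>integral {a..b} g\<bar> \<le> \<kappa>"
 shows "\<bar>integral {a..b} (\<lambda>s. omega (\<alpha> + 1) (t - s) * g s)\<bar>
   \<le> B * (b - a) * (omega (\<alpha> + 1) (t - b) - omega (\<alpha> + 1) (t - a)) + \<kappa> * omega (\<alpha> + 1) (t - a)"
proof -
 let ?w = "omega (\<alpha> + 1)"
 have g: "g integrable_on {a..b}"
  by (rule measurable_bounded_by_integrable_imp_integrable[OF m, of "\<lambda>s. B"]) (use B in auto)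
 have h: "(\<lambda>s. ?w (t - s) * g s) integrable_on {a..b}"
  using omega_times_bounded(1)[OF \<alpha>(1) ab(1) _ m B, of t] ab by (auto dest: set_lebesgue_integral_eq_integral(1))
 have d: "integral {a..b} (\<lambda>s. ?w (t - s) * g s - ?w (t - a) * g s) = integral {a..b} (\<lambda>s. ?w (t - s) * g s) - ?w (t - a) * integral {a..b} g"
  using g h by (subst Henstock_Kurzweil_Integration.integral_diff) (auto intro: integrable_on_mult_right)
 have "B \<ge> 0" using B[of a] ab by auto
 have "norm (integral {a..b} (\<lambda>s. ?w (t - s) * g s - ?w (t - a) * g s)) \<le> integral {a..b} (\<lambda>s. (?w (t - b) - ?w (t - a)) * B)"
 proof (rule integral_norm_bound_integral)
  show "(\<lambda>s. ?w (t - s) * g s - ?w (t - a) * g s) integrable_on {a..b}"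
   using g h by (intro integrable_diff integrable_on_mult_right)
  fix s assume s: "s \<in> {a..b}"
  have "?w (t - a) \<le> ?w (t - s)" "?w (t - s) \<le> ?w (t - b)"
   using s ab by (auto intro!: omega_antimono \<alpha>)
  then have "\<bar>?w (t - s) - ?w (t - a)\<bar> \<le> ?w (t - b) - ?w (t - a)" by linarith
  then have "\<bar>?w (t - s) - ?w (t - a)\<bar> * \<bar>g s\<bar> \<le> (?w (t - b) - ?w (t - a)) * B"
   using B[OF s] by (intro mult_mono) auto
  then show "norm (?w (t - s) * g s - ?w (t - a) * g s) \<le> (?w (t - b) - ?w (t - a)) * B"
   by (simp add: abs_mult[symmetric] left_diff_distrib)
 qed auto
 moreover have "\<bar>?w (t - a) * integral {a..b} g\<bar> \<le> \<kappa> * ?w (t - a)"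
  using mult_right_mono[OF \<kappa> omega_nonneg[OF \<alpha>(1), of "t - a"]] omega_nonneg[OF \<alpha>(1), of "t - a"] by (simp add: abs_mult mult.commute)
 ultimately show ?thesis using d ab by (simp add: mult_ac)
qed

text \<open>A gain of k^(1+\<alpha>) over the size of \<open>g\<close>. On cells far from t the
  oscillation bounds telescope once every k_j^(1-\<alpha>/2) is enlarged to that of cell n - 1,
  which is possible because the steps increase. The condition on \<open>\<kappa>\<close> makes the
  accumulated means no larger than this, whence the factor 2. On the last two cells the kernel is
  simply integrated.\<close>

lemma frac_integral_small_means:
 fixes \<tau> :: "nat \<Rightarrow> real"
 assumes \<alpha>: "-1 < \<alpha>" "\<alpha> < 0" and \<tau>0: "\<tau> 0 = 0"
  and kpos: "!!n. n \<in> {1..N} ==> \<tau> n - \<tau> (n - 1) > 0"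
  and kmono: "!!i j. 1 \<le> i ==> i \<le> j ==> j \<le> N ==> \<tau> i - \<tau> (i - 1) \<le> \<tau> j - \<tau> (j - 1)"
  and m: "g \<in> borel_measurable (lebesgue_on {0..\<tau> N})"
  and g0: "g 0 = 0"
  and g: "!!n s. n \<in> {1..N} ==> s \<in> {\<tau> (n - 1)<..\<tau> n} ==> \<bar>g s\<bar> \<le> D * (\<tau> n - \<tau> (n - 1)) powr (- \<alpha> / 2)"
  and mean: "!!n. n \<in> {1..N} ==> \<bar>integral {\<tau> (n - 1)..\<tau> n} g\<bar> \<le> \<kappa>"
  and \<kappa>: "\<kappa> * real N \<le> D * (\<tau> 1 - \<tau> 0) powr (1 - \<alpha> / 2)" "\<kappa> \<ge> 0" and D: "D \<ge> 0"
  and n: "n \<in> {1..N}" and t: "t \<in> {\<tau> (n - 1)..\<tau> n}"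
 shows "\<bar>frac_integral \<alpha> g t\<bar> \<le> (2 / Gamma (\<alpha> + 1) + 2 powr (\<alpha> + 1) / Gamma (\<alpha> + 2)) * D * (\<tau> n - \<tau> (n - 1)) powr (1 + \<alpha> / 2)"
proof -
 let ?w = "omega (\<alpha> + 1)"
 define k where "k n = \<tau> n - \<tau> (n - 1)" for n
 have kp: "k n > 0" if "n \<in> {1..N}" for n using kpos[OF that] by (simp add: k_def)
 have km: "k i \<le> k j" if "1 \<le> i" "i \<le> j" "j \<le> N" for i j using kmono[OF that] by (simp add: k_def)
 have \<tau>mono: "\<tau> i \<le> \<tau> j" if "i \<le> j" "j \<le> N" for i j
  using that
 proof (induction j)
  case (Suc j)
  then show ?case using kp[of "Suc j"] by (cases "i = Suc j") (auto simp: k_def)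
 qed simp
 have \<tau>nonneg: "\<tau> j \<ge> 0" if "j \<le> N" for j using \<tau>mono[of 0 j] \<tau>0 that by simp
 \<comment> \<open>The cell bounds increase with the cell, so that of cell j covers the whole
   history up to \<open>\<tau> j\<close>. The point 0 belongs to no cell and needs
   \<open>g0\<close>.\<close>
 have gb: "\<bar>g s\<bar> \<le> D * k j powr (- \<alpha> / 2)" if "j \<in> {1..N}" "s \<in> {0..\<tau> j}" for s j
  using that
 proof (induction j)
  case (Suc j)
  show ?case
  proof (cases "s \<in> {\<tau> j<..\<tau> (Suc j)}")
   case True
   then show ?thesis using g[of "Suc j" s] Suc.prems by (simp add: k_def)
  next
   case False
   then have s: "s \<in> {0..\<tau> j}" using Suc.prems by auto
   show ?thesis
   proof (cases "j = 0")
    case True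
    then show ?thesis using s \<tau>0 g0 D by auto
   next
    case j: False
    then have "\<bar>g s\<bar> \<le> D * k j powr (- \<alpha> / 2)" using Suc s by auto
    also have "\<dots> \<le> D * k (Suc j) powr (- \<alpha> / 2)"
     using j Suc.prems kp[of j] km[of j "Suc j"] \<alpha> D by (intro mult_left_mono powr_mono2) auto
    finally show ?thesis .
   qed
  qed
 qed simp
 have mg: "g \<in> borel_measurable (lebesgue_on {a..b})" if "0 \<le> a" "b \<le> \<tau> N" for a b
  by (rule measurable_restrict_mono[OF m]) (use that in auto)
 have n1N: "n - 1 \<le> N" "n - 2 \<le> N" using n by auto
 have tN: "t \<le> \<tau> N" "0 \<le> t" using t n \<tau>mono[of n N] \<tau>nonneg[OF n1N(1)] by auto
 have hint: "(\<lambda>s. ?w (t - s) * g s) integrable_on {a..b}" if "0 \<le> a" "a \<le> b" "b \<le> t" for a b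
  using omega_times_bounded(1)[OF \<alpha>(1) that(2,3) mg[OF that(1)], of "D * k n powr (- \<alpha> / 2)"] gb[OF n] that t tN
  by (auto dest!: set_lebesgue_integral_eq_integral(1))
 \<comment> \<open>The history is cut two cells back, so that t - \<tau> q is at least the step of
   cell n - 1 and the kernel is bounded on the far part. For n = 1 and n = 2 this gives q = 0 and
   the far part is empty.\<close>
 define q where "q = n - 2"
 have qn: "q \<le> n - 1" "q \<le> N" using n by (auto simp: q_def)
 have \<tau>q: "\<tau> q \<le> t" "0 \<le> \<tau> q" using t \<tau>mono[OF qn(1) n1N(1)] \<tau>nonneg[OF qn(2)] by auto
 have far: "\<bar>integral {0..\<tau> j} (\<lambda>s. ?w (t - s) * g s)\<bar>
   \<le> D * k (n - 1) powr (1 - \<alpha> / 2) * (?w (t - \<tau> j) - ?w t) + real j * \<kappa> * ?w (t - \<tau> j)" if "j \<le> q" for j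
  using that
 proof (induction j)
  case 0
  then show ?case by (simp add: \<tau>0)
 next
  case (Suc j)
  have j: "Suc j \<le> n - 2" "Suc j \<in> {1..N}" using Suc.prems n by (auto simp: q_def)
  have tj: "\<tau> j \<le> \<tau> (Suc j)" "\<tau> (Suc j) < t" "0 \<le> \<tau> j" "0 \<le> \<tau> (Suc j)"
  proof -
   have "\<tau> (n - 2) < \<tau> (n - 1)"
   proof -
    have "n - 1 \<in> {1..N}" using j n by auto
    from kp[OF this] show ?thesis by (simp add: k_def numeral_2_eq_2)
   qed
   then show "\<tau> (Suc j) < t" using \<tau>mono[OF j(1) n1N(2)] t by auto
  qed (use \<tau>mono[of j "Suc j"] j \<tau>nonneg[of j] \<tau>nonneg[of "Suc j"] in auto)
  have step: "\<bar>integral {\<tau> j..\<tau> (Suc j)} (\<lambda>s. ?w (t - s) * g s)\<bar>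
    \<le> (D * k (Suc j) powr (- \<alpha> / 2)) * (\<tau> (Suc j) - \<tau> j) * (?w (t - \<tau> (Suc j)) - ?w (t - \<tau> j)) + \<kappa> * ?w (t - \<tau> j)"
  proof (rule omega_times_small_mean[OF \<alpha> tj(1,2) mg])
   show "\<bar>g s\<bar> \<le> D * k (Suc j) powr (- \<alpha> / 2)" if "s \<in> {\<tau> j..\<tau> (Suc j)}" for s
    using gb[of "Suc j" s] j that tj by auto
   show "\<bar>integral {\<tau> j..\<tau> (Suc j)} g\<bar> \<le> \<kappa>" using mean[of "Suc j"] j by simp
  qed (use tj tN in auto)
  have w1: "?w (t - \<tau> j) \<le> ?w (t - \<tau> (Suc j))" using tj by (intro omega_antimono \<alpha>) auto
  have "k (Suc j) powr (- \<alpha> / 2) * (\<tau> (Suc j) - \<tau> j) = k (Suc j) powr (1 - \<alpha> / 2)"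
   using kp[OF j(2)] powr_add[of "k (Suc j)" "- \<alpha> / 2" 1] by (simp add: k_def algebra_simps)
  also have "\<dots> \<le> k (n - 1) powr (1 - \<alpha> / 2)"
   using kp[OF j(2)] km[of "Suc j" "n - 1"] j n \<alpha> by (intro powr_mono2) auto
  finally have "D * (k (Suc j) powr (- \<alpha> / 2) * (\<tau> (Suc j) - \<tau> j)) * (?w (t - \<tau> (Suc j)) - ?w (t - \<tau> j))
    \<le> D * k (n - 1) powr (1 - \<alpha> / 2) * (?w (t - \<tau> (Suc j)) - ?w (t - \<tau> j))"
   using D w1 by (intro mult_right_mono mult_left_mono) auto
  moreover have "real (Suc j) * \<kappa> * ?w (t - \<tau> (Suc j)) \<ge> real j * \<kappa> * ?w (t - \<tau> j) + \<kappa> * ?w (t - \<tau> j)"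
   using mult_left_mono[OF w1, of "real (Suc j) * \<kappa>"] \<kappa>(2) by (simp add: algebra_simps)
  moreover have "integral {0..\<tau> (Suc j)} (\<lambda>s. ?w (t - s) * g s) =
    integral {0..\<tau> j} (\<lambda>s. ?w (t - s) * g s) + integral {\<tau> j..\<tau> (Suc j)} (\<lambda>s. ?w (t - s) * g s)"
   by (rule Henstock_Kurzweil_Integration.integral_combine[symmetric]) (use tj hint in auto)
  ultimately show ?case using Suc step by (simp add: algebra_simps)
 qed
 have far': "\<bar>integral {0..\<tau> q} (\<lambda>s. ?w (t - s) * g s)\<bar> \<le> 2 / Gamma (\<alpha> + 1) * D * k n powr (1 + \<alpha> / 2)"
 proof (cases "n \<le> 2")
  case True
  then show ?thesis using D \<tau>0 Gamma_real_nonneg[of "\<alpha> + 1"] \<alpha> by (simp add: q_def)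
 next
  case False
  have n1: "n - 1 \<in> {1..N}" using n False by auto
  have kn1: "k (n - 1) > 0" by (rule kp[OF n1])
  have "t - \<tau> q \<ge> k (n - 1)" using t by (simp add: k_def q_def numeral_2_eq_2)
  then have wq: "?w (t - \<tau> q) \<le> ?w (k (n - 1))" by (intro omega_antimono \<alpha> kn1)
  have "D * k (n - 1) powr (1 - \<alpha> / 2) * (?w (t - \<tau> q) - ?w t) \<le> D * k (n - 1) powr (1 - \<alpha> / 2) * ?w (k (n - 1))"
   using D wq omega_nonneg[OF \<alpha>(1), of t] by (intro mult_left_mono) auto
  moreover have "real q * \<kappa> * ?w (t - \<tau> q) \<le> (D * k (n - 1) powr (1 - \<alpha> / 2)) * ?w (k (n - 1))"
  proof (rule mult_mono[OF _ wq])
   have "real q * \<kappa> \<le> \<kappa> * real N" using qn \<kappa>(2) by (simp add: mult.commute mult_left_mono)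
   also have "\<dots> \<le> D * k 1 powr (1 - \<alpha> / 2)" using \<kappa>(1) by (simp add: k_def)
   also have "\<dots> \<le> D * k (n - 1) powr (1 - \<alpha> / 2)"
    using D kp[of 1] km[of 1 "n - 1"] n False \<alpha> by (intro mult_left_mono powr_mono2) auto
   finally show "real q * \<kappa> \<le> D * k (n - 1) powr (1 - \<alpha> / 2)" .
  qed (use D \<alpha> omega_nonneg in auto)
  ultimately have "\<bar>integral {0..\<tau> q} (\<lambda>s. ?w (t - s) * g s)\<bar> \<le> 2 * D * (k (n - 1) powr (1 - \<alpha> / 2) * ?w (k (n - 1)))"
   using far[of q] by simp
  also have "k (n - 1) powr (1 - \<alpha> / 2) * ?w (k (n - 1)) = k (n - 1) powr (1 + \<alpha> / 2) / Gamma (\<alpha> + 1)"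
   unfolding omega_eq times_divide_eq_right powr_add[symmetric] by (simp add: add.commute)
  also have "\<dots> \<le> k n powr (1 + \<alpha> / 2) / Gamma (\<alpha> + 1)"
   using kn1 km[of "n - 1" n] n False \<alpha> by (intro divide_right_mono powr_mono2 Gamma_real_nonneg) auto
  finally have "\<bar>integral {0..\<tau> q} (\<lambda>s. ?w (t - s) * g s)\<bar> \<le> 2 * D * (k n powr (1 + \<alpha> / 2) / Gamma (\<alpha> + 1))"
   using D by (simp add: mult_left_mono)
  then show ?thesis by (simp add: mult_ac)
 qed
 have near: "\<bar>integral {\<tau> q..t} (\<lambda>s. ?w (t - s) * g s)\<bar> \<le> 2 powr (\<alpha> + 1) / Gamma (\<alpha> + 2) * D * k n powr (1 + \<alpha> / 2)"
 proof -
  have kn: "k n > 0" by (rule kp[OF n])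
  \<comment> \<open>At most two cells, none longer than the last; this is the origin of
    \<open>2 powr (\<alpha> + 1)\<close>.\<close>
  have "t - \<tau> q \<le> 2 * k n"
  proof (cases "n = 1")
   case True
   then show ?thesis using t kn by (auto simp: q_def k_def)
  next
   case False
   then have "k (n - 1) \<le> k n" using km[of "n - 1" n] n by auto
   then show ?thesis using t by (auto simp: q_def k_def numeral_2_eq_2)
  qed
  then have p: "(t - \<tau> q) powr (\<alpha> + 1) \<le> (2 * k n) powr (\<alpha> + 1)" using \<tau>q \<alpha> by (intro powr_mono2) auto
  have "\<bar>integral {\<tau> q..t} (\<lambda>s. ?w (t - s) * g s)\<bar>
   \<le> (D * k n powr (- \<alpha> / 2)) * (((t - \<tau> q) powr (\<alpha> + 1) - (t - t) powr (\<alpha> + 1)) / Gamma (\<alpha> + 2))"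
   by (rule omega_times_bounded[OF \<alpha>(1) \<tau>q(1) order_refl mg]) (use gb[OF n] \<tau>q t tN in auto)
  also have "\<dots> \<le> (D * k n powr (- \<alpha> / 2)) * ((2 * k n) powr (\<alpha> + 1) / Gamma (\<alpha> + 2))"
   using p D \<alpha> by (intro mult_left_mono divide_right_mono) (auto intro!: Gamma_real_nonneg)
  also have "\<dots> = 2 powr (\<alpha> + 1) / Gamma (\<alpha> + 2) * D * (k n powr (- \<alpha> / 2) * k n powr (\<alpha> + 1))"
   using kn by (simp add: powr_mult)
  also have "k n powr (- \<alpha> / 2) * k n powr (\<alpha> + 1) = k n powr (1 + \<alpha> / 2)"
   by (simp add: powr_add[symmetric] add.commute)
  finally show ?thesis .
 qed
 have "frac_integral \<alpha> g t = integral {0..\<tau> q} (\<lambda>s. ?w (t - s) * g s) + integral {\<tau> q..t} (\<lambda>s. ?w (t - s) * g s)"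
  unfolding frac_integral_def real_scaleR_def
  by (rule Henstock_Kurzweil_Integration.integral_combine[symmetric]) (use \<tau>q hint tN in auto)
 then show ?thesis using far' near by (simp add: k_def distrib_right)
qed

section \<open>Inverse inequalities\<close>

lemma integral_unit_interval_substitution:
 fixes f :: "real \<Rightarrow> real"
 assumes "a < b" "f integrable_on {a..b}"
 shows "integral {0..1} (\<lambda>x. f (a + (b - a) * x)) = integral {a..b} f / (b - a)"
proof -
 have "(f has_integral integral {a..b} f) (cbox a b)"
  using assms by (simp add: has_integral_integral)
 from has_integral_affinity[OF this, of "b - a" a]
 have "((\<lambda>x. f ((b - a) *\<^sub>R x + a)) has_integral integral {a..b} f / (b - a)) ((\<lambda>x. (1 / (b - a)) *\<^sub>R x + - ((1 / (b - a)) *\<^sub>R a)) ` cbox a b)"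
  using assms by simp
 moreover have "(\<lambda>x. (1 / (b - a)) *\<^sub>R x + - ((1 / (b - a)) *\<^sub>R a)) ` cbox a b = {0..1}"
  using assms by (subst image_affinity_cbox) (auto simp: diff_divide_distrib[symmetric])
 ultimately have "((\<lambda>x. f (a + (b - a) * x)) has_integral integral {a..b} f / (b - a)) {0..1}"
  by (simp add: add.commute)
 then show ?thesis by (rule integral_unique)
qed

text \<open>After rescaling to [0,1], values, derivatives and coefficients are all controlled by the
  L1 norm through \<open>poly_coeff_bound\<close>. That norm is at most the L2 norm by Jensen's
  inequality, and at most any uniform bound.\<close>

lemma poly_inverse_inequality:
 obtains C where "C > 0"
  "!!(q::real poly) a b t. degree q \<le> p ==> a < b ==> t \<in> {a..b} ==>
   (poly q t)\<^sup>2 \<le> C / (b - a) * integral {a..b} (\<lambda>s. (poly q s)\<^sup>2)"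
  "!!(q::real poly) a b t B. degree q \<le> p ==> a < b ==> t \<in> {a..b} ==>
   (!!s. s \<in> {a..b} ==> \<bar>poly q s\<bar> \<le> B) ==> \<bar>poly (pderiv q) t\<bar> \<le> C / (b - a) * B"
  "!!(q::real poly) i B. degree q \<le> p ==>
   (!!s. s \<in> {0..1} ==> \<bar>poly q s\<bar> \<le> B) ==> \<bar>coeff q i\<bar> \<le> C * B"
proof -
 obtain C0 where C0: "C0 > 0" "!!(q::real poly) i. degree q \<le> p ==> \<bar>coeff q i\<bar> \<le> C0 * integral {0..1} (\<lambda>x. \<bar>poly q x\<bar>)"
  using poly_coeff_bound[of p] by blast
 define C1 where "C1 = real (Suc p) * C0"
 have sup: "\<bar>poly q x\<bar> \<le> C1 * integral {0..1} (\<lambda>x. \<bar>poly q x\<bar>)" if q: "degree q \<le> p" and x: "x \<in> {0..1}" for q x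
 proof -
  have "\<bar>poly q x\<bar> \<le> (\<Sum>i\<le>p. \<bar>coeff q i * x ^ i\<bar>)" unfolding poly_eq_sum[OF q] by (rule sum_abs)
  also have "\<dots> \<le> (\<Sum>i\<le>p. C0 * integral {0..1} (\<lambda>x. \<bar>poly q x\<bar>))"
  proof (rule sum_mono)
   fix i
   have "\<bar>coeff q i\<bar> * \<bar>x ^ i\<bar> \<le> \<bar>coeff q i\<bar> * 1"
    using x by (intro mult_left_mono) (auto simp: power_abs[symmetric] power_le_one)
   then show "\<bar>coeff q i * x ^ i\<bar> \<le> C0 * integral {0..1} (\<lambda>x. \<bar>poly q x\<bar>)"
    using C0(2)[OF q, of i] by (simp add: abs_mult)
  qed
  finally show ?thesis by (simp add: C1_def)
 qed
 have resc: "poly q t = poly (pcompose q [:a, b - a:]) ((t - a) / (b - a))" if "a < b" for q and a b t :: real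
  using that by (simp add: poly_pcompose)
 have dresc: "degree (pcompose q [:a, b - a:]) \<le> p" if "degree q \<le> p" for q and a b :: real
  using that degree_pcompose_le[of q "[:a, b - a:]"] by (auto intro: order_trans)
 \<comment> \<open>Expansion of the nonnegative variance of |q| about its mean.\<close>
 have jensen: "(integral {0..1} (\<lambda>x. \<bar>poly q x\<bar>))\<^sup>2 \<le> integral {0..1} (\<lambda>x. (poly q x)\<^sup>2)" for q :: "real poly"
 proof -
  define m where "m = integral {0..1} (\<lambda>x. \<bar>poly q x\<bar>)"
  have i1: "(\<lambda>x. \<bar>poly q x\<bar>) integrable_on {0..1}" and i2: "(\<lambda>x. (poly q x)\<^sup>2) integrable_on {0..1}"
   by (intro integrable_continuous_real continuous_intros)+
  have "0 \<le> integral {0..1} (\<lambda>x. (\<bar>poly q x\<bar> - m)\<^sup>2)"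
   by (intro integral_nonneg integrable_continuous_real continuous_intros) auto
  also have "\<dots> = integral {0..1} (\<lambda>x. (poly q x)\<^sup>2 - 2 * m * \<bar>poly q x\<bar> + m\<^sup>2)"
   by (rule integral_cong) (simp add: power2_diff mult_ac)
  also have "\<dots> = integral {0..1} (\<lambda>x. (poly q x)\<^sup>2) - 2 * m * m + m\<^sup>2"
  proof -
   have "((\<lambda>x. (poly q x)\<^sup>2 - 2 * m * \<bar>poly q x\<bar> + m\<^sup>2) has_integral
     (integral {0..1} (\<lambda>x. (poly q x)\<^sup>2) - 2 * m * m + m\<^sup>2 * (1 - 0))) {0..1}"
   proof (intro has_integral_add has_integral_diff has_integral_mult_right)
    show "((\<lambda>x. (poly q x)\<^sup>2) has_integral integral {0..1} (\<lambda>x. (poly q x)\<^sup>2)) {0..1}"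
     using i2 by (rule integrable_integral)
    show "((\<lambda>x. \<bar>poly q x\<bar>) has_integral m) {0..1}"
     unfolding m_def using i1 by (rule integrable_integral)
    show "((\<lambda>x::real. m\<^sup>2) has_integral m\<^sup>2 * (1 - 0)) {0..1}"
     using has_integral_const_real[of "m\<^sup>2" 0 1] by simp
   qed
   then show ?thesis by (simp add: integral_unique)
  qed
  finally show ?thesis by (simp add: m_def power2_eq_square)
 qed
 define S where "S = (\<Sum>i\<le>p. real i * C0)"
 have "S \<ge> 0" unfolding S_def using C0(1) by (intro sum_nonneg) simp
 \<comment> \<open>The three summands serve the bounds for values, coefficients and derivatives, in
   this order.\<close>
 moreover define C where "C = C1\<^sup>2 + C0 + S"
 moreover have "C1\<^sup>2 \<ge> 0" by simp
 ultimately have C: "C1\<^sup>2 \<le> C" "C0 \<le> C" "S \<le> C" "C > 0"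
  using C0(1) by linarith+
 have coeffB: "\<bar>coeff q i\<bar> \<le> C0 * B" if q: "degree q \<le> p" and B: "!!s. s \<in> {0..1} ==> \<bar>poly q s\<bar> \<le> B" for q i B
 proof -
  have "integral {0..1} (\<lambda>x. \<bar>poly q x\<bar>) \<le> integral {0..1} (\<lambda>x::real. B)"
   by (rule integral_le) (use B in \<open>auto intro!: integrable_continuous_real continuous_intros\<close>)
  then have "C0 * integral {0..1} (\<lambda>x. \<bar>poly q x\<bar>) \<le> C0 * B" using C0(1) by simp
  then show ?thesis using C0(2)[OF q, of i] by linarith
 qed
 show ?thesis
 proof (rule that[OF C(4)])
  fix q :: "real poly" and a b t :: real assume q: "degree q \<le> p" and ab: "a < b" and t: "t \<in> {a..b}"
  let ?q = "pcompose q [:a, b - a:]"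
  have x: "(t - a) / (b - a) \<in> {0..1}" using ab t by (auto simp: field_simps)
  have "(poly q t)\<^sup>2 = \<bar>poly ?q ((t - a) / (b - a))\<bar>\<^sup>2" by (subst resc[OF ab]) simp
  also have "\<dots> \<le> (C1 * integral {0..1} (\<lambda>x. \<bar>poly ?q x\<bar>))\<^sup>2"
   by (intro power_mono sup dresc q x) simp
  also have "\<dots> \<le> C1\<^sup>2 * integral {0..1} (\<lambda>x. (poly ?q x)\<^sup>2)"
   unfolding power_mult_distrib by (intro mult_left_mono jensen) simp
  also have "\<dots> \<le> C * integral {0..1} (\<lambda>x. (poly ?q x)\<^sup>2)"
   by (intro mult_right_mono C integral_nonneg integrable_continuous_real continuous_intros) simp
  also have "integral {0..1} (\<lambda>x. (poly ?q x)\<^sup>2) = integral {a..b} (\<lambda>s. (poly q s)\<^sup>2) / (b - a)"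
using integral_unit_interval_substitution[OF ab integrable_poly[of "q\<^sup>2"]]
   by (simp add: poly_pcompose mult.commute poly_power[abs_def])
  finally show "(poly q t)\<^sup>2 \<le> C / (b - a) * integral {a..b} (\<lambda>s. (poly q s)\<^sup>2)" by simp
 next
  fix q :: "real poly" and a b t B :: real assume q: "degree q \<le> p" and ab: "a < b" and t: "t \<in> {a..b}"
   and B: "!!s. s \<in> {a..b} ==> \<bar>poly q s\<bar> \<le> B"
  let ?q = "pcompose q [:a, b - a:]" and ?x = "(t - a) / (b - a)"
  have x: "?x \<in> {0..1}" using ab t by (auto simp: field_simps)
  have B0: "B \<ge> 0" using B[OF t] by linarith
  have B': "\<bar>poly ?q s\<bar> \<le> B" if "s \<in> {0..1}" for s
  proof -
   have "0 \<le> (b - a) * s" "(b - a) * s \<le> (b - a) * 1" using that ab by (auto intro: mult_left_mono)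
   then show ?thesis using B[of "a + (b - a) * s"] by (simp add: poly_pcompose mult.commute)
  qed
  have "poly (pderiv ?q) ?x = (b - a) * poly (pderiv q) t"
   using ab by (simp add: pderiv_pcompose poly_pcompose pderiv_pCons)
  moreover have "\<bar>poly (pderiv ?q) ?x\<bar> \<le> C * B"
  proof -
   have "poly (pderiv ?q) ?x = (\<Sum>i\<le>p. coeff (pderiv ?q) i * ?x ^ i)"
    by (rule poly_eq_sum) (use dresc[OF q, of a b] degree_pderiv[of ?q] in simp)
   also have "\<dots> = (\<Sum>i\<le>p. real (Suc i) * coeff ?q (Suc i) * ?x ^ i)" by (simp add: coeff_pderiv)
   also have "\<dots> = (\<Sum>i<p. real (Suc i) * coeff ?q (Suc i) * ?x ^ i)"
    using dresc[OF q, of a b] by (simp add: lessThan_Suc_atMost[symmetric] coeff_eq_0)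
   finally have "\<bar>poly (pderiv ?q) ?x\<bar> \<le> (\<Sum>i<p. \<bar>real (Suc i) * coeff ?q (Suc i) * ?x ^ i\<bar>)" by (simp add: sum_abs del: of_nat_Suc)
   also have "\<dots> \<le> (\<Sum>i<p. real (Suc i) * (C0 * B))"
   proof (rule sum_mono)
    fix i
    have "\<bar>coeff ?q (Suc i)\<bar> * \<bar>?x ^ i\<bar> \<le> (C0 * B) * 1"
     using x coeffB[OF dresc[OF q] B'] C0(1) B0
     by (intro mult_mono) (auto simp: power_abs[symmetric] power_le_one)
    then show "\<bar>real (Suc i) * coeff ?q (Suc i) * ?x ^ i\<bar> \<le> real (Suc i) * (C0 * B)"
     by (simp add: abs_mult mult.assoc mult_left_mono del: of_nat_Suc)
   qed
   also have "\<dots> = (\<Sum>i<p. real (Suc i) * C0) * B" by (simp add: sum_distrib_right mult.assoc)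
   also have "(\<Sum>i<p. real (Suc i) * C0) = (\<Sum>i\<le>p. real i * C0)"
    by (simp add: lessThan_Suc_atMost[symmetric] sum.lessThan_Suc_shift del: sum.lessThan_Suc)
   also have "\<dots> = S" by (simp only: S_def)
   also have "\<dots> * B \<le> C * B" using C(3) B0 by (rule mult_right_mono)
   finally show ?thesis .
  qed
  ultimately show "\<bar>poly (pderiv q) t\<bar> \<le> C / (b - a) * B"
   using ab by (simp add: abs_mult field_simps)
 next
  fix q :: "real poly" and i B assume q: "degree q \<le> p" and B: "!!s. s \<in> {0..1} ==> \<bar>poly q s\<bar> \<le> B"
  have "B \<ge> 0" using B[of 0] by simp
  then have "C0 * B \<le> C * B" using C by (intro mult_right_mono) auto
  then show "\<bar>coeff q i\<bar> \<le> C * B" using coeffB[OF q B, of i] by linarith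
 qed
qed

section \<open>Polynomials with vector coefficients\<close>

definition vpoly :: "nat \<Rightarrow> (nat \<Rightarrow> 'v::real_vector) \<Rightarrow> real \<Rightarrow> 'v" where
 "vpoly d c t = (\<Sum>j\<le>d. t ^ j *\<^sub>R c j)"

definition vpoly' :: "nat \<Rightarrow> (nat \<Rightarrow> 'v::real_vector) \<Rightarrow> real \<Rightarrow> 'v" where
 "vpoly' d c t = (\<Sum>j\<le>d. (real j * t ^ (j - 1)) *\<^sub>R c j)"

lemma vpoly_diff: "vpoly d c t - vpoly d c' t = vpoly d (\<lambda>j. c j - c' j) t"
 by (simp add: vpoly_def sum_subtractf scaleR_diff_right)

lemma vpoly'_diff: "vpoly' d c t - vpoly' d c' t = vpoly' d (\<lambda>j. c j - c' j) t"
 by (simp add: vpoly'_def sum_subtractf scaleR_diff_right)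

lemma vpoly_minus_const: "vpoly d c t - w = vpoly d (c(0 := c 0 - w)) t"
proof -
 have "vpoly d (c(0 := c 0 - w)) t = (\<Sum>j\<le>d. t ^ j *\<^sub>R c j - (if j = 0 then w else 0))"
  unfolding vpoly_def by (rule sum.cong) (auto simp: scaleR_diff_right)
 then show ?thesis by (simp add: vpoly_def sum_subtractf)
qed

lemma vpoly'_minus_const: "vpoly' d (c(0 := w)) t = vpoly' d c t"
 unfolding vpoly'_def by (rule sum.cong) auto

lemma vpoly_has_vector_derivative:
 fixes c :: "nat \<Rightarrow> 'v::real_normed_vector"
 shows "(vpoly d c has_vector_derivative vpoly' d c t) (at t within S)"
proof -
 have "((\<lambda>t. t ^ j) has_real_derivative real j * t ^ (j - 1)) (at t within S)" for j
  by (auto intro!: derivative_eq_intros)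
 then show ?thesis
  unfolding vpoly_def[abs_def] vpoly'_def
  by (intro has_vector_derivative_sum) (auto intro!: derivative_eq_intros)
qed

lemma vpoly_continuous: "continuous_on S (vpoly d c :: real \<Rightarrow> 'v::real_normed_vector)"
 unfolding vpoly_def[abs_def] by (intro continuous_intros)

context psd_form
begin

text \<open>Pairing with a fixed vector produces a real polynomial, to which the scalar inequalities
  apply. A suitable choice of the vector leads back to \<open>nrm\<close>.\<close>

definition pairing_poly :: "nat \<Rightarrow> (nat \<Rightarrow> 'v) \<Rightarrow> 'v \<Rightarrow> real poly" where
 "pairing_poly d c w = (\<Sum>j\<le>d. monom (a (c j) w) j)"

lemma pairing_poly:
 "degree (pairing_poly d c w) \<le> d"
 "poly (pairing_poly d c w) t = a (vpoly d c t) w"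
 "poly (pderiv (pairing_poly d c w)) t = a (vpoly' d c t) w"
 "coeff (pairing_poly d c w) j = (if j \<le> d then a (c j) w else 0)"
proof -
 show *: "coeff (pairing_poly d c w) j = (if j \<le> d then a (c j) w else 0)" for j
  by (simp add: pairing_poly_def coeff_sum if_distrib cong: if_cong)
 show "degree (pairing_poly d c w) \<le> d" by (rule degree_le) (simp add: *)
 show "poly (pairing_poly d c w) t = a (vpoly d c t) w"
  by (simp add: pairing_poly_def vpoly_def poly_sum poly_monom linear_simps mult.commute)
 have "pderiv (pairing_poly d c w) = (\<Sum>j\<le>d. pderiv (monom (a (c j) w) j))"
  unfolding pairing_poly_def by (induction d) (simp_all add: pderiv_add)
 then show "poly (pderiv (pairing_poly d c w)) t = a (vpoly' d c t) w"
  by (simp add: vpoly'_def poly_sum poly_monom pderiv_monom linear_simps mult_ac)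
qed

lemma vpoly_nrm_square: "(nrm (vpoly d c t))\<^sup>2 = (\<Sum>i\<le>d. t ^ i * poly (pairing_poly d c (c i)) t)"
proof -
 have "(nrm (vpoly d c t))\<^sup>2 = a (vpoly d c t) (vpoly d c t)" by (rule nrm_square)
 also have "\<dots> = a (vpoly d c t) (\<Sum>i\<le>d. t ^ i *\<^sub>R c i)" by (simp add: vpoly_def)
 also have "\<dots> = (\<Sum>i\<le>d. t ^ i * a (vpoly d c t) (c i))" by (simp only: sum_right scale_right)
 finally show ?thesis by (simp add: pairing_poly(2))
qed

lemma continuous_nrm_square: "continuous_on S (\<lambda>t. (nrm (vpoly d c t))\<^sup>2)"
 unfolding vpoly_nrm_square by (intro continuous_intros)

text \<open>Duality with w, the value at t: the pairing polynomial equals the square of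
  \<open>nrm w\<close> at t and is elsewhere at most \<open>nrm w\<close> times the seminorm of the
  value there. One factor of the square of \<open>nrm w\<close> then cancels.\<close>

lemma vpoly_inverse_inequality:
 assumes C: "!!(q::real poly) a b t. degree q \<le> p ==> a < b ==> t \<in> {a..b} ==>
   (poly q t)\<^sup>2 \<le> C / (b - a) * integral {a..b} (\<lambda>s. (poly q s)\<^sup>2)"
  and C0: "C > 0" and d: "d \<le> p" and lr: "l < r" "t \<in> {l..r}"
 shows "(nrm (vpoly d c t))\<^sup>2 \<le> C / (r - l) * integral {l..r} (\<lambda>s. (nrm (vpoly d c s))\<^sup>2)"
proof -
 define w where "w = vpoly d c t"
 define q where "q = pairing_poly d c w"
 have q: "degree q \<le> p" using pairing_poly(1)[of d c w] d by (simp add: q_def)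
 have "((nrm w)\<^sup>2)\<^sup>2 = (poly q t)\<^sup>2" by (simp add: q_def pairing_poly w_def nrm_square)
 also have "\<dots> \<le> C / (r - l) * integral {l..r} (\<lambda>s. (poly q s)\<^sup>2)" by (rule C[OF q lr])
 also have "\<dots> \<le> C / (r - l) * integral {l..r} (\<lambda>s. (nrm w)\<^sup>2 * (nrm (vpoly d c s))\<^sup>2)"
 proof (intro mult_left_mono integral_le)
  fix s
  have "\<bar>poly q s\<bar> \<le> nrm (vpoly d c s) * nrm w" by (simp add: q_def pairing_poly cauchy_schwarz)
  then have "\<bar>poly q s\<bar>\<^sup>2 \<le> (nrm (vpoly d c s) * nrm w)\<^sup>2" by (rule power_mono) simp
  then show "(poly q s)\<^sup>2 \<le> (nrm w)\<^sup>2 * (nrm (vpoly d c s))\<^sup>2" by (simp add: power_mult_distrib mult.commute)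
 qed (use C0 lr in \<open>auto intro!: integrable_continuous_real continuous_intros continuous_nrm_square\<close>)
 also have "\<dots> = (nrm w)\<^sup>2 * (C / (r - l) * integral {l..r} (\<lambda>s. (nrm (vpoly d c s))\<^sup>2))" by simp
 finally have *: "(nrm w)\<^sup>2 * (nrm w)\<^sup>2 \<le> (nrm w)\<^sup>2 * (C / (r - l) * integral {l..r} (\<lambda>s. (nrm (vpoly d c s))\<^sup>2))"
  by (simp add: power2_eq_square)
 have nn: "0 \<le> C / (r - l) * integral {l..r} (\<lambda>s. (nrm (vpoly d c s))\<^sup>2)"
  using C0 lr by (intro mult_nonneg_nonneg integral_nonneg integrable_continuous_real continuous_nrm_square) auto
 show ?thesis
 proof (cases "nrm w = 0")
  case True
  then show ?thesis using nn by (simp add: w_def)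
 next
  case False
  then have "(nrm w)\<^sup>2 > 0" by simp
  with mult_left_le_imp_le[OF *] show ?thesis by (simp add: w_def)
 qed
qed

text \<open>Duality with the derivative at t. Subtracting \<open>w0\<close> does not change the
  derivative, so it is controlled by the distance to any constant; later this constant is a value
  from the neighbouring cell.\<close>

lemma vpoly_markov:
 assumes C: "!!(q::real poly) a b t B. degree q \<le> p ==> a < b ==> t \<in> {a..b} ==>
   (!!s. s \<in> {a..b} ==> \<bar>poly q s\<bar> \<le> B) ==> \<bar>poly (pderiv q) t\<bar> \<le> C / (b - a) * B"
  and C0: "C > 0" and d: "d \<le> p" and lr: "l < r" "t \<in> {l..r}"
  and B: "!!s. s \<in> {l..r} ==> nrm (vpoly d c s - w0) \<le> B"
 shows "nrm (vpoly' d c t) \<le> C / (r - l) * B"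
proof (rule nrm_le_of_form)
 define w where "w = vpoly' d c t"
 define c' where "c' = c(0 := c 0 - w0)"
 define q where "q = pairing_poly d c' w"
 have q: "degree q \<le> p" using pairing_poly(1)[of d c' w] d by (simp add: q_def)
 have "B \<ge> 0" using order_trans[OF nrm_nonneg B[OF lr(2)]] .
 then show "0 \<le> C / (r - l) * B" using C0 lr by auto
 have "\<bar>poly (pderiv q) t\<bar> \<le> C / (r - l) * (B * nrm w)"
 proof (rule C[OF q lr])
  fix s assume s: "s \<in> {l..r}"
  have "\<bar>poly q s\<bar> \<le> nrm (vpoly d c s - w0) * nrm w"
   by (simp add: q_def pairing_poly c'_def vpoly_minus_const[symmetric] cauchy_schwarz)
  also have "\<dots> \<le> B * nrm w" by (intro mult_right_mono B s) simp
  finally show "\<bar>poly q s\<bar> \<le> B * nrm w" .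
 qed
 then show "a (vpoly' d c t) (vpoly' d c t) \<le> C / (r - l) * B * nrm (vpoly' d c t)"
  by (simp add: q_def pairing_poly c'_def vpoly'_minus_const w_def)
qed

end

section \<open>Fractional integrals of piecewise polynomials\<close>

text \<open>The integral of \<open>omega (\<alpha> + 1) (t - s) * s ^ i\<close> for s from a to t,
  obtained by writing s = t - (t - s) and expanding binomially. The \<open>max\<close> makes it 0
  for t <= a. From the closed form, continuity and differentiability in t can be read off.\<close>

definition fmoment :: "real \<Rightarrow> nat \<Rightarrow> real \<Rightarrow> real \<Rightarrow> real" where
 "fmoment \<alpha> i a t = (\<Sum>l\<le>i. real (i choose l) * t ^ (i - l) * (- 1) ^ l *
   (max 0 (t - a) powr (\<alpha> + real l + 1) / (\<alpha> + real l + 1))) / Gamma (\<alpha> + 1)"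

lemma fmoment_continuous: "-1 < \<alpha> ==> continuous_on S (fmoment \<alpha> i a)"
 unfolding fmoment_def[abs_def]
 by (intro continuous_on_divide continuous_on_sum continuous_on_mult continuous_on_powr' continuous_intros)
  (auto simp: Gamma_eq_zero_iff nonpos_Ints_def)

text \<open>The lowest power of t - a is \<alpha> + 1 < 1, so t = a has to be excluded.\<close>

lemma fmoment_differentiable:
 assumes "t \<noteq> a"
 shows "fmoment \<alpha> i a differentiable (at t)"
proof -
 have m: "(\<lambda>t. max 0 (t - a) powr r) differentiable (at t)" for r
 proof (cases "t > a")
  case True
  have "((\<lambda>t. (t - a) powr r) has_real_derivative r * (t - a) powr (r - 1)) (at t)"
   using True by (auto intro!: derivative_eq_intros)
  then have "((\<lambda>t. max 0 (t - a) powr r) has_real_derivative r * (t - a) powr (r - 1)) (at t)"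
   by (rule has_field_derivative_transform_within[where d="t - a"]) (use True in \<open>auto simp: dist_real_def\<close>)
  then show ?thesis unfolding real_differentiable_def by blast
 next
  case False
  have "((\<lambda>t. 0) has_real_derivative 0) (at t)" by simp
  then have "((\<lambda>t. max 0 (t - a) powr r) has_real_derivative 0) (at t)"
   by (rule has_field_derivative_transform_within[where d="a - t"]) (use False assms in \<open>auto simp: dist_real_def\<close>)
  then show ?thesis unfolding real_differentiable_def by blast
 qed
 show ?thesis
  unfolding fmoment_def[abs_def] divide_inverse
  by (intro differentiable_mult differentiable_sum m differentiable_const differentiable_power differentiable_ident finite_atMost ballI)
qed

lemma fmoment_integral:
 assumes \<alpha>: "-1 < \<alpha>" and a: "0 \<le> a" "a \<le> b"
 shows "((\<lambda>s. omega (\<alpha> + 1) (t - s) * (indicator {a<..b} s * s ^ i)) has_integral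
  fmoment \<alpha> i a t - fmoment \<alpha> i b t) {0..t}"
proof (cases "t \<le> a")
 case True
 have "fmoment \<alpha> i a t = 0" "fmoment \<alpha> i b t = 0" using True a by (simp_all add: fmoment_def)
 then show ?thesis using True by (auto intro!: has_integral_is_0 simp: indicator_def)
next
 case False
 define b' where "b' = min b t"
 have b': "a \<le> b'" "b' \<le> t" "b' \<le> b" using False a by (auto simp: b'_def)
 define F where "F s = - ((\<Sum>l\<le>i. real (i choose l) * t ^ (i - l) * (- 1) ^ l *
   ((t - s) powr (\<alpha> + real l + 1) / (\<alpha> + real l + 1))) / Gamma (\<alpha> + 1))" for s
 have "((\<lambda>s. omega (\<alpha> + 1) (t - s) * s ^ i) has_integral F b' - F a) {a..b'}"
 proof (rule fundamental_theorem_of_calculus_interior[OF b'(1)])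
  show "continuous_on {a..b'} F" unfolding F_def
   by (intro continuous_on_minus continuous_on_divide continuous_on_sum continuous_on_mult continuous_on_powr' continuous_intros)
    (use b' \<alpha> in \<open>auto simp: Gamma_eq_zero_iff nonpos_Ints_def\<close>)
  fix s assume s: "s \<in> {a<..<b'}"
  then have pos: "t - s > 0" using b' by auto
  have d: "((\<lambda>s. (t - s) powr (\<alpha> + real l + 1) / (\<alpha> + real l + 1)) has_real_derivative - ((t - s) powr \<alpha> * (t - s) ^ l)) (at s)" for l
  proof -
   have "((\<lambda>s. (t - s) powr (\<alpha> + real l + 1) / (\<alpha> + real l + 1)) has_real_derivative - ((t - s) powr (\<alpha> + real l))) (at s)"
    using pos \<alpha> by (auto intro!: derivative_eq_intros)
   then show ?thesis using pos by (simp add: powr_add powr_realpow)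
  qed
  have "(F has_real_derivative - ((\<Sum>l\<le>i. real (i choose l) * t ^ (i - l) * (- 1) ^ l * - ((t - s) powr \<alpha> * (t - s) ^ l)) / Gamma (\<alpha> + 1))) (at s)"
   unfolding F_def by (intro DERIV_minus DERIV_cdivide DERIV_sum DERIV_cmult d)
  also have "- ((\<Sum>l\<le>i. real (i choose l) * t ^ (i - l) * (- 1) ^ l * - ((t - s) powr \<alpha> * (t - s) ^ l)) / Gamma (\<alpha> + 1))
    = (t - s) powr \<alpha> / Gamma (\<alpha> + 1) * (\<Sum>l\<le>i. real (i choose l) * (- (t - s)) ^ l * t ^ (i - l))"
   unfolding sum_negf sum_distrib_left sum_divide_distrib power_minus[of "t - s"] by (simp add: sum_negf mult_ac)
  also have "(\<Sum>l\<le>i. real (i choose l) * (- (t - s)) ^ l * t ^ (i - l)) = s ^ i"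
   using binomial_ring[of "- (t - s)" t i] by simp
  finally show "(F has_vector_derivative omega (\<alpha> + 1) (t - s) * s ^ i) (at s)"
   by (simp add: has_real_derivative_iff_has_vector_derivative omega_eq)
 qed
 moreover have "F a = - fmoment \<alpha> i a t" using False by (simp add: F_def fmoment_def)
 moreover have "F b' = - fmoment \<alpha> i b t"
  by (simp add: F_def fmoment_def b'_def min_def max_def)
 ultimately have "((\<lambda>s. omega (\<alpha> + 1) (t - s) * s ^ i) has_integral fmoment \<alpha> i a t - fmoment \<alpha> i b t) {a..b'}"
  by simp
 then have "((\<lambda>s. if s \<in> {a..b'} then omega (\<alpha> + 1) (t - s) * s ^ i else 0) has_integral fmoment \<alpha> i a t - fmoment \<alpha> i b t) {0..t}"
  by (subst has_integral_restrict) (use b' a in auto)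
 then show ?thesis
 proof (rule has_integral_spike_finite[of "{a}", rotated 2])
  fix s assume "s \<in> {0..t} - {a}"
  then show "omega (\<alpha> + 1) (t - s) * (indicator {a<..b} s * s ^ i) =
    (if s \<in> {a..b'} then omega (\<alpha> + 1) (t - s) * s ^ i else 0)"
   by (simp add: indicator_def b'_def)
 qed simp
qed

locale frac_mesh =
 fixes \<tau> :: "nat \<Rightarrow> real" and N :: nat and \<alpha> :: real
 assumes \<alpha>: "-1 < \<alpha>" "\<alpha> < 0" and \<tau>0: "\<tau> 0 = 0"
  and step_pos: "!!n. n \<in> {1..N} ==> \<tau> (n - 1) < \<tau> n"
begin

lemma node_mono: "i \<le> j ==> j \<le> N ==> \<tau> i \<le> \<tau> j"
proof (induction j)
 case (Suc j)
 then show ?case using step_pos[of "Suc j"] by (cases "i = Suc j") auto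
qed simp

lemma node_nonneg: "j \<le> N ==> 0 \<le> \<tau> j" using node_mono[of 0 j] \<tau>0 by simp

lemma pred_le: "n \<in> {1..N} ==> n - 1 \<le> N" by auto

definition cell :: "nat \<Rightarrow> real set" where "cell n = {\<tau> (n - 1)<..\<tau> n}"

lemma cell_disjoint: "n \<in> {1..N} ==> m \<in> {1..N} ==> t \<in> cell n ==> t \<in> cell m ==> n = m"
 using node_mono[OF _ pred_le[of m], of n] node_mono[OF _ pred_le[of n], of m]
 by (cases n m rule: linorder_cases) (force simp: cell_def)+

lemma cell_exists: "0 < t ==> t \<le> \<tau> m ==> m \<le> N ==> \<exists>n\<in>{1..m}. t \<in> cell n"
proof (induction m)
 case (Suc m)
 show ?case
 proof (cases "t \<le> \<tau> m")
  case True
  then show ?thesis using Suc by fastforce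
 next
  case False
  then show ?thesis using Suc by (intro bexI[of _ "Suc m"]) (auto simp: cell_def)
 qed
qed (use \<tau>0 in simp)

text \<open>A finite sum of indicators, so that forms and integrals pass through to the pieces. Its
  value is 0 at t = 0 and outside the mesh.\<close>

definition glue :: "(nat \<Rightarrow> real \<Rightarrow> 'v::real_vector) \<Rightarrow> real \<Rightarrow> 'v" where
 "glue X t = (\<Sum>n\<in>{1..N}. indicator (cell n) t *\<^sub>R X n t)"

lemma glue_eq:
 assumes "n \<in> {1..N}" "t \<in> cell n"
 shows "glue X t = X n t"
proof -
 have "glue X t = (\<Sum>m\<in>{1..N}. if m = n then X n t else 0)"
  unfolding glue_def
 proof (rule sum.cong)
  fix m assume "m \<in> {1..N}"
  then show "indicator (cell m) t *\<^sub>R X m t = (if m = n then X n t else 0)"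
   using assms cell_disjoint[of m n t] by (cases "t \<in> cell m") auto
 qed simp
 then show ?thesis using assms by simp
qed

lemma glue_outside: "t \<le> 0 \<or> t > \<tau> N ==> glue X t = 0"
proof -
 assume t: "t \<le> 0 \<or> t > \<tau> N"
 have "t \<notin> cell n" if "n \<in> {1..N}" for n
  using t node_nonneg[OF pred_le[OF that]] node_mono[of n N] that by (force simp: cell_def)
 then show ?thesis unfolding glue_def by (intro sum.neutral) auto
qed

definition moment_weight :: "nat \<Rightarrow> nat \<Rightarrow> real \<Rightarrow> real" where
 "moment_weight n i t = fmoment \<alpha> i (\<tau> (n - 1)) t - fmoment \<alpha> i (\<tau> n) t"

lemma moment_weight_continuous: "continuous_on S (moment_weight n i)"
 unfolding moment_weight_def[abs_def] using \<alpha>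
 by (intro continuous_on_diff fmoment_continuous) auto

lemma moment_weight_differentiable:
 assumes "n \<in> {1..N}" "m \<in> {1..N}" "t \<in> {\<tau> (m - 1)<..<\<tau> m}"
 shows "moment_weight n i differentiable (at t)"
proof -
 have ne: "t \<noteq> \<tau> j" if "j \<le> N" for j
  using assms that node_mono[OF _ pred_le[OF assms(2)], of j] node_mono[OF _ that, of m]
  by (cases "j \<le> m - 1") (force, force)
 show ?thesis unfolding moment_weight_def[abs_def]
  using assms by (intro differentiable_diff fmoment_differentiable ne) auto
qed

text \<open>Only finitely many vectors occur, with scalar functions of time as coefficients. The
  vector valued integral therefore reduces to the scalar integrals
  \<open>fmoment_integral\<close>.\<close>

lemma glue_frac_integral:
 fixes c :: "nat \<Rightarrow> nat \<Rightarrow> 'v::real_normed_vector"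
 shows "((\<lambda>s. omega (\<alpha> + 1) (t - s) *\<^sub>R glue (\<lambda>n. vpoly (d n) (c n)) s) has_integral
  (\<Sum>n\<in>{1..N}. \<Sum>i\<le>d n. moment_weight n i t *\<^sub>R c n i)) {0..t}"
proof -
 have "((\<lambda>s. \<Sum>n\<in>{1..N}. \<Sum>i\<le>d n. (omega (\<alpha> + 1) (t - s) * (indicator (cell n) s * s ^ i)) *\<^sub>R c n i) has_integral
  (\<Sum>n\<in>{1..N}. \<Sum>i\<le>d n. moment_weight n i t *\<^sub>R c n i)) {0..t}"
 proof (intro has_integral_sum finite_atLeastAtMost finite_atMost has_integral_scaleR_left)
  fix n i assume n: "n \<in> {1..N}"
  have "0 \<le> \<tau> (n - 1)" "\<tau> (n - 1) \<le> \<tau> n"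
   using n node_nonneg[of "n - 1"] step_pos[OF n] by auto
  then show "((\<lambda>s. omega (\<alpha> + 1) (t - s) * (indicator (cell n) s * s ^ i)) has_integral moment_weight n i t) {0..t}"
   unfolding cell_def moment_weight_def by (intro fmoment_integral \<alpha>)
 qed
 then show ?thesis
  by (simp add: glue_def vpoly_def scaleR_sum_right mult_ac)
qed

lemma frac_integral_glue:
 fixes c :: "nat \<Rightarrow> nat \<Rightarrow> 'v::real_normed_vector"
 shows "frac_integral \<alpha> (glue (\<lambda>n. vpoly (d n) (c n))) t =
  (\<Sum>n\<in>{1..N}. \<Sum>i\<le>d n. moment_weight n i t *\<^sub>R c n i)"
 unfolding frac_integral_def by (rule integral_unique[OF glue_frac_integral])

end

section \<open>Coercivity of the memory term\<close>

lemma (in psd_form) nrm_sum_le: "nrm (\<Sum>i\<in>I. f i) \<le> (\<Sum>i\<in>I. nrm (f i))"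
proof (induction I rule: infinite_finite_induct)
 case (insert x F)
 then show ?case using nrm_triangle[of "f x" "\<Sum>i\<in>F. f i"] by simp
qed simp_all

lemma (in psd_form) nrm_vpoly_bounded:
 obtains V where "V \<ge> 0" "!!t. t \<in> {0..T} ==> nrm (vpoly d c t) \<le> V" "!!t. t \<in> {0..T} ==> nrm (vpoly' d c t) \<le> V"
proof
 let ?V = "(\<Sum>j\<le>d. T ^ j * nrm (c j)) + (\<Sum>j\<le>d. real j * T ^ (j - 1) * nrm (c j))"
 fix t assume t: "t \<in> {0..T}"
 have p: "\<bar>t ^ j\<bar> \<le> T ^ j" for j using t by (simp add: power_mono)
 have 1: "nrm (vpoly d c t) \<le> (\<Sum>j\<le>d. T ^ j * nrm (c j))"
  unfolding vpoly_def
  by (rule order_trans[OF nrm_sum_le], rule sum_mono) (simp only: nrm_scale mult_right_mono[OF p] nrm_nonneg)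
 have 2: "nrm (vpoly' d c t) \<le> (\<Sum>j\<le>d. real j * T ^ (j - 1) * nrm (c j))"
  unfolding vpoly'_def
 proof (rule order_trans[OF nrm_sum_le], rule sum_mono)
  fix j
  have "\<bar>real j * t ^ (j - 1)\<bar> \<le> real j * T ^ (j - 1)" using p[of "j - 1"] by (simp add: abs_mult mult_left_mono)
  then show "nrm ((real j * t ^ (j - 1)) *\<^sub>R c j) \<le> real j * T ^ (j - 1) * nrm (c j)"
   by (simp only: nrm_scale mult_right_mono nrm_nonneg)
 qed
 have "T \<ge> 0" using t by simp
 then have "0 \<le> (\<Sum>j\<le>d. T ^ j * nrm (c j))" "0 \<le> (\<Sum>j\<le>d. real j * T ^ (j - 1) * nrm (c j))"
  by (auto intro!: sum_nonneg)
 then show "nrm (vpoly d c t) \<le> max 0 ?V" "nrm (vpoly' d c t) \<le> max 0 ?V" using 1 2 by auto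
qed simp

section \<open>Brackets and memory terms; energy of smooth kernels\<close>

locale frac_mesh_form = frac_mesh \<tau> N \<alpha> + psd_form a
 for \<tau> :: "nat \<Rightarrow> real" and N :: nat and \<alpha> :: real and a :: "'v::real_normed_vector \<Rightarrow> 'v \<Rightarrow> real"
begin

text \<open>For a time dependent functional b this stands for the integral over cell n of (db/dt)(t,
  X(t)), after integration by parts. In this form no derivative of a memory term is evaluated, so
  its singularities at nodes do no harm.\<close>

definition bracket :: "(real \<Rightarrow> 'v \<Rightarrow> real) \<Rightarrow> nat \<Rightarrow> nat \<Rightarrow> (nat \<Rightarrow> 'v) \<Rightarrow> real" where
 "bracket b n d c = b (\<tau> n) (vpoly d c (\<tau> n)) - b (\<tau> (n - 1)) (vpoly d c (\<tau> (n - 1)))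
   - integral {\<tau> (n - 1)..\<tau> n} (\<lambda>t. b t (vpoly' d c t))"

definition memory :: "(real \<Rightarrow> real) \<Rightarrow> (real \<Rightarrow> 'v) \<Rightarrow> real \<Rightarrow> 'v \<Rightarrow> real" where
 "memory k v t w = integral {0..t} (\<lambda>s. k (t - s) * a (v s) w)"

context
 fixes d :: "nat \<Rightarrow> nat" and c :: "nat \<Rightarrow> nat \<Rightarrow> 'v"
begin

abbreviation X :: "nat \<Rightarrow> real \<Rightarrow> 'v" where "X n \<equiv> vpoly (d n) (c n)"
abbreviation X' :: "nat \<Rightarrow> real \<Rightarrow> 'v" where "X' n \<equiv> vpoly' (d n) (c n)"
abbreviation T :: real where "T \<equiv> \<tau> N"
abbreviation v :: "real \<Rightarrow> 'v" where "v \<equiv> glue X"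
abbreviation M :: "real measure" where "M \<equiv> restrict_space lborel {0..T}"

lemma v_expand: "v s = (\<Sum>n\<in>{1..N}. \<Sum>i\<le>d n. (indicator (cell n) s * s ^ i) *\<^sub>R c n i)"
 by (simp add: glue_def vpoly_def scaleR_sum_right)

lemma pairing_expand: "a (v s) w = (\<Sum>n\<in>{1..N}. \<Sum>i\<le>d n. (indicator (cell n) s * s ^ i) * a (c n i) w)"
 by (simp add: v_expand linear_simps)

lemma pairing_expand': "a w (v s) = (\<Sum>n\<in>{1..N}. \<Sum>i\<le>d n. (indicator (cell n) s * s ^ i) * a w (c n i))"
 by (simp add: v_expand linear_simps)

lemma bounded_pieces:
 obtains V where "V \<ge> 0" "!!s. nrm (v s) \<le> V" "!!n t. n \<in> {1..N} ==> t \<in> {0..T} ==> nrm (X n t) \<le> V"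
  "!!n t. n \<in> {1..N} ==> t \<in> {0..T} ==> nrm (X' n t) \<le> V"
proof -
 have "\<exists>W. W \<ge> 0 \<and> (\<forall>t\<in>{0..T}. nrm (X n t) \<le> W \<and> nrm (X' n t) \<le> W)" for n
  by (rule nrm_vpoly_bounded[of T "d n" "c n"]) blast
 then have "\<exists>W. \<forall>n. W n \<ge> 0 \<and> (\<forall>t\<in>{0..T}. nrm (X n t) \<le> W n \<and> nrm (X' n t) \<le> W n)"
  by (intro choice allI)
 then obtain W where W: "!!n. W n \<ge> 0" "!!n t. t \<in> {0..T} ==> nrm (X n t) \<le> W n \<and> nrm (X' n t) \<le> W n" by blast
 define V where "V = (\<Sum>n\<in>{1..N}. W n)"
 have WV: "W n \<le> V" if "n \<in> {1..N}" for n
  unfolding V_def by (rule member_le_sum) (use that W(1) in auto)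
 have V0: "V \<ge> 0" unfolding V_def by (intro sum_nonneg W)
 show ?thesis
 proof (rule that[OF V0])
  show x: "nrm (X n t) \<le> V" "nrm (X' n t) \<le> V" if "n \<in> {1..N}" "t \<in> {0..T}" for n t
   using W(2)[OF that(2), of n] WV[OF that(1)] by auto
  show "nrm (v s) \<le> V" for s
  proof (cases "0 < s \<and> s \<le> T")
   case True
   then obtain n where "n \<in> {1..N}" "s \<in> cell n" using cell_exists[of s N] by auto
   then show ?thesis using glue_eq[of n s X] x(1)[of n s] True by simp
  next
   case False
   then show ?thesis using glue_outside[of s X] V0 by auto
  qed
 qed
qed

lemma T_nonneg: "T \<ge> 0" by (rule node_nonneg) simp

lemma finite_M: "finite_measure M"
 by (rule finite_measureI) (simp add: emeasure_restrict_space space_restrict_space emeasure_lborel_Icc_eq)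

lemma borel_M: "f \<in> borel_measurable borel ==> f \<in> borel_measurable M"
 by (simp add: measurable_restrict_space1)

lemma borel_MM:
 assumes "(\<lambda>p. f (fst p) (snd p)) \<in> borel_measurable (borel \<Otimes>\<^sub>M borel)"
 shows "(\<lambda>p. f (fst p) (snd p)) \<in> borel_measurable (M \<Otimes>\<^sub>M M)"
proof -
 have [measurable]: "(\<lambda>x. x) \<in> M \<rightarrow>\<^sub>M borel" by (simp add: measurable_restrict_space1)
 have "(\<lambda>p. (fst p, snd p)) \<in> M \<Otimes>\<^sub>M M \<rightarrow>\<^sub>M borel \<Otimes>\<^sub>M borel"
  by (intro measurable_Pair) (rule measurable_compose[OF _ \<open>(\<lambda>x. x) \<in> M \<rightarrow>\<^sub>M borel\<close>], simp)+
 from measurable_compose[OF this assms] show ?thesis by simp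
qed

lemma integrable_M:
 fixes f :: "real \<Rightarrow> real"
 assumes "f \<in> borel_measurable borel" "!!s. s \<in> {0..T} ==> \<bar>f s\<bar> \<le> B"
 shows "integrable M f"
 by (rule finite_measure.integrable_const_bound[OF finite_M, of _ B])
  (use assms borel_M in \<open>auto intro!: AE_I2 simp: space_restrict_space\<close>)

lemma integral_M_bound:
 fixes f :: "real \<Rightarrow> real"
 assumes "f \<in> borel_measurable borel" "!!s. s \<in> {0..T} ==> \<bar>f s\<bar> \<le> B"
 shows "\<bar>integral\<^sup>L M f\<bar> \<le> measure M (space M) * B"
proof -
 interpret F: finite_measure M by (rule finite_M)
 have "\<bar>integral\<^sup>L M f\<bar> \<le> integral\<^sup>L M (\<lambda>s. \<bar>f s\<bar>)"
  using integral_norm_bound[of M f] by simp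
 also have "\<dots> \<le> integral\<^sup>L M (\<lambda>s. B)"
  by (rule Bochner_Integration.integral_mono)
   (use integrable_M[OF assms] assms in \<open>auto simp: space_restrict_space\<close>)
 finally show ?thesis by simp
qed

lemma fubini_M:
 fixes f :: "real \<Rightarrow> real \<Rightarrow> real"
 assumes m: "(\<lambda>p. f (fst p) (snd p)) \<in> borel_measurable (borel \<Otimes>\<^sub>M borel)"
  and B: "!!s t. s \<in> {0..T} ==> t \<in> {0..T} ==> \<bar>f s t\<bar> \<le> B"
 shows "integral\<^sup>L M (\<lambda>t. integral\<^sup>L M (\<lambda>s. f s t)) = integral\<^sup>L M (\<lambda>s. integral\<^sup>L M (\<lambda>t. f s t))"
  "integrable M (\<lambda>s. integral\<^sup>L M (\<lambda>t. f s t))" "integrable M (\<lambda>t. integral\<^sup>L M (\<lambda>s. f s t))"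
proof -
 interpret F: finite_measure M by (rule finite_M)
 interpret P: pair_sigma_finite M M ..
 have fin: "finite_measure (M \<Otimes>\<^sub>M M)" by (rule finite_measure_pair_measure[OF finite_M finite_M])
 have i: "integrable (M \<Otimes>\<^sub>M M) (\<lambda>p. f (fst p) (snd p))"
  by (rule finite_measure.integrable_const_bound[OF fin, of _ B])
   (use B borel_MM[OF m] in \<open>auto intro!: AE_I2 simp: space_pair_measure space_restrict_space\<close>)
 then have i': "integrable (M \<Otimes>\<^sub>M M) (case_prod f)" by (simp add: case_prod_beta')
 show "integral\<^sup>L M (\<lambda>t. integral\<^sup>L M (\<lambda>s. f s t)) = integral\<^sup>L M (\<lambda>s. integral\<^sup>L M (\<lambda>t. f s t))"
  by (rule P.Fubini_integral[OF i'])
 show "integrable M (\<lambda>s. integral\<^sup>L M (\<lambda>t. f s t))" by (rule P.integrable_fst[OF i'])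
 show "integrable M (\<lambda>t. integral\<^sup>L M (\<lambda>s. f s t))" by (rule P.integrable_snd[OF i'])
qed

text \<open>Bridge from gauge integrals over subintervals to Lebesgue integrals over [0,T]. The
  half-open versions differ by null sets and fit the cells.\<close>

lemma integral_M:
 fixes f :: "real \<Rightarrow> real"
 assumes "f \<in> borel_measurable borel" "!!s. s \<in> {0..T} ==> \<bar>f s\<bar> \<le> B" "0 \<le> l" "r \<le> T"
 shows "integral {l..r} f = integral\<^sup>L M (\<lambda>s. indicator {l..r} s * f s)" "f integrable_on {l..r}"
  "integral {l..r} f = integral\<^sup>L M (\<lambda>s. indicator {l<..r} s * f s)"
  "integral {l..r} f = integral\<^sup>L M (\<lambda>s. indicator {l..<r} s * f s)"
proof -
 have sub: "{l..r} \<subseteq> {0..T}" using assms by auto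
 have i: "set_integrable lborel {0..T} f"
  using integrable_M[OF assms(1,2)] unfolding set_integrable_def by (simp add: integrable_restrict_space)
 have i2: "set_integrable lborel {l..r} f" by (rule set_integrable_subset[OF i _ sub]) simp
 have e: "integral\<^sup>L M (\<lambda>s. indicator S s * f s) = set_lebesgue_integral lborel S f" if "S \<subseteq> {l..r}" for S
 proof -
  have "integral\<^sup>L M (\<lambda>s. indicator S s * f s) = integral\<^sup>L lborel (\<lambda>s. indicator {0..T} s *\<^sub>R (indicator S s * f s))"
   by (rule integral_restrict_space) simp
  also have "(\<lambda>s. indicator {0..T} s *\<^sub>R (indicator S s * f s)) = (\<lambda>s. indicator S s *\<^sub>R f s)"
   using that sub by (intro ext) (auto simp: indicator_def)
  finally show ?thesis by (simp add: set_lebesgue_integral_def)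
 qed
 show "f integrable_on {l..r}" using set_borel_integral_eq_integral(1)[OF i2] .
 show 1: "integral {l..r} f = integral\<^sup>L M (\<lambda>s. indicator {l..r} s * f s)"
  unfolding e[OF order_refl] using set_borel_integral_eq_integral(2)[OF i2] by simp
 have mS: "(\<lambda>s. indicat_real S s *\<^sub>R f s) \<in> borel_measurable lborel" if "S \<in> sets borel" for S
 proof -
  have [measurable]: "f \<in> borel_measurable borel" "S \<in> sets borel" by fact+
  show ?thesis by measurable
 qed
 have ae: "integral\<^sup>L M (\<lambda>s. indicator S s * f s) = set_lebesgue_integral lborel {l..r} f"
  if "S \<in> sets borel" "S \<subseteq> {l..r}" "{l..r} - S \<subseteq> {l, r}" for S
  unfolding e[OF that(2)] unfolding set_lebesgue_integral_def
 proof (rule integral_cong_AE)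
  have "AE s in lborel. s \<notin> {l, r}"
   by (intro AE_not_in finite_imp_null_set_lborel) simp
  then show "AE s in lborel. indicator S s *\<^sub>R f s = indicator {l..r} s *\<^sub>R f s"
   by eventually_elim (use that in \<open>auto simp: indicator_def\<close>)
  show "(\<lambda>s. indicat_real S s *\<^sub>R f s) \<in> borel_measurable lborel"
   by (rule mS[OF that(1)])
  show "(\<lambda>s. indicat_real {l..r} s *\<^sub>R f s) \<in> borel_measurable lborel"
   by (rule mS) simp
 qed
 show "integral {l..r} f = integral\<^sup>L M (\<lambda>s. indicator {l<..r} s * f s)"
  by (subst ae) (use set_borel_integral_eq_integral(2)[OF i2] in auto)
 show "integral {l..r} f = integral\<^sup>L M (\<lambda>s. indicator {l..<r} s * f s)"
  by (subst ae) (use set_borel_integral_eq_integral(2)[OF i2] in auto)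
qed

lemma cell_borel [measurable]: "cell n \<in> sets borel" by (simp add: cell_def)

lemma pairing_borel [measurable]: "(\<lambda>s. a (v s) w) \<in> borel_measurable borel"
 unfolding pairing_expand by measurable

lemma pairing_borel' [measurable]: "(\<lambda>t. a w (v t)) \<in> borel_measurable borel"
 by (simp only: sym[of w] pairing_borel)

lemma vpoly_pairing_borel [measurable]: "(\<lambda>t. a w (X n t)) \<in> borel_measurable borel"
proof (rule borel_measurable_continuous_onI)
 show "continuous_on UNIV (\<lambda>t. a w (X n t))"
  unfolding vpoly_def linear_simps by (intro continuous_intros)
qed

lemma pairing_borel2 [measurable]: "(\<lambda>s. a (v s) (v s)) \<in> borel_measurable borel"
 unfolding pairing_expand by (subst pairing_expand') measurable

lemma pairing_borel_pair [measurable]: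
 "(\<lambda>p. a (v (fst p)) (v (snd p))) \<in> borel_measurable (borel \<Otimes>\<^sub>M borel)"
 "(\<lambda>p. a (v (fst p)) (X' n (snd p))) \<in> borel_measurable (borel \<Otimes>\<^sub>M borel)"
proof -
 show "(\<lambda>p. a (v (fst p)) (v (snd p))) \<in> borel_measurable (borel \<Otimes>\<^sub>M borel)"
  unfolding pairing_expand by (subst pairing_expand') measurable
 have "a w (X' n t) = (\<Sum>j\<le>d n. (real j * t ^ (j - 1)) * a w (c n j))" for w t
  by (simp add: vpoly'_def linear_simps)
 then show "(\<lambda>p. a (v (fst p)) (X' n (snd p))) \<in> borel_measurable (borel \<Otimes>\<^sub>M borel)"
  unfolding pairing_expand by simp
qed

lemma AE_M_not_node: "AE s in M. s \<in> {0..T} \<and> (\<forall>n\<le>N. s \<noteq> \<tau> n)"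
proof -
 have "AE s in lborel. s \<notin> \<tau> ` {..N}"
  by (intro AE_not_in finite_imp_null_set_lborel) simp
 then show ?thesis
  by (subst AE_restrict_space_iff) (auto elim!: eventually_mono)
qed

context
 fixes k k' :: "real \<Rightarrow> real" and B :: real
 assumes kd: "!!x. x \<ge> 0 ==> (k has_real_derivative k' x) (at x)"
  and kb [measurable]: "k \<in> borel_measurable borel" "k' \<in> borel_measurable borel"
  and kB: "!!x. x \<in> {0..T} ==> \<bar>k x\<bar> \<le> B" "!!x. x \<in> {0..T} ==> \<bar>k' x\<bar> \<le> B"
begin

text \<open>The causal kernel. Cutting off at nonpositive arguments extends the memory integral from
  [0,t] to all of [0,T], so that the domain no longer depends on t and Fubini applies.\<close>

abbreviation K :: "real \<Rightarrow> real" where "K x \<equiv> (if x > 0 then k x else 0)"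
abbreviation K' :: "real \<Rightarrow> real" where "K' x \<equiv> (if x > 0 then k' x else 0)"

lemma B_nonneg: "B \<ge> 0" using kB(1)[of 0] T_nonneg by auto

lemma K_bound:
 assumes "s \<in> {0..T}" "t \<in> {0..T}"
 shows "\<bar>K (t - s)\<bar> \<le> B" "\<bar>K' (t - s)\<bar> \<le> B"
 using kB[of "t - s"] assms B_nonneg by auto

lemma pairing_bound:
 assumes "nrm x \<le> V" "nrm y \<le> V"
 shows "\<bar>a x y\<bar> \<le> V * V"
 by (rule order_trans[OF cauchy_schwarz mult_mono[OF assms order_trans[OF nrm_nonneg assms(1)] nrm_nonneg]])

lemma K_pairing_bound:
 assumes "s \<in> {0..T}" "t \<in> {0..T}" "nrm x \<le> V" "nrm y \<le> V"
 shows "\<bar>K (t - s) * a x y\<bar> \<le> B * (V * V)" "\<bar>K' (t - s) * a x y\<bar> \<le> B * (V * V)"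
 unfolding abs_mult
 by (rule mult_mono[OF K_bound(1)[OF assms(1,2)] pairing_bound[OF assms(3,4)] B_nonneg abs_ge_zero])
  (rule mult_mono[OF K_bound(2)[OF assms(1,2)] pairing_bound[OF assms(3,4)] B_nonneg abs_ge_zero])

lemma memory_eq:
 assumes "t \<in> {0..T}"
 shows "memory k v t w = integral\<^sup>L M (\<lambda>s. K (t - s) * a (v s) w)"
proof -
 obtain V where V: "V \<ge> 0" "!!s. nrm (v s) \<le> V" by (rule bounded_pieces) (rule that)
 have "memory k v t w = integral {0..t} (\<lambda>s. K (t - s) * a (v s) w)"
  unfolding memory_def
  by (rule integral_spike[of "{t}"]) auto
 also have "\<dots> = integral\<^sup>L M (\<lambda>s. indicator {0..t} s * (K (t - s) * a (v s) w))"
 proof (rule integral_M(1))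
  show "\<bar>K (t - s) * a (v s) w\<bar> \<le> B * (V * nrm w)" if "s \<in> {0..T}" for s
   unfolding abs_mult using that assms
   by (intro mult_mono K_bound order_trans[OF cauchy_schwarz] V B_nonneg abs_ge_zero nrm_nonneg order_refl) auto
  show "(\<lambda>s. K (t - s) * a (v s) w) \<in> borel_measurable borel" by measurable
 qed (simp, use assms in simp)
 also have "\<dots> = integral\<^sup>L M (\<lambda>s. K (t - s) * a (v s) w)"
  by (rule Bochner_Integration.integral_cong) (auto simp: space_restrict_space indicator_def)
 finally show ?thesis .
qed

text \<open>Integration by parts in t, for fixed s, over the part of cell n that comes after s. The
  jump of \<open>K\<close> from 0 to \<open>k 0\<close> at t = s contributes only in the cell
  containing s. Keeping s off the nodes leaves exactly three cases: s before, inside or after the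
  cell.\<close>

lemma cell_identity:
 assumes n: "n \<in> {1..N}" and s: "s \<in> {0..T}" "!!j. j \<le> N ==> s \<noteq> \<tau> j"
 shows "K (\<tau> n - s) * a w (X n (\<tau> n)) - K (\<tau> (n - 1) - s) * a w (X n (\<tau> (n - 1)))
   - integral\<^sup>L M (\<lambda>t. indicator (cell n) t * (K (t - s) * a w (X' n t)))
  = indicator (cell n) s * (k 0 * a w (X n s)) + integral\<^sup>L M (\<lambda>t. indicator (cell n) t * (K' (t - s) * a w (X n t)))"
proof -
 obtain V where V: "V \<ge> 0" "!!t. t \<in> {0..T} ==> nrm (X n t) \<le> V" "!!t. t \<in> {0..T} ==> nrm (X' n t) \<le> V"
  by (rule bounded_pieces) (rule that, use n in auto)
 have nodes: "0 \<le> \<tau> (n - 1)" "\<tau> (n - 1) < \<tau> n" "\<tau> n \<le> T"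
  using node_nonneg[OF pred_le[OF n]] step_pos[OF n] node_mono[of n N] n by auto
 have cont: "continuous_on UNIV (\<lambda>t. a w (X n t))" "continuous_on UNIV (\<lambda>t. a w (X' n t))"
  unfolding vpoly_def vpoly'_def linear_simps by (intro continuous_intros)+
 then have [measurable]: "(\<lambda>t. a w (X n t)) \<in> borel_measurable borel" "(\<lambda>t. a w (X' n t)) \<in> borel_measurable borel"
  by (simp_all add: borel_measurable_continuous_onI)
 define l where "l = max s (\<tau> (n - 1))"
 have conv: "integral\<^sup>L M (\<lambda>t. indicator (cell n) t * (if t - s > 0 then f (t - s) * g t else 0)) = integral {l..\<tau> n} (\<lambda>t. f (t - s) * g t)"
  "(\<lambda>t. f (t - s) * g t) integrable_on {l..\<tau> n}"
  if [measurable]: "f \<in> borel_measurable borel" "g \<in> borel_measurable borel"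
   and f: "!!x. x \<in> {0..T} ==> \<bar>f x\<bar> \<le> B" and g: "!!t. t \<in> {0..T} ==> \<bar>g t\<bar> \<le> W" for f g :: "real \<Rightarrow> real" and W
 proof -
  have W: "W \<ge> 0" using g[of 0] T_nonneg by auto
  have b: "\<bar>if t - s > 0 then f (t - s) * g t else 0\<bar> \<le> B * W" if "t \<in> {0..T}" for t
   using f[of "t - s"] g[of t] that s(1) W B_nonneg by (auto simp: abs_mult intro!: mult_mono)
  have l0: "0 \<le> l" using nodes by (simp add: l_def)
  have *: "integral {l..\<tau> n} (\<lambda>t. if t - s > 0 then f (t - s) * g t else 0) = integral\<^sup>L M (\<lambda>t. indicator {l<..\<tau> n} t * (if t - s > 0 then f (t - s) * g t else 0))"
   "(\<lambda>t. if t - s > 0 then f (t - s) * g t else 0) integrable_on {l..\<tau> n}"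
   using integral_M(2,3)[OF _ b l0 nodes(3)] by simp_all
  have sp: "(if t - s > 0 then f (t - s) * g t else 0) = f (t - s) * g t" if "t \<in> {l..\<tau> n} - {s}" for t
   using that by (auto simp: l_def)
  show "(\<lambda>t. f (t - s) * g t) integrable_on {l..\<tau> n}"
   by (rule integrable_spike_finite[of "{s}", OF _ _ *(2)]) (use sp in auto)
  have "integral {l..\<tau> n} (\<lambda>t. f (t - s) * g t) = integral {l..\<tau> n} (\<lambda>t. if t - s > 0 then f (t - s) * g t else 0)"
   by (rule integral_spike[of "{s}"]) (use sp in auto)
  also note *(1)
  also have "integral\<^sup>L M (\<lambda>t. indicator {l<..\<tau> n} t * (if t - s > 0 then f (t - s) * g t else 0)) =
   integral\<^sup>L M (\<lambda>t. indicator (cell n) t * (if t - s > 0 then f (t - s) * g t else 0))"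
   by (rule Bochner_Integration.integral_cong) (auto simp: cell_def l_def indicator_def)
  finally show "integral\<^sup>L M (\<lambda>t. indicator (cell n) t * (if t - s > 0 then f (t - s) * g t else 0)) = integral {l..\<tau> n} (\<lambda>t. f (t - s) * g t)" by simp
 qed
 have g: "\<bar>a w (X n t)\<bar> \<le> nrm w * V" "\<bar>a w (X' n t)\<bar> \<le> nrm w * V" if "t \<in> {0..T}" for t
  by (rule order_trans[OF cauchy_schwarz]; intro mult_left_mono V that nrm_nonneg)+
 have i1: "integral\<^sup>L M (\<lambda>t. indicator (cell n) t * (K (t - s) * a w (X' n t))) = integral {l..\<tau> n} (\<lambda>t. k (t - s) * a w (X' n t))"
  "(\<lambda>t. k (t - s) * a w (X' n t)) integrable_on {l..\<tau> n}"
  using conv[of k "\<lambda>t. a w (X' n t)" "nrm w * V"] g kB by (simp_all add: if_distrib[of "\<lambda>x. x * _"] cong: if_cong)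
 have i2: "integral\<^sup>L M (\<lambda>t. indicator (cell n) t * (K' (t - s) * a w (X n t))) = integral {l..\<tau> n} (\<lambda>t. k' (t - s) * a w (X n t))"
  "(\<lambda>t. k' (t - s) * a w (X n t)) integrable_on {l..\<tau> n}"
  using conv[of k' "\<lambda>t. a w (X n t)" "nrm w * V"] g kB by (simp_all add: if_distrib[of "\<lambda>x. x * _"] cong: if_cong)
 show ?thesis
 proof (cases "s < \<tau> n")
  case False
  then have "\<tau> n < s" "l > \<tau> n" using s(2)[of n] n by (auto simp: l_def)
  then show ?thesis using i1 i2 nodes by (auto simp: indicator_def cell_def)
 next
  case True
  have ln: "l \<le> \<tau> n" using True nodes by (simp add: l_def)
  have "((\<lambda>t. k' (t - s) * a w (X n t) + k (t - s) * a w (X' n t)) has_integral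
    (k (\<tau> n - s) * a w (X n (\<tau> n)) - k (l - s) * a w (X n l))) {l..\<tau> n}"
  proof (rule fundamental_theorem_of_calculus[OF ln])
   fix t assume t: "t \<in> {l..\<tau> n}"
   have 1: "((\<lambda>t. k (t - s)) has_real_derivative k' (t - s)) (at t within {l..\<tau> n})"
   proof -
    have "t - s \<ge> 0" using t by (simp add: l_def)
    moreover have "((\<lambda>t. t - s) has_real_derivative 1) (at t within {l..\<tau> n})"
     by (auto intro!: derivative_eq_intros)
    ultimately show ?thesis
     using DERIV_chain2[of k "k' (t - s)" "\<lambda>t. t - s" t 1] kd by simp
   qed
   have 2: "((\<lambda>t. a w (X n t)) has_real_derivative a w (X' n t)) (at t within {l..\<tau> n})"
    using has_field_derivative_at_within[OF poly_DERIV[of "pairing_poly (d n) (c n) w" t]]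
    by (simp add: pairing_poly sym[of w])
   show "((\<lambda>t. k (t - s) * a w (X n t)) has_vector_derivative k' (t - s) * a w (X n t) + k (t - s) * a w (X' n t)) (at t within {l..\<tau> n})"
    using DERIV_mult[OF 1 2] by (simp add: has_real_derivative_iff_has_vector_derivative mult.commute)
  qed
  from integral_unique[OF this] have I: "integral {l..\<tau> n} (\<lambda>t. k' (t - s) * a w (X n t)) + integral {l..\<tau> n} (\<lambda>t. k (t - s) * a w (X' n t))
    = k (\<tau> n - s) * a w (X n (\<tau> n)) - k (l - s) * a w (X n l)"
   by (subst (asm) Henstock_Kurzweil_Integration.integral_add[OF i2(2) i1(2)]) simp
  show ?thesis
  proof (cases "s < \<tau> (n - 1)")
   case True
   then have "l = \<tau> (n - 1)" "s \<notin> cell n" by (auto simp: l_def cell_def)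
   then show ?thesis using I i1 i2 True \<open>s < \<tau> n\<close> by simp
  next
   case False
   then have "\<tau> (n - 1) < s" using s(2)[OF pred_le[OF n]] by linarith
   then have "l = s" "s \<in> cell n" using \<open>s < \<tau> n\<close> by (auto simp: l_def cell_def)
   then show ?thesis using I i1 i2 False \<open>s < \<tau> n\<close> by simp
  qed
 qed
qed

text \<open>The sum of \<open>cell_identity\<close> over the cells, integrated in s. Fubini brings
  the memory terms into this order, and the nodes excluded in \<open>cell_identity\<close> form a
  null set.\<close>

lemma memory_energy:
 "(\<Sum>n\<in>{1..N}. bracket (memory k v) n (d n) (c n)) =
  integral\<^sup>L M (\<lambda>s. k 0 * a (v s) (v s) + integral\<^sup>L M (\<lambda>t. K' (t - s) * a (v s) (v t)))"
proof -
 obtain V where V: "V \<ge> 0" "!!s. nrm (v s) \<le> V" "!!n t. n \<in> {1..N} ==> t \<in> {0..T} ==> nrm (X n t) \<le> V"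
  "!!n t. n \<in> {1..N} ==> t \<in> {0..T} ==> nrm (X' n t) \<le> V"
  by (rule bounded_pieces) (rule that)
 interpret F: finite_measure M by (rule finite_M)
 let ?E = "\<lambda>n s. integral\<^sup>L M (\<lambda>t. indicator (cell n) t * (K (t - s) * a (v s) (X' n t)))"
 have nodes: "\<tau> n \<in> {0..T}" "\<tau> (n - 1) \<in> {0..T}" "0 \<le> \<tau> (n - 1)" "\<tau> n \<le> T" if "n \<in> {1..N}" for n
  using node_nonneg[of n] node_nonneg[OF pred_le[OF that]] node_mono[of n N] node_mono[OF pred_le[OF that]] that by auto
 have bK: "\<bar>indicator (cell n) t * (K (t - s) * a (v s) (X' n t))\<bar> \<le> B * (V * V)"
  if "n \<in> {1..N}" "s \<in> {0..T}" "t \<in> {0..T}" for n s t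
  using K_pairing_bound(1)[OF that(2,3) V(2) V(4)[OF that(1,3)], of s] B_nonneg V(1) by (auto simp: indicator_def)
 have mK: "(\<lambda>p. indicator (cell n) (snd p) * (K (snd p - fst p) * a (v (fst p)) (X' n (snd p)))) \<in> borel_measurable (borel \<Otimes>\<^sub>M borel)" for n
  by measurable
 have third: "integral {\<tau> (n - 1)..\<tau> n} (\<lambda>t. memory k v t (X' n t)) = integral\<^sup>L M (\<lambda>s. ?E n s)" if n: "n \<in> {1..N}" for n
 proof -
  let ?f = "\<lambda>t. integral\<^sup>L M (\<lambda>s. K (t - s) * a (v s) (X' n t))"
  have "integral {\<tau> (n - 1)..\<tau> n} (\<lambda>t. memory k v t (X' n t)) = integral {\<tau> (n - 1)..\<tau> n} ?f"
  proof (rule integral_cong)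
   fix t assume "t \<in> {\<tau> (n - 1)..\<tau> n}"
   then have "t \<in> {0..T}" using nodes[OF n] by auto
   then show "memory k v t (X' n t) = ?f t" by (rule memory_eq)
  qed
  also have "\<dots> = integral\<^sup>L M (\<lambda>t. indicator {\<tau> (n - 1)<..\<tau> n} t * ?f t)"
  proof (rule integral_M(3)[of _ "measure M (space M) * (B * (V * V))"])
   have idM: "(\<lambda>x. x) \<in> M \<rightarrow>\<^sub>M borel" by (simp add: measurable_restrict_space1)
   have sw: "(\<lambda>p. (snd p, fst p)) \<in> borel \<Otimes>\<^sub>M M \<rightarrow>\<^sub>M borel \<Otimes>\<^sub>M borel"
    by (intro measurable_Pair measurable_compose[OF measurable_snd idM] measurable_fst)
   have mF: "(\<lambda>p. K (snd p - fst p) * a (v (fst p)) (X' n (snd p))) \<in> borel_measurable (borel \<Otimes>\<^sub>M borel)"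
    by measurable
   from measurable_compose[OF sw mF]
   have "(\<lambda>p. K (fst p - snd p) * a (v (snd p)) (X' n (fst p))) \<in> borel_measurable (borel \<Otimes>\<^sub>M M)"
    by (simp only: fst_conv snd_conv)
   then have "case_prod (\<lambda>t s. K (t - s) * a (v s) (X' n t)) \<in> borel_measurable (borel \<Otimes>\<^sub>M M)"
    by (simp add: case_prod_beta')
   then show "?f \<in> borel_measurable borel" by (rule F.borel_measurable_lebesgue_integral)
   fix t assume t: "t \<in> {0..T}"
   have bb: "\<bar>K (t - s) * a (v s) (X' n t)\<bar> \<le> B * (V * V)" if "s \<in> {0..T}" for s
    by (rule K_pairing_bound(1)[OF that t V(2) V(4)[OF n t]])
   show "\<bar>?f t\<bar> \<le> measure M (space M) * (B * (V * V))"
    by (rule integral_M_bound[OF _ bb]) measurable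
  qed (use nodes[OF n] in auto)
  also have "\<dots> = integral\<^sup>L M (\<lambda>t. integral\<^sup>L M (\<lambda>s. indicator (cell n) t * (K (t - s) * a (v s) (X' n t))))"
   by (simp add: cell_def)
  also have "\<dots> = integral\<^sup>L M (\<lambda>s. ?E n s)"
   by (rule fubini_M(1)[OF mK bK[OF n]])
  finally show ?thesis .
 qed
 have iE: "integrable M (\<lambda>s. ?E n s)" if "n \<in> {1..N}" for n
  by (rule fubini_M(2)[OF mK bK[OF that]])
 have iK: "integrable M (\<lambda>s. K (t - s) * a (v s) (X n t))" if "n \<in> {1..N}" "t \<in> {0..T}" for n t
  by (rule integrable_M[OF _ K_pairing_bound(1)[OF _ that(2) V(2) V(3)[OF that]]]) measurable
 have iK': "integrable M (\<lambda>t. indicator (cell n) t * (K' (t - s) * a (v s) (X n t)))"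
  if "n \<in> {1..N}" "s \<in> {0..T}" for n s
 proof (rule integrable_M)
  show "(\<lambda>t. indicator (cell n) t * (K' (t - s) * a (v s) (X n t))) \<in> borel_measurable borel"
   using vpoly_pairing_borel[of "v s" n] by measurable
  show "\<bar>indicator (cell n) t * (K' (t - s) * a (v s) (X n t))\<bar> \<le> B * (V * V)" if "t \<in> {0..T}" for t
   using K_pairing_bound(2)[OF \<open>s \<in> {0..T}\<close> that V(2) V(3)[OF \<open>n \<in> {1..N}\<close> that], of s] B_nonneg V(1)
   by (auto simp: indicator_def)
 qed
 have iKK: "integrable M (\<lambda>s. integral\<^sup>L M (\<lambda>t. K' (t - s) * a (v s) (v t)))"
 proof (rule fubini_M(2))
  show "(\<lambda>p. K' (snd p - fst p) * a (v (fst p)) (v (snd p))) \<in> borel_measurable (borel \<Otimes>\<^sub>M borel)"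
   by measurable
  show "\<bar>K' (t - s) * a (v s) (v t)\<bar> \<le> B * (V * V)" if "s \<in> {0..T}" "t \<in> {0..T}" for s t
   by (rule K_pairing_bound(2)[OF that V(2) V(2)])
 qed
 have sum_identity: "(\<Sum>n\<in>{1..N}. K (\<tau> n - s) * a (v s) (X n (\<tau> n)) - K (\<tau> (n - 1) - s) * a (v s) (X n (\<tau> (n - 1))) - ?E n s) =
    k 0 * a (v s) (v s) + integral\<^sup>L M (\<lambda>t. K' (t - s) * a (v s) (v t))"
  if elim: "s \<in> {0..T}" "!!n. n \<le> N ==> s \<noteq> \<tau> n" for s
 proof -
   have e1: "(\<Sum>n\<in>{1..N}. K (\<tau> n - s) * a (v s) (X n (\<tau> n)) - K (\<tau> (n - 1) - s) * a (v s) (X n (\<tau> (n - 1))) - ?E n s)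
     = (\<Sum>n\<in>{1..N}. indicator (cell n) s * (k 0 * a (v s) (X n s)) + integral\<^sup>L M (\<lambda>t. indicator (cell n) t * (K' (t - s) * a (v s) (X n t))))"
    by (rule sum.cong) (use elim cell_identity in auto)
   have e2: "(\<Sum>n\<in>{1..N}. indicator (cell n) s * (k 0 * a (v s) (X n s)) + integral\<^sup>L M (\<lambda>t. indicator (cell n) t * (K' (t - s) * a (v s) (X n t))))
     = k 0 * a (v s) (v s) + (\<Sum>n\<in>{1..N}. integral\<^sup>L M (\<lambda>t. indicator (cell n) t * (K' (t - s) * a (v s) (X n t))))"
   proof -
    have "a (v s) (v s) = (\<Sum>n\<in>{1..N}. indicator (cell n) s * a (v s) (X n s))"
     by (subst (2) glue_def) (simp add: linear_simps)
    then show ?thesis by (simp only: sum.distrib sum_distrib_left mult.left_commute)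
   qed
   have e3: "(\<Sum>n\<in>{1..N}. integral\<^sup>L M (\<lambda>t. indicator (cell n) t * (K' (t - s) * a (v s) (X n t)))) =
     integral\<^sup>L M (\<lambda>t. \<Sum>n\<in>{1..N}. indicator (cell n) t * (K' (t - s) * a (v s) (X n t)))"
    by (rule Bochner_Integration.integral_sum[symmetric]) (rule iK', use elim in auto)
   have e4: "(\<lambda>t. \<Sum>n\<in>{1..N}. indicator (cell n) t * (K' (t - s) * a (v s) (X n t))) = (\<lambda>t. K' (t - s) * a (v s) (v t))"
   proof
    fix t
    have "a (v s) (v t) = (\<Sum>n\<in>{1..N}. indicator (cell n) t * a (v s) (X n t))"
     by (subst (2) glue_def) (simp add: linear_simps)
    then show "(\<Sum>n\<in>{1..N}. indicator (cell n) t * (K' (t - s) * a (v s) (X n t))) = K' (t - s) * a (v s) (v t)"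
     by (simp only: sum_distrib_left mult.left_commute)
   qed
  show ?thesis by (simp only: e1 e2 e3 e4)
 qed
 let ?L = "\<lambda>s. \<Sum>n\<in>{1..N}. K (\<tau> n - s) * a (v s) (X n (\<tau> n)) - K (\<tau> (n - 1) - s) * a (v s) (X n (\<tau> (n - 1))) - ?E n s"
 let ?R = "\<lambda>s. k 0 * a (v s) (v s) + integral\<^sup>L M (\<lambda>t. K' (t - s) * a (v s) (v t))"
 have ae: "AE s in M. ?L s = ?R s"
  using AE_M_not_node by (rule eventually_mono) (rule sum_identity; simp)
 have int: "integrable M (\<lambda>s. K (\<tau> n - s) * a (v s) (X n (\<tau> n)) - K (\<tau> (n - 1) - s) * a (v s) (X n (\<tau> (n - 1))) - ?E n s)"
  if "n \<in> {1..N}" for n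
  by (rule Bochner_Integration.integrable_diff[OF Bochner_Integration.integrable_diff[OF iK[OF that nodes(1)[OF that]] iK[OF that nodes(2)[OF that]]] iE[OF that]])
 have m1: "?L \<in> borel_measurable M"
  by (rule borel_measurable_integrable[OF Bochner_Integration.integrable_sum[OF int]])
 have m2: "?R \<in> borel_measurable M"
  by (rule borel_measurable_add[OF borel_M borel_measurable_integrable[OF iKK]]) measurable
 have br: "bracket (memory k v) n (d n) (c n) =
   integral\<^sup>L M (\<lambda>s. K (\<tau> n - s) * a (v s) (X n (\<tau> n)) - K (\<tau> (n - 1) - s) * a (v s) (X n (\<tau> (n - 1))) - ?E n s)"
  if n: "n \<in> {1..N}" for n
 proof -
  have "integral\<^sup>L M (\<lambda>s. K (\<tau> n - s) * a (v s) (X n (\<tau> n)) - K (\<tau> (n - 1) - s) * a (v s) (X n (\<tau> (n - 1))) - ?E n s)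
   = integral\<^sup>L M (\<lambda>s. K (\<tau> n - s) * a (v s) (X n (\<tau> n)) - K (\<tau> (n - 1) - s) * a (v s) (X n (\<tau> (n - 1)))) - integral\<^sup>L M (?E n)"
   by (rule Bochner_Integration.integral_diff[OF Bochner_Integration.integrable_diff[OF iK[OF n nodes(1)[OF n]] iK[OF n nodes(2)[OF n]]] iE[OF n]])
  also have "integral\<^sup>L M (\<lambda>s. K (\<tau> n - s) * a (v s) (X n (\<tau> n)) - K (\<tau> (n - 1) - s) * a (v s) (X n (\<tau> (n - 1))))
   = integral\<^sup>L M (\<lambda>s. K (\<tau> n - s) * a (v s) (X n (\<tau> n))) - integral\<^sup>L M (\<lambda>s. K (\<tau> (n - 1) - s) * a (v s) (X n (\<tau> (n - 1))))"
   by (rule Bochner_Integration.integral_diff[OF iK[OF n nodes(1)[OF n]] iK[OF n nodes(2)[OF n]]])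
  finally show ?thesis
   by (simp only: bracket_def third[OF n] memory_eq[OF nodes(1)[OF n]] memory_eq[OF nodes(2)[OF n]])
 qed
 have f1: "(\<Sum>n\<in>{1..N}. bracket (memory k v) n (d n) (c n)) = (\<Sum>n\<in>{1..N}. integral\<^sup>L M (\<lambda>s. K (\<tau> n - s) * a (v s) (X n (\<tau> n)) - K (\<tau> (n - 1) - s) * a (v s) (X n (\<tau> (n - 1))) - ?E n s))"
  by (rule sum.cong[OF refl br])
 have f2: "(\<Sum>n\<in>{1..N}. integral\<^sup>L M (\<lambda>s. K (\<tau> n - s) * a (v s) (X n (\<tau> n)) - K (\<tau> (n - 1) - s) * a (v s) (X n (\<tau> (n - 1))) - ?E n s)) = integral\<^sup>L M ?L"
  by (rule Bochner_Integration.integral_sum[OF int, symmetric])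
 have f3: "integral\<^sup>L M ?L = integral\<^sup>L M ?R"
  by (rule integral_cong_AE[OF m1 m2 ae])
 show ?thesis by (rule trans[OF f1 trans[OF f2 f3]])
qed

lemma memory_integrable:
 assumes n: "n \<in> {1..N}"
 shows "(\<lambda>t. memory k v t (X' n t)) integrable_on {\<tau> (n - 1)..\<tau> n}"
proof -
 obtain V where V: "V \<ge> 0" "!!s. nrm (v s) \<le> V" "!!n t. n \<in> {1..N} ==> t \<in> {0..T} ==> nrm (X n t) \<le> V"
  "!!n t. n \<in> {1..N} ==> t \<in> {0..T} ==> nrm (X' n t) \<le> V"
  by (rule bounded_pieces) (rule that)
 interpret F: finite_measure M by (rule finite_M)
 have nodes: "0 \<le> \<tau> (n - 1)" "\<tau> n \<le> T"
  using node_nonneg[OF pred_le[OF n]] node_mono[of n N] n by auto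
 let ?f = "\<lambda>t. integral\<^sup>L M (\<lambda>s. K (t - s) * a (v s) (X' n t))"
 have idM: "(\<lambda>x. x) \<in> M \<rightarrow>\<^sub>M borel" by (simp add: measurable_restrict_space1)
 have sw: "(\<lambda>p. (snd p, fst p)) \<in> borel \<Otimes>\<^sub>M M \<rightarrow>\<^sub>M borel \<Otimes>\<^sub>M borel"
  by (intro measurable_Pair measurable_compose[OF measurable_snd idM] measurable_fst)
 have mF: "(\<lambda>p. K (snd p - fst p) * a (v (fst p)) (X' n (snd p))) \<in> borel_measurable (borel \<Otimes>\<^sub>M borel)"
  by measurable
 from measurable_compose[OF sw mF]
 have "(\<lambda>p. K (fst p - snd p) * a (v (snd p)) (X' n (fst p))) \<in> borel_measurable (borel \<Otimes>\<^sub>M M)"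
  by (simp only: fst_conv snd_conv)
 then have "case_prod (\<lambda>t s. K (t - s) * a (v s) (X' n t)) \<in> borel_measurable (borel \<Otimes>\<^sub>M M)"
  by (simp add: case_prod_beta')
 then have mf: "?f \<in> borel_measurable borel" by (rule F.borel_measurable_lebesgue_integral)
 have bf: "\<bar>?f t\<bar> \<le> measure M (space M) * (B * (V * V))" if t: "t \<in> {0..T}" for t
 proof -
  have bb: "\<bar>K (t - s) * a (v s) (X' n t)\<bar> \<le> B * (V * V)" if "s \<in> {0..T}" for s
   by (rule K_pairing_bound(1)[OF that t V(2) V(4)[OF n t]])
  show ?thesis by (rule integral_M_bound[OF _ bb]) measurable
 qed
 have "?f integrable_on {\<tau> (n - 1)..\<tau> n}" by (rule integral_M(2)[OF mf bf nodes])
 then show ?thesis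
 proof (rule integrable_eq)
  fix t assume "t \<in> {\<tau> (n - 1)..\<tau> n}"
  then have "t \<in> {0..T}" using nodes by auto
  then show "?f t = memory k v t (X' n t)" by (rule memory_eq[symmetric])
 qed
qed

lemma K'_integral:
 assumes "s \<in> {0..T}"
 shows "integral\<^sup>L M (\<lambda>t. K' (t - s)) = k (T - s) - k 0" "integral\<^sup>L M (\<lambda>t. K' (s - t)) = k s - k 0"
proof -
 have sM: "(\<lambda>t. K' (t - s)) \<in> borel_measurable borel" "(\<lambda>t. K' (s - t)) \<in> borel_measurable borel" by measurable
 have "integral\<^sup>L M (\<lambda>t. K' (t - s)) = integral\<^sup>L M (\<lambda>t. indicator {s<..T} t * K' (t - s))"
  by (rule Bochner_Integration.integral_cong) (auto simp: space_restrict_space indicator_def)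
 also have "\<dots> = integral {s..T} (\<lambda>t. K' (t - s))"
  by (rule integral_M(3)[OF sM(1) K_bound(2)[OF assms], symmetric]) (use assms in auto)
 also have "\<dots> = integral {s..T} (\<lambda>t. k' (t - s))"
  by (rule integral_spike[of "{s}"]) auto
 also have "\<dots> = k (T - s) - k (s - s)"
 proof (rule integral_unique[OF fundamental_theorem_of_calculus])
  fix t assume t: "t \<in> {s..T}"
  have "((\<lambda>t. t - s) has_real_derivative 1) (at t within {s..T})"
   by (auto intro!: derivative_eq_intros)
  then show "((\<lambda>t. k (t - s)) has_vector_derivative k' (t - s)) (at t within {s..T})"
   using DERIV_chain2[of k "k' (t - s)" "\<lambda>t. t - s" t 1 "{s..T}"] kd[of "t - s"] t
   by (simp add: has_real_derivative_iff_has_vector_derivative)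
 qed (use assms in auto)
 finally show "integral\<^sup>L M (\<lambda>t. K' (t - s)) = k (T - s) - k 0" by simp
 have "integral\<^sup>L M (\<lambda>t. K' (s - t)) = integral\<^sup>L M (\<lambda>t. indicator {0..<s} t * K' (s - t))"
  by (rule Bochner_Integration.integral_cong) (auto simp: space_restrict_space indicator_def)
 also have "\<dots> = integral {0..s} (\<lambda>t. K' (s - t))"
  by (rule integral_M(4)[OF sM(2) K_bound(2)[OF _ assms], symmetric]) (use assms in auto)
 also have "\<dots> = integral {0..s} (\<lambda>t. k' (s - t))"
  by (rule integral_spike[of "{s}"]) auto
 also have "\<dots> = - k (s - s) - - k (s - 0)"
 proof (rule integral_unique[OF fundamental_theorem_of_calculus])
  fix t assume t: "t \<in> {0..s}"
  have "((\<lambda>t. s - t) has_real_derivative - 1) (at t within {0..s})"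
   by (auto intro!: derivative_eq_intros)
  then have "((\<lambda>t. k (s - t)) has_real_derivative k' (s - t) * - 1) (at t within {0..s})"
   using kd[of "s - t"] t by (intro DERIV_chain2) auto
  from DERIV_minus[OF this]
  show "((\<lambda>t. - k (s - t)) has_vector_derivative k' (s - t)) (at t within {0..s})"
   by (simp add: has_real_derivative_iff_has_vector_derivative)
 qed (use assms in auto)
 finally show "integral\<^sup>L M (\<lambda>t. K' (s - t)) = k s - k 0" by simp
qed

text \<open>Polarisation expresses 2 a(v(s), v(t)) by both squares minus the square of the
  difference. Integrating \<open>k'\<close> in the two square terms cancels every
  \<open>k 0\<close>. Twice the energy becomes the mass weighted with k(T - s), plus the mass
  weighted with k(s), minus the double integral of k'(t - s) |v(s) - v(t)|^2 over s < t. All three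
  contributions are nonnegative; only the total mass, the mass of the last cell and the pairs of
  neighbouring cells are kept.\<close>

lemma memory_energy_lower:
 assumes k0: "!!x. x \<in> {0..T} ==> k x \<ge> 0" and kdec: "!!x y. 0 \<le> x ==> x \<le> y ==> y \<le> T ==> k y \<le> k x"
  and k'0: "!!x. x \<in> {0..T} ==> k' x \<le> 0" and k'inc: "!!x y. 0 \<le> x ==> x \<le> y ==> y \<le> T ==> k' x \<le> k' y"
  and N: "N \<ge> 1"
 shows "k T * integral\<^sup>L M (\<lambda>s. (nrm (v s))\<^sup>2)
   + k (\<tau> N - \<tau> (N - 1)) * integral\<^sup>L M (\<lambda>s. indicator (cell N) s * (nrm (v s))\<^sup>2)
   + (\<Sum>n\<in>{1..<N}. - k' (\<tau> (n + 1) - \<tau> (n - 1)) *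
     integral\<^sup>L M (\<lambda>s. integral\<^sup>L M (\<lambda>t. indicator (cell n) s * indicator (cell (n + 1)) t * (nrm (v s - v t))\<^sup>2)))
  \<le> 2 * (\<Sum>n\<in>{1..N}. bracket (memory k v) n (d n) (c n))"
proof -
 obtain V where V: "V \<ge> 0" "!!s. nrm (v s) \<le> V" "!!n t. n \<in> {1..N} ==> t \<in> {0..T} ==> nrm (X n t) \<le> V"
  "!!n t. n \<in> {1..N} ==> t \<in> {0..T} ==> nrm (X' n t) \<le> V"
  by (rule bounded_pieces) (rule that)
 interpret F: finite_measure M by (rule finite_M)
 let ?G = "\<lambda>s. (nrm (v s))\<^sup>2"
 let ?D = "\<lambda>s t. (nrm (v s - v t))\<^sup>2"
 have mG [measurable]: "?G \<in> borel_measurable borel" unfolding nrm_square by measurable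
 have Deq: "?D s t = ?G s + ?G t - 2 * a (v s) (v t)" for s t
  by (simp add: nrm_square linear_simps sym[of "v t" "v s"])
 have mD [measurable]: "(\<lambda>p. ?D (fst p) (snd p)) \<in> borel_measurable (borel \<Otimes>\<^sub>M borel)"
  unfolding Deq by measurable
 have bG: "\<bar>?G s\<bar> \<le> V\<^sup>2" for s using V(2)[of s] by (simp add: power_mono)
 have bD: "\<bar>?D s t\<bar> \<le> (2 * V)\<^sup>2" for s t
 proof -
  have "nrm (v s - v t) \<le> 2 * V" using nrm_triangle_diff[of "v s" "v t"] V(2)[of s] V(2)[of t] by linarith
  from power_mono[OF this nrm_nonneg, of 2] show ?thesis by simp
 qed
 have mDs [measurable]: "(\<lambda>t. ?D s t) \<in> borel_measurable borel" for s
  unfolding Deq unfolding nrm_square by measurable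
 have mK' [measurable]: "(\<lambda>p. K' (snd p - fst p)) \<in> borel_measurable (borel \<Otimes>\<^sub>M (borel :: real measure))" by measurable
 have b1: "\<bar>K' (t - s) * ?G s\<bar> \<le> B * V\<^sup>2" "\<bar>K' (t - s) * ?G t\<bar> \<le> B * V\<^sup>2" "\<bar>K' (t - s) * ?D s t\<bar> \<le> B * (2 * V)\<^sup>2"
  if st: "s \<in> {0..T}" "t \<in> {0..T}" for s t
  by (simp_all only: abs_mult, rule mult_mono[OF K_bound(2)[OF st] bG B_nonneg abs_ge_zero],
   rule mult_mono[OF K_bound(2)[OF st] bG B_nonneg abs_ge_zero], rule mult_mono[OF K_bound(2)[OF st] bD B_nonneg abs_ge_zero])
 have m1: "(\<lambda>p. K' (snd p - fst p) * ?G (fst p)) \<in> borel_measurable (borel \<Otimes>\<^sub>M borel)" by measurable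
 have m2: "(\<lambda>p. K' (snd p - fst p) * ?G (snd p)) \<in> borel_measurable (borel \<Otimes>\<^sub>M borel)" by measurable
 have m3: "(\<lambda>p. K' (snd p - fst p) * ?D (fst p) (snd p)) \<in> borel_measurable (borel \<Otimes>\<^sub>M borel)" by measurable
 note f1 = fubini_M[OF m1 b1(1)] and f2 = fubini_M[OF m2 b1(2)] and f3 = fubini_M[OF m3 b1(3)]
 have iG: "integrable M (\<lambda>s. q s * ?G s)" if "q \<in> borel_measurable borel" "!!s. s \<in> {0..T} ==> \<bar>q s\<bar> \<le> W" for q :: "real \<Rightarrow> real" and W
 proof (rule integrable_M)
  show "\<bar>q s * ?G s\<bar> \<le> W * V\<^sup>2" if "s \<in> {0..T}" for s
   unfolding abs_mult
   by (rule mult_mono[OF \<open>!!s. s \<in> {0..T} ==> \<bar>q s\<bar> \<le> W\<close>[OF that] bG order_trans[OF abs_ge_zero \<open>!!s. s \<in> {0..T} ==> \<bar>q s\<bar> \<le> W\<close>[OF that]] abs_ge_zero])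
 qed (use that(1) in measurable)
 have sec: "integrable M (\<lambda>t. K' (t - s) * ?G s)" "integrable M (\<lambda>t. K' (t - s) * ?G t)" "integrable M (\<lambda>t. K' (t - s) * ?D s t)"
  if s: "s \<in> {0..T}" for s
 proof -
  show "integrable M (\<lambda>t. K' (t - s) * ?G s)" "integrable M (\<lambda>t. K' (t - s) * ?G t)" "integrable M (\<lambda>t. K' (t - s) * ?D s t)"
   by (intro integrable_M[OF _ b1(1)[OF s]] integrable_M[OF _ b1(2)[OF s]] integrable_M[OF _ b1(3)[OF s]]; measurable)+
 qed
 have inner: "integral\<^sup>L M (\<lambda>t. K' (t - s) * a (v s) (v t)) =
   (integral\<^sup>L M (\<lambda>t. K' (t - s) * ?G s) + integral\<^sup>L M (\<lambda>t. K' (t - s) * ?G t) - integral\<^sup>L M (\<lambda>t. K' (t - s) * ?D s t)) / 2"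
  if s: "s \<in> {0..T}" for s
 proof -
  have "(\<lambda>t. K' (t - s) * a (v s) (v t)) = (\<lambda>t. (K' (t - s) * ?G s + K' (t - s) * ?G t - K' (t - s) * ?D s t) / 2)"
   by (rule ext) (simp add: Deq algebra_simps)
  then show ?thesis using sec[OF s] by simp
 qed
 have "integral\<^sup>L M (\<lambda>s. k 0 * a (v s) (v s) + integral\<^sup>L M (\<lambda>t. K' (t - s) * a (v s) (v t)))
  = integral\<^sup>L M (\<lambda>s. k 0 * ?G s + (integral\<^sup>L M (\<lambda>t. K' (t - s) * ?G s) + integral\<^sup>L M (\<lambda>t. K' (t - s) * ?G t) - integral\<^sup>L M (\<lambda>t. K' (t - s) * ?D s t)) / 2)"
 proof (rule Bochner_Integration.integral_cong)
  fix s assume "s \<in> space M"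
  then have s: "s \<in> {0..T}" by (simp add: space_restrict_space)
  show "k 0 * a (v s) (v s) + integral\<^sup>L M (\<lambda>t. K' (t - s) * a (v s) (v t)) =
   k 0 * ?G s + (integral\<^sup>L M (\<lambda>t. K' (t - s) * ?G s) + integral\<^sup>L M (\<lambda>t. K' (t - s) * ?G t) - integral\<^sup>L M (\<lambda>t. K' (t - s) * ?D s t)) / 2"
   unfolding inner[OF s] by (simp only: nrm_square)
 qed simp
 also have "\<dots> = k 0 * integral\<^sup>L M ?G + (integral\<^sup>L M (\<lambda>s. integral\<^sup>L M (\<lambda>t. K' (t - s) * ?G s))
   + integral\<^sup>L M (\<lambda>s. integral\<^sup>L M (\<lambda>t. K' (t - s) * ?G t)) - integral\<^sup>L M (\<lambda>s. integral\<^sup>L M (\<lambda>t. K' (t - s) * ?D s t))) / 2"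
  using f1(2) f2(2) f3(2) iG[of "\<lambda>s. 1" 1] by simp
 also have "integral\<^sup>L M (\<lambda>s. integral\<^sup>L M (\<lambda>t. K' (t - s) * ?G s)) = integral\<^sup>L M (\<lambda>s. k (T - s) * ?G s - k 0 * ?G s)"
 proof (rule Bochner_Integration.integral_cong)
  fix s assume "s \<in> space M"
  then have s: "s \<in> {0..T}" by (simp add: space_restrict_space)
  show "integral\<^sup>L M (\<lambda>t. K' (t - s) * ?G s) = k (T - s) * ?G s - k 0 * ?G s"
   by (simp only: integral_mult_left_zero K'_integral(1)[OF s] left_diff_distrib)
 qed simp
 also have "integral\<^sup>L M (\<lambda>s. integral\<^sup>L M (\<lambda>t. K' (t - s) * ?G t)) = integral\<^sup>L M (\<lambda>t. integral\<^sup>L M (\<lambda>s. K' (t - s) * ?G t))"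
  by (rule f2(1)[symmetric])
 also have "integral\<^sup>L M (\<lambda>t. integral\<^sup>L M (\<lambda>s. K' (t - s) * ?G t)) = integral\<^sup>L M (\<lambda>s. k s * ?G s - k 0 * ?G s)"
 proof (rule Bochner_Integration.integral_cong)
  fix s assume "s \<in> space M"
  then have s: "s \<in> {0..T}" by (simp add: space_restrict_space)
  show "integral\<^sup>L M (\<lambda>t. K' (s - t) * ?G s) = k s * ?G s - k 0 * ?G s"
   by (simp only: integral_mult_left_zero K'_integral(2)[OF s] left_diff_distrib)
 qed simp
 finally have E0: "integral\<^sup>L M (\<lambda>s. k 0 * a (v s) (v s) + integral\<^sup>L M (\<lambda>t. K' (t - s) * a (v s) (v t))) =
   k 0 * integral\<^sup>L M ?G + (integral\<^sup>L M (\<lambda>s. k (T - s) * ?G s - k 0 * ?G s)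
   + integral\<^sup>L M (\<lambda>s. k s * ?G s - k 0 * ?G s) - integral\<^sup>L M (\<lambda>s. integral\<^sup>L M (\<lambda>t. K' (t - s) * ?D s t))) / 2" .
 have d1: "integral\<^sup>L M (\<lambda>s. k (T - s) * ?G s - k 0 * ?G s) = integral\<^sup>L M (\<lambda>s. k (T - s) * ?G s) - k 0 * integral\<^sup>L M ?G"
  using iG[of "\<lambda>s. k (T - s)" B] iG[of "\<lambda>s. 1" 1] kB(1) by simp
 have d2: "integral\<^sup>L M (\<lambda>s. k s * ?G s - k 0 * ?G s) = integral\<^sup>L M (\<lambda>s. k s * ?G s) - k 0 * integral\<^sup>L M ?G"
  using iG[of k B] iG[of "\<lambda>s. 1" 1] kB(1) by simp
 have E: "2 * (\<Sum>n\<in>{1..N}. bracket (memory k v) n (d n) (c n)) =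
   integral\<^sup>L M (\<lambda>s. k (T - s) * ?G s) + integral\<^sup>L M (\<lambda>s. k s * ?G s)
   - integral\<^sup>L M (\<lambda>s. integral\<^sup>L M (\<lambda>t. K' (t - s) * ?D s t))"
 proof -
  have alg: "2 * (x + ((p - x) + (q - x) - r) / 2) = p + q - r" for x p q r :: real by (simp add: field_simps)
  show ?thesis unfolding memory_energy E0 d1 d2 by (rule alg)
 qed
 have l1: "k T * integral\<^sup>L M ?G \<le> integral\<^sup>L M (\<lambda>s. k s * ?G s)"
  unfolding integral_mult_right_zero[symmetric]
  by (rule Bochner_Integration.integral_mono)
   (use iG[of "\<lambda>s. k T" B] iG[of k B] kB(1) kdec T_nonneg in \<open>auto simp: space_restrict_space intro!: mult_right_mono\<close>)
 have cN: "indicat_real (cell N) \<in> borel_measurable borel" by measurable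
 have nodesN: "0 \<le> \<tau> (N - 1)" "\<tau> (N - 1) < \<tau> N" using node_nonneg[of "N - 1"] step_pos[of N] N by auto
 have l2: "k (\<tau> N - \<tau> (N - 1)) * integral\<^sup>L M (\<lambda>s. indicator (cell N) s * ?G s) \<le> integral\<^sup>L M (\<lambda>s. k (T - s) * ?G s)"
  unfolding integral_mult_right_zero[symmetric]
 proof (rule Bochner_Integration.integral_mono)
  show "integrable M (\<lambda>s. k (\<tau> N - \<tau> (N - 1)) * (indicator (cell N) s * ?G s))"
   by (intro integrable_mult_right iG[OF cN, of 1]) (auto simp: indicator_def)
  show "integrable M (\<lambda>s. k (T - s) * ?G s)" by (rule iG[of _ B]) (use kB(1) in auto)
  show "k (\<tau> N - \<tau> (N - 1)) * (indicator (cell N) s * ?G s) \<le> k (T - s) * ?G s" if "s \<in> space M" for s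
   using that kdec[of "T - s" "\<tau> N - \<tau> (N - 1)"] k0[of "T - s"] nodesN
   by (auto simp: indicator_def cell_def space_restrict_space intro!: mult_right_mono)
 qed
 \<comment> \<open>At most one pair (n, n + 1) of cells contains a given (s, t), and there t - s <=
   \<tau> (n + 1) - \<tau> (n - 1). As \<open>k'\<close> is nonpositive and increasing, its value at
   that length bounds the weight -k'(t - s) from below.\<close>
 define P where "P n s t = indicator (cell n) s * indicator (cell (n + 1)) t * ?D s t" for n s t
 have mP: "(\<lambda>p. P n (fst p) (snd p)) \<in> borel_measurable (borel \<Otimes>\<^sub>M borel)" for n unfolding P_def by measurable
 have bP: "\<bar>P n s t\<bar> \<le> (2 * V)\<^sup>2" for n s t using bD[of s t] by (auto simp: P_def indicator_def)
 note fP = fubini_M[OF mP bP]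
 have secP: "integrable M (\<lambda>t. P n s t)" for n s
 proof (rule integrable_M[OF _ bP])
  show "P n s \<in> borel_measurable borel" unfolding P_def by measurable
 qed
 let ?w = "\<lambda>n. - k' (\<tau> (n + 1) - \<tau> (n - 1))"
 have pw: "(\<Sum>n\<in>{1..<N}. ?w n * P n s t) \<le> - (K' (t - s) * ?D s t)" if st: "s \<in> {0..T}" "t \<in> {0..T}" for s t
 proof (cases "\<exists>n\<in>{1..<N}. s \<in> cell n \<and> t \<in> cell (n + 1)")
  case True
  then obtain n where n: "n \<in> {1..<N}" "s \<in> cell n" "t \<in> cell (n + 1)" by blast
  have "(\<Sum>m\<in>{1..<N}. ?w m * P m s t) = (\<Sum>m\<in>{1..<N}. if m = n then ?w n * P n s t else 0)"
  proof (rule sum.cong)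
   fix m assume m: "m \<in> {1..<N}"
   show "?w m * P m s t = (if m = n then ?w n * P n s t else 0)"
    using cell_disjoint[of m n s] m n by (cases "s \<in> cell m") (auto simp: P_def)
  qed simp
  also have "\<dots> = ?w n * ?D s t" using n by (simp add: P_def)
  also have "\<dots> \<le> - (K' (t - s) * ?D s t)"
  proof -
   have nn: "0 \<le> \<tau> (n - 1)" "\<tau> (n + 1) \<le> T" using node_nonneg[of "n - 1"] node_mono[of "n + 1" N] n by auto
   have "t - s > 0" "t - s \<le> \<tau> (n + 1) - \<tau> (n - 1)" using n by (auto simp: cell_def)
   then have "k' (t - s) \<le> k' (\<tau> (n + 1) - \<tau> (n - 1))" using k'inc nn by auto
   then have "- k' (\<tau> (n + 1) - \<tau> (n - 1)) * ?D s t \<le> - k' (t - s) * ?D s t" by (intro mult_right_mono) auto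
   then show ?thesis using \<open>t - s > 0\<close> by simp
  qed
  finally show ?thesis .
 next
  case False
  then have "(\<Sum>m\<in>{1..<N}. ?w m * P m s t) = 0" by (intro sum.neutral) (auto simp: P_def indicator_def)
  moreover have "K' (t - s) * ?D s t \<le> 0" using k'0[of "t - s"] st by (auto intro!: mult_nonpos_nonneg)
  ultimately show ?thesis by linarith
 qed
 have "(\<Sum>n\<in>{1..<N}. ?w n * integral\<^sup>L M (\<lambda>s. integral\<^sup>L M (\<lambda>t. P n s t)))
   = (\<Sum>n\<in>{1..<N}. integral\<^sup>L M (\<lambda>s. ?w n * integral\<^sup>L M (\<lambda>t. P n s t)))"
  by (rule sum.cong[OF refl], rule integral_mult_right_zero[symmetric])
 also have "\<dots> = integral\<^sup>L M (\<lambda>s. \<Sum>n\<in>{1..<N}. ?w n * integral\<^sup>L M (\<lambda>t. P n s t))"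
  by (rule Bochner_Integration.integral_sum[symmetric], rule integrable_mult_right, rule fP(2))
 also have "\<dots> \<le> integral\<^sup>L M (\<lambda>s. - integral\<^sup>L M (\<lambda>t. K' (t - s) * ?D s t))"
 proof (rule Bochner_Integration.integral_mono)
  show "integrable M (\<lambda>s. \<Sum>n\<in>{1..<N}. ?w n * integral\<^sup>L M (\<lambda>t. P n s t))"
   by (rule Bochner_Integration.integrable_sum, rule integrable_mult_right, rule fP(2))
  show "integrable M (\<lambda>s. - integral\<^sup>L M (\<lambda>t. K' (t - s) * ?D s t))" using f3(2) by simp
  fix s assume "s \<in> space M"
  then have s: "s \<in> {0..T}" by (simp add: space_restrict_space)
  have "(\<Sum>n\<in>{1..<N}. ?w n * integral\<^sup>L M (\<lambda>t. P n s t)) = integral\<^sup>L M (\<lambda>t. \<Sum>n\<in>{1..<N}. ?w n * P n s t)"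
   by (simp only: integral_mult_right_zero[symmetric])
    (rule Bochner_Integration.integral_sum[symmetric], rule integrable_mult_right, rule secP)
  also have "\<dots> \<le> integral\<^sup>L M (\<lambda>t. - (K' (t - s) * ?D s t))"
  proof (rule Bochner_Integration.integral_mono)
   show "integrable M (\<lambda>t. \<Sum>n\<in>{1..<N}. ?w n * P n s t)"
    by (rule Bochner_Integration.integrable_sum, rule integrable_mult_right, rule secP)
   show "integrable M (\<lambda>t. - (K' (t - s) * ?D s t))" using sec(3)[OF s] by simp
  qed (use pw[OF s] in \<open>simp add: space_restrict_space\<close>)
  finally show "(\<Sum>n\<in>{1..<N}. ?w n * integral\<^sup>L M (\<lambda>t. P n s t)) \<le> - integral\<^sup>L M (\<lambda>t. K' (t - s) * ?D s t)" by simp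
 qed
 finally have l3: "(\<Sum>n\<in>{1..<N}. ?w n * integral\<^sup>L M (\<lambda>s. integral\<^sup>L M (\<lambda>t. P n s t))) \<le> - integral\<^sup>L M (\<lambda>s. integral\<^sup>L M (\<lambda>t. K' (t - s) * ?D s t))"
  by simp
 show ?thesis using E l1 l2 l3 unfolding P_def by linarith
qed

end

end

end

section \<open>Passage from shifted kernels to the singular kernel\<close>

context frac_mesh_form
begin

context
 fixes d :: "nat \<Rightarrow> nat" and c :: "nat \<Rightarrow> nat \<Rightarrow> 'v"
begin

lemma memory_omega:
 "memory (omega (\<alpha> + 1)) (glue (\<lambda>n. vpoly (d n) (c n))) t w = (\<Sum>n\<in>{1..N}. \<Sum>i\<le>d n. moment_weight n i t * a (c n i) w)"
proof -
 have e: "a (glue (\<lambda>n. vpoly (d n) (c n)) s) w = glue (\<lambda>n. vpoly (d n) (\<lambda>i. a (c n i) w)) s" for s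
  by (simp add: glue_def vpoly_def linear_simps)
 show ?thesis
  unfolding memory_def e
  using frac_integral_glue[of d "\<lambda>n i. a (c n i) w" t] by (simp add: frac_integral_def)
qed

lemma memory_omega_continuous:
 "continuous_on S (\<lambda>t. memory (omega (\<alpha> + 1)) (glue (\<lambda>n. vpoly (d n) (c n))) t w)"
 unfolding memory_omega by (intro continuous_intros moment_weight_continuous)

lemma memory_sum_right:
 "memory (omega (\<alpha> + 1)) (glue (\<lambda>n. vpoly (d n) (c n))) t (vpoly' e f r) =
  (\<Sum>j\<le>e. (real j * r ^ (j - 1)) * memory (omega (\<alpha> + 1)) (glue (\<lambda>n. vpoly (d n) (c n))) t (f j))"
 unfolding memory_omega vpoly'_def linear_simps
 by (subst (2) sum_distrib_left) (simp add: sum_distrib_left mult_ac, subst sum.swap, rule sum.cong[OF refl], subst sum.swap, rule refl)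

lemma omega_shift_integral:
 assumes h: "h > 0" and t: "t \<ge> 0"
 shows "(\<lambda>s. omega (\<alpha> + 1) (t - s) - omega (\<alpha> + 1) (t - s + h)) integrable_on {0..t}"
  "integral {0..t} (\<lambda>s. omega (\<alpha> + 1) (t - s) - omega (\<alpha> + 1) (t - s + h)) \<le> h powr (\<alpha> + 1) / Gamma (\<alpha> + 2)"
proof -
 have 1: "((\<lambda>s. omega (\<alpha> + 1) (t - s)) has_integral ((t - 0) powr (\<alpha> + 1) - (t - t) powr (\<alpha> + 1)) / Gamma (\<alpha> + 2)) {0..t}"
  by (rule omega_integral) (use \<alpha> t in auto)
 have 2: "((\<lambda>s. omega (\<alpha> + 1) (t + h - s)) has_integral ((t + h - 0) powr (\<alpha> + 1) - (t + h - t) powr (\<alpha> + 1)) / Gamma (\<alpha> + 2)) {0..t}"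
  by (rule omega_integral) (use \<alpha> t h in auto)
 have e: "t - s + h = t + h - s" for s by simp
 have 3: "((\<lambda>s. omega (\<alpha> + 1) (t - s) - omega (\<alpha> + 1) (t - s + h)) has_integral
  ((t - 0) powr (\<alpha> + 1) - (t - t) powr (\<alpha> + 1)) / Gamma (\<alpha> + 2) - ((t + h - 0) powr (\<alpha> + 1) - (t + h - t) powr (\<alpha> + 1)) / Gamma (\<alpha> + 2)) {0..t}"
  unfolding e by (rule has_integral_diff[OF 1 2])
 then show "(\<lambda>s. omega (\<alpha> + 1) (t - s) - omega (\<alpha> + 1) (t - s + h)) integrable_on {0..t}" by blast
 have "t powr (\<alpha> + 1) \<le> (t + h) powr (\<alpha> + 1)" using h t \<alpha> by (intro powr_mono2) auto
 then have "t powr (\<alpha> + 1) / Gamma (\<alpha> + 2) \<le> (t + h) powr (\<alpha> + 1) / Gamma (\<alpha> + 2)"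
  using \<alpha> by (intro divide_right_mono) (auto intro!: Gamma_real_nonneg)
 then show "integral {0..t} (\<lambda>s. omega (\<alpha> + 1) (t - s) - omega (\<alpha> + 1) (t - s + h)) \<le> h powr (\<alpha> + 1) / Gamma (\<alpha> + 2)"
  using integral_unique[OF 3] by (simp add: diff_divide_distrib)
qed

text \<open>The kernel decreases, so the difference of the two kernels has one sign and an explicit
  integral, which is at most a constant times h^(\<alpha>+1).\<close>

lemma memory_shift_diff:
 assumes h: "h > 0" and t: "t \<in> {0..\<tau> N}" and V: "!!s. nrm (glue (\<lambda>n. vpoly (d n) (c n)) s) \<le> V"
 shows "\<bar>memory (\<lambda>x. omega (\<alpha> + 1) (x + h)) (glue (\<lambda>n. vpoly (d n) (c n))) t w
   - memory (omega (\<alpha> + 1)) (glue (\<lambda>n. vpoly (d n) (c n))) t w\<bar> \<le> V * nrm w * (h powr (\<alpha> + 1) / Gamma (\<alpha> + 2))"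
proof -
 let ?v = "glue (\<lambda>n. vpoly (d n) (c n))" and ?w = "omega (\<alpha> + 1)"
 have V0: "V \<ge> 0" using order_trans[OF nrm_nonneg V] .
 have av: "\<bar>a (?v s) w\<bar> \<le> V * nrm w" for s
  by (rule order_trans[OF cauchy_schwarz mult_right_mono[OF V nrm_nonneg]])
 have m: "(\<lambda>s. a (?v s) w) \<in> borel_measurable (lebesgue_on {0..t})"
  using pairing_borel[of d c w] by (simp add: measurable_completion measurable_restrict_space1)
 have i1: "(\<lambda>s. ?w (t - s) * a (?v s) w) integrable_on {0..t}"
  using omega_times_bounded(1)[OF \<alpha>(1) _ order_refl m av] t by (auto dest: set_lebesgue_integral_eq_integral(1))
 have i2: "(\<lambda>s. ?w (t - s + h) * a (?v s) w) integrable_on {0..t}"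
  using omega_times_bounded(1)[OF \<alpha>(1) _ _ m av, of "t + h"] t h by (auto simp: algebra_simps dest: set_lebesgue_integral_eq_integral(1))
 have e0: "memory (\<lambda>x. ?w (x + h)) ?v t w - memory ?w ?v t w = - integral {0..t} (\<lambda>s. ?w (t - s) * a (?v s) w - ?w (t - s + h) * a (?v s) w)"
  unfolding memory_def by (subst Henstock_Kurzweil_Integration.integral_diff[OF i1 i2]) simp
 \<comment> \<open>At s = t the kernel takes the default value 0 instead of infinity, which spoils
   the sign of the difference; this point is removed.\<close>
 have "integral {0..t} (\<lambda>s. if s = t then 0 else ?w (t - s) * a (?v s) w - ?w (t - s + h) * a (?v s) w)
   = integral {0..t} (\<lambda>s. ?w (t - s) * a (?v s) w - ?w (t - s + h) * a (?v s) w)"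
  by (rule integral_spike[of "{t}"]) auto
 then have "\<bar>memory (\<lambda>x. ?w (x + h)) ?v t w - memory ?w ?v t w\<bar>
   = norm (integral {0..t} (\<lambda>s. if s = t then 0 else ?w (t - s) * a (?v s) w - ?w (t - s + h) * a (?v s) w))"
  unfolding e0 by simp
 also have "\<dots> \<le> integral {0..t} (\<lambda>s. if s = t then 0 else (?w (t - s) - ?w (t - s + h)) * (V * nrm w))"
 proof (rule integral_norm_bound_integral)
  show "(\<lambda>s. if s = t then 0 else ?w (t - s) * a (?v s) w - ?w (t - s + h) * a (?v s) w) integrable_on {0..t}"
   by (rule integrable_spike_finite[of "{t}", OF _ _ integrable_diff[OF i1 i2]]) auto
  have i3: "(\<lambda>s. (?w (t - s) - ?w (t - s + h)) * (V * nrm w)) integrable_on {0..t}"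
   using omega_shift_integral(1)[OF h, of t] t by (intro integrable_on_mult_left) auto
  show "(\<lambda>s. if s = t then 0 else (?w (t - s) - ?w (t - s + h)) * (V * nrm w)) integrable_on {0..t}"
   by (rule integrable_spike_finite[of "{t}", OF _ _ i3]) auto
  show "norm (if s = t then 0 else ?w (t - s) * a (?v s) w - ?w (t - s + h) * a (?v s) w) \<le> (if s = t then 0 else (?w (t - s) - ?w (t - s + h)) * (V * nrm w))"
   if "s \<in> {0..t}" for s
  proof (cases "s = t")
   case False
   then have "?w (t - s + h) \<le> ?w (t - s)" using that h by (intro omega_antimono \<alpha>) auto
   then have "\<bar>(?w (t - s) - ?w (t - s + h)) * a (?v s) w\<bar> \<le> (?w (t - s) - ?w (t - s + h)) * (V * nrm w)"
    using av[of s] by (simp add: abs_mult mult_left_mono)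
   then show ?thesis using False by (simp add: left_diff_distrib)
  qed simp
 qed
 also have "\<dots> = integral {0..t} (\<lambda>s. (?w (t - s) - ?w (t - s + h)) * (V * nrm w))"
  by (rule integral_spike[of "{t}"]) auto
 also have "\<dots> = V * nrm w * integral {0..t} (\<lambda>s. ?w (t - s) - ?w (t - s + h))" by simp
 also have "\<dots> \<le> V * nrm w * (h powr (\<alpha> + 1) / Gamma (\<alpha> + 2))"
  using omega_shift_integral(2)[OF h, of t] t V0 by (intro mult_left_mono) auto
 finally show ?thesis .
qed

lemma bracket_shift_diff:
 assumes h: "h > 0" and n: "n \<in> {1..N}"
  and V: "!!s. nrm (glue (\<lambda>n. vpoly (d n) (c n)) s) \<le> V"
   "!!t. t \<in> {0..\<tau> N} ==> nrm (vpoly (d n) (c n) t) \<le> V" "!!t. t \<in> {0..\<tau> N} ==> nrm (vpoly' (d n) (c n) t) \<le> V"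
  and i: "(\<lambda>t. memory (\<lambda>x. omega (\<alpha> + 1) (x + h)) (glue (\<lambda>n. vpoly (d n) (c n))) t (vpoly' (d n) (c n) t)) integrable_on {\<tau> (n - 1)..\<tau> n}"
 shows "\<bar>bracket (memory (\<lambda>x. omega (\<alpha> + 1) (x + h)) (glue (\<lambda>n. vpoly (d n) (c n)))) n (d n) (c n)
  - bracket (memory (omega (\<alpha> + 1)) (glue (\<lambda>n. vpoly (d n) (c n)))) n (d n) (c n)\<bar>
  \<le> (2 + \<tau> N) * (V * V) / Gamma (\<alpha> + 2) * h powr (\<alpha> + 1)"
proof -
 let ?v = "glue (\<lambda>n. vpoly (d n) (c n))" and ?X = "vpoly (d n) (c n)" and ?X' = "vpoly' (d n) (c n)"
 let ?mh = "memory (\<lambda>x. omega (\<alpha> + 1) (x + h)) ?v" and ?m = "memory (omega (\<alpha> + 1)) ?v"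
 define e where "e = V * V * (h powr (\<alpha> + 1) / Gamma (\<alpha> + 2))"
 have G: "Gamma (\<alpha> + 2) > 0" using \<alpha> by (simp add: Gamma_real_pos)
 have V0: "V \<ge> 0" using order_trans[OF nrm_nonneg V(1)] .
 have e0: "e \<ge> 0" using V0 G by (simp add: e_def)
 have nodes: "\<tau> n \<in> {0..\<tau> N}" "\<tau> (n - 1) \<in> {0..\<tau> N}" "\<tau> (n - 1) \<le> \<tau> n" "0 \<le> \<tau> (n - 1)" "\<tau> n \<le> \<tau> N"
  using node_nonneg[of n] node_nonneg[OF pred_le[OF n]] node_mono[of n N] node_mono[OF _ order_refl, of "n - 1"] step_pos[OF n] n by auto
 have diff: "\<bar>?mh t w - ?m t w\<bar> \<le> e" if "t \<in> {0..\<tau> N}" "nrm w \<le> V" for t w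
 proof -
  have "V * nrm w * (h powr (\<alpha> + 1) / Gamma (\<alpha> + 2)) \<le> e"
   unfolding e_def using that(2) V0 G by (intro mult_right_mono mult_left_mono) auto
  then show ?thesis using memory_shift_diff[OF h that(1) V(1), of w] by linarith
 qed
 have i2: "(\<lambda>t. ?m t (?X' t)) integrable_on {\<tau> (n - 1)..\<tau> n}"
  unfolding memory_sum_right
  by (intro integrable_continuous_real continuous_intros memory_omega_continuous)
 have "\<bar>integral {\<tau> (n - 1)..\<tau> n} (\<lambda>t. ?mh t (?X' t) - ?m t (?X' t))\<bar> \<le> integral {\<tau> (n - 1)..\<tau> n} (\<lambda>t. e)"
  unfolding real_norm_def[symmetric]
 proof (rule integral_norm_bound_integral)
  show "(\<lambda>t. ?mh t (?X' t) - ?m t (?X' t)) integrable_on {\<tau> (n - 1)..\<tau> n}" by (rule integrable_diff[OF i i2])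
  fix t assume "t \<in> {\<tau> (n - 1)..\<tau> n}"
  then have "t \<in> {0..\<tau> N}" using nodes by auto
  then show "norm (?mh t (?X' t) - ?m t (?X' t)) \<le> e" using diff V(3) by simp
 qed auto
 also have "\<dots> = (\<tau> n - \<tau> (n - 1)) * e" using nodes by simp
 also have "\<dots> \<le> \<tau> N * e" using nodes e0 by (intro mult_right_mono) auto
 finally have I: "\<bar>integral {\<tau> (n - 1)..\<tau> n} (\<lambda>t. ?mh t (?X' t)) - integral {\<tau> (n - 1)..\<tau> n} (\<lambda>t. ?m t (?X' t))\<bar> \<le> \<tau> N * e"
  by (subst (asm) Henstock_Kurzweil_Integration.integral_diff[OF i i2])
 have "\<bar>bracket ?mh n (d n) (c n) - bracket ?m n (d n) (c n)\<bar> \<le> e + e + \<tau> N * e"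
  unfolding bracket_def
  using diff[OF nodes(1) V(2)[OF nodes(1)]] diff[OF nodes(2) V(2)[OF nodes(2)]] I by linarith
 also have "\<dots> = (2 + \<tau> N) * (V * V) / Gamma (\<alpha> + 2) * h powr (\<alpha> + 1)"
  by (simp add: e_def algebra_simps add_divide_distrib)
 finally show ?thesis .
qed

text \<open>For h > 0 the kernel x -> \<open>omega (\<alpha> + 1) (x + h)\<close> is differentiable
  on x >= 0, nonnegative and decreasing with increasing derivative, so
  \<open>memory_energy_lower\<close> applies. As h tends to 0, the left side converges because it
  evaluates kernel and derivative at positive lengths only, and the brackets change by
  O(h^(\<alpha>+1)).\<close>

theorem frac_energy_lower:
 assumes N: "N \<ge> 1"
 defines "g \<equiv> glue (\<lambda>n. vpoly (d n) (c n))"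
 defines "\<mu> \<equiv> restrict_space lborel {0..\<tau> N}"
 shows "omega (\<alpha> + 1) (\<tau> N) * integral\<^sup>L \<mu> (\<lambda>s. (nrm (g s))\<^sup>2)
   + omega (\<alpha> + 1) (\<tau> N - \<tau> (N - 1)) * integral\<^sup>L \<mu> (\<lambda>s. indicator (cell N) s * (nrm (g s))\<^sup>2)
   + (\<Sum>n\<in>{1..<N}. - (\<alpha> * (\<tau> (n + 1) - \<tau> (n - 1)) powr (\<alpha> - 1) / Gamma (\<alpha> + 1)) *
     integral\<^sup>L \<mu> (\<lambda>s. integral\<^sup>L \<mu> (\<lambda>t. indicator (cell n) s * indicator (cell (n + 1)) t * (nrm (g s - g t))\<^sup>2)))
  \<le> 2 * (\<Sum>n\<in>{1..N}. bracket (memory (omega (\<alpha> + 1)) g) n (d n) (c n))"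
proof -
 obtain V where V: "V \<ge> 0" "!!s. nrm (glue (\<lambda>n. vpoly (d n) (c n)) s) \<le> V" "!!n t. n \<in> {1..N} ==> t \<in> {0..\<tau> N} ==> nrm (vpoly (d n) (c n) t) \<le> V"
  "!!n t. n \<in> {1..N} ==> t \<in> {0..\<tau> N} ==> nrm (vpoly' (d n) (c n) t) \<le> V"
  by (rule bounded_pieces[of d c]) (rule that)
 define k where "k h x = omega (\<alpha> + 1) (x + h)" for h x :: real
 define k' where "k' h x = \<alpha> * (x + h) powr (\<alpha> - 1) / Gamma (\<alpha> + 1)" for h x :: real
 define E where "E w = integral\<^sup>L \<mu> (\<lambda>s. integral\<^sup>L \<mu> (\<lambda>t. indicator (cell w) s * indicator (cell (w + 1)) t * (nrm (g s - g t))\<^sup>2))" for w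
 let ?L = "\<lambda>h. k h (\<tau> N) * integral\<^sup>L \<mu> (\<lambda>s. (nrm (g s))\<^sup>2)
   + k h (\<tau> N - \<tau> (N - 1)) * integral\<^sup>L \<mu> (\<lambda>s. indicator (cell N) s * (nrm (g s))\<^sup>2)
   + (\<Sum>n\<in>{1..<N}. - k' h (\<tau> (n + 1) - \<tau> (n - 1)) * E n)"
 define C where "C = 2 * real N * ((2 + \<tau> N) * (V * V) / Gamma (\<alpha> + 2))"
 let ?R = "2 * (\<Sum>n\<in>{1..N}. bracket (memory (omega (\<alpha> + 1)) g) n (d n) (c n))"
 have G1: "Gamma (\<alpha> + 1) > 0" using \<alpha> by (simp add: Gamma_real_pos)
 have step: "?L h \<le> ?R + C * h powr (\<alpha> + 1)" if h: "h > 0" for h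
 proof -
  define B where "B = max \<bar>k h 0\<bar> \<bar>k' h 0\<bar>"
  have kd: "(k h has_real_derivative k' h x) (at x)" if "x \<ge> 0" for x
   unfolding k_def[abs_def] k'_def omega_eq using that h less_imp_neq[OF G1] by (auto intro!: derivative_eq_intros)
  have km: "k h \<in> borel_measurable borel" "k' h \<in> borel_measurable borel"
   unfolding k_def[abs_def] k'_def[abs_def] omega_eq by measurable
  have kdec: "k h y \<le> k h x" if "0 \<le> x" "x \<le> y" for x y
   unfolding k_def using that h by (intro omega_antimono \<alpha>) auto
  have kinc: "k' h x \<le> k' h y" if "0 \<le> x" "x \<le> y" for x y
   unfolding k'_def using that h \<alpha> G1
   by (intro divide_right_mono mult_left_mono_neg powr_mono2') auto
  have k0: "k h x \<ge> 0" for x unfolding k_def using omega_nonneg[OF \<alpha>(1)] .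
  have k'0: "k' h x \<le> 0" for x unfolding k'_def using \<alpha> G1 by (auto intro!: divide_nonpos_pos mult_nonpos_nonneg)
  have kB: "\<bar>k h x\<bar> \<le> B" "\<bar>k' h x\<bar> \<le> B" if "x \<in> {0..\<tau> N}" for x
   using that kdec[of 0 x] kinc[of 0 x] k0[of x] k'0[of x] by (auto simp: B_def)
  have "?L h \<le> 2 * (\<Sum>n\<in>{1..N}. bracket (memory (k h) g) n (d n) (c n))"
   unfolding g_def \<mu>_def E_def
   by (rule memory_energy_lower[OF kd km kB]) (use k0 k'0 kdec kinc N in auto)
  also have "\<dots> \<le> 2 * (\<Sum>n\<in>{1..N}. bracket (memory (omega (\<alpha> + 1)) g) n (d n) (c n) + (2 + \<tau> N) * (V * V) / Gamma (\<alpha> + 2) * h powr (\<alpha> + 1))"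
  proof (intro mult_left_mono sum_mono)
   fix n assume n: "n \<in> {1..N}"
   have i: "(\<lambda>t. memory (k h) g t (vpoly' (d n) (c n) t)) integrable_on {\<tau> (n - 1)..\<tau> n}"
    unfolding g_def by (rule memory_integrable[OF kd km kB n])
   have "\<bar>bracket (memory (k h) g) n (d n) (c n) - bracket (memory (omega (\<alpha> + 1)) g) n (d n) (c n)\<bar>
    \<le> (2 + \<tau> N) * (V * V) / Gamma (\<alpha> + 2) * h powr (\<alpha> + 1)"
    unfolding g_def k_def[abs_def]
    by (rule bracket_shift_diff[OF h n]) (use V n i in \<open>auto simp: g_def k_def[abs_def]\<close>)
   then show "bracket (memory (k h) g) n (d n) (c n) \<le> bracket (memory (omega (\<alpha> + 1)) g) n (d n) (c n) + (2 + \<tau> N) * (V * V) / Gamma (\<alpha> + 2) * h powr (\<alpha> + 1)"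
    by linarith
  qed simp
  also have "\<dots> = ?R + C * h powr (\<alpha> + 1)"
   by (simp add: sum.distrib C_def algebra_simps)
  finally show ?thesis .
 qed
 have tT: "\<tau> N > 0" "\<tau> N - \<tau> (N - 1) > 0" using step_pos[of N] node_nonneg[of "N - 1"] N by auto
 have tn: "\<tau> (n + 1) - \<tau> (n - 1) > 0" if "n \<in> {1..<N}" for n
  using step_pos[of "n + 1"] step_pos[of n] that by auto
 have klim: "((\<lambda>h. k h x) \<longlongrightarrow> omega (\<alpha> + 1) x) (at_right 0)" if "x > 0" for x
  unfolding k_def omega_eq
  by (rule tendsto_eq_intros | use that less_imp_neq[OF G1] in simp)+
 have k'lim: "((\<lambda>h. k' h x) \<longlongrightarrow> \<alpha> * x powr (\<alpha> - 1) / Gamma (\<alpha> + 1)) (at_right 0)" if "x > 0" for x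
  unfolding k'_def
  by (rule tendsto_eq_intros | use that less_imp_neq[OF G1] in simp)+
 have Llim: "(?L \<longlongrightarrow> omega (\<alpha> + 1) (\<tau> N) * integral\<^sup>L \<mu> (\<lambda>s. (nrm (g s))\<^sup>2)
   + omega (\<alpha> + 1) (\<tau> N - \<tau> (N - 1)) * integral\<^sup>L \<mu> (\<lambda>s. indicator (cell N) s * (nrm (g s))\<^sup>2)
   + (\<Sum>n\<in>{1..<N}. - (\<alpha> * (\<tau> (n + 1) - \<tau> (n - 1)) powr (\<alpha> - 1) / Gamma (\<alpha> + 1)) * E n)) (at_right 0)"
  by (intro tendsto_add tendsto_mult tendsto_sum tendsto_minus tendsto_const klim k'lim tT tn)
 have "((\<lambda>h. h powr (\<alpha> + 1)) \<longlongrightarrow> 0) (at_right 0)"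
 proof (rule tendsto_zero_powrI)
  show "((\<lambda>h. h) \<longlongrightarrow> 0) (at_right (0::real))" by (rule tendsto_ident_at)
  show "((\<lambda>h. \<alpha> + 1) \<longlongrightarrow> \<alpha> + 1) (at_right (0::real))" by (rule tendsto_const)
  show "\<alpha> + 1 > 0" using \<alpha> by simp
 qed (auto simp: eventually_at_filter)
 then have "((\<lambda>h. ?R + C * h powr (\<alpha> + 1)) \<longlongrightarrow> ?R + C * 0) (at_right 0)"
  by (intro tendsto_add tendsto_mult tendsto_const)
 then have Rlim: "((\<lambda>h. ?R + C * h powr (\<alpha> + 1)) \<longlongrightarrow> ?R) (at_right 0)" by simp
 show ?thesis
  using tendsto_le[OF trivial_limit_at_right_real Rlim Llim] step
  by (auto simp: eventually_at_filter E_def)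
qed

end

end

lemma vpoly_mem: "subspace V ==> (!!j. j \<le> d ==> c j \<in> V) ==> vpoly d c t \<in> V"
 unfolding vpoly_def by (intro subspace_sum subspace_scale) auto

lemma vpoly'_mem: "subspace V ==> (!!j. j \<le> d ==> c j \<in> V) ==> vpoly' d c t \<in> V"
 unfolding vpoly'_def by (intro subspace_sum subspace_scale) auto

section \<open>Differences between neighbouring cells and what the energy controls\<close>

locale dg_cross = frac_mesh_form \<tau> N \<alpha> a
 for \<tau> :: "nat \<Rightarrow> real" and N :: nat and \<alpha> :: real and a :: "'v::real_normed_vector \<Rightarrow> 'v \<Rightarrow> real" +
 fixes d :: "nat \<Rightarrow> nat" and c :: "nat \<Rightarrow> nat \<Rightarrow> 'v" and p :: nat and Cp \<rho> :: real
 assumes inv: "!!(q::real poly) a b t. degree q \<le> p ==> a < b ==> t \<in> {a..b} ==>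
   (poly q t)\<^sup>2 \<le> Cp / (b - a) * integral {a..b} (\<lambda>s. (poly q s)\<^sup>2)"
  and mark: "!!(q::real poly) a b t B. degree q \<le> p ==> a < b ==> t \<in> {a..b} ==>
   (!!s. s \<in> {a..b} ==> \<bar>poly q s\<bar> \<le> B) ==> \<bar>poly (pderiv q) t\<bar> \<le> Cp / (b - a) * B"
  and Cp: "Cp > 0" and dp: "!!n. n \<in> {1..N} ==> d n \<le> p" and N1: "N \<ge> 1" and \<rho>: "\<rho> \<ge> 1"
  and ratio: "!!n. n \<in> {1..<N} ==> \<tau> n - \<tau> (n - 1) \<le> \<tau> (n + 1) - \<tau> n"
   "!!n. n \<in> {1..<N} ==> \<tau> (n + 1) - \<tau> n \<le> \<rho> * (\<tau> n - \<tau> (n - 1))"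
begin

abbreviation Y :: "nat \<Rightarrow> real \<Rightarrow> 'v" where "Y n \<equiv> vpoly (d n) (c n)"
abbreviation g :: "real \<Rightarrow> 'v" where "g \<equiv> glue (\<lambda>n. vpoly (d n) (c n))"
abbreviation \<mu> :: "real measure" where "\<mu> \<equiv> restrict_space lborel {0..\<tau> N}"

definition stp :: "nat \<Rightarrow> real" where "stp n = \<tau> n - \<tau> (n - 1)"

definition last_mass :: real where
 "last_mass = integral\<^sup>L \<mu> (\<lambda>s. indicator (cell N) s * (nrm (g s))\<^sup>2)"

definition cross_mass :: "nat \<Rightarrow> real" where
 "cross_mass n = integral\<^sup>L \<mu> (\<lambda>s. integral\<^sup>L \<mu> (\<lambda>t. indicator (cell n) s * indicator (cell (n + 1)) t * (nrm (g s - g t))\<^sup>2))"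

text \<open>A uniform bound for all differences between values on cell n and values on cell n + 1.
  The last cell is compared with 0, as if the function vanished beyond the final node.\<close>

definition cross_sup :: "nat \<Rightarrow> real" where
 "cross_sup n = sqrt (if n = N then Cp / stp N * last_mass else Cp\<^sup>2 / (stp n * stp (n + 1)) * cross_mass n)"

lemma stp_pos: "n \<in> {1..N} ==> stp n > 0" using step_pos[of n] by (simp add: stp_def)

lemma split_last: "{1..N} = insert N {1..<N}" using N1 by auto

lemma cell_nodes:
 assumes "n \<in> {1..N}"
 shows "0 \<le> \<tau> (n - 1)" "\<tau> (n - 1) < \<tau> n" "\<tau> n \<le> \<tau> N"
 using node_nonneg[OF pred_le[OF assms]] step_pos[OF assms] node_mono[of n N] assms by auto

lemma vpoly_sq_measurable:
 "(\<lambda>s. (nrm (vpoly e f s - w))\<^sup>2) \<in> borel_measurable borel"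
 unfolding vpoly_minus_const by (intro borel_measurable_continuous_onI continuous_nrm_square)

lemma vpoly_sq_bounded:
 obtains W where "W \<ge> 0" "!!s. s \<in> {0..\<tau> N} ==> \<bar>(nrm (vpoly e f s - w))\<^sup>2\<bar> \<le> W"
proof (rule nrm_vpoly_bounded[of "\<tau> N" e "f(0 := f 0 - w)"])
 fix V assume V: "V \<ge> 0" "!!t. t \<in> {0..\<tau> N} ==> nrm (vpoly e (f(0 := f 0 - w)) t) \<le> V"
 show ?thesis
 proof (rule that[of "V\<^sup>2"])
  show "\<bar>(nrm (vpoly e f s - w))\<^sup>2\<bar> \<le> V\<^sup>2" if "s \<in> {0..\<tau> N}" for s
   using power_mono[OF V(2)[OF that] nrm_nonneg, of 2] by (simp add: vpoly_minus_const)
 qed simp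
qed

lemma cell_integral:
 assumes n: "n \<in> {1..N}"
 shows "integral {\<tau> (n - 1)..\<tau> n} (\<lambda>s. (nrm (Y n s - w))\<^sup>2) = integral\<^sup>L \<mu> (\<lambda>s. indicator (cell n) s * (nrm (g s - w))\<^sup>2)"
  "integrable \<mu> (\<lambda>s. indicator (cell n) s * (nrm (g s - w))\<^sup>2)"
proof -
 obtain W where W: "W \<ge> 0" "!!s. s \<in> {0..\<tau> N} ==> \<bar>(nrm (Y n s - w))\<^sup>2\<bar> \<le> W"
  by (rule vpoly_sq_bounded) (rule that)
 have e: "(\<lambda>s. indicator (cell n) s * (nrm (g s - w))\<^sup>2) = (\<lambda>s. indicator (cell n) s * (nrm (Y n s - w))\<^sup>2)"
 proof
  fix s show "indicator (cell n) s * (nrm (g s - w))\<^sup>2 = indicator (cell n) s * (nrm (Y n s - w))\<^sup>2"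
   using glue_eq[OF n, of s "\<lambda>n. Y n"] by (cases "s \<in> cell n") auto
 qed
 show "integral {\<tau> (n - 1)..\<tau> n} (\<lambda>s. (nrm (Y n s - w))\<^sup>2) = integral\<^sup>L \<mu> (\<lambda>s. indicator (cell n) s * (nrm (g s - w))\<^sup>2)"
  unfolding e unfolding cell_def
  by (rule integral_M(3)[OF vpoly_sq_measurable W(2) cell_nodes(1,3)[OF n]])
 have "cell n \<in> sets borel" by (rule cell_borel)
 then show "integrable \<mu> (\<lambda>s. indicator (cell n) s * (nrm (g s - w))\<^sup>2)"
  unfolding e
  by (intro integrable_M[of _ W] borel_measurable_times borel_measurable_indicator vpoly_sq_measurable)
   (use W in \<open>auto simp: indicator_def\<close>)
qed

lemma last_bound:
 assumes t: "t \<in> {\<tau> (N - 1)..\<tau> N}"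
 shows "(nrm (Y N t))\<^sup>2 \<le> Cp / stp N * last_mass"
proof -
 have n: "N \<in> {1..N}" using N1 by simp
 have "(nrm (Y N t))\<^sup>2 \<le> Cp / (\<tau> N - \<tau> (N - 1)) * integral {\<tau> (N - 1)..\<tau> N} (\<lambda>s. (nrm (Y N s))\<^sup>2)"
  by (rule vpoly_inverse_inequality[OF inv Cp dp[OF n] cell_nodes(2)[OF n] t])
 then show ?thesis using cell_integral(1)[OF n, of 0] by (simp add: last_mass_def stp_def)
qed

lemma cross_integrable:
 assumes n: "n \<in> {1..<N}"
 shows "integrable \<mu> (\<lambda>s. integral\<^sup>L \<mu> (\<lambda>t. indicator (cell n) s * indicator (cell (n + 1)) t * (nrm (g s - g t))\<^sup>2))"
proof -
 obtain V where V: "V \<ge> 0" "!!s. nrm (g s) \<le> V" "!!n t. n \<in> {1..N} ==> t \<in> {0..\<tau> N} ==> nrm (Y n t) \<le> V"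
  "!!n t. n \<in> {1..N} ==> t \<in> {0..\<tau> N} ==> nrm (vpoly' (d n) (c n) t) \<le> V"
  by (rule bounded_pieces[of d c]) (rule that)
 have D: "(nrm (g s - g t))\<^sup>2 = a (g s) (g s) + a (g t) (g t) - 2 * a (g s) (g t)" for s t
  by (simp add: nrm_square linear_simps sym[of "g t" "g s"])
 note [measurable] = pairing_borel_pair(1)[of d c] pairing_borel2[of d c] cell_borel
 show ?thesis
 proof (rule fubini_M(2))
  show "(\<lambda>p. indicator (cell n) (fst p) * indicator (cell (n + 1)) (snd p) * (nrm (g (fst p) - g (snd p)))\<^sup>2) \<in> borel_measurable (borel \<Otimes>\<^sub>M borel)"
   unfolding D by measurable
  show "\<bar>indicator (cell n) s * indicator (cell (n + 1)) t * (nrm (g s - g t))\<^sup>2\<bar> \<le> (2 * V)\<^sup>2" for s t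
  proof -
   have "nrm (g s - g t) \<le> 2 * V" using nrm_triangle_diff[of "g s" "g t"] V(2)[of s] V(2)[of t] by linarith
   from power_mono[OF this nrm_nonneg, of 2] show ?thesis by (auto simp: indicator_def)
  qed
 qed
qed

text \<open>The inverse inequality is used once in each variable with the other one fixed, hence the
  square of \<open>Cp\<close> and the product of both steps.\<close>

lemma cross_bound:
 assumes n: "n \<in> {1..<N}" and s: "s \<in> {\<tau> (n - 1)..\<tau> n}" and t: "t \<in> {\<tau> n..\<tau> (n + 1)}"
 shows "(nrm (Y n s - Y (n + 1) t))\<^sup>2 \<le> Cp\<^sup>2 / (stp n * stp (n + 1)) * cross_mass n"
proof -
 have n1: "n \<in> {1..N}" "n + 1 \<in> {1..N}" using n by auto
 have pos: "stp n > 0" "stp (n + 1) > 0" using stp_pos n1 by auto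
 have t': "t \<in> {\<tau> (n + 1 - 1)..\<tau> (n + 1)}" using t by simp
 have A: "(nrm (Y n s - Y (n + 1) t))\<^sup>2 \<le> Cp / stp n * integral {\<tau> (n - 1)..\<tau> n} (\<lambda>x. (nrm (Y n x - Y (n + 1) t))\<^sup>2)"
  unfolding vpoly_minus_const stp_def
  by (rule vpoly_inverse_inequality[OF inv Cp dp[OF n1(1)] cell_nodes(2)[OF n1(1)] s])
 have "integral {\<tau> (n - 1)..\<tau> n} (\<lambda>x. (nrm (Y n x - Y (n + 1) t))\<^sup>2)
   = integral\<^sup>L \<mu> (\<lambda>x. indicator (cell n) x * (nrm (g x - Y (n + 1) t))\<^sup>2)"
  by (rule cell_integral(1)[OF n1(1)])
 also have "\<dots> \<le> integral\<^sup>L \<mu> (\<lambda>x. Cp / stp (n + 1) * integral\<^sup>L \<mu> (\<lambda>y. indicator (cell n) x * indicator (cell (n + 1)) y * (nrm (g x - g y))\<^sup>2))"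
 proof (rule Bochner_Integration.integral_mono)
  show "integrable \<mu> (\<lambda>x. indicator (cell n) x * (nrm (g x - Y (n + 1) t))\<^sup>2)"
   by (rule cell_integral(2)[OF n1(1)])
  show "integrable \<mu> (\<lambda>x. Cp / stp (n + 1) * integral\<^sup>L \<mu> (\<lambda>y. indicator (cell n) x * indicator (cell (n + 1)) y * (nrm (g x - g y))\<^sup>2))"
   by (rule integrable_mult_right[OF cross_integrable[OF n]])
  fix x
  have "(nrm (Y (n + 1) t - g x))\<^sup>2 \<le> Cp / stp (n + 1) * integral {\<tau> (n + 1 - 1)..\<tau> (n + 1)} (\<lambda>y. (nrm (Y (n + 1) y - g x))\<^sup>2)"
   unfolding vpoly_minus_const stp_def
   by (rule vpoly_inverse_inequality[OF inv Cp dp[OF n1(2)] cell_nodes(2)[OF n1(2)] t'])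
  also have "integral {\<tau> (n + 1 - 1)..\<tau> (n + 1)} (\<lambda>y. (nrm (Y (n + 1) y - g x))\<^sup>2)
   = integral\<^sup>L \<mu> (\<lambda>y. indicator (cell (n + 1)) y * (nrm (g y - g x))\<^sup>2)"
   by (rule cell_integral(1)[OF n1(2)])
  finally have "(nrm (g x - Y (n + 1) t))\<^sup>2 \<le> Cp / stp (n + 1) * integral\<^sup>L \<mu> (\<lambda>y. indicator (cell (n + 1)) y * (nrm (g x - g y))\<^sup>2)"
   by (simp only: nrm_minus_commute[of "g x"])
  then show "indicator (cell n) x * (nrm (g x - Y (n + 1) t))\<^sup>2 \<le> Cp / stp (n + 1) * integral\<^sup>L \<mu> (\<lambda>y. indicator (cell n) x * indicator (cell (n + 1)) y * (nrm (g x - g y))\<^sup>2)"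
   by (cases "x \<in> cell n") auto
 qed
 also have "\<dots> = Cp / stp (n + 1) * cross_mass n" by (simp add: cross_mass_def)
 finally have B: "integral {\<tau> (n - 1)..\<tau> n} (\<lambda>x. (nrm (Y n x - Y (n + 1) t))\<^sup>2) \<le> Cp / stp (n + 1) * cross_mass n" .
 have "Cp / stp n \<ge> 0" using pos Cp by simp
 from order_trans[OF A mult_left_mono[OF B this]] show ?thesis by (simp add: power2_eq_square)
qed

lemma mass_nonneg: "last_mass \<ge> 0" "cross_mass n \<ge> 0"
 unfolding last_mass_def cross_mass_def by (auto intro!: Bochner_Integration.integral_nonneg)

lemma cross_sup_nonneg: "n \<in> {1..N} ==> cross_sup n \<ge> 0"
 unfolding cross_sup_def
 using stp_pos[of n] stp_pos[of "n + 1"] stp_pos[of N] Cp mass_nonneg by (auto intro!: mult_nonneg_nonneg divide_nonneg_nonneg)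

lemma cross_sup_bound:
 assumes n: "n \<in> {1..N}" and s: "s \<in> {\<tau> (n - 1)..\<tau> n}"
 shows "n < N ==> t \<in> {\<tau> n..\<tau> (n + 1)} ==> nrm (Y n s - Y (n + 1) t) \<le> cross_sup n"
  "n = N ==> nrm (Y n s) \<le> cross_sup n"
proof -
 show "nrm (Y n s - Y (n + 1) t) \<le> cross_sup n" if "n < N" "t \<in> {\<tau> n..\<tau> (n + 1)}"
  unfolding cross_sup_def using cross_bound[of n s t] that n s by (auto intro!: real_le_rsqrt)
 show "nrm (Y n s) \<le> cross_sup n" if "n = N"
  unfolding cross_sup_def using last_bound[of s] that s by (auto intro!: real_le_rsqrt)
qed

definition energy :: real where
 "energy = (\<Sum>n\<in>{1..N}. bracket (memory (omega (\<alpha> + 1)) g) n (d n) (c n))"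

lemma total_mass_ge: "last_mass \<le> integral\<^sup>L \<mu> (\<lambda>s. (nrm (g s))\<^sup>2)"
 unfolding last_mass_def
proof (rule Bochner_Integration.integral_mono)
 have n: "N \<in> {1..N}" using N1 by simp
 show "integrable \<mu> (\<lambda>s. indicator (cell N) s * (nrm (g s))\<^sup>2)" using cell_integral(2)[OF n, of 0] by simp
 obtain V where V: "V \<ge> 0" "!!s. nrm (g s) \<le> V" "!!n t. n \<in> {1..N} ==> t \<in> {0..\<tau> N} ==> nrm (Y n t) \<le> V"
  "!!n t. n \<in> {1..N} ==> t \<in> {0..\<tau> N} ==> nrm (vpoly' (d n) (c n) t) \<le> V"
  by (rule bounded_pieces[of d c]) (rule that)
 show "integrable \<mu> (\<lambda>s. (nrm (g s))\<^sup>2)"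
 proof (rule integrable_M)
  show "(\<lambda>s. (nrm (g s))\<^sup>2) \<in> borel_measurable borel" unfolding nrm_square by (rule pairing_borel2)
  show "\<bar>(nrm (g s))\<^sup>2\<bar> \<le> V\<^sup>2" for s using power_mono[OF V(2) nrm_nonneg, of s 2] by simp
 qed
qed (auto simp: indicator_def)

text \<open>The energy weights neighbouring pairs with the power \<alpha> - 1 of the step, and the
  two inverse inequalities cost k^(-2); this is why k^(1+\<alpha>) is the right weight for
  \<open>cross_sup\<close>. The factor (1 + \<rho>)^(1-\<alpha>) comes from \<tau> (n + 1) - \<tau>
  (n - 1) <= (1 + \<rho>) k_n, the second summand of the constant from the last cell.\<close>

lemma energy_bounds:
 "omega (\<alpha> + 1) (\<tau> N) * last_mass \<le> 2 * energy"
 "(\<Sum>n\<in>{1..N}. stp n powr (1 + \<alpha>) * (cross_sup n)\<^sup>2) \<le>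
   (Cp\<^sup>2 * (1 + \<rho>) powr (1 - \<alpha>) * Gamma (\<alpha> + 1) / (- \<alpha>) + Cp * Gamma (\<alpha> + 1)) * (2 * energy)"
proof -
 have G: "Gamma (\<alpha> + 1) > 0" using \<alpha> by (simp add: Gamma_real_pos)
 have nN: "N \<in> {1..N}" using N1 by simp
 define w where "w n = - (\<alpha> * (\<tau> (n + 1) - \<tau> (n - 1)) powr (\<alpha> - 1) / Gamma (\<alpha> + 1))" for n
 have w0: "w n \<ge> 0" for n unfolding w_def using \<alpha> G by (auto intro!: divide_nonpos_pos mult_nonpos_nonneg)
 have L: "omega (\<alpha> + 1) (\<tau> N) * integral\<^sup>L \<mu> (\<lambda>s. (nrm (g s))\<^sup>2) + omega (\<alpha> + 1) (stp N) * last_mass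
   + (\<Sum>n\<in>{1..<N}. w n * cross_mass n) \<le> 2 * energy"
  using frac_energy_lower[OF N1, of d c] by (simp add: energy_def w_def last_mass_def cross_mass_def stp_def)
 have o: "omega (\<alpha> + 1) (\<tau> N) \<ge> 0" "omega (\<alpha> + 1) (stp N) \<ge> 0" using omega_nonneg \<alpha> by auto
 have t0: "omega (\<alpha> + 1) (\<tau> N) * last_mass \<le> omega (\<alpha> + 1) (\<tau> N) * integral\<^sup>L \<mu> (\<lambda>s. (nrm (g s))\<^sup>2)"
  using total_mass_ge o by (intro mult_left_mono)
 have t0': "0 \<le> omega (\<alpha> + 1) (\<tau> N) * last_mass" "0 \<le> omega (\<alpha> + 1) (stp N) * last_mass" "0 \<le> (\<Sum>n\<in>{1..<N}. w n * cross_mass n)"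
  using o mass_nonneg w0 by (auto intro!: sum_nonneg)
 show "omega (\<alpha> + 1) (\<tau> N) * last_mass \<le> 2 * energy" using L t0 t0' by linarith
 have tN: "stp N powr (1 + \<alpha>) * (cross_sup N)\<^sup>2 = Cp * Gamma (\<alpha> + 1) * (omega (\<alpha> + 1) (stp N) * last_mass)"
 proof -
  have "(cross_sup N)\<^sup>2 = Cp / stp N * last_mass"
   unfolding cross_sup_def using stp_pos[OF nN] Cp mass_nonneg by simp
  then show ?thesis using stp_pos[OF nN] G by (simp add: omega_eq powr_add)
 qed
 define C where "C = Cp\<^sup>2 * (1 + \<rho>) powr (1 - \<alpha>) * Gamma (\<alpha> + 1) / (- \<alpha>)"
 have C0: "C \<ge> 0" unfolding C_def using \<alpha> G by (intro divide_nonneg_nonneg) auto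
 have tn: "stp n powr (1 + \<alpha>) * (cross_sup n)\<^sup>2 \<le> C * (w n * cross_mass n)" if n: "n \<in> {1..<N}" for n
 proof -
  have pos: "stp n > 0" "stp (n + 1) > 0" using stp_pos[of n] stp_pos[of "n + 1"] n by auto
  have r: "stp n \<le> stp (n + 1)" "stp (n + 1) \<le> \<rho> * stp n" using ratio[OF n] by (auto simp: stp_def)
  have "(cross_sup n)\<^sup>2 = Cp\<^sup>2 / (stp n * stp (n + 1)) * cross_mass n"
   unfolding cross_sup_def using pos Cp mass_nonneg n by simp
  also have "\<dots> \<le> Cp\<^sup>2 / (stp n * stp n) * cross_mass n"
   using pos r Cp mass_nonneg by (intro mult_right_mono divide_left_mono mult_left_mono) auto
  finally have "stp n powr (1 + \<alpha>) * (cross_sup n)\<^sup>2 \<le> stp n powr (1 + \<alpha>) * (Cp\<^sup>2 / (stp n * stp n) * cross_mass n)"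
   by (intro mult_left_mono) auto
  also have "\<dots> = Cp\<^sup>2 * cross_mass n * (stp n powr (1 + \<alpha>) / (stp n * stp n))" by simp
  also have "stp n powr (1 + \<alpha>) / (stp n * stp n) = stp n powr (\<alpha> - 1)"
   using pos by (simp add: powr_add powr_diff)
  also have "stp n powr (\<alpha> - 1) = (1 + \<rho>) powr (1 - \<alpha>) * ((1 + \<rho>) * stp n) powr (\<alpha> - 1)"
   using pos \<rho> by (simp add: powr_mult powr_add[symmetric])
  also have "Cp\<^sup>2 * cross_mass n * ((1 + \<rho>) powr (1 - \<alpha>) * ((1 + \<rho>) * stp n) powr (\<alpha> - 1))
    \<le> Cp\<^sup>2 * cross_mass n * ((1 + \<rho>) powr (1 - \<alpha>) * (\<tau> (n + 1) - \<tau> (n - 1)) powr (\<alpha> - 1))"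
  proof (intro mult_left_mono powr_mono2')
   show "\<tau> (n + 1) - \<tau> (n - 1) \<le> (1 + \<rho>) * stp n" "0 < \<tau> (n + 1) - \<tau> (n - 1)"
    using r pos by (auto simp: stp_def algebra_simps)
  qed (use \<alpha> mass_nonneg in auto)
  also have "\<dots> = C * (w n * cross_mass n)" using \<alpha> less_imp_neq[OF G] by (simp add: C_def w_def)
  finally show ?thesis .
 qed
 have "(\<Sum>n\<in>{1..N}. stp n powr (1 + \<alpha>) * (cross_sup n)\<^sup>2) = (\<Sum>n\<in>{1..<N}. stp n powr (1 + \<alpha>) * (cross_sup n)\<^sup>2) + stp N powr (1 + \<alpha>) * (cross_sup N)\<^sup>2"
  unfolding split_last by simp
 also have "\<dots> \<le> C * (\<Sum>n\<in>{1..<N}. w n * cross_mass n) + Cp * Gamma (\<alpha> + 1) * (omega (\<alpha> + 1) (stp N) * last_mass)"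
  unfolding tN sum_distrib_left by (intro add_mono sum_mono tn order_refl)
 also have "\<dots> \<le> C * (2 * energy) + Cp * Gamma (\<alpha> + 1) * (2 * energy)"
  using L t0 t0' C0 Cp G by (intro add_mono mult_left_mono) auto
 also have "\<dots> = (C + Cp * Gamma (\<alpha> + 1)) * (2 * energy)" by (simp only: distrib_right)
 finally show "(\<Sum>n\<in>{1..N}. stp n powr (1 + \<alpha>) * (cross_sup n)\<^sup>2) \<le>
   (Cp\<^sup>2 * (1 + \<rho>) powr (1 - \<alpha>) * Gamma (\<alpha> + 1) / (- \<alpha>) + Cp * Gamma (\<alpha> + 1)) * (2 * energy)"
  unfolding C_def .
qed

text \<open>Markov's inequality relative to the value of the next piece at the common node, or
  relative to 0 on the last cell, so that only differences enter.\<close>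

lemma derivative_bound:
 assumes n: "n \<in> {1..N}" and t: "t \<in> {\<tau> (n - 1)..\<tau> n}"
 shows "nrm (vpoly' (d n) (c n) t) \<le> Cp / stp n * cross_sup n"
proof (cases "n = N")
 case True
 have B: "nrm (Y n s - 0) \<le> cross_sup n" if "s \<in> {\<tau> (n - 1)..\<tau> n}" for s
  using cross_sup_bound(2)[OF n that True] by simp
 show ?thesis unfolding stp_def
  by (rule vpoly_markov[OF mark Cp dp[OF n] cell_nodes(2)[OF n] t B])
next
 case False
 then have m: "n < N" "\<tau> n \<in> {\<tau> n..\<tau> (n + 1)}" using n cell_nodes(2)[of "n + 1"] by auto
 have B: "nrm (Y n s - Y (n + 1) (\<tau> n)) \<le> cross_sup n" if "s \<in> {\<tau> (n - 1)..\<tau> n}" for s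
  by (rule cross_sup_bound(1)[OF n that m])
 show ?thesis unfolding stp_def
  by (rule vpoly_markov[OF mark Cp dp[OF n] cell_nodes(2)[OF n] t B])
qed

text \<open>Summation by parts. The first nodal term vanishes because \<open>z\<close> does at time
  0, and linearity merges the two terms at every interior node into \<open>z\<close> of a jump.
  Jumps and derivatives are both bounded by \<open>cross_sup\<close>; the length of a cell cancels
  the 1/k of the derivative bound.\<close>

lemma bracket_sum_upper:
 assumes V: "subspace V" and cV: "!!n j. n \<in> {1..N} ==> j \<le> d n ==> c n j \<in> V"
  and z0: "!!w. w \<in> V ==> z 0 w = 0" and zd: "!!t w w'. w \<in> V ==> w' \<in> V ==> z t (w - w') = z t w - z t w'"
  and zb: "!!n t w. n \<in> {1..N} ==> t \<in> {\<tau> (n - 1)..\<tau> n} ==> w \<in> V ==> \<bar>z t w\<bar> \<le> Z n * nrm w"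
  and Z0: "!!n. n \<in> {1..N} ==> Z n \<ge> 0"
  and zi: "!!n. n \<in> {1..N} ==> (\<lambda>t. z t (vpoly' (d n) (c n) t)) integrable_on {\<tau> (n - 1)..\<tau> n}"
 shows "\<bar>\<Sum>n\<in>{1..N}. bracket z n (d n) (c n)\<bar> \<le> (1 + Cp) * (\<Sum>n\<in>{1..N}. Z n * cross_sup n)"
proof -
 have YV: "Y n t \<in> V" if "n \<in> {1..N}" for n t by (rule vpoly_mem[OF V cV[OF that]])
 define I where "I n = integral {\<tau> (n - 1)..\<tau> n} (\<lambda>t. z t (vpoly' (d n) (c n) t))" for n
 have I: "\<bar>I n\<bar> \<le> Cp * (Z n * cross_sup n)" if n: "n \<in> {1..N}" for n
 proof -
  have "norm (I n) \<le> integral {\<tau> (n - 1)..\<tau> n} (\<lambda>t. Z n * (Cp / stp n * cross_sup n))"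
   unfolding I_def
  proof (rule integral_norm_bound_integral[OF zi[OF n]])
   fix t assume t: "t \<in> {\<tau> (n - 1)..\<tau> n}"
   have "vpoly' (d n) (c n) t \<in> V" by (rule vpoly'_mem[OF V cV[OF n]])
   from zb[OF n t this] mult_left_mono[OF derivative_bound[OF n t] Z0[OF n]]
   show "norm (z t (vpoly' (d n) (c n) t)) \<le> Z n * (Cp / stp n * cross_sup n)" by simp
  qed auto
  also have "\<dots> = stp n * (Z n * (Cp / stp n * cross_sup n))"
   using cell_nodes(2)[OF n] by (simp add: stp_def)
  also have "\<dots> = Cp * (Z n * cross_sup n)" using stp_pos[OF n] by simp
  finally show ?thesis by simp
 qed
 define b where "b m = (if m = N then z (\<tau> N) (Y N (\<tau> N)) else z (\<tau> m) (Y m (\<tau> m) - Y (m + 1) (\<tau> m)))" for m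
 have b: "\<bar>b m\<bar> \<le> Z m * cross_sup m" if m: "m \<in> {1..N}" for m
 proof -
  have tm: "\<tau> m \<in> {\<tau> (m - 1)..\<tau> m}" using cell_nodes(2)[OF m] by simp
  show ?thesis
  proof (cases "m = N")
   case True
   then show ?thesis
    using order_trans[OF zb[OF m tm YV[OF m]] mult_left_mono[OF cross_sup_bound(2)[OF m tm True] Z0[OF m]]] by (simp add: b_def)
  next
   case False
   then have m1: "m < N" "m + 1 \<in> {1..N}" using m by auto
   have "\<tau> m \<in> {\<tau> m..\<tau> (m + 1)}" using cell_nodes(2)[OF m1(2)] by simp
   from order_trans[OF zb[OF m tm subspace_diff[OF V YV[OF m] YV[OF m1(2)]]] mult_left_mono[OF cross_sup_bound(1)[OF m tm m1(1) this] Z0[OF m]]]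
   show ?thesis using False by (simp add: b_def)
  qed
 qed
 have tel: "(\<Sum>n\<in>{1..m}. z (\<tau> n) (Y n (\<tau> n)) - z (\<tau> (n - 1)) (Y n (\<tau> (n - 1))))
   = (\<Sum>n\<in>{1..<m}. b n) + z (\<tau> m) (Y m (\<tau> m))" if "1 \<le> m" "m \<le> N" for m
  using that
 proof (induction m rule: dec_induct)
  case base
  then show ?case using z0[OF YV, of 1] N1 \<tau>0 by simp
 next
  case (step m)
  have "{1..Suc m} = insert (Suc m) {1..m}" "{1..<Suc m} = insert m {1..<m}" using step by auto
  then show ?case using step zd[OF YV YV, of m "Suc m" "\<tau> m"] by (simp add: b_def)
 qed
 have "(\<Sum>n\<in>{1..N}. bracket z n (d n) (c n)) = (\<Sum>n\<in>{1..N}. z (\<tau> n) (Y n (\<tau> n)) - z (\<tau> (n - 1)) (Y n (\<tau> (n - 1)))) - (\<Sum>n\<in>{1..N}. I n)"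
  by (simp add: bracket_def I_def sum_subtractf)
 also have "(\<Sum>n\<in>{1..N}. z (\<tau> n) (Y n (\<tau> n)) - z (\<tau> (n - 1)) (Y n (\<tau> (n - 1)))) = (\<Sum>n\<in>{1..<N}. b n) + b N"
  using tel[OF N1 order_refl] by (simp add: b_def)
 also have "(\<Sum>n\<in>{1..<N}. b n) + b N = (\<Sum>n\<in>{1..N}. b n)"
  unfolding split_last by simp
 finally have "\<bar>\<Sum>n\<in>{1..N}. bracket z n (d n) (c n)\<bar> \<le> \<bar>\<Sum>n\<in>{1..N}. b n\<bar> + \<bar>\<Sum>n\<in>{1..N}. I n\<bar>" by linarith
 also have "\<dots> \<le> (\<Sum>n\<in>{1..N}. Z n * cross_sup n) + (\<Sum>n\<in>{1..N}. Cp * (Z n * cross_sup n))"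
  by (intro add_mono order_trans[OF sum_abs] sum_mono b I)
 also have "\<dots> = (1 + Cp) * (\<Sum>n\<in>{1..N}. Z n * cross_sup n)" by (simp add: distrib_right sum_distrib_left sum.distrib)
 finally show ?thesis .
qed

end

section \<open>The projection in time\<close>

text \<open>The bounds for \<open>u\<close> hold only for positive times, so the left end point may
  carry any value; a single point affects neither measurability nor boundedness.\<close>

lemma bounded_continuous_absolutely_integrable:
 fixes f :: "real \<Rightarrow> real"
 assumes "continuous_on {l<..r} f" "!!x. x \<in> {l<..r} ==> \<bar>f x\<bar> \<le> B"
 shows "f absolutely_integrable_on {l..r}" "f \<in> borel_measurable (lebesgue_on {l..r})"
proof -
 define h where "h x = (if x \<in> {l<..r} then f x else 0)" for x
 have "f \<in> borel_measurable (lebesgue_on {l<..r})"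
  by (rule continuous_imp_measurable_on_sets_lebesgue[OF assms(1)]) simp
 then have h: "h \<in> borel_measurable lebesgue"
  unfolding h_def[abs_def] by (subst borel_measurable_if) simp_all
 have "(\<lambda>x. if x \<in> {l..r} then f x else 0) = (\<lambda>x. h x + indicat_real {l} x * (if l \<le> r then f l else 0))"
  by (auto simp: h_def fun_eq_iff indicator_def)
 moreover have "(\<lambda>x. h x + indicat_real {l} x * (if l \<le> r then f l else 0)) \<in> borel_measurable lebesgue"
  by (intro borel_measurable_add borel_measurable_times h borel_measurable_const borel_measurable_indicator) simp
 ultimately show m: "f \<in> borel_measurable (lebesgue_on {l..r})"
  by (subst borel_measurable_if[symmetric]) simp_all
 have "norm (f x) \<le> max B \<bar>f l\<bar>" if "x \<in> {l..r}" for x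
  using assms(2)[of x] that by (cases "x = l") auto
 then show "f absolutely_integrable_on {l..r}"
  by (intro measurable_bounded_by_integrable_imp_absolutely_integrable[OF m, of "\<lambda>x. max B \<bar>f l\<bar>"]) auto
qed

lemma poly_scaleR_vpoly:
 assumes "degree q \<le> d"
 shows "poly q t *\<^sub>R v = vpoly d (\<lambda>j. coeff q j *\<^sub>R v) t"
 by (simp add: vpoly_def poly_eq_sum[OF assms] scaleR_sum_left mult.commute)

lemma vpoly_sum: "(\<Sum>i\<in>I. vpoly d (c i) t) = vpoly d (\<lambda>j. \<Sum>i\<in>I. c i j) t"
 by (simp add: vpoly_def scaleR_sum_right) (rule sum.swap)

lemma vpoly_add: "vpoly d c t + vpoly d c' t = vpoly d (\<lambda>j. c j + c' j) t"
 by (simp add: vpoly_def sum.distrib scaleR_add_right)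

lemma vpoly_const: "vpoly d (\<lambda>j. if j = 0 then v else 0) t = v"
proof -
 have "vpoly d (\<lambda>j. if j = 0 then v else 0) t = (\<Sum>j\<le>d. if j = 0 then v else 0)"
  unfolding vpoly_def by (rule sum.cong) auto
 then show ?thesis by simp
qed

lemma vpoly_affine:
 fixes c :: "nat \<Rightarrow> 'v::real_vector" and s k :: real and d :: nat
 defines "e \<equiv> \<lambda>i. \<Sum>j\<le>d. coeff ([:s, k:] ^ j) i *\<^sub>R c j"
 shows "vpoly d c (s + k * y) = vpoly d e y"
proof -
 have deg: "degree ([:s, k:] ^ j) \<le> d" if "j \<le> d" for j
  using degree_power_le[of "[:s, k:]" j] that by (cases "k = 0") (auto intro: order_trans)
 have "vpoly d c (s + k * y) = (\<Sum>j\<le>d. poly ([:s, k:] ^ j) y *\<^sub>R c j)"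
  unfolding vpoly_def by (rule sum.cong) (simp_all add: poly_power mult.commute)
 also have "\<dots> = (\<Sum>j\<le>d. vpoly d (\<lambda>i. coeff ([:s, k:] ^ j) i *\<^sub>R c j) y)"
  by (rule sum.cong[OF refl]) (rule poly_scaleR_vpoly, simp add: deg)
 also have "\<dots> = vpoly d e y" by (simp add: vpoly_sum e_def)
 finally show ?thesis .
qed

lemma vpoly'_eq_vpoly:
 assumes "d \<ge> 1"
 shows "vpoly' d c t = vpoly (d - 1) (\<lambda>j. real (Suc j) *\<^sub>R c (Suc j)) t"
proof -
 obtain e where e: "d = Suc e" using assms by (cases d) auto
 have "vpoly' d c t = (\<Sum>j\<le>e. (real (Suc j) * t ^ j) *\<^sub>R c (Suc j))"
  unfolding vpoly'_def e by (subst sum.atMost_Suc_shift) simp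
 then show ?thesis by (simp add: e vpoly_def mult.commute)
qed

text \<open>The coefficient is paired with itself, and one factor of its seminorm cancels.\<close>

lemma (in psd_form) vpoly_coeff_bound:
 assumes C: "!!(q::real poly) i B. degree q \<le> p ==> (!!s. s \<in> {0..1} ==> \<bar>poly q s\<bar> \<le> B) ==> \<bar>coeff q i\<bar> \<le> C * B"
  and C0: "C > 0" and d: "d \<le> p" and B: "!!y. y \<in> {0..1} ==> nrm (vpoly d e y) \<le> B" and j: "j \<le> d"
 shows "nrm (e j) \<le> C * B"
proof (rule nrm_le_of_form)
 have "B \<ge> 0" using order_trans[OF nrm_nonneg B[of 0]] by simp
 then show "0 \<le> C * B" using C0 by simp
 define q where "q = pairing_poly d e (e j)"
 have q: "degree q \<le> p" using pairing_poly(1)[of d e "e j"] d by (simp add: q_def)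
 have b: "\<bar>poly q s\<bar> \<le> B * nrm (e j)" if "s \<in> {0..1}" for s
  unfolding q_def pairing_poly
  by (rule order_trans[OF cauchy_schwarz mult_right_mono[OF B[OF that] nrm_nonneg]])
 have "\<bar>coeff q j\<bar> \<le> C * (B * nrm (e j))" by (rule C[OF q b])
 then show "a (e j) (e j) \<le> C * B * nrm (e j)" using j by (simp add: q_def pairing_poly)
qed

text \<open>\<open>C\<pi>\<close> acts as a Lebesgue constant: it turns bounds for the moments into
  a uniform bound for the projection.\<close>

locale projection_basis =
 fixes d :: nat and \<pi> :: "nat \<Rightarrow> real poly" and C\<pi> :: real
 assumes \<pi>: "!!i. i < d ==> degree (\<pi> i) \<le> d" "!!i. i < d ==> poly (\<pi> i) 1 = 0"
  "!!i j. i < d ==> j < d ==> integral {0..1} (\<lambda>x. x ^ j * poly (\<pi> i) x) = (if i = j then 1 else 0)"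
  "!!q x. degree q \<le> d ==> poly q 1 = 0 ==>
    poly q x = (\<Sum>i<d. poly (\<pi> i) x * integral {0..1} (\<lambda>y. y ^ i * poly q y))"
  and C\<pi>: "!!x. x \<in> {0..1} ==> (\<Sum>i<d. \<bar>poly (\<pi> i) x\<bar>) \<le> C\<pi>"
begin

definition cell_moment :: "nat \<Rightarrow> nat \<Rightarrow> nat \<Rightarrow> real" where
 "cell_moment m i r = integral {real r / real m..real (Suc r) / real m} (\<lambda>y. y ^ i)"

text \<open>A Riemann sum for the i-th moment of \<open>u - u e\<close> on the unit interval, exact
  in the monomial and sampling \<open>u\<close> at right end points. A finite combination stays in
  the subspace, and the sample points avoid \<open>s\<close>, where nothing is assumed.\<close>

definition sampled_moment :: "nat \<Rightarrow> (real \<Rightarrow> 'v::real_vector) \<Rightarrow> real \<Rightarrow> real \<Rightarrow> nat \<Rightarrow> 'v" where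
 "sampled_moment m u s e i = (\<Sum>r<m. cell_moment m i r *\<^sub>R (u (s + (e - s) * (real (Suc r) / real m)) - u e))"

definition sampled_projection :: "nat \<Rightarrow> (real \<Rightarrow> 'v::real_vector) \<Rightarrow> real \<Rightarrow> real \<Rightarrow> real \<Rightarrow> 'v" where
 "sampled_projection m u s e t = u e + (\<Sum>i<d. poly (\<pi> i) ((t - s) / (e - s)) *\<^sub>R sampled_moment m u s e i)"

lemma sampled_projection_end: "s < e ==> sampled_projection m u s e e = u e"
 by (simp add: sampled_projection_def \<pi>(2))

lemma sampled_projection_vpoly:
 assumes V: "subspace V" and u: "!!t. t \<in> {s<..e} ==> u t \<in> V" and se: "s < e"
 obtains c where "!!j. j \<le> d ==> c j \<in> V" "!!t. sampled_projection m u s e t = vpoly d c t"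
proof -
 let ?q = "\<lambda>i. pcompose (\<pi> i) [:- s / (e - s), 1 / (e - s):]"
 have deg: "degree (?q i) \<le> d" if "i < d" for i
  using degree_pcompose_le[of "\<pi> i" "[:- s / (e - s), 1 / (e - s):]"] \<pi>(1)[OF that] se by simp
 have pq: "poly (\<pi> i) ((t - s) / (e - s)) = poly (?q i) t" for i t
  by (simp add: poly_pcompose diff_divide_distrib)
 define c where "c j = (if j = 0 then u e else 0) + (\<Sum>i<d. coeff (?q i) j *\<^sub>R sampled_moment m u s e i)" for j
 have node: "u (s + (e - s) * (real (Suc r) / real m)) \<in> V" if "r < m" for r
 proof (rule u)
  have "0 < (e - s) * (real (Suc r) / real m)" using se that by simp
  moreover have "(e - s) * (real (Suc r) / real m) \<le> (e - s) * 1" using se that by (intro mult_left_mono) auto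
  ultimately show "s + (e - s) * (real (Suc r) / real m) \<in> {s<..e}" by auto
 qed
 have mom: "sampled_moment m u s e i \<in> V" for i
  unfolding sampled_moment_def
  by (intro subspace_sum[OF V] subspace_scale[OF V] subspace_diff[OF V] node u) (use se in auto)
 show ?thesis
 proof (rule that)
  show "c j \<in> V" if "j \<le> d" for j
   unfolding c_def using mom u[of e] se subspace_0[OF V]
   by (intro subspace_add[OF V] subspace_sum[OF V] subspace_scale[OF V]) auto
  show "sampled_projection m u s e t = vpoly d c t" for t
  proof -
   have "(\<Sum>i<d. poly (\<pi> i) ((t - s) / (e - s)) *\<^sub>R sampled_moment m u s e i)
    = (\<Sum>i<d. vpoly d (\<lambda>j. coeff (?q i) j *\<^sub>R sampled_moment m u s e i) t)"
    by (rule sum.cong[OF refl], subst pq, rule poly_scaleR_vpoly, rule deg, simp)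
   also have "\<dots> = vpoly d (\<lambda>j. \<Sum>i<d. coeff (?q i) j *\<^sub>R sampled_moment m u s e i) t" by (rule vpoly_sum)
   finally show ?thesis
    unfolding sampled_projection_def c_def
    by (subst vpoly_const[of d "u e" t, symmetric]) (simp add: vpoly_add)
  qed
 qed
qed

lemma integral_split_unit:
 fixes f :: "real \<Rightarrow> real"
 assumes "f integrable_on {0..1}" "m > 0"
 shows "integral {0..1} f = (\<Sum>r<m. integral {real r / real m..real (Suc r) / real m} f)"
proof -
 have "integral {0..real n / real m} f = (\<Sum>r<n. integral {real r / real m..real (Suc r) / real m} f)" if "n \<le> m" for n
  using that
 proof (induction n)
  case (Suc n)
  have sub: "f integrable_on {0..real (Suc n) / real m}"
   by (rule integrable_on_subinterval[OF assms(1)]) (use Suc assms(2) in auto)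
  have "integral {0..real (Suc n) / real m} f = integral {0..real n / real m} f + integral {real n / real m..real (Suc n) / real m} f"
   by (rule Henstock_Kurzweil_Integration.integral_combine[symmetric, OF _ _ sub]) (auto simp: divide_right_mono)
  then show ?case using Suc by simp
 qed simp
 from this[of m] show ?thesis using assms(2) by simp
qed

end

text \<open>With a fixed test vector \<open>w\<close> every integral is a real one. \<open>G\<close>
  bounds the increments towards the right end and \<open>\<kappa>\<close> the oscillation at the
  sampling distance.\<close>

locale projected_pairing = projection_basis d \<pi> C\<pi> + psd_form b
 for d :: nat and \<pi> :: "nat \<Rightarrow> real poly" and C\<pi> :: real and b :: "'v::real_vector \<Rightarrow> 'v \<Rightarrow> real" +
 fixes u :: "real \<Rightarrow> 'v" and s e :: real and w :: 'v and m :: nat and \<kappa> G :: real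
 assumes se: "s < e" and m: "m > 0"
  and cont: "continuous_on {s<..e} (\<lambda>t. b (u t) w)"
  and bnd: "!!t. t \<in> {s<..e} ==> \<bar>b (u t - u e) w\<bar> \<le> G"
  and modulus: "!!t t'. t \<in> {s<..e} ==> t' \<in> {s<..e} ==> \<bar>t - t'\<bar> \<le> (e - s) / real m ==> \<bar>b (u t - u t') w\<bar> \<le> \<kappa>"
begin

definition unit_pairing :: "real \<Rightarrow> real" where "unit_pairing y = b (u (s + (e - s) * y) - u e) w"

lemma unit_mem:
 assumes "y \<in> {0<..1}"
 shows "s + (e - s) * y \<in> {s<..e}"
proof -
 have "0 < (e - s) * y" using se assms by simp
 moreover have "(e - s) * y \<le> (e - s) * 1" by (intro mult_left_mono) (use se assms in auto)
 ultimately show ?thesis by auto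
qed

lemma unit_pairing_props:
 "continuous_on {0<..1} unit_pairing" "!!y. y \<in> {0<..1} ==> \<bar>unit_pairing y\<bar> \<le> G"
proof -
 have "continuous_on {0<..1} (\<lambda>y. b (u (s + (e - s) * y)) w)"
  by (rule continuous_on_compose2[OF cont]) (use unit_mem in \<open>auto intro!: continuous_intros\<close>)
 then show "continuous_on {0<..1} unit_pairing"
  unfolding unit_pairing_def[abs_def] diff_left by (intro continuous_intros)
 show "!!y. y \<in> {0<..1} ==> \<bar>unit_pairing y\<bar> \<le> G"
  unfolding unit_pairing_def by (rule bnd[OF unit_mem])
qed

lemma moment_integrable: "(\<lambda>y. y ^ i * unit_pairing y) integrable_on {0..1}"
proof -
 have "(\<lambda>y. y ^ i * unit_pairing y) absolutely_integrable_on {0..1}"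
 proof (rule bounded_continuous_absolutely_integrable(1))
  show "continuous_on {0<..1} (\<lambda>y. y ^ i * unit_pairing y)" by (intro continuous_intros unit_pairing_props)
  show "\<bar>y ^ i * unit_pairing y\<bar> \<le> G" if "y \<in> {0<..1}" for y
   using mult_mono[of "y ^ i" 1 "\<bar>unit_pairing y\<bar>" G] unit_pairing_props(2)[OF that] that
   by (simp add: abs_mult power_le_one)
 qed
 then show ?thesis by (rule set_lebesgue_integral_eq_integral(1))
qed

text \<open>On each subinterval \<open>u\<close> is compared with its value at the right end. The
  weights add up to the integral of y^i, which is at most 1.\<close>

lemma sampled_moment_error:
 "\<bar>b (sampled_moment m u s e i) w - integral {0..1} (\<lambda>y. y ^ i * unit_pairing y)\<bar> \<le> \<kappa>"
proof -
 let ?I = "\<lambda>r. {real r / real m..real (Suc r) / real m}"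
 have \<kappa>: "\<kappa> \<ge> 0" using modulus[of e e] se by simp
 have sub: "?I r \<subseteq> {0..1}" if "r < m" for r
  using that m by (auto intro: order_trans[OF divide_nonneg_nonneg] order_trans[of _ "real (Suc r) / real m" 1])
 have int1: "(\<lambda>y. y ^ i * unit_pairing y) integrable_on ?I r" if "r < m" for r
  by (rule integrable_on_subinterval[OF moment_integrable sub[OF that]])
 have int2: "(\<lambda>y::real. y ^ i) integrable_on S" if "S = {l..r}" for l r S
  unfolding that by (intro integrable_continuous_real continuous_intros)
 have cellerr: "\<bar>cell_moment m i r * unit_pairing (real (Suc r) / real m) - integral (?I r) (\<lambda>y. y ^ i * unit_pairing y)\<bar>
   \<le> \<kappa> * cell_moment m i r" if r: "r < m" for r
 proof -
  let ?f = "\<lambda>y. y ^ i * unit_pairing (real (Suc r) / real m) - y ^ i * unit_pairing y"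
  have i3: "(\<lambda>y::real. y ^ i * unit_pairing (real (Suc r) / real m)) integrable_on ?I r"
   by (intro integrable_continuous_real continuous_intros)
  have e1: "cell_moment m i r * unit_pairing (real (Suc r) / real m) - integral (?I r) (\<lambda>y. y ^ i * unit_pairing y) = integral (?I r) ?f"
   using Henstock_Kurzweil_Integration.integral_diff[OF i3 int1[OF r]] by (simp add: cell_moment_def)
  have e2: "integral (?I r) ?f = integral (?I r) (\<lambda>y. if y = 0 then 0 else ?f y)"
   by (rule integral_spike[of "{0}"]) auto
  have e3: "norm (integral (?I r) (\<lambda>y. if y = 0 then 0 else ?f y)) \<le> integral (?I r) (\<lambda>y. \<kappa> * y ^ i)"
  proof (rule integral_norm_bound_integral)
   show "(\<lambda>y. if y = 0 then 0 else ?f y) integrable_on ?I r"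
    by (rule integrable_spike_finite[of "{0}", OF _ _ integrable_diff[OF i3 int1[OF r]]]) auto
   show "(\<lambda>y. \<kappa> * y ^ i) integrable_on ?I r" by (intro integrable_continuous_real continuous_intros)
   fix y assume y: "y \<in> ?I r"
   show "norm (if y = 0 then 0 else ?f y) \<le> \<kappa> * y ^ i"
   proof (cases "y = 0")
    case True
    then show ?thesis using \<kappa> by simp
   next
    case False
    have "y \<in> {0..1}" using y sub[OF r] by blast
     then have y01: "y \<in> {0<..1}" using False by auto
    have r01: "real (Suc r) / real m \<in> {0<..1}" using r by auto
    have "\<bar>(s + (e - s) * (real (Suc r) / real m)) - (s + (e - s) * y)\<bar> = (e - s) * (real (Suc r) / real m - y)"
    proof -
     have "(s + (e - s) * (real (Suc r) / real m)) - (s + (e - s) * y) = (e - s) * (real (Suc r) / real m - y)"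
      by (simp only: right_diff_distrib add_diff_cancel_left)
     moreover have "0 \<le> (e - s) * (real (Suc r) / real m - y)" using y se by (intro mult_nonneg_nonneg) auto
     ultimately show ?thesis by linarith
    qed
    also have "\<dots> \<le> (e - s) * (1 / real m)"
     using y se by (intro mult_left_mono) (auto simp: add_divide_distrib)
    finally have close: "\<bar>(s + (e - s) * (real (Suc r) / real m)) - (s + (e - s) * y)\<bar> \<le> (e - s) / real m" by simp
    have incr: "\<bar>unit_pairing (real (Suc r) / real m) - unit_pairing y\<bar> \<le> \<kappa>"
     using modulus[OF unit_mem[OF r01] unit_mem[OF y01] close] by (simp add: unit_pairing_def diff_left)
    have "\<bar>y ^ i\<bar> * \<bar>unit_pairing (real (Suc r) / real m) - unit_pairing y\<bar> \<le> y ^ i * \<kappa>"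
     using y01 \<open>\<bar>unit_pairing (real (Suc r) / real m) - unit_pairing y\<bar> \<le> \<kappa>\<close> by (intro mult_mono) auto
    moreover have "\<bar>?f y\<bar> = \<bar>y ^ i\<bar> * \<bar>unit_pairing (real (Suc r) / real m) - unit_pairing y\<bar>"
     by (simp only: right_diff_distrib[symmetric] abs_mult)
    ultimately have "\<bar>?f y\<bar> \<le> \<kappa> * y ^ i" by (simp only: mult.commute[of \<kappa> "y ^ i"])
    then show ?thesis by (simp only: if_not_P[OF False] real_norm_def)
   qed
  qed
  have e4: "integral (?I r) (\<lambda>y. \<kappa> * y ^ i) = \<kappa> * cell_moment m i r" by (simp add: cell_moment_def)
  show ?thesis using e3 unfolding real_norm_def e4 e2[symmetric] e1[symmetric] .
 qed
 have "b (sampled_moment m u s e i) w = (\<Sum>r<m. cell_moment m i r * unit_pairing (real (Suc r) / real m))"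
  by (simp add: sampled_moment_def unit_pairing_def sum_left scale_left)
 then have "\<bar>b (sampled_moment m u s e i) w - integral {0..1} (\<lambda>y. y ^ i * unit_pairing y)\<bar>
   = \<bar>\<Sum>r<m. cell_moment m i r * unit_pairing (real (Suc r) / real m) - integral (?I r) (\<lambda>y. y ^ i * unit_pairing y)\<bar>"
  by (simp add: integral_split_unit[OF moment_integrable m] sum_subtractf)
 also have "\<dots> \<le> (\<Sum>r<m. \<kappa> * cell_moment m i r)"
  by (rule order_trans[OF sum_abs]) (rule sum_mono, rule cellerr, simp)
 also have "\<dots> = \<kappa> * integral {0..1} (\<lambda>y. y ^ i)"
  unfolding integral_split_unit[OF int2[OF refl] m] cell_moment_def sum_distrib_left ..
 also have "\<dots> \<le> \<kappa> * integral {0..1} (\<lambda>y::real. 1)"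
  by (intro mult_left_mono integral_le int2[OF refl] \<kappa>) (auto simp: power_le_one)
 finally show ?thesis by simp
qed

lemma sampled_projection_pairing:
 "b (sampled_projection m u s e t) w = b (u e) w + (\<Sum>i<d. poly (\<pi> i) ((t - s) / (e - s)) * b (sampled_moment m u s e i) w)"
 by (simp add: sampled_projection_def add_left sum_left scale_left)

lemma sampled_projection_moments:
 assumes "j < d"
 shows "\<bar>integral {0..1} (\<lambda>y. y ^ j * b (sampled_projection m u s e (s + (e - s) * y) - u (s + (e - s) * y)) w)\<bar> \<le> \<kappa>"
proof -
 have e1: "integral {0..1} (\<lambda>y. y ^ j * b (sampled_projection m u s e (s + (e - s) * y) - u (s + (e - s) * y)) w)
   = integral {0..1} (\<lambda>y. (\<Sum>i<d. (y ^ j * poly (\<pi> i) y) * b (sampled_moment m u s e i) w) - y ^ j * unit_pairing y)"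
 proof (rule integral_cong)
  fix y :: real
  have "(s + (e - s) * y - s) / (e - s) = y" using se by simp
  then show "y ^ j * b (sampled_projection m u s e (s + (e - s) * y) - u (s + (e - s) * y)) w
    = (\<Sum>i<d. (y ^ j * poly (\<pi> i) y) * b (sampled_moment m u s e i) w) - y ^ j * unit_pairing y"
   by (simp only: diff_left sampled_projection_pairing unit_pairing_def distrib_left right_diff_distrib
     sum_distrib_left mult.assoc)
 qed
 have e2: "integral {0..1} (\<lambda>y. (\<Sum>i<d. (y ^ j * poly (\<pi> i) y) * b (sampled_moment m u s e i) w) - y ^ j * unit_pairing y)
   = integral {0..1} (\<lambda>y. \<Sum>i<d. (y ^ j * poly (\<pi> i) y) * b (sampled_moment m u s e i) w) - integral {0..1} (\<lambda>y. y ^ j * unit_pairing y)"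
  by (rule Henstock_Kurzweil_Integration.integral_diff[OF _ moment_integrable]) (intro integrable_continuous_real continuous_intros)
 have "integral {0..1} (\<lambda>y. \<Sum>i<d. (y ^ j * poly (\<pi> i) y) * b (sampled_moment m u s e i) w)
   = (\<Sum>i<d. integral {0..1} (\<lambda>y. (y ^ j * poly (\<pi> i) y) * b (sampled_moment m u s e i) w))"
  by (intro Henstock_Kurzweil_Integration.integral_sum integrable_continuous_real continuous_intros) simp
 also have "\<dots> = (\<Sum>i<d. if i = j then b (sampled_moment m u s e i) w else 0)"
  using \<pi>(3)[OF _ assms] by (intro sum.cong) auto
 also have "\<dots> = b (sampled_moment m u s e j) w" using assms by simp
 finally show ?thesis using sampled_moment_error[of j] unfolding e1 e2 by (simp only:)
qed

text \<open>Quasi-optimality: q - q(e) is reproduced exactly, so only the moments of the difference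
  between \<open>u\<close> and q matter. Subtracting the values at e doubles \<epsilon>, and
  sampling adds \<open>\<kappa>\<close> to each moment.\<close>

lemma sampled_projection_error:
 assumes q: "degree q \<le> d" "!!t. t \<in> {s<..e} ==> \<bar>b (u t) w - poly q t\<bar> \<le> \<epsilon>" and t: "t \<in> {s<..e}"
 shows "\<bar>b (sampled_projection m u s e t - u t) w\<bar> \<le> (2 + 2 * C\<pi>) * \<epsilon> + C\<pi> * \<kappa>"
proof -
 define x where "x = (t - s) / (e - s)"
 have x: "x \<in> {0<..1}" "s + (e - s) * x = t" using t se by (auto simp: x_def)
 have eps: "\<epsilon> \<ge> 0" using q(2)[OF t] by linarith
 have \<kappa>: "\<kappa> \<ge> 0" using modulus[of e e] se by simp
 \<comment> \<open>Transported to [0,1] and normalised to vanish at 1, as the reproduction formula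
   requires.\<close>
 define q' where "q' = pcompose q [:s, e - s:] - [:poly q e:]"
 have q'x: "poly q' y = poly q (s + (e - s) * y) - poly q e" for y
  by (simp add: q'_def poly_pcompose mult.commute)
 have dq': "degree q' \<le> d" unfolding q'_def
  using degree_pcompose_le[of q "[:s, e - s:]"] q(1) se by (intro degree_diff_le) auto
 have rep: "poly q' x = (\<Sum>i<d. poly (\<pi> i) x * integral {0..1} (\<lambda>y. y ^ i * poly q' y))"
  by (rule \<pi>(4)[OF dq']) (simp add: q'x)
 have diff: "\<bar>unit_pairing y - poly q' y\<bar> \<le> 2 * \<epsilon>" if "y \<in> {0<..1}" for y
  using q(2)[OF unit_mem[OF that]] q(2)[of e] se by (simp add: unit_pairing_def q'x diff_left)
 have mom: "\<bar>integral {0..1} (\<lambda>y. y ^ i * unit_pairing y) - integral {0..1} (\<lambda>y. y ^ i * poly q' y)\<bar> \<le> 2 * \<epsilon>" for i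
 proof -
  have i2: "(\<lambda>y. y ^ i * poly q' y) integrable_on {0..1}" by (intro integrable_continuous_real continuous_intros)
  let ?f = "\<lambda>y. y ^ i * unit_pairing y - y ^ i * poly q' y"
  have e1: "integral {0..1} (\<lambda>y. y ^ i * unit_pairing y) - integral {0..1} (\<lambda>y. y ^ i * poly q' y) = integral {0..1} ?f"
   using Henstock_Kurzweil_Integration.integral_diff[OF moment_integrable i2] by simp
  have e2: "integral {0..1} ?f = integral {0..1} (\<lambda>y. if y = 0 then 0 else ?f y)" by (rule integral_spike[of "{0}"]) auto
  have e3: "norm (integral {0..1} (\<lambda>y. if y = 0 then 0 else ?f y)) \<le> integral {0..1} (\<lambda>y::real. 2 * \<epsilon>)"
  proof (rule integral_norm_bound_integral)
   show "(\<lambda>y. if y = 0 then 0 else ?f y) integrable_on {0..1}"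
    by (rule integrable_spike_finite[of "{0}", OF _ _ integrable_diff[OF moment_integrable i2]]) auto
   fix y :: real assume y: "y \<in> {0..1}"
   show "norm (if y = 0 then 0 else ?f y) \<le> 2 * \<epsilon>"
   proof (cases "y = 0")
    case False
    then have y01: "y \<in> {0<..1}" using y by auto
    have "\<bar>y ^ i\<bar> * \<bar>unit_pairing y - poly q' y\<bar> \<le> 1 * (2 * \<epsilon>)"
     using diff[OF y01] y by (intro mult_mono) (auto simp: power_le_one power_abs)
    moreover have "\<bar>?f y\<bar> = \<bar>y ^ i\<bar> * \<bar>unit_pairing y - poly q' y\<bar>"
     by (simp only: right_diff_distrib[symmetric] abs_mult)
    ultimately have "\<bar>?f y\<bar> \<le> 2 * \<epsilon>" by simp
    then show ?thesis by (simp only: if_not_P[OF False] real_norm_def)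
   qed (use eps in simp)
  qed auto
  have e4: "integral {0..1} (\<lambda>y::real. 2 * \<epsilon>) = 2 * \<epsilon>" by simp
  show ?thesis using e3 unfolding real_norm_def e4 e2[symmetric] e1[symmetric] .
 qed
 have f1: "b (sampled_projection m u s e t - u t) w = (\<Sum>i<d. poly (\<pi> i) x * b (sampled_moment m u s e i) w) - unit_pairing x"
  by (simp add: diff_left sampled_projection_pairing unit_pairing_def x(2) flip: x_def)
 have f2: "(\<Sum>i<d. poly (\<pi> i) x * b (sampled_moment m u s e i) w) - unit_pairing x = (\<Sum>i<d. poly (\<pi> i) x * (b (sampled_moment m u s e i) w - integral {0..1} (\<lambda>y. y ^ i * poly q' y))) + (poly q' x - unit_pairing x)"
  by (subst rep) (simp add: right_diff_distrib sum_subtractf)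
 have f3: "\<bar>(\<Sum>i<d. poly (\<pi> i) x * (b (sampled_moment m u s e i) w - integral {0..1} (\<lambda>y. y ^ i * poly q' y))) + (poly q' x - unit_pairing x)\<bar> \<le> (\<Sum>i<d. \<bar>poly (\<pi> i) x\<bar> * (2 * \<epsilon> + \<kappa>)) + 2 * \<epsilon>"
 proof (rule order_trans[OF abs_triangle_ineq add_mono])
  show "\<bar>\<Sum>i<d. poly (\<pi> i) x * (b (sampled_moment m u s e i) w - integral {0..1} (\<lambda>y. y ^ i * poly q' y))\<bar> \<le> (\<Sum>i<d. \<bar>poly (\<pi> i) x\<bar> * (2 * \<epsilon> + \<kappa>))"
  proof (rule order_trans[OF sum_abs sum_mono])
   fix i
   have "\<bar>b (sampled_moment m u s e i) w - integral {0..1} (\<lambda>y. y ^ i * poly q' y)\<bar> \<le> 2 * \<epsilon> + \<kappa>"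
    using sampled_moment_error[of i] mom[of i] by linarith
   then show "\<bar>poly (\<pi> i) x * (b (sampled_moment m u s e i) w - integral {0..1} (\<lambda>y. y ^ i * poly q' y))\<bar> \<le> \<bar>poly (\<pi> i) x\<bar> * (2 * \<epsilon> + \<kappa>)"
    unfolding abs_mult by (intro mult_left_mono) auto
  qed
  show "\<bar>poly q' x - unit_pairing x\<bar> \<le> 2 * \<epsilon>" using diff[OF x(1)] by linarith
 qed
 have f4: "(\<Sum>i<d. \<bar>poly (\<pi> i) x\<bar> * (2 * \<epsilon> + \<kappa>)) = (\<Sum>i<d. \<bar>poly (\<pi> i) x\<bar>) * (2 * \<epsilon> + \<kappa>)" by (simp add: sum_distrib_right)
 have f5: "(\<Sum>i<d. \<bar>poly (\<pi> i) x\<bar>) * (2 * \<epsilon> + \<kappa>) \<le> C\<pi> * (2 * \<epsilon> + \<kappa>)"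
  using C\<pi>[of x] x eps \<kappa> by (intro mult_right_mono) auto
 have "\<bar>b (sampled_projection m u s e t - u t) w\<bar> \<le> C\<pi> * (2 * \<epsilon> + \<kappa>) + 2 * \<epsilon>"
  using f3 f5 unfolding f4 f2[symmetric] f1[symmetric] by linarith
 then show ?thesis by (simp add: algebra_simps)
qed

end

section \<open>The energy estimate\<close>

text \<open>The abstract error argument: \<open>c\<close> holds the coefficients of \<theta>, and
  \<open>V\<close> stands for \<open>H10\<close>. \<open>\<kappa>\<close> measures by how much the
  means of \<open>\<eta>\<close> fail to vanish; its bound involves the number of cells because
  these failures accumulate over the history.\<close>

locale dg_error = dg_cross \<tau> N \<alpha> a d c p Cp \<rho>
 for \<tau> :: "nat \<Rightarrow> real" and N :: nat and \<alpha> :: real and a :: "'v::real_inner \<Rightarrow> 'v \<Rightarrow> real"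
  and d :: "nat \<Rightarrow> nat" and c :: "nat \<Rightarrow> nat \<Rightarrow> 'v" and p :: nat and Cp \<rho> :: real +
 fixes V :: "'v set" and \<eta> :: "real \<Rightarrow> 'v" and K D B \<kappa> :: real
 assumes V: "subspace V" and cV: "!!n j. n \<in> {1..N} ==> j \<le> d n ==> c n j \<in> V"
  and K: "K > 0" and \<eta>0: "\<eta> 0 = 0" and D: "D \<ge> 0" and B: "B \<ge> 0"
  and \<kappa>: "\<kappa> \<ge> 0" "\<kappa> * real N \<le> D * (\<tau> 1 - \<tau> 0) powr (1 - \<alpha> / 2)"
  and \<eta>_measurable: "!!w. w \<in> V ==> (\<lambda>s. a (\<eta> s) w) \<in> borel_measurable (lebesgue_on {0..\<tau> N})"
  and \<eta>_bound: "!!n s w. n \<in> {1..N} ==> s \<in> cell n ==> w \<in> V ==>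
   \<bar>a (\<eta> s) w\<bar> \<le> D * (\<tau> n - \<tau> (n - 1)) powr (- \<alpha> / 2) * nrm w"
  and \<eta>_mean: "!!n w. n \<in> {1..N} ==> w \<in> V ==> \<bar>integral {\<tau> (n - 1)..\<tau> n} (\<lambda>s. a (\<eta> s) w)\<bar> \<le> \<kappa> * nrm w"
  and \<eta>_inner: "!!n. n \<in> {1..N} ==> \<bar>integral {\<tau> (n - 1)..\<tau> n} (\<lambda>t. inner (\<eta> t) (vpoly' (d n) (c n) t))\<bar>
   \<le> B * D * (\<tau> n - \<tau> (n - 1)) powr (1 + \<alpha> / 2) * cross_sup n"
  and \<eta>_continuous: "!!w. w \<in> V ==> continuous_on {0..\<tau> N} (\<lambda>t. frac_integral \<alpha> (\<lambda>s. a (\<eta> s) w) t)"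
begin

definition defect :: "real \<Rightarrow> 'v \<Rightarrow> real" where "defect t w = frac_integral \<alpha> (\<lambda>s. a (\<eta> s) w) t"

text \<open>Before the first cell \<theta> is 0, since the discrete and the exact solution start
  from the same value.\<close>

definition jump :: "nat \<Rightarrow> 'v" where
 "jump n = Y n (\<tau> (n - 1)) - (if n = 1 then 0 else Y (n - 1) (\<tau> (n - 1)))"

lemma defect_integrable:
 assumes w: "w \<in> V" and t: "t \<in> {0..\<tau> N}"
 shows "(\<lambda>s. omega (\<alpha> + 1) (t - s) * a (\<eta> s) w) integrable_on {0..t}"
proof -
 define W where "W = (\<Sum>n\<in>{1..N}. D * (\<tau> n - \<tau> (n - 1)) powr (- \<alpha> / 2) * nrm w)"
 have W: "D * (\<tau> n - \<tau> (n - 1)) powr (- \<alpha> / 2) * nrm w \<le> W" if "n \<in> {1..N}" for n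
  unfolding W_def by (rule member_le_sum) (use that D in auto)
 have W0: "W \<ge> 0" unfolding W_def using D by (intro sum_nonneg) auto
 have b: "\<bar>a (\<eta> s) w\<bar> \<le> W" if s: "s \<in> {0..t}" for s
 proof (cases "s = 0")
  case False
  then obtain n where n: "n \<in> {1..N}" "s \<in> cell n" using cell_exists[of s N] s t by auto
  show ?thesis by (rule order_trans[OF \<eta>_bound[OF n w] W[OF n(1)]])
 qed (simp add: \<eta>0 W0)
 have "(\<lambda>s. a (\<eta> s) w) \<in> borel_measurable (lebesgue_on {0..t})"
  by (rule measurable_restrict_mono[OF \<eta>_measurable[OF w]]) (use t in auto)
 then show ?thesis
  using omega_times_bounded(1)[OF \<alpha>(1), of 0 t t "\<lambda>s. a (\<eta> s) w" W] b t
  by (auto intro: set_lebesgue_integral_eq_integral(1))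
qed

lemma defect_combination:
 fixes k :: nat
 assumes e: "!!j. j \<le> k ==> e j \<in> V" and t: "t \<in> {0..\<tau> N}"
 shows "defect t (\<Sum>j\<le>k. r j *\<^sub>R e j) = (\<Sum>j\<le>k. r j * defect t (e j))"
proof -
 have "defect t (\<Sum>j\<le>k. r j *\<^sub>R e j) = integral {0..t} (\<lambda>s. \<Sum>j\<le>k. r j * (omega (\<alpha> + 1) (t - s) * a (\<eta> s) (e j)))"
  unfolding defect_def frac_integral_def
  by (rule integral_cong) (simp add: linear_simps sum_distrib_left mult_ac)
 also have "\<dots> = (\<Sum>j\<le>k. integral {0..t} (\<lambda>s. r j * (omega (\<alpha> + 1) (t - s) * a (\<eta> s) (e j))))"
  using integrable_on_mult_right[OF defect_integrable[OF e t]] by (intro Henstock_Kurzweil_Integration.integral_sum) auto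
 finally show ?thesis by (simp add: defect_def frac_integral_def)
qed

lemma defect_diff:
 assumes "w \<in> V" "w' \<in> V" "t \<in> {0..\<tau> N}"
 shows "defect t (w - w') = defect t w - defect t w'"
proof -
 have "(\<Sum>j\<le>1::nat. (if j = 0 then 1 else - 1) *\<^sub>R (if j = 0 then w else w')) = w - w'" by simp
 moreover have "defect t (\<Sum>j\<le>1::nat. (if j = 0 then 1 else - 1) *\<^sub>R (if j = 0 then w else w'))
   = (\<Sum>j\<le>1::nat. (if j = 0 then 1 else - 1) * defect t (if j = 0 then w else w'))"
  by (rule defect_combination) (use assms in auto)
 ultimately show ?thesis by simp
qed

lemma step_increasing:
 assumes "1 \<le> i" "i \<le> j" "j \<le> N"
 shows "\<tau> i - \<tau> (i - 1) \<le> \<tau> j - \<tau> (j - 1)"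
 using assms(2,3)
proof (induction j rule: dec_induct)
 case (step j)
 then show ?case using ratio(1)[of j] assms(1) by simp
qed simp

definition Cf :: real where "Cf = 2 / Gamma (\<alpha> + 1) + 2 powr (\<alpha> + 1) / Gamma (\<alpha> + 2)"

lemma Cf_pos: "Cf > 0"
proof -
 have "Gamma (\<alpha> + 1) > 0" "Gamma (\<alpha> + 2) > 0" using \<alpha> by (auto intro!: Gamma_real_pos)
 then show ?thesis unfolding Cf_def by (intro add_pos_pos divide_pos_pos) auto
qed

lemma defect_bound:
 assumes n: "n \<in> {1..N}" and t: "t \<in> {\<tau> (n - 1)..\<tau> n}" and w: "w \<in> V"
 shows "\<bar>defect t w\<bar> \<le> Cf * D * stp n powr (1 + \<alpha> / 2) * nrm w"
proof -
 have "\<bar>frac_integral \<alpha> (\<lambda>s. a (\<eta> s) w) t\<bar> \<le> (2 / Gamma (\<alpha> + 1) + 2 powr (\<alpha> + 1) / Gamma (\<alpha> + 2))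
   * (D * nrm w) * (\<tau> n - \<tau> (n - 1)) powr (1 + \<alpha> / 2)"
 proof (rule frac_integral_small_means[where N = N and \<kappa> = "\<kappa> * nrm w"])
  show "\<tau> n - \<tau> (n - 1) > 0" if "n \<in> {1..N}" for n using step_pos[OF that] by simp
  show "\<bar>a (\<eta> s) w\<bar> \<le> D * nrm w * (\<tau> n - \<tau> (n - 1)) powr (- \<alpha> / 2)"
   if "n \<in> {1..N}" "s \<in> {\<tau> (n - 1)<..\<tau> n}" for n s
   using \<eta>_bound[OF that(1) _ w, of s] that(2) by (simp add: cell_def mult_ac)
  show "\<kappa> * nrm w * real N \<le> D * nrm w * (\<tau> 1 - \<tau> 0) powr (1 - \<alpha> / 2)"
   using mult_right_mono[OF \<kappa>(2), of "nrm w"] by (simp add: mult_ac)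
 qed (use \<alpha> \<tau>0 step_increasing \<eta>_measurable[OF w] \<eta>0 \<eta>_mean w \<kappa>(1) D n t in auto)
 then show ?thesis by (simp add: defect_def Cf_def stp_def mult_ac)
qed

definition Ce :: real where
 "Ce = Cp\<^sup>2 * (1 + \<rho>) powr (1 - \<alpha>) * Gamma (\<alpha> + 1) / (- \<alpha>) + Cp * Gamma (\<alpha> + 1)"

text \<open>\<open>B\<close> comes from pairing \<open>\<eta>\<close> with the derivative of
  \<theta>. The other term is the memory of \<open>\<eta>\<close>: \<open>Cf\<close> from
  \<open>defect_bound\<close> and \<open>1 + Cp\<close> from
  \<open>bracket_sum_upper\<close>.\<close>

definition Cr :: real where "Cr = B + K * (1 + Cp) * Cf"

lemma Ce_pos: "Ce > 0"
proof -
 have G: "Gamma (\<alpha> + 1) > 0" using \<alpha> by (simp add: Gamma_real_pos)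
 have "Cp\<^sup>2 * (1 + \<rho>) powr (1 - \<alpha>) * Gamma (\<alpha> + 1) / (- \<alpha>) \<ge> 0"
  using \<alpha> G by (intro divide_nonneg_nonneg mult_nonneg_nonneg) auto
 then show ?thesis unfolding Ce_def using Cp G by (intro add_nonneg_pos) auto
qed

context
 assumes error_equation: "!!n. n \<in> {1..N} ==> inner (jump n) (Y n (\<tau> (n - 1)))
   + integral {\<tau> (n - 1)..\<tau> n} (\<lambda>t. inner (vpoly' (d n) (c n) t) (Y n t))
   + K * bracket (memory (omega (\<alpha> + 1)) g) n (d n) (c n)
  = integral {\<tau> (n - 1)..\<tau> n} (\<lambda>t. inner (\<eta> t) (vpoly' (d n) (c n) t)) - K * bracket defect n (d n) (c n)"
begin

text \<open>Polarisation for the jump term, 2 (x - y, x) = |x|^2 + |x - y|^2 - |y|^2, added to half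
  the increment of |Y|^2 over the cell.\<close>

lemma nodal_identity:
 assumes n: "n \<in> {1..N}"
 shows "inner (jump n) (Y n (\<tau> (n - 1))) + integral {\<tau> (n - 1)..\<tau> n} (\<lambda>t. inner (vpoly' (d n) (c n) t) (Y n t))
  = ((norm (Y n (\<tau> n)))\<^sup>2 + (norm (jump n))\<^sup>2 - (norm (if n = 1 then 0 else Y (n - 1) (\<tau> (n - 1))))\<^sup>2) / 2"
proof -
 have "((\<lambda>t. inner (vpoly' (d n) (c n) t) (Y n t)) has_integral
   inner (Y n (\<tau> n)) (Y n (\<tau> n)) / 2 - inner (Y n (\<tau> (n - 1))) (Y n (\<tau> (n - 1))) / 2) {\<tau> (n - 1)..\<tau> n}"
 proof (rule fundamental_theorem_of_calculus)
  show "\<tau> (n - 1) \<le> \<tau> n" using cell_nodes[OF n] by simp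
  fix t
  have "((\<lambda>t. inner (Y n t) (Y n t)) has_vector_derivative
    inner (Y n t) (vpoly' (d n) (c n) t) + inner (vpoly' (d n) (c n) t) (Y n t)) (at t within {\<tau> (n - 1)..\<tau> n})"
   by (rule bounded_bilinear.has_vector_derivative[OF bounded_bilinear_inner]) (rule vpoly_has_vector_derivative)+
  then have "((\<lambda>t. inner (Y n t) (Y n t)) has_real_derivative 2 * inner (vpoly' (d n) (c n) t) (Y n t)) (at t within {\<tau> (n - 1)..\<tau> n})"
   by (simp add: has_real_derivative_iff_has_vector_derivative inner_commute)
  then have "((\<lambda>t. inner (Y n t) (Y n t) / 2) has_real_derivative inner (vpoly' (d n) (c n) t) (Y n t)) (at t within {\<tau> (n - 1)..\<tau> n})"
   by (auto dest: DERIV_cdivide[where c = 2])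
  then show "((\<lambda>t. inner (Y n t) (Y n t) / 2) has_vector_derivative inner (vpoly' (d n) (c n) t) (Y n t)) (at t within {\<tau> (n - 1)..\<tau> n})"
   by (simp add: has_real_derivative_iff_has_vector_derivative)
 qed
 then have e: "integral {\<tau> (n - 1)..\<tau> n} (\<lambda>t. inner (vpoly' (d n) (c n) t) (Y n t))
   = (norm (Y n (\<tau> n)))\<^sup>2 / 2 - (norm (Y n (\<tau> (n - 1))))\<^sup>2 / 2"
  by (simp add: integral_unique dot_square_norm)
 have i: "inner (x - y) x = ((norm x)\<^sup>2 + (norm (x - y))\<^sup>2 - (norm y)\<^sup>2) / 2" for x y :: 'v
  by (simp only: power2_norm_eq_inner) (simp add: inner_diff_left inner_diff_right inner_commute)
 show ?thesis unfolding e using i[of "Y n (\<tau> (n - 1))" "if n = 1 then 0 else Y (n - 1) (\<tau> (n - 1))"]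
  unfolding jump_def by (simp add: field_simps)
qed

lemma telescoped:
 "m \<le> N ==> (\<Sum>n\<in>{1..m}. ((norm (Y n (\<tau> n)))\<^sup>2 + (norm (jump n))\<^sup>2 - (norm (if n = 1 then 0 else Y (n - 1) (\<tau> (n - 1))))\<^sup>2) / 2)
  = ((if m = 0 then 0 else (norm (Y m (\<tau> m)))\<^sup>2) + (\<Sum>n\<in>{1..m}. (norm (jump n))\<^sup>2)) / 2"
 by (induction m) (auto simp: field_simps)

lemma energy_identity:
 "((norm (Y N (\<tau> N)))\<^sup>2 + (\<Sum>n\<in>{1..N}. (norm (jump n))\<^sup>2)) / 2 + K * energy
  = (\<Sum>n\<in>{1..N}. integral {\<tau> (n - 1)..\<tau> n} (\<lambda>t. inner (\<eta> t) (vpoly' (d n) (c n) t)))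
   - K * (\<Sum>n\<in>{1..N}. bracket defect n (d n) (c n))"
proof -
 have t: "((norm (Y N (\<tau> N)))\<^sup>2 + (\<Sum>n\<in>{1..N}. (norm (jump n))\<^sup>2)) / 2
   = (\<Sum>n\<in>{1..N}. inner (jump n) (Y n (\<tau> (n - 1))) + integral {\<tau> (n - 1)..\<tau> n} (\<lambda>t. inner (vpoly' (d n) (c n) t) (Y n t)))"
 proof -
  have "(\<Sum>n\<in>{1..N}. inner (jump n) (Y n (\<tau> (n - 1))) + integral {\<tau> (n - 1)..\<tau> n} (\<lambda>t. inner (vpoly' (d n) (c n) t) (Y n t)))
    = (\<Sum>n\<in>{1..N}. ((norm (Y n (\<tau> n)))\<^sup>2 + (norm (jump n))\<^sup>2 - (norm (if n = 1 then 0 else Y (n - 1) (\<tau> (n - 1))))\<^sup>2) / 2)"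
   by (rule sum.cong[OF refl nodal_identity])
  then show ?thesis unfolding telescoped[OF order_refl] using N1 by simp
 qed
 show ?thesis
  unfolding t energy_def sum_distrib_left sum.distrib[symmetric] sum_subtractf[symmetric]
  by (rule sum.cong[OF refl]) (rule error_equation)
qed

definition weighted_sum :: real where "weighted_sum = (\<Sum>n\<in>{1..N}. stp n powr (1 + \<alpha> / 2) * cross_sup n)"

lemma residual_bound:
 "((norm (Y N (\<tau> N)))\<^sup>2 + (\<Sum>n\<in>{1..N}. (norm (jump n))\<^sup>2)) / 2 + K * energy \<le> Cr * D * weighted_sum"
proof -
 have 1: "\<bar>\<Sum>n\<in>{1..N}. bracket defect n (d n) (c n)\<bar> \<le> (1 + Cp) * (\<Sum>n\<in>{1..N}. (Cf * D * stp n powr (1 + \<alpha> / 2)) * cross_sup n)"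
 proof -
  \<comment> \<open>Additivity of \<open>defect\<close> is available for t in [0, \<tau> N], where
    its integrals exist, while \<open>bracket_sum_upper\<close> asks for it at every t.\<close>
  define z where "z t w = (if t \<in> {0..\<tau> N} then defect t w else 0)" for t w
  have nodes: "t \<in> {0..\<tau> N}" if "n \<in> {1..N}" "t \<in> {\<tau> (n - 1)..\<tau> n}" for n t
   using cell_nodes[OF that(1)] that(2) by auto
  have eq: "bracket defect n (d n) (c n) = bracket z n (d n) (c n)" if n: "n \<in> {1..N}" for n
  proof -
   have "integral {\<tau> (n - 1)..\<tau> n} (\<lambda>t. defect t (vpoly' (d n) (c n) t)) = integral {\<tau> (n - 1)..\<tau> n} (\<lambda>t. z t (vpoly' (d n) (c n) t))"
    by (rule integral_cong) (use nodes[OF n] in \<open>simp add: z_def\<close>)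
   then show ?thesis using cell_nodes[OF n] unfolding bracket_def by (simp add: z_def)
  qed
  have "\<bar>\<Sum>n\<in>{1..N}. bracket z n (d n) (c n)\<bar> \<le> (1 + Cp) * (\<Sum>n\<in>{1..N}. (Cf * D * stp n powr (1 + \<alpha> / 2)) * cross_sup n)"
  proof (rule bracket_sum_upper[OF V cV])
   show "z 0 w = 0" for w by (simp add: z_def defect_def frac_integral_def)
   show "z t (w - w') = z t w - z t w'" if "w \<in> V" "w' \<in> V" for t w w' using defect_diff[OF that, of t] by (simp add: z_def)
   show "\<bar>z t w\<bar> \<le> Cf * D * stp n powr (1 + \<alpha> / 2) * nrm w" if "n \<in> {1..N}" "t \<in> {\<tau> (n - 1)..\<tau> n}" "w \<in> V" for n t w
    using defect_bound[OF that] nodes[OF that(1,2)] by (simp add: z_def)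
   show "0 \<le> Cf * D * stp n powr (1 + \<alpha> / 2)" if "n \<in> {1..N}" for n using Cf_pos D by simp
   show "(\<lambda>t. z t (vpoly' (d n) (c n) t)) integrable_on {\<tau> (n - 1)..\<tau> n}" if n: "n \<in> {1..N}" for n
   proof -
    have cont: "continuous_on {\<tau> (n - 1)..\<tau> n} (\<lambda>t. defect t (c n j))" if "j \<le> d n" for j
     unfolding defect_def by (rule continuous_on_subset[OF \<eta>_continuous[OF cV[OF n that]]]) (use nodes[OF n] in auto)
    have "(\<lambda>t. \<Sum>j\<le>d n. (real j * t ^ (j - 1)) * defect t (c n j)) integrable_on {\<tau> (n - 1)..\<tau> n}"
     by (intro integrable_continuous_real continuous_on_sum continuous_on_mult continuous_intros cont) auto
    then show ?thesis
    proof (rule integrable_eq)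
     fix t assume t: "t \<in> {\<tau> (n - 1)..\<tau> n}"
     have "defect t (\<Sum>j\<le>d n. (real j * t ^ (j - 1)) *\<^sub>R c n j) = (\<Sum>j\<le>d n. (real j * t ^ (j - 1)) * defect t (c n j))"
      by (rule defect_combination[OF cV[OF n] nodes[OF n t]])
     then show "(\<Sum>j\<le>d n. (real j * t ^ (j - 1)) * defect t (c n j)) = z t (vpoly' (d n) (c n) t)"
      using nodes[OF n t] by (simp add: z_def vpoly'_def)
    qed
   qed
  qed auto
  moreover have "(\<Sum>n\<in>{1..N}. bracket defect n (d n) (c n)) = (\<Sum>n\<in>{1..N}. bracket z n (d n) (c n))"
   by (rule sum.cong[OF refl eq])
  ultimately show ?thesis by simp
 qed
 have e: "(\<Sum>n\<in>{1..N}. (Cf * D * stp n powr (1 + \<alpha> / 2)) * cross_sup n) = Cf * D * weighted_sum"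
  by (simp add: weighted_sum_def sum_distrib_left mult_ac)
 have 2: "\<bar>\<Sum>n\<in>{1..N}. integral {\<tau> (n - 1)..\<tau> n} (\<lambda>t. inner (\<eta> t) (vpoly' (d n) (c n) t))\<bar> \<le> B * D * weighted_sum"
  unfolding weighted_sum_def sum_distrib_left
  by (rule order_trans[OF sum_abs sum_mono]) (use \<eta>_inner in \<open>simp add: stp_def mult_ac\<close>)
 have "\<bar>K * (\<Sum>n\<in>{1..N}. bracket defect n (d n) (c n))\<bar> \<le> K * ((1 + Cp) * (Cf * D * weighted_sum))"
  using mult_left_mono[OF 1, of K] K unfolding e by (simp add: abs_mult)
 then have "(\<Sum>n\<in>{1..N}. integral {\<tau> (n - 1)..\<tau> n} (\<lambda>t. inner (\<eta> t) (vpoly' (d n) (c n) t)))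
   - K * (\<Sum>n\<in>{1..N}. bracket defect n (d n) (c n)) \<le> B * D * weighted_sum + K * ((1 + Cp) * (Cf * D * weighted_sum))"
  using 2 by linarith
 also have "\<dots> = Cr * D * weighted_sum" by (simp add: Cr_def algebra_simps)
 finally show ?thesis unfolding energy_identity .
qed

lemma Cr_nonneg: "Cr \<ge> 0" unfolding Cr_def using B K Cp Cf_pos by simp

text \<open>Splitting k^(1+\<alpha>/2) = k^(1/2) k^((1+\<alpha>)/2), Cauchy-Schwarz produces the sum
  of the steps, which is \<open>\<tau> N\<close>, and the sum bounded in
  \<open>energy_bounds\<close>.\<close>

lemma weighted_sum_square: "weighted_sum\<^sup>2 \<le> \<tau> N * (Ce * (2 * energy))"
proof -
 have "weighted_sum = (\<Sum>n\<in>{1..N}. sqrt (stp n) * (stp n powr ((1 + \<alpha>) / 2) * cross_sup n))"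
  unfolding weighted_sum_def
 proof (rule sum.cong[OF refl])
  fix n assume n: "n \<in> {1..N}"
  have "stp n powr (1 + \<alpha> / 2) = stp n powr (1 / 2 + (1 + \<alpha>) / 2)" by (simp add: field_simps)
  also have "\<dots> = sqrt (stp n) * stp n powr ((1 + \<alpha>) / 2)"
   unfolding powr_add using stp_pos[OF n] by (simp add: powr_half_sqrt)
  finally show "stp n powr (1 + \<alpha> / 2) * cross_sup n = sqrt (stp n) * (stp n powr ((1 + \<alpha>) / 2) * cross_sup n)" by simp
 qed
 then have "weighted_sum\<^sup>2 \<le> (\<Sum>n\<in>{1..N}. (sqrt (stp n))\<^sup>2) * (\<Sum>n\<in>{1..N}. (stp n powr ((1 + \<alpha>) / 2) * cross_sup n)\<^sup>2)"
  using Cauchy_Schwarz_ineq_sum[of "\<lambda>n. sqrt (stp n)" "\<lambda>n. stp n powr ((1 + \<alpha>) / 2) * cross_sup n" "{1..N}"] by simp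
 moreover have "(\<Sum>n\<in>{1..N}. (sqrt (stp n))\<^sup>2) = (\<Sum>n\<in>{1..N}. stp n)"
  by (rule sum.cong) (use stp_pos in \<open>auto intro: less_imp_le\<close>)
 moreover have "(\<Sum>n\<in>{1..m}. stp n) = \<tau> m" for m
  by (induction m) (auto simp: stp_def \<tau>0)
 moreover have "(\<Sum>n\<in>{1..N}. (stp n powr ((1 + \<alpha>) / 2) * cross_sup n)\<^sup>2) = (\<Sum>n\<in>{1..N}. stp n powr (1 + \<alpha>) * (cross_sup n)\<^sup>2)"
 proof (rule sum.cong[OF refl])
  fix n
  have "(stp n powr ((1 + \<alpha>) / 2))\<^sup>2 = stp n powr (1 + \<alpha>)"
   unfolding power2_eq_square powr_add[symmetric] by simp
  then show "(stp n powr ((1 + \<alpha>) / 2) * cross_sup n)\<^sup>2 = stp n powr (1 + \<alpha>) * (cross_sup n)\<^sup>2"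
   by (simp add: power_mult_distrib)
 qed
 ultimately have "weighted_sum\<^sup>2 \<le> \<tau> N * (\<Sum>n\<in>{1..N}. stp n powr (1 + \<alpha>) * (cross_sup n)\<^sup>2)" by simp
 also have "\<dots> \<le> \<tau> N * (Ce * (2 * energy))"
  unfolding Ce_def by (rule mult_left_mono[OF energy_bounds(2)]) (rule node_nonneg, simp)
 finally show ?thesis .
qed

lemma energy_nonneg: "energy \<ge> 0"
proof -
 have "0 \<le> omega (\<alpha> + 1) (\<tau> N) * last_mass" using mass_nonneg omega_nonneg[OF \<alpha>(1)] by simp
 then show ?thesis using energy_bounds(1) by linarith
qed

text \<open>The residual is linear in \<open>weighted_sum\<close>, whose square is bounded by the
  energy and hence again by the residual. Dividing gives \<open>weighted_sum\<close> = O(D), and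
  inserting this into the residual gives the bound of order D^2.\<close>

theorem energy_estimate:
 "(norm (Y N (\<tau> N)))\<^sup>2 + (\<Sum>n\<in>{1..N}. (norm (jump n))\<^sup>2) + 2 * K * energy \<le> 4 * Cr\<^sup>2 * Ce * \<tau> N / K * D\<^sup>2"
proof -
 define A where "A = (norm (Y N (\<tau> N)))\<^sup>2 + (\<Sum>n\<in>{1..N}. (norm (jump n))\<^sup>2)"
 define R where "R = Cr * D * weighted_sum"
 have A: "A \<ge> 0" unfolding A_def by (intro add_nonneg_nonneg sum_nonneg) auto
 have res: "A / 2 + K * energy \<le> R" using residual_bound unfolding A_def R_def .
 have S0: "weighted_sum \<ge> 0" unfolding weighted_sum_def by (intro sum_nonneg mult_nonneg_nonneg cross_sup_nonneg) auto
 have tN: "\<tau> N \<ge> 0" by (rule node_nonneg) simp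
 have KE: "K * energy \<le> Cr * D * weighted_sum" using res A unfolding R_def by linarith
 have S: "weighted_sum \<le> 2 * \<tau> N * Ce * Cr * D / K"
 proof (cases "weighted_sum = 0")
  case True
  then show ?thesis using tN Ce_pos Cr_nonneg D K by simp
 next
  case False
  have "K * weighted_sum\<^sup>2 \<le> \<tau> N * (Ce * 2) * (K * energy)"
   using mult_left_mono[OF weighted_sum_square, of K] K by (simp add: mult_ac)
  also have "\<dots> \<le> \<tau> N * (Ce * 2) * (Cr * D * weighted_sum)"
   by (rule mult_left_mono[OF KE]) (use tN Ce_pos in simp)
  finally have "K * weighted_sum * weighted_sum \<le> (2 * \<tau> N * Ce * Cr * D) * weighted_sum" by (simp add: power2_eq_square mult_ac)
  then have "K * weighted_sum \<le> 2 * \<tau> N * Ce * Cr * D" using False S0 by (simp only: mult_le_cancel_right)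
  then show ?thesis using K by (simp add: field_simps)
 qed
 have "A + 2 * (K * energy) \<le> 2 * R" using res by linarith
 also have "2 * R \<le> 2 * (Cr * D * (2 * \<tau> N * Ce * Cr * D / K))"
  unfolding R_def by (intro mult_left_mono S) (use Cr_nonneg D in auto)
 also have "\<dots> = 4 * Cr\<^sup>2 * Ce * \<tau> N / K * D\<^sup>2" by (simp add: power2_eq_square mult_ac)
 finally show ?thesis unfolding A_def by (simp add: mult.assoc)
qed

end

end

section \<open>The projection as an operator with a uniform constant\<close>

lemma modulus_continuous_on:
 fixes f \<Phi> :: "real \<Rightarrow> real"
 assumes \<Phi>: "continuous_on S \<Phi>" and B: "!!t t'. t \<in> S ==> t' \<in> S ==> t \<le> t' ==> \<bar>f t' - f t\<bar> \<le> B * \<bar>\<Phi> t' - \<Phi> t\<bar>"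
  and B0: "B \<ge> 0"
 shows "continuous_on S f"
 unfolding continuous_on_iff
proof (intro ballI allI impI)
 fix x \<epsilon> :: real assume x: "x \<in> S" and e: "0 < \<epsilon>"
 have sym: "\<bar>f y - f x\<bar> \<le> B * \<bar>\<Phi> y - \<Phi> x\<bar>" if "y \<in> S" for y
  using B[OF x that] B[OF that x] by (cases "x \<le> y") (auto simp: abs_minus_commute)
 obtain \<delta> where \<delta>: "\<delta> > 0" "!!y. y \<in> S ==> dist y x < \<delta> ==> dist (\<Phi> y) (\<Phi> x) < \<epsilon> / (B + 1)"
  using \<Phi>[unfolded continuous_on_iff, rule_format, OF x, of "\<epsilon> / (B + 1)"] e B0 by auto
 have "dist (f y) (f x) < \<epsilon>" if "y \<in> S" "dist y x < \<delta>" for y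
 proof -
  have "\<bar>f y - f x\<bar> \<le> (B + 1) * \<bar>\<Phi> y - \<Phi> x\<bar>" using sym[OF that(1)] by (simp add: distrib_right)
  also have "\<dots> < \<epsilon>" using \<delta>(2)[OF that] B0 by (simp add: dist_real_def pos_less_divide_eq mult.commute)
  finally show ?thesis by (simp add: dist_real_def)
 qed
 then show "\<exists>\<delta>>0. \<forall>x'\<in>S. dist x' x < \<delta> \<longrightarrow> dist (f x') (f x) < \<epsilon>" using \<delta>(1) by blast
qed

text \<open>Packaged as a predicate so that the constant is fixed before the interval, the function
  and the forms. \<open>F\<close> is a set because one and the same interpolant has to work for the
  gradient form and the inner product. The type argument fixes the vector space.\<close>

definition projection_bound :: "'v::real_vector itself \<Rightarrow> nat \<Rightarrow> real \<Rightarrow> bool" where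
 "projection_bound _ d C\<pi> \<longleftrightarrow> (\<forall>(V::'v set) F u (s::real) e (\<Phi>::real \<Rightarrow> real) \<kappa>. subspace V \<longrightarrow> s < e \<longrightarrow>
  (\<forall>t\<in>{s<..e}. u t \<in> V) \<longrightarrow> (\<forall>b\<in>F. psd_form b) \<longrightarrow> continuous_on {s..e} \<Phi> \<longrightarrow> mono_on {s..e} \<Phi> \<longrightarrow>
  (\<forall>b\<in>F. \<forall>w\<in>V. \<forall>t t'. s < t \<longrightarrow> t \<le> t' \<longrightarrow> t' \<le> e \<longrightarrow>
   \<bar>b (u t' - u t) w\<bar> \<le> (\<Phi> t' - \<Phi> t) * psd_form.nrm b w) \<longrightarrow> \<kappa> > 0 \<longrightarrow>
  (\<exists>c. (\<forall>j\<le>d. c j \<in> V) \<and> vpoly d c e = u e \<and>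
   (\<forall>b\<in>F. \<forall>w\<in>V.
    (\<forall>q \<epsilon>. degree q \<le> d \<longrightarrow> (\<forall>t\<in>{s<..e}. \<bar>b (u t) w - poly q t\<bar> \<le> \<epsilon>) \<longrightarrow>
     (\<forall>t\<in>{s<..e}. \<bar>b (vpoly d c t - u t) w\<bar> \<le> (2 + 2 * C\<pi>) * \<epsilon> + C\<pi> * \<kappa> * psd_form.nrm b w)) \<and>
    (\<forall>j<d. \<bar>integral {0..1} (\<lambda>y. y ^ j * b (vpoly d c (s + (e - s) * y) - u (s + (e - s) * y)) w)\<bar>
     \<le> \<kappa> * psd_form.nrm b w))))"

lemma projection_operator:
 fixes d :: nat
 obtains C\<pi> :: real where "C\<pi> \<ge> 0" "projection_bound TYPE('v::real_vector) d C\<pi>"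
proof -
 obtain \<pi> :: "nat \<Rightarrow> real poly" where \<pi>: "!!i. i < d ==> degree (\<pi> i) \<le> d" "!!i. i < d ==> poly (\<pi> i) 1 = 0"
  "!!i j. i < d ==> j < d ==> integral {0..1} (\<lambda>x. x ^ j * poly (\<pi> i) x) = (if i = j then 1 else 0)"
  "!!q x. degree q \<le> d ==> poly q 1 = 0 ==>
    poly q x = (\<Sum>i<d. poly (\<pi> i) x * integral {0..1} (\<lambda>y. y ^ i * poly q y))"
  by (rule dg_projection_basis[of d]) (rule that)
 have "compact ((\<lambda>x. \<Sum>i<d. \<bar>poly (\<pi> i) x\<bar>) ` {0..1})"
  by (intro compact_continuous_image continuous_intros) auto
 then obtain C where C: "!!x. x \<in> {0..1} ==> norm (\<Sum>i<d. \<bar>poly (\<pi> i) x\<bar>) \<le> C"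
  using compact_imp_bounded[of "(\<lambda>x. \<Sum>i<d. \<bar>poly (\<pi> i) x\<bar>) ` {0..1}"] unfolding bounded_iff by blast
 have C0: "C \<ge> 0" using order_trans[OF norm_ge_zero C[of 0]] by simp
 have basis: "projection_basis d \<pi> C"
 proof
  fix x :: real assume "x \<in> {0..1}"
  then show "(\<Sum>i<d. \<bar>poly (\<pi> i) x\<bar>) \<le> C" using C[of x] by simp
 qed (rule \<pi>; assumption)+
 interpret projection_basis d \<pi> C by (rule basis)
 show ?thesis
 proof (rule that[OF C0], unfold projection_bound_def, intro allI impI)
  fix V :: "'v set" and F and u :: "real \<Rightarrow> 'v" and s e :: real and \<Phi> :: "real \<Rightarrow> real" and \<kappa> :: real
  assume V: "subspace V" and se: "s < e" and u: "\<forall>t\<in>{s<..e}. u t \<in> V"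
   and F: "\<forall>b\<in>F. psd_form b" and \<Phi>: "continuous_on {s..e} \<Phi>" "mono_on {s..e} \<Phi>"
   and inc: "\<forall>b\<in>F. \<forall>w\<in>V. \<forall>t t'. s < t \<longrightarrow> t \<le> t' \<longrightarrow> t' \<le> e \<longrightarrow>
    \<bar>b (u t' - u t) w\<bar> \<le> (\<Phi> t' - \<Phi> t) * psd_form.nrm b w" and \<kappa>: "\<kappa> > 0"
  note u = bspec[OF u] and F = bspec[OF F] and inc = inc[rule_format]
  have "uniformly_continuous_on {s..e} \<Phi>" by (rule compact_uniformly_continuous[OF \<Phi>(1)]) simp
  then obtain \<delta> where \<delta>: "\<delta> > 0" "!!t t'. t \<in> {s..e} ==> t' \<in> {s..e} ==> dist t' t < \<delta> ==> dist (\<Phi> t') (\<Phi> t) < \<kappa>"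
   unfolding uniformly_continuous_on_def using \<kappa> by metis
  \<comment> \<open>The sampling is so fine that \<open>\<Phi>\<close> varies by less than
    \<open>\<kappa>\<close> between neighbouring points. As \<open>\<Phi>\<close> controls all forms
    and test vectors at once, one m serves them all.\<close>
  obtain m :: nat where "(e - s) / \<delta> < real m" using reals_Archimedean2 by blast
  moreover have "0 < (e - s) / \<delta>" using se \<delta>(1) by simp
  ultimately have "real m > 0" "e - s < real m * \<delta>"
   using \<delta>(1) by (linarith, simp add: divide_less_eq)
  then have m: "m > 0" "(e - s) / real m < \<delta>" by (simp_all add: divide_less_eq mult.commute)
  obtain c where c: "!!j. j \<le> d ==> c j \<in> V" "!!t. sampled_projection m u s e t = vpoly d c t"
   by (rule sampled_projection_vpoly[OF V u se]) (assumption | rule that)+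
  have pair: "projected_pairing d \<pi> C b u s e w m (\<kappa> * psd_form.nrm b w) ((\<Phi> e - \<Phi> s) * psd_form.nrm b w)"
   if b: "b \<in> F" and w: "w \<in> V" for b w
  proof -
   interpret psd_form b by (rule F[OF b])
   show ?thesis
   proof
    show "s < e" "m > 0" by fact+
    show "continuous_on {s<..e} (\<lambda>t. b (u t) w)"
    proof (rule modulus_continuous_on[where \<Phi> = \<Phi> and B = "nrm w"])
     show "continuous_on {s<..e} \<Phi>" by (rule continuous_on_subset[OF \<Phi>(1)]) auto
     fix t t' assume t: "t \<in> {s<..e}" "t' \<in> {s<..e}" "t \<le> t'"
     have "\<bar>b (u t' - u t) w\<bar> \<le> (\<Phi> t' - \<Phi> t) * nrm w" by (rule inc[OF b w]) (use t in auto)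
     moreover have "(\<Phi> t' - \<Phi> t) * nrm w \<le> \<bar>\<Phi> t' - \<Phi> t\<bar> * nrm w" by (intro mult_right_mono) auto
     ultimately show "\<bar>b (u t') w - b (u t) w\<bar> \<le> nrm w * \<bar>\<Phi> t' - \<Phi> t\<bar>"
      unfolding diff_left by (simp add: mult.commute)
    qed simp
    show "\<bar>b (u t - u e) w\<bar> \<le> (\<Phi> e - \<Phi> s) * nrm w" if t: "t \<in> {s<..e}" for t
    proof -
     have "\<bar>b (u e - u t) w\<bar> \<le> (\<Phi> e - \<Phi> t) * nrm w" by (rule inc[OF b w]) (use t in auto)
     also have "\<dots> \<le> (\<Phi> e - \<Phi> s) * nrm w"
      using mono_onD[OF \<Phi>(2), of s t] t by (intro mult_right_mono) auto
     finally show ?thesis unfolding diff_left by linarith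
    qed
    show "\<bar>b (u t - u t') w\<bar> \<le> \<kappa> * nrm w" if t: "t \<in> {s<..e}" "t' \<in> {s<..e}" "\<bar>t - t'\<bar> \<le> (e - s) / real m" for t t'
    proof -
     have *: "\<bar>b (u y - u x) w\<bar> \<le> \<kappa> * nrm w" if xy: "x \<in> {s<..e}" "y \<in> {s<..e}" "\<bar>x - y\<bar> \<le> (e - s) / real m" "x \<le> y" for x y
     proof -
      have "\<bar>b (u y - u x) w\<bar> \<le> (\<Phi> y - \<Phi> x) * nrm w" by (rule inc[OF b w]) (use xy in auto)
      also have "\<dots> \<le> \<kappa> * nrm w"
      proof (rule mult_right_mono)
       have "dist (\<Phi> y) (\<Phi> x) < \<kappa>" by (rule \<delta>(2)) (use xy m(2) in \<open>auto simp: dist_real_def\<close>)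
       then show "\<Phi> y - \<Phi> x \<le> \<kappa>" by (simp add: dist_real_def)
      qed simp
      finally show ?thesis .
     qed
     show ?thesis
     proof (cases "t \<le> t'")
      case True
      then show ?thesis using *[OF t True] unfolding diff_left by linarith
     next
      case False
      then show ?thesis using *[OF t(2,1)] t(3) by (simp add: abs_minus_commute)
     qed
    qed
   qed
  qed
  show "\<exists>c. (\<forall>j\<le>d. c j \<in> V) \<and> vpoly d c e = u e \<and>
    (\<forall>b\<in>F. \<forall>w\<in>V.
     (\<forall>q \<epsilon>. degree q \<le> d \<longrightarrow> (\<forall>t\<in>{s<..e}. \<bar>b (u t) w - poly q t\<bar> \<le> \<epsilon>) \<longrightarrow>
      (\<forall>t\<in>{s<..e}. \<bar>b (vpoly d c t - u t) w\<bar> \<le> (2 + 2 * C) * \<epsilon> + C * \<kappa> * psd_form.nrm b w)) \<and>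
     (\<forall>j<d. \<bar>integral {0..1} (\<lambda>y. y ^ j * b (vpoly d c (s + (e - s) * y) - u (s + (e - s) * y)) w)\<bar>
      \<le> \<kappa> * psd_form.nrm b w))"
  proof (intro exI[of _ c] conjI ballI allI impI)
   show "c j \<in> V" if "j \<le> d" for j by (rule c(1)[OF that])
   show "vpoly d c e = u e" using sampled_projection_end[OF se, of m u] c(2) by simp
   fix b w assume bw: "b \<in> F" "w \<in> V"
   interpret projected_pairing d \<pi> C b u s e w m "\<kappa> * psd_form.nrm b w" "(\<Phi> e - \<Phi> s) * psd_form.nrm b w"
    by (rule pair[OF bw])
   show "\<bar>b (vpoly d c t - u t) w\<bar> \<le> (2 + 2 * C) * \<epsilon> + C * \<kappa> * psd_form.nrm b w"
    if q: "degree q \<le> d" "\<forall>t\<in>{s<..e}. \<bar>b (u t) w - poly q t\<bar> \<le> \<epsilon>" "t \<in> {s<..e}" for q \<epsilon> t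
    using sampled_projection_error[OF q(1) _ q(3), of \<epsilon>] q(2) unfolding c(2) by (auto simp: mult.assoc)
   show "\<bar>integral {0..1} (\<lambda>y. y ^ j * b (vpoly d c (s + (e - s) * y) - u (s + (e - s) * y)) w)\<bar> \<le> \<kappa> * psd_form.nrm b w"
    if "j < d" for j using sampled_projection_moments[OF that] unfolding c(2) .
  qed
 qed
qed

text \<open>The derivative of a piece has degree \<open>d n - 1\<close>, so in the unit variable
  only the nearly vanishing moments of \<open>\<eta>\<close> occur. The coefficients of the
  derivative are bounded by Markov's inequality and \<open>vpoly_coeff_bound\<close> in the seminorm
  of the form, then in that of \<open>h\<close> by the Poincare type assumption.\<close>

lemma (in dg_cross) pairing_moment_bound:
 fixes \<eta> :: "real \<Rightarrow> 'v" and h :: "'v \<Rightarrow> 'v \<Rightarrow> real"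
 assumes h: "psd_form h" and V: "subspace V" and cV: "!!j. j \<le> d n ==> c n j \<in> V" and n: "n \<in> {1..N}"
  and coefficient: "!!(q::real poly) i B. degree q \<le> p ==> (!!s. s \<in> {0..1} ==> \<bar>poly q s\<bar> \<le> B) ==> \<bar>coeff q i\<bar> \<le> Cp * B"
  and poincare: "!!w. w \<in> V ==> psd_form.nrm h w \<le> C\<^sub>\<Omega> * nrm w" "C\<^sub>\<Omega> \<ge> 0" and \<kappa>: "\<kappa> \<ge> 0"
  and int: "!!j w. w \<in> V ==> (\<lambda>y. y ^ j * h (\<eta> (\<tau> (n - 1) + (\<tau> n - \<tau> (n - 1)) * y)) w) integrable_on {0..1}"
  and moment: "!!j w. j < d n ==> w \<in> V ==>
   \<bar>integral {0..1} (\<lambda>y. y ^ j * h (\<eta> (\<tau> (n - 1) + (\<tau> n - \<tau> (n - 1)) * y)) w)\<bar> \<le> \<kappa> * psd_form.nrm h w"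
 shows "\<bar>integral {\<tau> (n - 1)..\<tau> n} (\<lambda>t. h (\<eta> t) (vpoly' (d n) (c n) t))\<bar> \<le> \<kappa> * real p * C\<^sub>\<Omega> * Cp\<^sup>2 * cross_sup n"
  (is "\<bar>integral ?I ?f\<bar> \<le> _")
proof (cases "d n \<ge> 1 \<and> ?f integrable_on ?I")
 \<comment> \<open>The integral is 0 either because the derivative of a constant vanishes or because
   a non-integrable function has integral 0 by convention.\<close>
 case False
 have "0 \<le> \<kappa> * real p * C\<^sub>\<Omega> * Cp\<^sup>2 * cross_sup n" using \<kappa> poincare(2) cross_sup_nonneg[OF n] by simp
 moreover have "integral ?I ?f = 0"
 proof (cases "d n \<ge> 1")
  case True
  then show ?thesis using False by (simp add: not_integrable_integral)
 next
  case False
  then have "d n = 0" by simp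
  then have "?f = (\<lambda>t. 0)" using psd_form.zero_right[OF h] by (simp add: vpoly'_def fun_eq_iff)
  then show ?thesis by simp
 qed
 ultimately show ?thesis by simp
next
 case True
 interpret h: psd_form h by (rule h)
 define k where "k = \<tau> n - \<tau> (n - 1)"
 have k: "k > 0" using stp_pos[OF n] by (simp add: k_def stp_def)
 define r where "r = d n - 1"
 have dr: "d n = Suc r" using True by (simp add: r_def)
 define e where "e i = (\<Sum>j\<le>r. coeff ([:\<tau> (n - 1), k:] ^ j) i *\<^sub>R (real (Suc j) *\<^sub>R c n (Suc j)))" for i
 have der: "vpoly' (d n) (c n) (\<tau> (n - 1) + k * y) = vpoly r e y" for y
  unfolding vpoly'_eq_vpoly[OF conjunct1[OF True]] r_def[symmetric] vpoly_affine e_def ..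
 have eV: "e i \<in> V" for i
  unfolding e_def by (intro subspace_sum[OF V] subspace_scale[OF V] cV) (simp add: dr)
 have nb: "nrm (e j) \<le> Cp * (Cp / k * cross_sup n)" if "j \<le> r" for j
 proof (rule vpoly_coeff_bound[where p = p and d = r])
  show "r \<le> p" using dp[OF n] dr by simp
  show "nrm (vpoly r e y) \<le> Cp / k * cross_sup n" if y: "y \<in> {0..1}" for y
  proof -
   have "k * y \<le> k * 1" using k y by (intro mult_left_mono) auto
   moreover have "0 \<le> k * y" using k y by simp
   moreover have "\<tau> n = \<tau> (n - 1) + k" by (simp add: k_def)
   ultimately have "\<tau> (n - 1) + k * y \<in> {\<tau> (n - 1)..\<tau> n}" by simp
   from derivative_bound[OF n this] show ?thesis unfolding der stp_def k_def[symmetric] .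
  qed
 qed (use coefficient Cp that in auto)
 have hb: "h.nrm (e j) \<le> C\<^sub>\<Omega> * (Cp * (Cp / k * cross_sup n))" if "j \<le> r" for j
  by (rule order_trans[OF poincare(1)[OF eV] mult_left_mono[OF nb[OF that] poincare(2)]])
 have "integral ?I ?f = k * integral {0..1} (\<lambda>y. ?f (\<tau> (n - 1) + k * y))"
  using integral_unit_interval_substitution[of "\<tau> (n - 1)" "\<tau> n" ?f] True k by (simp add: k_def)
 also have "integral {0..1} (\<lambda>y. ?f (\<tau> (n - 1) + k * y)) = integral {0..1} (\<lambda>y. \<Sum>j\<le>r. y ^ j * h (\<eta> (\<tau> (n - 1) + k * y)) (e j))"
  by (rule integral_cong) (simp only: der, simp add: vpoly_def h.linear_simps)
 also have "\<dots> = (\<Sum>j\<le>r. integral {0..1} (\<lambda>y. y ^ j * h (\<eta> (\<tau> (n - 1) + k * y)) (e j)))"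
  using int[OF eV] by (intro Henstock_Kurzweil_Integration.integral_sum) (auto simp: k_def)
 finally have i: "integral ?I ?f = k * (\<Sum>j\<le>r. integral {0..1} (\<lambda>y. y ^ j * h (\<eta> (\<tau> (n - 1) + k * y)) (e j)))" .
 have s: "\<bar>\<Sum>j\<le>r. integral {0..1} (\<lambda>y. y ^ j * h (\<eta> (\<tau> (n - 1) + k * y)) (e j))\<bar> \<le> (\<Sum>j\<le>r. \<kappa> * (C\<^sub>\<Omega> * (Cp * (Cp / k * cross_sup n))))"
 proof (rule order_trans[OF sum_abs sum_mono])
  fix j assume "j \<in> {..r}"
  then have j: "j \<le> r" by simp
  show "\<bar>integral {0..1} (\<lambda>y. y ^ j * h (\<eta> (\<tau> (n - 1) + k * y)) (e j))\<bar> \<le> \<kappa> * (C\<^sub>\<Omega> * (Cp * (Cp / k * cross_sup n)))"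
   using order_trans[OF moment[of j "e j"] mult_left_mono[OF hb[OF j] \<kappa>]] j dr eV by (simp add: k_def)
 qed
 have "\<bar>integral ?I ?f\<bar> \<le> k * (\<Sum>j\<le>r. \<kappa> * (C\<^sub>\<Omega> * (Cp * (Cp / k * cross_sup n))))"
  unfolding i using mult_left_mono[OF s, of k] k by (simp add: abs_mult)
 also have "\<dots> = \<kappa> * real (d n) * C\<^sub>\<Omega> * Cp\<^sup>2 * cross_sup n" using k by (simp add: dr power2_eq_square)
 also have "\<dots> \<le> \<kappa> * real p * C\<^sub>\<Omega> * Cp\<^sup>2 * cross_sup n"
  using dp[OF n] \<kappa> poincare(2) cross_sup_nonneg[OF n] by (intro mult_right_mono mult_left_mono) auto
 finally show ?thesis .
qed

section \<open>The discrete scheme\<close>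

lemma Lim_piecewise:
 fixes U :: "real \<Rightarrow> 'v::real_normed_vector"
 assumes "l < r" "!!t. t \<in> {l<..<r} ==> U t = vpoly d c t"
 shows "Lim (at_right l) U = vpoly d c l" "Lim (at_left r) U = vpoly d c r"
proof -
 have c: "(vpoly d c \<longlongrightarrow> vpoly d c x) (at x within S)" for x S
  using vpoly_continuous[of UNIV d c] continuous_within_subset[of x UNIV "vpoly d c" S]
  by (auto simp: continuous_on_eq_continuous_within continuous_within)
 have "\<forall>\<^sub>F t in at_right l. vpoly d c t = U t"
  using eventually_at_right_less[of l] eventually_at_right[OF assms(1)] assms(2)
  by (auto simp: eventually_at_right[OF assms(1)] intro!: exI[of _ r] assms(1))
 then have "(U \<longlongrightarrow> vpoly d c l) (at_right l)" by (rule Lim_transform_eventually[OF c])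
 then show "Lim (at_right l) U = vpoly d c l" by (intro tendsto_Lim) auto
 have "\<forall>\<^sub>F t in at_left r. vpoly d c t = U t"
  using assms(2) by (auto simp: eventually_at_left[OF assms(1)] intro!: exI[of _ l] assms(1))
 then have "(U \<longlongrightarrow> vpoly d c r) (at_left r)" by (rule Lim_transform_eventually[OF c])
 then show "Lim (at_left r) U = vpoly d c r" by (intro tendsto_Lim) auto
qed

lemma (in frac_mesh_form) bracket_has_integral:
 assumes n: "n \<in> {1..N}"
  and lin: "!!t r. t \<in> {\<tau> (n - 1)..\<tau> n} ==> z t (\<Sum>j\<le>m. r j *\<^sub>R e j) = (\<Sum>j\<le>m. r j * z t (e j))"
  and cont: "!!j. j \<le> m ==> continuous_on {\<tau> (n - 1)..\<tau> n} (\<lambda>t. z t (e j))"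
  and der: "!!j t. j \<le> m ==> t \<in> {\<tau> (n - 1)<..<\<tau> n} ==> ((\<lambda>t. z t (e j)) has_real_derivative z' j t) (at t)"
 shows "((\<lambda>t. \<Sum>j\<le>m. t ^ j * z' j t) has_integral bracket z n m e) {\<tau> (n - 1)..\<tau> n}"
proof -
 have le: "\<tau> (n - 1) \<le> \<tau> n" using step_pos[OF n] by simp
 define F where "F t = (\<Sum>j\<le>m. t ^ j * z t (e j))" for t
 define F1 where "F1 t = (\<Sum>j\<le>m. (real j * t ^ (j - 1)) * z t (e j))" for t
 have "((\<lambda>t. (\<Sum>j\<le>m. t ^ j * z' j t) + F1 t) has_integral F (\<tau> n) - F (\<tau> (n - 1))) {\<tau> (n - 1)..\<tau> n}"
 proof (rule fundamental_theorem_of_calculus_interior[OF le])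
  show "continuous_on {\<tau> (n - 1)..\<tau> n} F"
   unfolding F_def by (intro continuous_on_sum continuous_on_mult cont continuous_intros) auto
  fix t assume t: "t \<in> {\<tau> (n - 1)<..<\<tau> n}"
  have "(F has_real_derivative (\<Sum>j\<le>m. (real j * t ^ (j - 1)) * z t (e j) + z' j t * t ^ j)) (at t)"
   unfolding F_def by (intro DERIV_sum DERIV_mult der t) (auto intro!: derivative_eq_intros)
  then show "(F has_vector_derivative (\<Sum>j\<le>m. t ^ j * z' j t) + F1 t) (at t)"
   by (simp add: has_real_derivative_iff_has_vector_derivative F1_def sum.distrib add.commute mult.commute)
 qed
 moreover have "(F1 has_integral integral {\<tau> (n - 1)..\<tau> n} F1) {\<tau> (n - 1)..\<tau> n}"
  unfolding F1_def
  by (intro integrable_integral integrable_continuous_real continuous_on_sum continuous_on_mult cont continuous_intros) auto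
 ultimately have "((\<lambda>t. ((\<Sum>j\<le>m. t ^ j * z' j t) + F1 t) - F1 t) has_integral
   (F (\<tau> n) - F (\<tau> (n - 1))) - integral {\<tau> (n - 1)..\<tau> n} F1) {\<tau> (n - 1)..\<tau> n}" by (rule has_integral_diff)
 moreover have "F t = z t (vpoly m e t)" if "t \<in> {\<tau> (n - 1)..\<tau> n}" for t
  unfolding F_def vpoly_def by (rule lin[OF that, symmetric])
 moreover have "integral {\<tau> (n - 1)..\<tau> n} F1 = integral {\<tau> (n - 1)..\<tau> n} (\<lambda>t. z t (vpoly' m e t))"
  by (rule integral_cong) (simp add: F1_def vpoly'_def lin)
 ultimately show ?thesis using le by (simp add: bracket_def)
qed

section \<open>The exact and the discrete problem in bracket form\<close>

locale dg_problem = bounded_open_set \<Omega> + frac_mesh_form \<tau> N \<alpha> "bounded_open_set.grad_form \<Omega>"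
 for \<Omega> :: "'a::euclidean_space set" and \<tau> :: "nat \<Rightarrow> real" and N :: nat and \<alpha> :: real +
 fixes K T M \<sigma> :: real and p :: nat and d :: "nat \<Rightarrow> nat" and f :: "real \<Rightarrow> 'a l2" and u0 :: "'a l2"
  and u U :: "real \<Rightarrow> 'a l2"
 assumes final_time: "T = \<tau> N" and N1: "N \<ge> 1" and \<sigma>: "\<sigma> > 0" and M: "M > 0"
  and solution: "fractional_diffusion_solution \<Omega> K T \<alpha> f u0 u"
  and regular: "regularity \<Omega> T p M \<sigma> u"
  and scheme: "dg_solution \<Omega> K \<alpha> \<tau> N d f u0 U"
begin

lemma u_H10: "t \<in> {0<..T} ==> u t \<in> H10 \<Omega>"
 using solution by (simp add: fractional_diffusion_solution_def)

lemma T_pos: "T > 0"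
 using step_pos[of N] node_nonneg[of "N - 1"] N1 by (simp add: final_time)

lemmas increment = regular_increment[OF regular u_H10 \<sigma> M]

lemma H10_H1: "x \<in> H10 \<Omega> ==> x \<in> H1 \<Omega>" by (simp add: H10_iff)

lemma diff_form_eq: "x \<in> H10 \<Omega> ==> w \<in> H10 \<Omega> ==> diff_form \<Omega> K x w = K * grad_form x w"
 by (simp add: diff_form_def grad_inner_eq H10_H1)

lemma cell_in: "n \<in> {1..N} ==> t \<in> {\<tau> (n - 1)..\<tau> n} ==> t \<in> {0..T}"
 using node_nonneg[OF pred_le, of n] node_mono[of n N] by (auto simp: final_time)

lemma pieces:
 obtains c where "!!n j. n \<in> {1..N} ==> j \<le> d n ==> c n j \<in> H10 \<Omega>"
  "!!n t. n \<in> {1..N} ==> t \<in> {\<tau> (n - 1)<..<\<tau> n} ==> U t = vpoly (d n) (c n) t"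
proof -
 have "\<forall>n\<in>{1..N}. \<exists>e. (\<forall>j\<le>d n. e j \<in> H10 \<Omega>) \<and> (\<forall>t\<in>{\<tau> (n - 1)<..<\<tau> n}. U t = vpoly (d n) e t)"
 proof
  fix n assume "n \<in> {1..N}"
  with scheme obtain X where X: "X \<in> time_polys (H10 \<Omega>) (d n)" "\<forall>t\<in>mesh_interval \<tau> n. U t = X t"
   unfolding dg_solution_def dg_space_def by blast
  from X(1) obtain e where e: "\<forall>j\<le>d n. e j \<in> H10 \<Omega>" "X = (\<lambda>t. \<Sum>j\<le>d n. t ^ j *\<^sub>R e j)"
   unfolding time_polys_def by blast
  show "\<exists>e. (\<forall>j\<le>d n. e j \<in> H10 \<Omega>) \<and> (\<forall>t\<in>{\<tau> (n - 1)<..<\<tau> n}. U t = vpoly (d n) e t)"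
   by (rule exI[of _ e]) (use e X(2) in \<open>simp add: mesh_interval_def vpoly_def\<close>)
 qed
 then obtain c where "\<forall>n\<in>{1..N}. (\<forall>j\<le>d n. c n j \<in> H10 \<Omega>) \<and> (\<forall>t\<in>{\<tau> (n - 1)<..<\<tau> n}. U t = vpoly (d n) (c n) t)"
  unfolding bchoice_iff by blast
 then show ?thesis by (intro that) auto
qed

text \<open>All parts come from the increment bound, with t^\<sigma> as modulus. The time 0 is
  treated separately because \<open>u 0\<close> is only known to lie in \<open>L2\<close>.\<close>

lemma grad_pairing_bounded:
 assumes w: "w \<in> H10 \<Omega>"
 shows "t \<in> {0..T} ==> (\<lambda>s. grad_form (u s) w) \<in> borel_measurable (lebesgue_on {0..t})"
  "continuous_on {0<..T} (\<lambda>s. grad_form (u s) w)"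
  "\<exists>B. \<forall>s\<in>{0..T}. \<bar>grad_form (u s) w\<bar> \<le> B"
proof -
 show c: "continuous_on {0<..T} (\<lambda>s. grad_form (u s) w)"
 proof (rule modulus_continuous_on[where \<Phi> = "\<lambda>t. t powr \<sigma>" and B = "M / \<sigma> * grad.nrm w"])
  fix t t' assume t: "t \<in> {0<..T}" "t' \<in> {0<..T}" "t \<le> t'"
  have "\<bar>grad_form (u t' - u t) w\<bar> \<le> M / \<sigma> * (t' powr \<sigma> - t powr \<sigma>) * grad.nrm w"
   by (rule increment(2)) (use t w in auto)
  also have "\<dots> = (M / \<sigma> * grad.nrm w) * (t' powr \<sigma> - t powr \<sigma>)" by simp
  also have "\<dots> \<le> (M / \<sigma> * grad.nrm w) * \<bar>t' powr \<sigma> - t powr \<sigma>\<bar>"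
   using M \<sigma> by (intro mult_left_mono) auto
  finally show "\<bar>grad_form (u t') w - grad_form (u t) w\<bar> \<le> M / \<sigma> * grad.nrm w * \<bar>t' powr \<sigma> - t powr \<sigma>\<bar>"
   by (simp add: grad.diff_left)
 qed (use M \<sigma> in \<open>auto intro!: continuous_intros\<close>)
 define B where "B = \<bar>grad_form (u T) w\<bar> + M / \<sigma> * T powr \<sigma> * grad.nrm w"
 have b: "\<bar>grad_form (u s) w\<bar> \<le> B" if s: "s \<in> {0<..T}" for s
 proof -
  have "\<bar>grad_form (u T - u s) w\<bar> \<le> M / \<sigma> * (T powr \<sigma> - s powr \<sigma>) * grad.nrm w"
   by (rule increment(2)) (use s w in auto)
  also have "\<dots> \<le> M / \<sigma> * T powr \<sigma> * grad.nrm w" using M \<sigma> by (intro mult_right_mono mult_left_mono) auto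
  finally show ?thesis unfolding B_def grad.diff_left by linarith
 qed
 show "(\<lambda>s. grad_form (u s) w) \<in> borel_measurable (lebesgue_on {0..t})" if "t \<in> {0..T}"
  by (rule bounded_continuous_absolutely_integrable(2)[OF continuous_on_subset[OF c] b]) (use that in auto)
 show "\<exists>B. \<forall>s\<in>{0..T}. \<bar>grad_form (u s) w\<bar> \<le> B"
 proof (intro exI[of _ "max B \<bar>grad_form (u 0) w\<bar>"] ballI)
  fix s assume "s \<in> {0..T}"
  then show "\<bar>grad_form (u s) w\<bar> \<le> max B \<bar>grad_form (u 0) w\<bar>" using b[of s] by (cases "s = 0") auto
 qed
qed

definition exact_memory :: "real \<Rightarrow> 'a l2 \<Rightarrow> real" where
 "exact_memory t w = frac_integral \<alpha> (\<lambda>s. grad_form (u s) w) t"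

lemma exact_memory_integrable:
 assumes w: "w \<in> H10 \<Omega>" and t: "t \<in> {0..T}"
 shows "(\<lambda>s. omega (\<alpha> + 1) (t - s) * grad_form (u s) w) integrable_on {0..t}"
proof -
 obtain B where B: "\<forall>s\<in>{0..T}. \<bar>grad_form (u s) w\<bar> \<le> B" using grad_pairing_bounded(3)[OF w] by blast
 have "(\<lambda>s. omega (\<alpha> + 1) (t - s) * grad_form (u s) w) absolutely_integrable_on {0..t}"
  by (rule omega_times_bounded(1)[where B = B]) (use \<alpha> t grad_pairing_bounded(1)[OF w t] B in auto)
 then show ?thesis by (rule set_lebesgue_integral_eq_integral(1))
qed

lemma exact_memory_combination:
 fixes m :: nat
 assumes e: "!!j. j \<le> m ==> e j \<in> H10 \<Omega>" and t: "t \<in> {0..T}"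
 shows "exact_memory t (\<Sum>j\<le>m. r j *\<^sub>R e j) = (\<Sum>j\<le>m. r j * exact_memory t (e j))"
proof -
 have "exact_memory t (\<Sum>j\<le>m. r j *\<^sub>R e j) = integral {0..t} (\<lambda>s. \<Sum>j\<le>m. r j * (omega (\<alpha> + 1) (t - s) * grad_form (u s) (e j)))"
  unfolding exact_memory_def frac_integral_def
  by (rule integral_cong) (simp add: grad.linear_simps sum_distrib_left mult_ac)
 also have "\<dots> = (\<Sum>j\<le>m. integral {0..t} (\<lambda>s. r j * (omega (\<alpha> + 1) (t - s) * grad_form (u s) (e j))))"
  using integrable_on_mult_right[OF exact_memory_integrable[OF e t]]
  by (intro Henstock_Kurzweil_Integration.integral_sum) auto
 finally show ?thesis by (simp add: exact_memory_def frac_integral_def)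
qed

text \<open>\<open>diff_form\<close> and \<open>K * grad_form\<close> are known to agree on
  \<open>H10\<close>, hence for s > 0; the remaining point s = 0 is negligible.\<close>

lemma frac_integral_diff_form:
 assumes w: "w \<in> H10 \<Omega>" and t: "t \<in> {0..T}"
 shows "frac_integral \<alpha> (\<lambda>s. diff_form \<Omega> K (u s) w) t = K * exact_memory t w"
proof -
 have "frac_integral \<alpha> (\<lambda>s. diff_form \<Omega> K (u s) w) t = integral {0..t} (\<lambda>s. K * (omega (\<alpha> + 1) (t - s) * grad_form (u s) w))"
  unfolding frac_integral_def
  by (rule integral_spike[of "{0}"]) (use u_H10 diff_form_eq[OF _ w] t in auto)
 then show ?thesis by (simp add: exact_memory_def frac_integral_def)
qed

lemma frac_integral_diff_form_derivative:
 assumes w: "w \<in> H10 \<Omega>" and t: "t \<in> {0<..T}"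
 shows "(frac_integral \<alpha> (\<lambda>s. diff_form \<Omega> K (u s) w) has_vector_derivative
  frac_deriv T \<alpha> (\<lambda>s. diff_form \<Omega> K (u s) w) t) (at t within {0..T})"
 using solution w t unfolding fractional_diffusion_solution_def frac_deriv_def
 by (auto simp: vector_derivative_works[symmetric])

text \<open>For t > 0 continuity follows from the differentiability demanded of a solution. At 0 the
  fractional integral of a bounded function is O(t^(\<alpha>+1)).\<close>

lemma scaled_memory_continuous:
 assumes w: "w \<in> H10 \<Omega>"
 shows "continuous_on {0..T} (\<lambda>t. K * exact_memory t w)"
 unfolding continuous_on_eq_continuous_within
proof
 fix t assume t: "t \<in> {0..T}"
 show "continuous (at t within {0..T}) (\<lambda>t. K * exact_memory t w)"
 proof (cases "t = 0")
  case False
  then have "continuous (at t within {0..T}) (frac_integral \<alpha> (\<lambda>s. diff_form \<Omega> K (u s) w))"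
   using t by (intro has_vector_derivative_continuous[OF frac_integral_diff_form_derivative[OF w]]) auto
  then show ?thesis
   by (rule continuous_transform_within[of _ _ _ 1]) (use t frac_integral_diff_form[OF w] in auto)
 next
  case True
  obtain B where B: "\<forall>s\<in>{0..T}. \<bar>grad_form (u s) w\<bar> \<le> B" using grad_pairing_bounded(3)[OF w] by blast
  have "\<bar>exact_memory x w\<bar> \<le> B / Gamma (\<alpha> + 2) * x powr (\<alpha> + 1)" if x: "x \<in> {0..T}" for x
   using omega_times_bounded(2)[OF \<alpha>(1), of 0 x x "\<lambda>s. grad_form (u s) w" B] x grad_pairing_bounded(1)[OF w x] B \<alpha>
   by (simp add: exact_memory_def frac_integral_def)
  then have le: "\<forall>\<^sub>F x in at 0 within {0..T}. norm (exact_memory x w) \<le> B / Gamma (\<alpha> + 2) * x powr (\<alpha> + 1)"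
   by (simp add: eventually_at_filter)
  have c: "continuous_on {0..T} (\<lambda>x. B / Gamma (\<alpha> + 2) * x powr (\<alpha> + 1))"
   using \<alpha> by (intro continuous_on_mult continuous_on_powr' continuous_intros) auto
  have "((\<lambda>x. B / Gamma (\<alpha> + 2) * x powr (\<alpha> + 1)) \<longlongrightarrow> 0) (at 0 within {0..T})"
   using c[unfolded continuous_on, rule_format, of 0] T_pos by simp
  from Lim_null_comparison[OF le this] have "((\<lambda>x. exact_memory x w) \<longlongrightarrow> 0) (at 0 within {0..T})" .
  moreover have "exact_memory 0 w = 0" by (simp add: exact_memory_def frac_integral_def)
  ultimately show ?thesis using True by (auto simp: continuous_within intro!: tendsto_mult_right_zero)
 qed
qed

text \<open>Inside the cell the equation expresses \<open>f\<close>, tested with fixed vectors, by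
  two time derivatives, and \<open>bracket_has_integral\<close> integrates both. Integrability of
  \<open>f\<close> against polynomials thus follows from the equation.\<close>

lemma source_integral:
 assumes n: "n \<in> {1..N}" and e: "!!j. j \<le> d n ==> e j \<in> H10 \<Omega>"
 shows "((\<lambda>t. inner (f t) (vpoly (d n) e t)) has_integral
  bracket (\<lambda>t. inner (u t)) n (d n) e + bracket (\<lambda>t w. K * exact_memory t w) n (d n) e) {\<tau> (n - 1)..\<tau> n}"
proof -
 have inside: "t \<in> {0<..<T}" if "t \<in> {\<tau> (n - 1)<..<\<tau> n}" for t
  using that cell_in[OF n, of "\<tau> n"] node_nonneg[OF pred_le[OF n]] step_pos[OF n] by auto
 have c: "continuous_on {0..T} u" using solution by (simp add: fractional_diffusion_solution_def)
 have sub: "{\<tau> (n - 1)..\<tau> n} \<subseteq> {0..T}" using cell_in[OF n] by auto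
 have 1: "((\<lambda>t. \<Sum>j\<le>d n. t ^ j * inner (time_deriv T 1 u t) (e j)) has_integral bracket (\<lambda>t. inner (u t)) n (d n) e) {\<tau> (n - 1)..\<tau> n}"
 proof (rule bracket_has_integral[OF n])
  show "continuous_on {\<tau> (n - 1)..\<tau> n} (\<lambda>t. inner (u t) (e j))" for j
   by (intro continuous_intros continuous_on_subset[OF c sub])
  show "((\<lambda>t. inner (u t) (e j)) has_real_derivative inner (time_deriv T 1 u t) (e j)) (at t)" if "t \<in> {\<tau> (n - 1)<..<\<tau> n}" for j t
  proof -
   have "u differentiable (at t within {0<..T})"
    using solution inside[OF that] by (simp add: fractional_diffusion_solution_def)
   then have "(u has_vector_derivative time_deriv T 1 u t) (at t within {0<..T})"
    by (simp add: vector_derivative_works)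
   then have "(u has_vector_derivative time_deriv T 1 u t) (at t within {0<..<T})"
    by (rule has_vector_derivative_within_subset) auto
   then have "(u has_vector_derivative time_deriv T 1 u t) (at t)"
    using inside[OF that] by (simp add: at_within_open[OF _ open_greaterThanLessThan])
   then show ?thesis by (rule inner_has_real_derivative)
  qed
 qed (simp add: inner_sum_right)
 have 2: "((\<lambda>t. \<Sum>j\<le>d n. t ^ j * frac_deriv T \<alpha> (\<lambda>s. diff_form \<Omega> K (u s) (e j)) t) has_integral
   bracket (\<lambda>t w. K * exact_memory t w) n (d n) e) {\<tau> (n - 1)..\<tau> n}"
 proof (rule bracket_has_integral[OF n])
  show "K * exact_memory t (\<Sum>j\<le>d n. r j *\<^sub>R e j) = (\<Sum>j\<le>d n. r j * (K * exact_memory t (e j)))"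
   if "t \<in> {\<tau> (n - 1)..\<tau> n}" for t r
   using exact_memory_combination[OF e cell_in[OF n that]] by (simp add: sum_distrib_left mult.left_commute)
  show "continuous_on {\<tau> (n - 1)..\<tau> n} (\<lambda>t. K * exact_memory t (e j))" if "j \<le> d n" for j
   by (rule continuous_on_subset[OF scaled_memory_continuous[OF e[OF that]] sub])
  fix j t assume j: "j \<le> d n" and t: "t \<in> {\<tau> (n - 1)<..<\<tau> n}"
  have "(frac_integral \<alpha> (\<lambda>s. diff_form \<Omega> K (u s) (e j)) has_vector_derivative
    frac_deriv T \<alpha> (\<lambda>s. diff_form \<Omega> K (u s) (e j)) t) (at t)"
   using frac_integral_diff_form_derivative[OF e[OF j], of t] inside[OF t] by (simp add: at_within_Icc_at)
  then have "((\<lambda>t. K * exact_memory t (e j)) has_vector_derivative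
    frac_deriv T \<alpha> (\<lambda>s. diff_form \<Omega> K (u s) (e j)) t) (at t)"
   by (rule has_vector_derivative_transform_within_open[of _ _ _ "{0<..<T}"])
    (use inside[OF t] frac_integral_diff_form[OF e[OF j]] in auto)
  then show "((\<lambda>t. K * exact_memory t (e j)) has_real_derivative frac_deriv T \<alpha> (\<lambda>s. diff_form \<Omega> K (u s) (e j)) t) (at t)"
   by (simp add: has_real_derivative_iff_has_vector_derivative)
 qed
 show ?thesis
 proof (rule has_integral_spike_finite[OF _ _ has_integral_add[OF 1 2]])
  fix t assume "t \<in> {\<tau> (n - 1)..\<tau> n} - {\<tau> (n - 1), \<tau> n}"
  then have "t \<in> {\<tau> (n - 1)<..<\<tau> n}" by auto
  from inside[OF this] have "inner (f t) (e j) = inner (time_deriv T 1 u t) (e j) + frac_deriv T \<alpha> (\<lambda>s. diff_form \<Omega> K (u s) (e j)) t"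
   if "j \<le> d n" for j
   using solution e[OF that] by (simp add: fractional_diffusion_solution_def)
  then show "inner (f t) (vpoly (d n) e t) = (\<Sum>j\<le>d n. t ^ j * inner (time_deriv T 1 u t) (e j))
    + (\<Sum>j\<le>d n. t ^ j * frac_deriv T \<alpha> (\<lambda>s. diff_form \<Omega> K (u s) (e j)) t)"
   by (simp add: vpoly_def inner_sum_right distrib_left sum.distrib)
 qed simp
qed

definition previous :: "(nat \<Rightarrow> nat \<Rightarrow> 'a l2) \<Rightarrow> nat \<Rightarrow> 'a l2" where
 "previous c n = (if n = 1 then u 0 else vpoly (d (n - 1)) (c (n - 1)) (\<tau> (n - 1)))"

context
 fixes c :: "nat \<Rightarrow> nat \<Rightarrow> 'a l2"
 assumes cH: "!!n j. n \<in> {1..N} ==> j \<le> d n ==> c n j \<in> H10 \<Omega>"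
  and cU: "!!n t. n \<in> {1..N} ==> t \<in> {\<tau> (n - 1)<..<\<tau> n} ==> U t = vpoly (d n) (c n) t"
begin

text \<open>Derivative of the explicit fractional integral of \<open>U\<close>; it is used only
  between nodes, where the weights are differentiable.\<close>

definition memory_deriv :: "real \<Rightarrow> 'a l2" where
 "memory_deriv t = (\<Sum>n\<in>{1..N}. \<Sum>i\<le>d n. deriv (moment_weight n i) t *\<^sub>R c n i)"

lemma memory_deriv_H10: "memory_deriv t \<in> H10 \<Omega>"
 unfolding memory_deriv_def using cH by (intro subspace_sum[OF subspace_H10] subspace_scale[OF subspace_H10]) auto

lemma moment_weight_deriv:
 assumes "n \<in> {1..N}" "m \<in> {1..N}" "t \<in> {\<tau> (m - 1)<..<\<tau> m}"
 shows "(moment_weight n i has_real_derivative deriv (moment_weight n i) t) (at t)"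
 using moment_weight_differentiable[OF assms] by (simp add: DERIV_deriv_iff_real_differentiable)

lemma frac_deriv_U:
 assumes m: "m \<in> {1..N}" and t: "t \<in> {\<tau> (m - 1)<..<\<tau> m}"
 shows "frac_deriv (\<tau> N) \<alpha> U t = memory_deriv t"
proof -
 have inside: "t \<in> {0<..<\<tau> N}"
  using t cell_in[OF m, of "\<tau> m"] node_nonneg[OF pred_le[OF m]] step_pos[OF m] by (auto simp: final_time)
 have eq: "frac_integral \<alpha> U r = (\<Sum>n\<in>{1..N}. \<Sum>i\<le>d n. moment_weight n i r *\<^sub>R c n i)" if r: "r \<in> {0..\<tau> N}" for r
 proof -
  have "frac_integral \<alpha> U r = frac_integral \<alpha> (glue (\<lambda>n. vpoly (d n) (c n))) r"
   unfolding frac_integral_def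
  \<comment> \<open>At the nodes \<open>U\<close> may take arbitrary values in \<open>H10\<close>,
    unrelated to the pieces; these finitely many points are discarded.\<close>
  proof (rule integral_spike[of "\<tau> ` {0..N}"])
   show "negligible (\<tau> ` {0..N})" by (intro negligible_finite) simp
   fix s assume s: "s \<in> {0..r} - \<tau> ` {0..N}"
   then have "s \<noteq> 0" using \<tau>0 by (metis DiffD2 atLeast0AtMost atMost_iff image_eqI le0)
   then obtain n where n: "n \<in> {1..N}" "s \<in> cell n" using cell_exists[of s N] s r by auto
   have "s \<noteq> \<tau> n" using s n(1) by auto
   then show "omega (\<alpha> + 1) (r - s) *\<^sub>R glue (\<lambda>n. vpoly (d n) (c n)) s = omega (\<alpha> + 1) (r - s) *\<^sub>R U s"
    using cU[OF n(1), of s] glue_eq[OF n, of "\<lambda>n. vpoly (d n) (c n)"] n(2) by (simp add: cell_def)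
  qed
  then show ?thesis by (simp add: frac_integral_glue)
 qed
 have "((\<lambda>r. \<Sum>n\<in>{1..N}. \<Sum>i\<le>d n. moment_weight n i r *\<^sub>R c n i) has_vector_derivative memory_deriv t) (at t)"
  unfolding memory_deriv_def
 proof (intro has_vector_derivative_sum)
  fix n i assume "n \<in> {1..N}"
  from has_vector_derivative_scaleR[OF moment_weight_deriv[OF this m t] has_vector_derivative_const[of "c n i"]]
  show "((\<lambda>r. moment_weight n i r *\<^sub>R c n i) has_vector_derivative deriv (moment_weight n i) t *\<^sub>R c n i) (at t)" by simp
 qed
 then have "(frac_integral \<alpha> U has_vector_derivative memory_deriv t) (at t)"
  by (rule has_vector_derivative_transform_within_open[of _ _ _ "{0<..<\<tau> N}"]) (use inside eq in auto)
 then have "vector_derivative (frac_integral \<alpha> U) (at t) = memory_deriv t" by (rule vector_derivative_at)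
 then show ?thesis using inside by (simp add: frac_deriv_def at_within_Icc_at)
qed

lemma scheme_integral:
 assumes n: "n \<in> {1..N}" and e: "!!j. j \<le> d n ==> e j \<in> H10 \<Omega>"
 shows "((\<lambda>t. inner (vector_derivative U (at t)) (vpoly (d n) e t) + diff_form \<Omega> K (frac_deriv (\<tau> N) \<alpha> U t) (vpoly (d n) e t)) has_integral
   integral {\<tau> (n - 1)..\<tau> n} (\<lambda>t. inner (vpoly' (d n) (c n) t) (vpoly (d n) e t))
   + K * bracket (memory (omega (\<alpha> + 1)) (glue (\<lambda>n. vpoly (d n) (c n)))) n (d n) e) {\<tau> (n - 1)..\<tau> n}"
proof -
 let ?z = "memory (omega (\<alpha> + 1)) (glue (\<lambda>n. vpoly (d n) (c n)))"
 have 1: "((\<lambda>t. \<Sum>j\<le>d n. t ^ j * grad_form (memory_deriv t) (e j)) has_integral bracket ?z n (d n) e) {\<tau> (n - 1)..\<tau> n}"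
 proof (rule bracket_has_integral[OF n])
  show "?z t (\<Sum>j\<le>d n. r j *\<^sub>R e j) = (\<Sum>j\<le>d n. r j * ?z t (e j))" for t r
   unfolding memory_omega grad.linear_simps
   by (subst (2) sum_distrib_left) (simp add: sum_distrib_left mult_ac, subst sum.swap, rule sum.cong[OF refl], subst sum.swap, rule refl)
  show "continuous_on {\<tau> (n - 1)..\<tau> n} (\<lambda>t. ?z t (e j))" for j by (rule memory_omega_continuous)
  fix j t assume t: "t \<in> {\<tau> (n - 1)<..<\<tau> n}"
  show "((\<lambda>t. ?z t (e j)) has_real_derivative grad_form (memory_deriv t) (e j)) (at t)"
   unfolding memory_omega memory_deriv_def grad.linear_simps
   by (intro DERIV_sum DERIV_cmult_right moment_weight_deriv[OF _ n t])
 qed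
 have 2: "((\<lambda>t. inner (vpoly' (d n) (c n) t) (vpoly (d n) e t)) has_integral
   integral {\<tau> (n - 1)..\<tau> n} (\<lambda>t. inner (vpoly' (d n) (c n) t) (vpoly (d n) e t))) {\<tau> (n - 1)..\<tau> n}"
 proof (intro integrable_integral integrable_continuous_real continuous_on_inner)
  show "continuous_on {\<tau> (n - 1)..\<tau> n} (vpoly' (d n) (c n))"
   unfolding vpoly'_def[abs_def] by (intro continuous_intros)
 qed (rule vpoly_continuous)
 show ?thesis
 proof (rule has_integral_spike_finite[OF _ _ has_integral_add[OF 2 has_integral_mult_right[OF 1, of K]]])
  fix t assume "t \<in> {\<tau> (n - 1)..\<tau> n} - {\<tau> (n - 1), \<tau> n}"
  then have t: "t \<in> {\<tau> (n - 1)<..<\<tau> n}" by auto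
  have "(vpoly (d n) (c n) has_vector_derivative vpoly' (d n) (c n) t) (at t)" by (rule vpoly_has_vector_derivative)
  then have "(U has_vector_derivative vpoly' (d n) (c n) t) (at t)"
   by (rule has_vector_derivative_transform_within_open[of _ _ _ "{\<tau> (n - 1)<..<\<tau> n}"]) (use t cU[OF n] in auto)
  then have "vector_derivative U (at t) = vpoly' (d n) (c n) t" by (rule vector_derivative_at)
  moreover have "diff_form \<Omega> K (frac_deriv (\<tau> N) \<alpha> U t) (vpoly (d n) e t) = K * (\<Sum>j\<le>d n. t ^ j * grad_form (memory_deriv t) (e j))"
   unfolding frac_deriv_U[OF n t]
   by (subst diff_form_eq[OF memory_deriv_H10 vpoly_mem[OF subspace_H10 e]]) (simp_all add: vpoly_def grad.linear_simps)
  ultimately show "inner (vector_derivative U (at t)) (vpoly (d n) e t) + diff_form \<Omega> K (frac_deriv (\<tau> N) \<alpha> U t) (vpoly (d n) e t)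
   = inner (vpoly' (d n) (c n) t) (vpoly (d n) e t) + K * (\<Sum>j\<le>d n. t ^ j * grad_form (memory_deriv t) (e j))" by simp
 qed simp
qed

text \<open>Scheme and exact equation share the right side. With both memory terms written as
  brackets they can be subtracted without touching derivatives at the nodes.\<close>

lemma weak_equation:
 assumes n: "n \<in> {1..N}" and e: "!!j. j \<le> d n ==> e j \<in> H10 \<Omega>"
 shows "inner (vpoly (d n) (c n) (\<tau> (n - 1)) - previous c n) (vpoly (d n) e (\<tau> (n - 1)))
   + integral {\<tau> (n - 1)..\<tau> n} (\<lambda>t. inner (vpoly' (d n) (c n) t) (vpoly (d n) e t))
   + K * bracket (memory (omega (\<alpha> + 1)) (glue (\<lambda>n. vpoly (d n) (c n)))) n (d n) e
  = bracket (\<lambda>t. inner (u t)) n (d n) e + K * bracket exact_memory n (d n) e"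
proof -
 have step: "\<tau> (n - 1) < \<tau> n" using step_pos[OF n] by simp
 have r: "right_value \<tau> U (n - 1) = vpoly (d n) (c n) (\<tau> (n - 1))"
  unfolding right_value_def by (rule Lim_piecewise(1)[OF step cU[OF n]])
 have x: "right_value \<tau> (vpoly (d n) e) (n - 1) = vpoly (d n) e (\<tau> (n - 1))"
  unfolding right_value_def by (rule Lim_piecewise(1)[OF step refl])
 have l: "left_value u0 \<tau> U (n - 1) = previous c n"
 proof (cases "n = 1")
  case True
  then show ?thesis using solution by (simp add: left_value_def previous_def fractional_diffusion_solution_def)
 next
  case False
  then have n': "n - 1 \<in> {1..N}" using n by auto
  have "\<tau> (n - 1 - 1) < \<tau> (n - 1)" using step_pos[OF n'] by simp
  have n0: "n - 1 \<noteq> 0" using n' by auto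
  show ?thesis
   unfolding left_value_def previous_def if_not_P[OF n0] if_not_P[OF False]
   by (rule Lim_piecewise(2)[OF \<open>\<tau> (n - 1 - 1) < \<tau> (n - 1)\<close> cU[OF n']])
 qed
 have "vpoly (d n) e \<in> time_polys (H10 \<Omega>) (d n)"
  unfolding time_polys_def using e by (auto simp: vpoly_def[abs_def])
 then have "inner (right_value \<tau> U (n - 1) - left_value u0 \<tau> U (n - 1)) (right_value \<tau> (vpoly (d n) e) (n - 1))
    + integral {\<tau> (n - 1)..\<tau> n} (\<lambda>t. inner (vector_derivative U (at t)) (vpoly (d n) e t)
      + diff_form \<Omega> K (frac_deriv (\<tau> N) \<alpha> U t) (vpoly (d n) e t))
    = integral {\<tau> (n - 1)..\<tau> n} (\<lambda>t. inner (f t) (vpoly (d n) e t))"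
  using scheme n unfolding dg_solution_def by blast
 moreover have "bracket (\<lambda>t w. K * exact_memory t w) n (d n) e = K * bracket exact_memory n (d n) e"
  by (simp add: bracket_def right_diff_distrib)
 moreover have "integral {\<tau> (n - 1)..\<tau> n} (\<lambda>t. inner (vector_derivative U (at t)) (vpoly (d n) e t)
   + diff_form \<Omega> K (frac_deriv (\<tau> N) \<alpha> U t) (vpoly (d n) e t))
  = integral {\<tau> (n - 1)..\<tau> n} (\<lambda>t. inner (vpoly' (d n) (c n) t) (vpoly (d n) e t))
   + K * bracket (memory (omega (\<alpha> + 1)) (glue (\<lambda>n. vpoly (d n) (c n)))) n (d n) e"
  by (rule integral_unique, rule scheme_integral[OF n], rule e)
 moreover have "integral {\<tau> (n - 1)..\<tau> n} (\<lambda>t. inner (f t) (vpoly (d n) e t))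
  = bracket (\<lambda>t. inner (u t)) n (d n) e + bracket (\<lambda>t w. K * exact_memory t w) n (d n) e"
  by (rule integral_unique, rule source_integral[OF n], rule e)
 ultimately show ?thesis unfolding r x l by linarith
qed

end

end

lemma nrm_inner: "psd_form.nrm inner w = norm (w :: 'v::real_inner)"
 unfolding psd_form.nrm_def[OF inner_form.psd_form_axioms] norm_eq_sqrt_inner ..

lemma (in frac_mesh_form) bracket_diff:
 assumes n: "n \<in> {1..N}"
  and eq: "!!t j. t \<in> {\<tau> (n - 1)..\<tau> n} ==> b t (vpoly m e t) = b1 t (vpoly m e t) - b2 t (vpoly m e t)"
   "!!t. t \<in> {\<tau> (n - 1)..\<tau> n} ==> b t (vpoly' m e t) = b1 t (vpoly' m e t) - b2 t (vpoly' m e t)"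
  and int: "(\<lambda>t. b1 t (vpoly' m e t)) integrable_on {\<tau> (n - 1)..\<tau> n}" "(\<lambda>t. b2 t (vpoly' m e t)) integrable_on {\<tau> (n - 1)..\<tau> n}"
 shows "bracket b n m e = bracket b1 n m e - bracket b2 n m e"
proof -
 have "integral {\<tau> (n - 1)..\<tau> n} (\<lambda>t. b t (vpoly' m e t)) = integral {\<tau> (n - 1)..\<tau> n} (\<lambda>t. b1 t (vpoly' m e t) - b2 t (vpoly' m e t))"
  by (rule integral_cong) (rule eq(2))
 also have "\<dots> = integral {\<tau> (n - 1)..\<tau> n} (\<lambda>t. b1 t (vpoly' m e t)) - integral {\<tau> (n - 1)..\<tau> n} (\<lambda>t. b2 t (vpoly' m e t))"
  by (rule Henstock_Kurzweil_Integration.integral_diff[OF int])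
 finally show ?thesis
  unfolding bracket_def using eq(1)[of "\<tau> n"] eq(1)[of "\<tau> (n - 1)"] step_pos[OF n] by simp
qed

lemma (in frac_mesh) glue_truncate:
 assumes m: "m \<le> N" and s: "s \<le> \<tau> m"
 shows "frac_mesh.glue \<tau> m X s = glue X s"
proof -
 interpret m: frac_mesh \<tau> m \<alpha> by unfold_locales (use \<alpha> \<tau>0 step_pos m in auto)
 show ?thesis
 proof (cases "s > 0")
  case True
  then obtain n where n: "n \<in> {1..m}" "s \<in> cell n" using cell_exists[of s m] s m by auto
  then show ?thesis using glue_eq[of n s X] m.glue_eq[of n s X] m by (simp add: cell_def m.cell_def)
 qed (simp add: glue_outside m.glue_outside)
qed

section \<open>Error equation and stability on the mesh cut off at a node\<close>

locale dg_projection = dg_problem \<Omega> \<tau> N \<alpha> K T M \<sigma> p d f u0 u U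
 for \<Omega> :: "'a::euclidean_space set" and \<tau> :: "nat \<Rightarrow> real" and N :: nat and \<alpha> K T M \<sigma> :: real and p :: nat
  and d :: "nat \<Rightarrow> nat" and f :: "real \<Rightarrow> 'a l2" and u0 :: "'a l2" and u U :: "real \<Rightarrow> 'a l2" +
 fixes c cP :: "nat \<Rightarrow> nat \<Rightarrow> 'a l2" and Cp \<rho> C\<^sub>\<Omega> D \<kappa> :: real
 assumes cH: "!!n j. n \<in> {1..N} ==> j \<le> d n ==> c n j \<in> H10 \<Omega>"
  and cU: "!!n t. n \<in> {1..N} ==> t \<in> {\<tau> (n - 1)<..<\<tau> n} ==> U t = vpoly (d n) (c n) t"
  and PH: "!!n j. n \<in> {1..N} ==> j \<le> d n ==> cP n j \<in> H10 \<Omega>"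
  and P_node: "!!n. n \<in> {1..N} ==> vpoly (d n) (cP n) (\<tau> n) = u (\<tau> n)"
  and P_bound: "!!b n t w. b \<in> {grad_form, inner} ==> n \<in> {1..N} ==> t \<in> {\<tau> (n - 1)<..\<tau> n} ==> w \<in> H10 \<Omega> ==>
   \<bar>b (vpoly (d n) (cP n) t - u t) w\<bar> \<le> D * (\<tau> n - \<tau> (n - 1)) powr (- \<alpha> / 2) * psd_form.nrm b w"
  and P_moment: "!!b n j w. b \<in> {grad_form, inner} ==> n \<in> {1..N} ==> j < d n ==> w \<in> H10 \<Omega> ==>
   \<bar>integral {0..1} (\<lambda>y. y ^ j * b (vpoly (d n) (cP n) (\<tau> (n - 1) + (\<tau> n - \<tau> (n - 1)) * y)
    - u (\<tau> (n - 1) + (\<tau> n - \<tau> (n - 1)) * y)) w)\<bar> \<le> \<kappa> * psd_form.nrm b w"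
  and \<kappa>: "\<kappa> \<ge> 0" "\<kappa> * \<tau> N * real N \<le> D * (\<tau> 1 - \<tau> 0) powr (1 - \<alpha> / 2)" "\<kappa> \<le> D * (\<tau> 1 - \<tau> 0) powr (1 + \<alpha> / 2)"
  and D: "D \<ge> 0" and K: "K > 0"
  and inv: "!!(q::real poly) a b t. degree q \<le> p ==> a < b ==> t \<in> {a..b} ==>
   (poly q t)\<^sup>2 \<le> Cp / (b - a) * integral {a..b} (\<lambda>s. (poly q s)\<^sup>2)"
  and mark: "!!(q::real poly) a b t B. degree q \<le> p ==> a < b ==> t \<in> {a..b} ==>
   (!!s. s \<in> {a..b} ==> \<bar>poly q s\<bar> \<le> B) ==> \<bar>poly (pderiv q) t\<bar> \<le> Cp / (b - a) * B"
  and coefficient: "!!(q::real poly) i B. degree q \<le> p ==> (!!s. s \<in> {0..1} ==> \<bar>poly q s\<bar> \<le> B) ==> \<bar>coeff q i\<bar> \<le> Cp * B"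
  and Cp: "Cp > 0" and dp: "!!n. n \<in> {1..N} ==> 1 \<le> d n \<and> d n \<le> p" and \<rho>: "\<rho> \<ge> 1"
  and ratio: "!!n. n \<in> {1..<N} ==> \<tau> n - \<tau> (n - 1) \<le> \<tau> (n + 1) - \<tau> n"
   "!!n. n \<in> {1..<N} ==> \<tau> (n + 1) - \<tau> n \<le> \<rho> * (\<tau> n - \<tau> (n - 1))"
  and poincare_constant: "C\<^sub>\<Omega> \<ge> 0" "!!w. w \<in> H10 \<Omega> ==> norm w \<le> C\<^sub>\<Omega> * grad.nrm w"
begin

abbreviation UU :: "nat \<Rightarrow> real \<Rightarrow> 'a l2" where "UU n \<equiv> vpoly (d n) (c n)"
abbreviation PP :: "nat \<Rightarrow> real \<Rightarrow> 'a l2" where "PP n \<equiv> vpoly (d n) (cP n)"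

definition \<theta> :: "nat \<Rightarrow> nat \<Rightarrow> 'a l2" where "\<theta> n j = c n j - cP n j"

text \<open>The cut-offs give \<open>\<eta> 0 = 0\<close>, while on the cells \<open>\<eta>\<close>
  is the projection error.\<close>

definition \<eta> :: "real \<Rightarrow> 'a l2" where
 "\<eta> s = glue (\<lambda>n. vpoly (d n) (cP n)) s - (if s \<in> {0<..T} then u s else 0)"

lemma \<theta>_H10: "n \<in> {1..N} ==> j \<le> d n ==> \<theta> n j \<in> H10 \<Omega>"
 unfolding \<theta>_def by (intro subspace_diff[OF subspace_H10] cH PH)

lemma \<theta>_eq: "vpoly (d n) (\<theta> n) t = UU n t - PP n t"
 by (simp add: vpoly_diff \<theta>_def[abs_def])

lemma \<theta>'_eq: "vpoly' (d n) (\<theta> n) t = vpoly' (d n) (c n) t - vpoly' (d n) (cP n) t"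
 by (simp add: vpoly'_diff \<theta>_def[abs_def])

lemma \<eta>_cell:
 assumes n: "n \<in> {1..N}" and s: "s \<in> {\<tau> (n - 1)<..\<tau> n}"
 shows "\<eta> s = PP n s - u s"
proof -
 have "s \<in> {0<..T}" using cell_in[OF n, of s] s node_nonneg[OF pred_le[OF n]] by auto
 then show ?thesis using glue_eq[OF n, of s] s by (simp add: \<eta>_def cell_def)
qed

lemma \<eta>_pairing_measurable:
 assumes w: "w \<in> H10 \<Omega>" and t: "t \<in> {0..T}"
 shows "(\<lambda>s. grad_form (\<eta> s) w) \<in> borel_measurable (lebesgue_on {0..t})"
proof -
 let ?v = "\<lambda>s. if s \<in> {0<..T} then grad_form (u s) w else 0"
 obtain B where B: "\<forall>s\<in>{0..T}. \<bar>grad_form (u s) w\<bar> \<le> B" using grad_pairing_bounded(3)[OF w] by blast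
 have "?v \<in> borel_measurable (lebesgue_on {0..t})"
 proof (rule bounded_continuous_absolutely_integrable(2)[where B = B])
  have "continuous_on {0<..t} (\<lambda>s. grad_form (u s) w)"
   by (rule continuous_on_subset[OF grad_pairing_bounded(2)[OF w]]) (use t in auto)
  then show "continuous_on {0<..t} ?v" by (rule continuous_on_eq) (use t in auto)
 qed (use B t in auto)
 moreover have "(\<lambda>s. grad_form (glue (\<lambda>n. vpoly (d n) (cP n)) s) w) \<in> borel_measurable (lebesgue_on {0..t})"
 proof (intro measurable_restrict_space1 measurable_completion)
  have "(\<lambda>s. grad_form (glue (\<lambda>n. vpoly (d n) (cP n)) s) w) = (\<lambda>s. \<Sum>n\<in>{1..N}. \<Sum>i\<le>d n. (indicator (cell n) s * s ^ i) * grad_form (cP n i) w)"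
   by (rule ext) (simp only: glue_def vpoly_def grad.sum_left grad.scale_left sum_distrib_left mult.assoc)
  also have "\<dots> \<in> borel_measurable lborel" unfolding cell_def by measurable
  finally show "(\<lambda>s. grad_form (glue (\<lambda>n. vpoly (d n) (cP n)) s) w) \<in> borel_measurable lborel" .
 qed
 ultimately have "(\<lambda>s. grad_form (glue (\<lambda>n. vpoly (d n) (cP n)) s) w - ?v s) \<in> borel_measurable (lebesgue_on {0..t})"
  by (intro borel_measurable_diff)
 then show ?thesis unfolding \<eta>_def grad.diff_left by (simp add: if_distrib[of "\<lambda>x. grad_form x w"] cong: if_cong)
qed

lemma frac_integral_\<eta>:
 assumes w: "w \<in> H10 \<Omega>" and t: "t \<in> {0..T}"
 shows "frac_integral \<alpha> (\<lambda>s. grad_form (\<eta> s) w) t = memory (omega (\<alpha> + 1)) (glue (\<lambda>n. vpoly (d n) (cP n))) t w - exact_memory t w"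
proof -
 have "frac_integral \<alpha> (\<lambda>s. grad_form (\<eta> s) w) t = integral {0..t} (\<lambda>s. omega (\<alpha> + 1) (t - s) * grad_form (glue (\<lambda>n. vpoly (d n) (cP n)) s) w
   - omega (\<alpha> + 1) (t - s) * grad_form (u s) w)"
  unfolding frac_integral_def
  by (rule integral_spike[of "{0}"]) (use t in \<open>auto simp: \<eta>_def grad.diff_left right_diff_distrib\<close>)
 also have "\<dots> = integral {0..t} (\<lambda>s. omega (\<alpha> + 1) (t - s) * grad_form (glue (\<lambda>n. vpoly (d n) (cP n)) s) w)
   - integral {0..t} (\<lambda>s. omega (\<alpha> + 1) (t - s) * grad_form (u s) w)"
 proof (rule Henstock_Kurzweil_Integration.integral_diff)
  show "(\<lambda>s. omega (\<alpha> + 1) (t - s) * grad_form (u s) w) integrable_on {0..t}" by (rule exact_memory_integrable[OF w t])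
  have "grad_form (glue (\<lambda>n. vpoly (d n) (cP n)) s) w = glue (\<lambda>n. vpoly (d n) (\<lambda>i. grad_form (cP n i) w)) s" for s
   by (simp add: glue_def vpoly_def grad.linear_simps)
  then show "(\<lambda>s. omega (\<alpha> + 1) (t - s) * grad_form (glue (\<lambda>n. vpoly (d n) (cP n)) s) w) integrable_on {0..t}"
   using glue_frac_integral[of t d "\<lambda>n i. grad_form (cP n i) w"] by (auto simp: has_integral_integrable)
 qed
 finally show ?thesis by (simp add: memory_def exact_memory_def frac_integral_def)
qed

lemma exact_memory_continuous: "w \<in> H10 \<Omega> ==> continuous_on {0..T} (\<lambda>t. exact_memory t w)"
 using continuous_on_mult_left[OF scaled_memory_continuous, of w "1 / K"] K by simp

lemma memory_vpoly'_integrable: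
 fixes k :: nat and l r :: real
 shows "(\<lambda>t. memory (omega (\<alpha> + 1)) (glue (\<lambda>n. vpoly (d n) (b n))) t (vpoly' k e t)) integrable_on {l..r}"
 unfolding memory_sum_right
 by (intro integrable_continuous_real continuous_on_sum continuous_on_mult memory_omega_continuous continuous_intros)

lemma exact_memory_vpoly'_integrable:
 fixes k :: nat
 assumes n: "n \<in> {1..N}" and e: "!!j. j \<le> k ==> e j \<in> H10 \<Omega>"
 shows "(\<lambda>t. exact_memory t (vpoly' k e t)) integrable_on {\<tau> (n - 1)..\<tau> n}"
proof (rule integrable_eq)
 have sub: "{\<tau> (n - 1)..\<tau> n} \<subseteq> {0..T}" using cell_in[OF n] by auto
 show "(\<lambda>t. \<Sum>j\<le>k. (real j * t ^ (j - 1)) * exact_memory t (e j)) integrable_on {\<tau> (n - 1)..\<tau> n}"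
  using continuous_on_subset[OF exact_memory_continuous[OF e] sub]
  by (intro integrable_continuous_real continuous_on_sum continuous_on_mult continuous_intros) auto
 fix t assume t: "t \<in> {\<tau> (n - 1)..\<tau> n}"
 show "(\<Sum>j\<le>k. (real j * t ^ (j - 1)) * exact_memory t (e j)) = exact_memory t (vpoly' k e t)"
  unfolding vpoly'_def by (rule exact_memory_combination[OF e cell_in[OF n t], symmetric])
qed

text \<open>Puts the time derivative on the test polynomial, so that P meets it in the same way as
  \<open>u\<close> and the moments of \<open>\<eta>\<close> come into play.\<close>

lemma projection_by_parts:
 assumes n: "n \<in> {1..N}"
 shows "integral {\<tau> (n - 1)..\<tau> n} (\<lambda>t. inner (vpoly' (d n) (cP n) t) (vpoly k e t))
  = inner (PP n (\<tau> n)) (vpoly k e (\<tau> n)) - inner (PP n (\<tau> (n - 1))) (vpoly k e (\<tau> (n - 1)))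
   - integral {\<tau> (n - 1)..\<tau> n} (\<lambda>t. inner (PP n t) (vpoly' k e t))"
proof -
 have le: "\<tau> (n - 1) \<le> \<tau> n" using step_pos[OF n] by simp
 have i: "(\<lambda>t. inner (PP n t) (vpoly' k e t)) integrable_on {\<tau> (n - 1)..\<tau> n}"
  "(\<lambda>t. inner (vpoly' (d n) (cP n) t) (vpoly k e t)) integrable_on {\<tau> (n - 1)..\<tau> n}"
  unfolding vpoly_def vpoly'_def by (intro integrable_continuous_real continuous_intros)+
 have "((\<lambda>t. inner (PP n t) (vpoly' k e t) + inner (vpoly' (d n) (cP n) t) (vpoly k e t)) has_integral
   inner (PP n (\<tau> n)) (vpoly k e (\<tau> n)) - inner (PP n (\<tau> (n - 1))) (vpoly k e (\<tau> (n - 1)))) {\<tau> (n - 1)..\<tau> n}"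
  by (rule fundamental_theorem_of_calculus[OF le], rule bounded_bilinear.has_vector_derivative[OF bounded_bilinear_inner])
   (rule vpoly_has_vector_derivative)+
 then show ?thesis using Henstock_Kurzweil_Integration.integral_add[OF i] by (simp add: integral_unique)
qed

lemma \<eta>_derivative_pairing:
 assumes n: "n \<in> {1..N}"
 shows "integral {\<tau> (n - 1)..\<tau> n} (\<lambda>t. inner (\<eta> t) (vpoly' k e t))
  = integral {\<tau> (n - 1)..\<tau> n} (\<lambda>t. inner (PP n t) (vpoly' k e t)) - integral {\<tau> (n - 1)..\<tau> n} (\<lambda>t. inner (u t) (vpoly' k e t))"
proof -
 have sub: "{\<tau> (n - 1)..\<tau> n} \<subseteq> {0..T}" using cell_in[OF n] by auto
 have c: "continuous_on {\<tau> (n - 1)..\<tau> n} u"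
  by (rule continuous_on_subset[OF _ sub]) (use solution in \<open>simp add: fractional_diffusion_solution_def\<close>)
 have "integral {\<tau> (n - 1)..\<tau> n} (\<lambda>t. inner (\<eta> t) (vpoly' k e t))
   = integral {\<tau> (n - 1)..\<tau> n} (\<lambda>t. inner (PP n t) (vpoly' k e t) - inner (u t) (vpoly' k e t))"
  by (rule integral_spike[of "{\<tau> (n - 1)}"]) (auto simp: \<eta>_cell[OF n] inner_diff_left)
 also have "\<dots> = integral {\<tau> (n - 1)..\<tau> n} (\<lambda>t. inner (PP n t) (vpoly' k e t)) - integral {\<tau> (n - 1)..\<tau> n} (\<lambda>t. inner (u t) (vpoly' k e t))"
  by (rule Henstock_Kurzweil_Integration.integral_diff; unfold vpoly_def vpoly'_def; intro integrable_continuous_real continuous_intros c)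
 finally show ?thesis .
qed

context
 fixes m :: nat
 assumes m: "m \<in> {1..N}"
begin

text \<open>On the first m cells alone, \<open>\<tau> m\<close> is the final node. The energy
  estimate bounds the error only there, so it is applied for every m.\<close>

lemma m_mesh: "frac_mesh \<tau> m \<alpha>"
 by unfold_locales (use \<alpha> \<tau>0 step_pos m in auto)

lemma m_form: "frac_mesh_form \<tau> m \<alpha> grad_form"
 by (rule frac_mesh_form.intro[OF m_mesh]) unfold_locales

lemma m_cross: "dg_cross \<tau> m \<alpha> grad_form d p Cp \<rho>"
proof (rule dg_cross.intro[OF m_form], unfold_locales)
 show "(poly q t)\<^sup>2 \<le> Cp / (b - a) * integral {a..b} (\<lambda>s. (poly q s)\<^sup>2)"
  if "degree q \<le> p" "a < b" "t \<in> {a..b}" for q :: "real poly" and a b t by (rule inv[OF that])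
 show "\<bar>poly (pderiv q) t\<bar> \<le> Cp / (b - a) * B"
  if "degree q \<le> p" "a < b" "t \<in> {a..b}" "!!s. s \<in> {a..b} ==> \<bar>poly q s\<bar> \<le> B" for q :: "real poly" and a b t B
  by (rule mark[OF that])
qed (use Cp dp \<rho> ratio m in auto)

lemma k1_le: "n \<in> {1..m} ==> \<tau> 1 - \<tau> 0 \<le> \<tau> n - \<tau> (n - 1)"
proof (induction n)
 case (Suc n)
 then show ?case using ratio(1)[of n] m by (cases n) auto
qed simp

text \<open>The mean over a cell is its length times a unit moment, so \<open>\<kappa>\<close> turns
  into \<open>\<kappa> * \<tau> N\<close>. The constant in the place of \<open>B\<close> is that of
  \<open>pairing_moment_bound\<close>; the third condition on \<open>\<kappa>\<close> turns its
  factor \<open>\<kappa>\<close> into D k^(1+\<alpha>/2), first on the smallest step and then on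
  every step.\<close>

lemma m_error: "dg_error \<tau> m \<alpha> grad_form d \<theta> p Cp \<rho> (H10 \<Omega>) \<eta> K D (real p * C\<^sub>\<Omega> * Cp\<^sup>2) (\<kappa> * \<tau> N)"
proof (rule dg_error.intro[OF m_cross])
 interpret m: dg_cross \<tau> m \<alpha> grad_form d \<theta> p Cp \<rho> by (rule m_cross)
 have mN: "n \<in> {1..N}" if "n \<in> {1..m}" for n using that m by auto
 have tm: "\<tau> m \<in> {0..T}" using cell_in[OF m, of "\<tau> m"] step_pos[OF m] by auto
 have tN: "\<tau> N \<ge> 0" using T_pos by (simp add: final_time)
 have step_le: "\<tau> n - \<tau> (n - 1) \<le> \<tau> N" if "n \<in> {1..N}" for n
  using node_nonneg[OF pred_le[OF that]] node_mono[of n N] that by auto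
 show "dg_error_axioms \<tau> m \<alpha> grad_form d \<theta> Cp (H10 \<Omega>) \<eta> K D (real p * C\<^sub>\<Omega> * Cp\<^sup>2) (\<kappa> * \<tau> N)"
 proof
  show "subspace (H10 \<Omega>)" by (rule subspace_H10)
  show "\<theta> n j \<in> H10 \<Omega>" if "n \<in> {1..m}" "j \<le> d n" for n j using \<theta>_H10[OF mN] that by simp
  show "K > 0" "D \<ge> 0" using K D by auto
  show "\<eta> 0 = 0" by (simp add: \<eta>_def glue_outside)
  show "0 \<le> real p * C\<^sub>\<Omega> * Cp\<^sup>2" using poincare_constant(1) by simp
  show "0 \<le> \<kappa> * \<tau> N" using \<kappa>(1) tN by simp
  have "\<kappa> * \<tau> N * real m \<le> \<kappa> * \<tau> N * real N" using m \<kappa>(1) tN by (intro mult_left_mono) auto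
  then show "\<kappa> * \<tau> N * real m \<le> D * (\<tau> 1 - \<tau> 0) powr (1 - \<alpha> / 2)" using \<kappa>(2) by linarith
  show "(\<lambda>s. grad_form (\<eta> s) w) \<in> borel_measurable (lebesgue_on {0..\<tau> m})" if "w \<in> H10 \<Omega>" for w
   by (rule \<eta>_pairing_measurable[OF that tm])
  show "\<bar>grad_form (\<eta> s) w\<bar> \<le> D * (\<tau> n - \<tau> (n - 1)) powr (- \<alpha> / 2) * grad.nrm w"
   if "n \<in> {1..m}" "s \<in> m.cell n" "w \<in> H10 \<Omega>" for n s w
   using P_bound[of grad_form n s w] \<eta>_cell[of n s] mN[OF that(1)] that by (simp add: m.cell_def)
  show "\<bar>integral {\<tau> (n - 1)..\<tau> n} (\<lambda>s. grad_form (\<eta> s) w)\<bar> \<le> \<kappa> * \<tau> N * grad.nrm w"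
   if n: "n \<in> {1..m}" and w: "w \<in> H10 \<Omega>" for n w
  proof (cases "(\<lambda>s. grad_form (\<eta> s) w) integrable_on {\<tau> (n - 1)..\<tau> n}")
   case True
   have step: "\<tau> (n - 1) < \<tau> n" using step_pos[OF mN[OF n]] by simp
   define k where "k = \<tau> n - \<tau> (n - 1)"
   have kp: "k > 0" using step by (simp add: k_def)
   have "integral {\<tau> (n - 1)..\<tau> n} (\<lambda>s. grad_form (\<eta> s) w) = k * integral {0..1} (\<lambda>y. grad_form (\<eta> (\<tau> (n - 1) + k * y)) w)"
    using integral_unit_interval_substitution[OF step True] kp by (simp add: k_def)
   also have "integral {0..1} (\<lambda>y. grad_form (\<eta> (\<tau> (n - 1) + k * y)) w)
     = integral {0..1} (\<lambda>y. y ^ 0 * grad_form (PP n (\<tau> (n - 1) + k * y) - u (\<tau> (n - 1) + k * y)) w)"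
   proof (rule integral_spike[of "{0}"])
    fix y :: real assume y: "y \<in> {0..1} - {0}"
    have "k * y \<le> k * 1" "0 < k * y" using kp y by (auto intro!: mult_left_mono)
    then have "\<tau> (n - 1) + k * y \<in> {\<tau> (n - 1)<..\<tau> n}" by (auto simp: k_def)
    from \<eta>_cell[OF mN[OF n] this] show "y ^ 0 * grad_form (PP n (\<tau> (n - 1) + k * y) - u (\<tau> (n - 1) + k * y)) w
      = grad_form (\<eta> (\<tau> (n - 1) + k * y)) w" by simp
   qed simp
   finally have e: "integral {\<tau> (n - 1)..\<tau> n} (\<lambda>s. grad_form (\<eta> s) w)
    = k * integral {0..1} (\<lambda>y. y ^ 0 * grad_form (PP n (\<tau> (n - 1) + k * y) - u (\<tau> (n - 1) + k * y)) w)" .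
   have "\<bar>integral {0..1} (\<lambda>y. y ^ 0 * grad_form (PP n (\<tau> (n - 1) + k * y) - u (\<tau> (n - 1) + k * y)) w)\<bar> \<le> \<kappa> * grad.nrm w"
    unfolding k_def by (rule P_moment) (use mN[OF n] dp[OF mN[OF n]] w in auto)
   then have "k * \<bar>integral {0..1} (\<lambda>y. y ^ 0 * grad_form (PP n (\<tau> (n - 1) + k * y) - u (\<tau> (n - 1) + k * y)) w)\<bar> \<le> \<tau> N * (\<kappa> * grad.nrm w)"
    by (intro mult_mono) (use step_le[OF mN[OF n]] tN in \<open>auto simp: k_def\<close>)
   then show ?thesis unfolding e abs_mult using kp by (simp add: mult_ac)
  next
   case False
   then show ?thesis using \<kappa>(1) tN by (simp add: not_integrable_integral)
  qed
  show "\<bar>integral {\<tau> (n - 1)..\<tau> n} (\<lambda>t. inner (\<eta> t) (vpoly' (d n) (\<theta> n) t))\<bar>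
    \<le> real p * C\<^sub>\<Omega> * Cp\<^sup>2 * D * (\<tau> n - \<tau> (n - 1)) powr (1 + \<alpha> / 2) * m.cross_sup n"
   if n: "n \<in> {1..m}" for n
  proof -
   have step: "\<tau> (n - 1) < \<tau> n" using step_pos[OF mN[OF n]] by simp
   define k where "k = \<tau> n - \<tau> (n - 1)"
   have kp: "k > 0" using step by (simp add: k_def)
   have at: "\<eta> (\<tau> (n - 1) + k * y) = PP n (\<tau> (n - 1) + k * y) - u (\<tau> (n - 1) + k * y)" if y: "y \<in> {0..1} - {0}" for y
   proof -
    have "k * y \<le> k * 1" "0 < k * y" using kp y by (auto intro!: mult_left_mono)
    then have "\<tau> (n - 1) + k * y \<in> {\<tau> (n - 1)<..\<tau> n}" by (auto simp: k_def)
    then show ?thesis by (rule \<eta>_cell[OF mN[OF n]])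
   qed
   have cont: "continuous_on {0..1} (\<lambda>y. u (\<tau> (n - 1) + k * y))"
   proof (rule continuous_on_compose2[where g = u and t = "{0..T}"])
    show "continuous_on {0..T} u" using solution by (simp add: fractional_diffusion_solution_def)
    have "\<tau> (n - 1) + k * y \<in> {0..T}" if "y \<in> {0..1}" for y
    proof (rule cell_in[OF mN[OF n]])
     have "k * y \<le> k * 1" "0 \<le> k * y" using kp that by (auto intro!: mult_left_mono)
     then show "\<tau> (n - 1) + k * y \<in> {\<tau> (n - 1)..\<tau> n}" by (auto simp: k_def)
    qed
    then show "(\<lambda>y. \<tau> (n - 1) + k * y) ` {0..1} \<subseteq> {0..T}" by auto
   qed (intro continuous_intros)
   have "\<bar>integral {\<tau> (n - 1)..\<tau> n} (\<lambda>t. inner (\<eta> t) (vpoly' (d n) (\<theta> n) t))\<bar> \<le> \<kappa> * real p * C\<^sub>\<Omega> * Cp\<^sup>2 * m.cross_sup n"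
   proof (rule m.pairing_moment_bound[where h = inner and V = "H10 \<Omega>"])
    show "psd_form (inner :: 'a l2 \<Rightarrow> 'a l2 \<Rightarrow> real)" by (rule inner_form.psd_form_axioms)
    show "\<bar>coeff q i\<bar> \<le> Cp * B" if "degree q \<le> p" "!!s. s \<in> {0..1} ==> \<bar>poly q s\<bar> \<le> B" for q :: "real poly" and i B
     by (rule coefficient[OF that])
    show "psd_form.nrm inner w \<le> C\<^sub>\<Omega> * grad.nrm w" if "w \<in> H10 \<Omega>" for w using poincare_constant(2)[OF that] by (simp add: nrm_inner)
    fix j w assume w: "w \<in> H10 \<Omega>"
    have spike: "integral {0..1} (\<lambda>y. y ^ j * inner (\<eta> (\<tau> (n - 1) + k * y)) w)
      = integral {0..1} (\<lambda>y. y ^ j * inner (PP n (\<tau> (n - 1) + k * y) - u (\<tau> (n - 1) + k * y)) w)"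
     by (rule integral_spike[of "{0}"]) (use at in auto)
    have "(\<lambda>y. y ^ j * inner (PP n (\<tau> (n - 1) + k * y) - u (\<tau> (n - 1) + k * y)) w) integrable_on {0..1}"
     unfolding vpoly_def by (intro integrable_continuous_real continuous_intros cont)
    then show "(\<lambda>y. y ^ j * inner (\<eta> (\<tau> (n - 1) + (\<tau> n - \<tau> (n - 1)) * y)) w) integrable_on {0..1}"
     unfolding k_def[symmetric] by (rule integrable_spike_finite[of "{0}", rotated 2]) (use at in auto)
    show "\<bar>integral {0..1} (\<lambda>y. y ^ j * inner (\<eta> (\<tau> (n - 1) + (\<tau> n - \<tau> (n - 1)) * y)) w)\<bar> \<le> \<kappa> * psd_form.nrm inner w"
     if "j < d n"
     unfolding k_def[symmetric] spike unfolding k_def by (rule P_moment) (use mN[OF n] that w in auto)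
   qed (use subspace_H10 \<theta>_H10 mN[OF n] n poincare_constant(1) \<kappa>(1) in auto)
   also have "\<dots> = (real p * C\<^sub>\<Omega> * Cp\<^sup>2 * m.cross_sup n) * \<kappa>" by simp
   also have "\<dots> \<le> (real p * C\<^sub>\<Omega> * Cp\<^sup>2 * m.cross_sup n) * (D * (\<tau> n - \<tau> (n - 1)) powr (1 + \<alpha> / 2))"
   proof (rule mult_left_mono)
    have "(\<tau> 1 - \<tau> 0) powr (1 + \<alpha> / 2) \<le> (\<tau> n - \<tau> (n - 1)) powr (1 + \<alpha> / 2)"
     by (rule powr_mono2) (use \<alpha> k1_le[OF n] step_pos[of 1] m in auto)
    then have "D * (\<tau> 1 - \<tau> 0) powr (1 + \<alpha> / 2) \<le> D * (\<tau> n - \<tau> (n - 1)) powr (1 + \<alpha> / 2)" by (intro mult_left_mono D)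
    then show "\<kappa> \<le> D * (\<tau> n - \<tau> (n - 1)) powr (1 + \<alpha> / 2)" using \<kappa>(3) by linarith
    show "0 \<le> real p * C\<^sub>\<Omega> * Cp\<^sup>2 * m.cross_sup n" using poincare_constant(1) m.cross_sup_nonneg[OF n] by simp
   qed
   finally show ?thesis by (simp add: mult_ac)
  qed
  show "continuous_on {0..\<tau> m} (\<lambda>t. frac_integral \<alpha> (\<lambda>s. grad_form (\<eta> s) w) t)" if w: "w \<in> H10 \<Omega>" for w
  proof (rule continuous_on_subset[of "{0..T}"])
   have "continuous_on {0..T} (\<lambda>t. memory (omega (\<alpha> + 1)) (glue (\<lambda>n. vpoly (d n) (cP n))) t w - exact_memory t w)"
    by (intro continuous_on_diff memory_omega_continuous exact_memory_continuous[OF w])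
   then show "continuous_on {0..T} (\<lambda>t. frac_integral \<alpha> (\<lambda>s. grad_form (\<eta> s) w) t)"
    by (rule continuous_on_eq) (simp add: frac_integral_\<eta>[OF w])
  qed (use tm in auto)
 qed
qed

interpretation m: dg_error \<tau> m \<alpha> grad_form d \<theta> p Cp \<rho> "H10 \<Omega>" \<eta> K D "real p * C\<^sub>\<Omega> * Cp\<^sup>2" "\<kappa> * \<tau> N"
 by (rule m_error)

text \<open>By causality the memory up to \<open>\<tau> m\<close> sees only the first m cells, where
  the truncated and the full function agree. The rest is linearity.\<close>

lemma memory_split:
 assumes t: "t \<le> \<tau> m"
 shows "memory (omega (\<alpha> + 1)) (frac_mesh.glue \<tau> m (\<lambda>n. vpoly (d n) (\<theta> n))) t w
  = memory (omega (\<alpha> + 1)) (glue (\<lambda>n. vpoly (d n) (c n))) t w - memory (omega (\<alpha> + 1)) (glue (\<lambda>n. vpoly (d n) (cP n))) t w"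
proof -
 have "memory (omega (\<alpha> + 1)) (frac_mesh.glue \<tau> m (\<lambda>n. vpoly (d n) (\<theta> n))) t w = memory (omega (\<alpha> + 1)) (glue (\<lambda>n. vpoly (d n) (\<theta> n))) t w"
  unfolding memory_def by (rule integral_cong) (use glue_truncate[of m _ "\<lambda>n. vpoly (d n) (\<theta> n)"] m t in auto)
 then show ?thesis
  by (simp only: memory_omega \<theta>_def grad.diff_left right_diff_distrib sum_subtractf)
qed

text \<open>The scheme minus the exact equation, tested with \<theta>. After
  \<open>projection_by_parts\<close> the nodal terms of P and u cancel at the right node, where P
  interpolates; at the left node they combine with the scheme's jump to that of \<theta>.\<close>

lemma error_equation:
 assumes n: "n \<in> {1..m}"
 shows "inner (m.jump n) (vpoly (d n) (\<theta> n) (\<tau> (n - 1)))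
   + integral {\<tau> (n - 1)..\<tau> n} (\<lambda>t. inner (vpoly' (d n) (\<theta> n) t) (vpoly (d n) (\<theta> n) t))
   + K * bracket (memory (omega (\<alpha> + 1)) (frac_mesh.glue \<tau> m (\<lambda>n. vpoly (d n) (\<theta> n)))) n (d n) (\<theta> n)
  = integral {\<tau> (n - 1)..\<tau> n} (\<lambda>t. inner (\<eta> t) (vpoly' (d n) (\<theta> n) t)) - K * bracket m.defect n (d n) (\<theta> n)"
proof -
 have nN: "n \<in> {1..N}" using n m by auto
 have sub: "t \<in> {0..T}" "t \<le> \<tau> m" if "t \<in> {\<tau> (n - 1)..\<tau> n}" for t
  using cell_in[OF nN that] that node_mono[of n m] n m by auto
 have tH: "vpoly (d n) (\<theta> n) t \<in> H10 \<Omega>" "vpoly' (d n) (\<theta> n) t \<in> H10 \<Omega>" for t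
  by (rule vpoly_mem[OF subspace_H10 \<theta>_H10[OF nN]], assumption, rule vpoly'_mem[OF subspace_H10 \<theta>_H10[OF nN]])
 have 1: "bracket (memory (omega (\<alpha> + 1)) (frac_mesh.glue \<tau> m (\<lambda>n. vpoly (d n) (\<theta> n)))) n (d n) (\<theta> n)
  = bracket (memory (omega (\<alpha> + 1)) (glue (\<lambda>n. vpoly (d n) (c n)))) n (d n) (\<theta> n)
   - bracket (memory (omega (\<alpha> + 1)) (glue (\<lambda>n. vpoly (d n) (cP n)))) n (d n) (\<theta> n)"
  by (rule bracket_diff[OF nN]; (rule memory_vpoly'_integrable)?) (use memory_split sub in auto)
 have 2: "bracket m.defect n (d n) (\<theta> n) = bracket (memory (omega (\<alpha> + 1)) (glue (\<lambda>n. vpoly (d n) (cP n)))) n (d n) (\<theta> n)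
   - bracket exact_memory n (d n) (\<theta> n)"
 proof (rule bracket_diff[OF nN]; (rule memory_vpoly'_integrable)?)
  show "(\<lambda>t. exact_memory t (vpoly' (d n) (\<theta> n) t)) integrable_on {\<tau> (n - 1)..\<tau> n}"
   by (rule exact_memory_vpoly'_integrable[OF nN \<theta>_H10[OF nN]])
 qed (use frac_integral_\<eta> tH sub in \<open>auto simp: m.defect_def\<close>)
 have 3: "m.jump n = UU n (\<tau> (n - 1)) - PP n (\<tau> (n - 1)) - (previous c n - u (\<tau> (n - 1)))"
 proof (cases "n = 1")
  case True
  then show ?thesis by (simp add: m.jump_def \<theta>_eq previous_def \<tau>0)
 next
  case False
  then have "n - 1 \<in> {1..N}" using nN by auto
  from P_node[OF this] show ?thesis using False by (simp add: m.jump_def \<theta>_eq previous_def)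
 qed
 have i: "integral {\<tau> (n - 1)..\<tau> n} (\<lambda>t. inner (vpoly' (d n) (\<theta> n) t) (vpoly (d n) (\<theta> n) t))
  = integral {\<tau> (n - 1)..\<tau> n} (\<lambda>t. inner (vpoly' (d n) (c n) t) (vpoly (d n) (\<theta> n) t))
   - integral {\<tau> (n - 1)..\<tau> n} (\<lambda>t. inner (vpoly' (d n) (cP n) t) (vpoly (d n) (\<theta> n) t))"
  unfolding \<theta>'_eq inner_diff_left
  by (rule Henstock_Kurzweil_Integration.integral_diff; unfold vpoly_def vpoly'_def; intro integrable_continuous_real continuous_intros)
 have w: "inner (UU n (\<tau> (n - 1)) - previous c n) (vpoly (d n) (\<theta> n) (\<tau> (n - 1)))
   + integral {\<tau> (n - 1)..\<tau> n} (\<lambda>t. inner (vpoly' (d n) (c n) t) (vpoly (d n) (\<theta> n) t))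
   + K * bracket (memory (omega (\<alpha> + 1)) (glue (\<lambda>n. vpoly (d n) (c n)))) n (d n) (\<theta> n)
  = bracket (\<lambda>t. inner (u t)) n (d n) (\<theta> n) + K * bracket exact_memory n (d n) (\<theta> n)"
  by (rule weak_equation[OF cH cU nN \<theta>_H10[OF nN]])
 have b: "bracket (\<lambda>t. inner (u t)) n (d n) (\<theta> n) = inner (u (\<tau> n)) (vpoly (d n) (\<theta> n) (\<tau> n))
   - inner (u (\<tau> (n - 1))) (vpoly (d n) (\<theta> n) (\<tau> (n - 1))) - integral {\<tau> (n - 1)..\<tau> n} (\<lambda>t. inner (u t) (vpoly' (d n) (\<theta> n) t))"
  by (simp add: bracket_def)
 show ?thesis
  using w unfolding 1 2 3 i b projection_by_parts[OF nN] \<eta>_derivative_pairing[OF nN] P_node[OF nN]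
  by (simp only: inner_diff_left right_diff_distrib)
qed

text \<open>The constant of \<open>energy_estimate\<close> without the factors
  \<open>\<tau> m\<close> and D^2, written out in the data to show that it depends neither on m and
  N nor on the solution.\<close>

definition stab_const :: real where
 "stab_const = 4 * (real p * C\<^sub>\<Omega> * Cp\<^sup>2 + K * (1 + Cp) * (2 / Gamma (\<alpha> + 1) + 2 powr (\<alpha> + 1) / Gamma (\<alpha> + 2)))\<^sup>2
  * (Cp\<^sup>2 * (1 + \<rho>) powr (1 - \<alpha>) * Gamma (\<alpha> + 1) / (- \<alpha>) + Cp * Gamma (\<alpha> + 1)) / K"

lemma stability:
 "(norm (vpoly (d m) (\<theta> m) (\<tau> m)))\<^sup>2 + (\<Sum>n\<in>{1..m}. (norm (m.jump n))\<^sup>2) + 2 * K * m.energy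
  \<le> stab_const * \<tau> m * D\<^sup>2"
proof -
 have "(norm (vpoly (d m) (\<theta> m) (\<tau> m)))\<^sup>2 + (\<Sum>n\<in>{1..m}. (norm (m.jump n))\<^sup>2) + 2 * K * m.energy
  \<le> 4 * m.Cr\<^sup>2 * m.Ce * \<tau> m / K * D\<^sup>2"
  by (rule m.energy_estimate) (rule error_equation)
 then show ?thesis unfolding m.Cr_def m.Ce_def m.Cf_def stab_const_def by (simp add: mult_ac)
qed

lemma stab_const_nonneg: "stab_const \<ge> 0"
proof -
 have "stab_const = 4 * m.Cr\<^sup>2 * m.Ce / K"
  unfolding m.Cr_def m.Ce_def m.Cf_def stab_const_def ..
 then show ?thesis using m.Ce_pos K by simp
qed

lemma node_bound: "norm (vpoly (d m) (\<theta> m) (\<tau> m)) \<le> sqrt (stab_const * T) * D"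
 and jump_bound: "norm (m.jump m) \<le> sqrt (stab_const * T) * D"
 and energy_bound: "2 * K * m.energy \<le> stab_const * \<tau> m * D\<^sup>2"
proof -
 have e: "m.energy \<ge> 0"
  by (rule m.energy_nonneg) (rule error_equation)
 then have e: "2 * K * m.energy \<ge> 0" using K by simp
 have j: "(norm (m.jump m))\<^sup>2 \<le> (\<Sum>n\<in>{1..m}. (norm (m.jump n))\<^sup>2)"
  by (rule member_le_sum) (use m in auto)
 have s0: "0 \<le> (\<Sum>n\<in>{1..m}. (norm (m.jump n))\<^sup>2)" by (intro sum_nonneg) auto
 have "\<tau> m \<le> T" using node_mono[of m N] m by (simp add: final_time)
 then have "stab_const * \<tau> m * D\<^sup>2 \<le> stab_const * T * D\<^sup>2"
  using stab_const_nonneg by (intro mult_right_mono mult_left_mono) auto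
 also have "\<dots> = (sqrt (stab_const * T) * D)\<^sup>2"
  using stab_const_nonneg T_pos by (simp add: power_mult_distrib)
 finally have t: "stab_const * \<tau> m * D\<^sup>2 \<le> (sqrt (stab_const * T) * D)\<^sup>2" .
 have n0: "0 \<le> sqrt (stab_const * T) * D" using stab_const_nonneg T_pos D by simp
 show "norm (vpoly (d m) (\<theta> m) (\<tau> m)) \<le> sqrt (stab_const * T) * D"
  by (rule power2_le_imp_le[OF _ n0]) (use stability e s0 t in linarith)
 show "norm (m.jump m) \<le> sqrt (stab_const * T) * D"
  by (rule power2_le_imp_le[OF _ n0]) (use stability e j t zero_le_power2[of "norm (vpoly (d m) (\<theta> m) (\<tau> m))"] in linarith)
 show "2 * K * m.energy \<le> stab_const * \<tau> m * D\<^sup>2"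
  using stability s0 zero_le_power2[of "norm (vpoly (d m) (\<theta> m) (\<tau> m))"] by linarith
qed

text \<open>The energy divided by \<open>omega (\<alpha> + 1) (\<tau> m)\<close> bounds the mass of
  the last cell, and the inverse inequality costs 1 / k_m. The energy estimate itself carries a
  factor \<tau> m, which leaves the quotient \<tau> m / k_m.\<close>

lemma gradient_bound:
 assumes t: "t \<in> {\<tau> (m - 1)..\<tau> m}"
 shows "grad.nrm (vpoly (d m) (\<theta> m) t)
  \<le> sqrt (Cp * stab_const * Gamma (\<alpha> + 1) * T powr (- \<alpha>) / K) * sqrt (\<tau> m / (\<tau> m - \<tau> (m - 1))) * D"
proof (rule power2_le_imp_le)
 let ?k = "\<tau> m - \<tau> (m - 1)"
 have k: "?k > 0" using step_pos[OF m] by simp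
 have tm: "\<tau> m > 0" "\<tau> m \<le> T" using k node_nonneg[OF pred_le[OF m]] node_mono[of m N] m by (auto simp: final_time)
 have G: "Gamma (\<alpha> + 1) > 0" using \<alpha> by (simp add: Gamma_real_pos)
 have w: "omega (\<alpha> + 1) (\<tau> m) > 0" using tm G by (simp add: omega_eq)
 have "m.last_mass * omega (\<alpha> + 1) (\<tau> m) \<le> 2 * m.energy" using m.energy_bounds(1) by (simp add: mult.commute)
 then have "m.last_mass \<le> 2 * m.energy / omega (\<alpha> + 1) (\<tau> m)" using w by (simp add: pos_le_divide_eq)
 also have "\<dots> = 2 * m.energy * (Gamma (\<alpha> + 1) * \<tau> m powr (- \<alpha>))"
  by (simp add: omega_eq powr_minus divide_inverse)
 also have "\<dots> \<le> (stab_const * \<tau> m * D\<^sup>2 / K) * (Gamma (\<alpha> + 1) * T powr (- \<alpha>))"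
 proof (rule mult_mono)
  show "2 * m.energy \<le> stab_const * \<tau> m * D\<^sup>2 / K" using energy_bound K by (simp add: pos_le_divide_eq mult_ac)
  show "Gamma (\<alpha> + 1) * \<tau> m powr (- \<alpha>) \<le> Gamma (\<alpha> + 1) * T powr (- \<alpha>)"
   using G tm \<alpha> by (intro mult_left_mono powr_mono2) auto
 qed (use stab_const_nonneg tm K G in auto)
 finally have lm: "m.last_mass \<le> (stab_const * \<tau> m * D\<^sup>2 / K) * (Gamma (\<alpha> + 1) * T powr (- \<alpha>))" .
 have "(grad.nrm (vpoly (d m) (\<theta> m) t))\<^sup>2 \<le> Cp / m.stp m * m.last_mass" by (rule m.last_bound[OF t])
 also have "\<dots> \<le> Cp / ?k * ((stab_const * \<tau> m * D\<^sup>2 / K) * (Gamma (\<alpha> + 1) * T powr (- \<alpha>)))"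
  unfolding m.stp_def using k Cp by (intro mult_left_mono lm) auto
 also have "\<dots> = (Cp * stab_const * Gamma (\<alpha> + 1) * T powr (- \<alpha>) / K) * (\<tau> m / ?k) * D\<^sup>2" by (simp add: mult_ac)
 also have "\<dots> = (sqrt (Cp * stab_const * Gamma (\<alpha> + 1) * T powr (- \<alpha>) / K) * sqrt (\<tau> m / ?k) * D)\<^sup>2"
  using Cp stab_const_nonneg G K k tm by (simp add: power_mult_distrib)
 finally show "(grad.nrm (vpoly (d m) (\<theta> m) t))\<^sup>2 \<le> (sqrt (Cp * stab_const * Gamma (\<alpha> + 1) * T powr (- \<alpha>) / K) * sqrt (\<tau> m / ?k) * D)\<^sup>2" .
 show "0 \<le> sqrt (Cp * stab_const * Gamma (\<alpha> + 1) * T powr (- \<alpha>) / K) * sqrt (\<tau> m / ?k) * D"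
  using Cp stab_const_nonneg G K k tm D by simp
qed

text \<open>The bound for pairings is tested with the error itself, which lies in
  \<open>H10\<close>.\<close>

lemma projection_error:
 assumes t: "t \<in> {\<tau> (m - 1)<..\<tau> m}"
 shows "norm (PP m t - u t) \<le> T powr (- \<alpha> / 2) * D"
proof -
 let ?k = "\<tau> m - \<tau> (m - 1)" and ?e = "PP m t - u t"
 have k: "?k > 0" "?k \<le> T"
  using step_pos[OF m] node_nonneg[OF pred_le[OF m]] node_mono[of m N] m by (auto simp: final_time)
 have "t \<in> {0<..T}" using t node_nonneg[OF pred_le[OF m]] node_mono[of m N] m by (auto simp: final_time)
 then have e: "?e \<in> H10 \<Omega>"
  by (intro subspace_diff[OF subspace_H10] vpoly_mem[OF subspace_H10] PH[OF m] u_H10)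
 have "\<bar>inner ?e ?e\<bar> \<le> D * ?k powr (- \<alpha> / 2) * norm ?e"
  using P_bound[of inner m t ?e] m t e by (simp add: nrm_inner)
 then have "norm ?e * norm ?e \<le> D * ?k powr (- \<alpha> / 2) * norm ?e" by (simp add: dot_square_norm power2_eq_square)
 then have "norm ?e \<le> D * ?k powr (- \<alpha> / 2)"
  using D by (cases "norm ?e = 0") (auto simp: mult_le_cancel_right)
 also have "\<dots> \<le> D * T powr (- \<alpha> / 2)" using k \<alpha> by (intro mult_left_mono powr_mono2 D) auto
 finally show ?thesis by (simp add: mult.commute)
qed

end

text \<open>Convexity of the norm along a segment. This is how degree 1 avoids the loss of
  N^(1/2).\<close>

lemma linear_segment_bound:
 fixes X :: "real \<Rightarrow> 'b::real_normed_vector"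
 assumes "r < s" "t \<in> {r..s}" "norm (vpoly 1 e r) \<le> B" "norm (vpoly 1 e s) \<le> B"
 shows "norm (vpoly 1 e t :: 'b) \<le> B"
proof -
 define l where "l = (t - r) / (s - r)"
 have "l * (s - r) = t - r" using assms(1) by (simp add: l_def)
 then have "t = (1 - l) * r + l * s" by (simp add: algebra_simps)
 moreover have "0 \<le> l" "l \<le> 1" using assms(1,2) by (auto simp: l_def)
 ultimately have l: "0 \<le> l" "l \<le> 1" "t = (1 - l) * r + l * s" by auto
 have "vpoly 1 e t = (1 - l) *\<^sub>R vpoly 1 e r + l *\<^sub>R vpoly 1 e s"
  unfolding l(3) by (simp add: vpoly_def algebra_simps flip: scaleR_add_left)
 then have "norm (vpoly 1 e t) \<le> (1 - l) * norm (vpoly 1 e r) + l * norm (vpoly 1 e s)"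
  using norm_triangle_ineq[of "(1 - l) *\<^sub>R vpoly 1 e r" "l *\<^sub>R vpoly 1 e s"] l by simp
 also have "\<dots> \<le> (1 - l) * B + l * B" using l assms by (intro add_mono mult_left_mono) auto
 finally show ?thesis by (simp add: algebra_simps)
qed

text \<open>In general \<theta> is bounded by its gradient and Poincare's inequality. For degree 1
  the two end points suffice; the left one is reached from the previous node across a jump, which
  doubles the constant.\<close>

lemma cell_error:
 assumes m: "m \<in> {1..N}" and t: "t \<in> {\<tau> (m - 1)<..<\<tau> m}"
 shows "norm (U t - u t) \<le> (C\<^sub>\<Omega> * sqrt (Cp * stab_const * Gamma (\<alpha> + 1) * T powr (- \<alpha>) / K)
   * sqrt (\<tau> m / (\<tau> m - \<tau> (m - 1))) + T powr (- \<alpha> / 2)) * D"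
  and "d m = 1 ==> norm (U t - u t) \<le> (2 * sqrt (stab_const * T) + T powr (- \<alpha> / 2)) * D"
proof -
 let ?\<theta> = "vpoly (d m) (\<theta> m)"
 have split: "norm (U t - u t) \<le> norm (?\<theta> t) + T powr (- \<alpha> / 2) * D"
  using norm_triangle_ineq[of "?\<theta> t" "PP m t - u t"] projection_error[OF m, of t] cU[OF m t] t by (simp add: \<theta>_eq)
 have "norm (?\<theta> t) \<le> C\<^sub>\<Omega> * grad.nrm (?\<theta> t)"
  by (rule poincare_constant(2)[OF vpoly_mem[OF subspace_H10 \<theta>_H10[OF m]]])
 also have "\<dots> \<le> C\<^sub>\<Omega> * (sqrt (Cp * stab_const * Gamma (\<alpha> + 1) * T powr (- \<alpha>) / K)
   * sqrt (\<tau> m / (\<tau> m - \<tau> (m - 1))) * D)"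
  by (rule mult_left_mono[OF gradient_bound[OF m]]) (use t poincare_constant in auto)
 finally show "norm (U t - u t) \<le> (C\<^sub>\<Omega> * sqrt (Cp * stab_const * Gamma (\<alpha> + 1) * T powr (- \<alpha>) / K)
   * sqrt (\<tau> m / (\<tau> m - \<tau> (m - 1))) + T powr (- \<alpha> / 2)) * D"
  using split by (simp add: algebra_simps)
 assume d1: "d m = 1"
 let ?B = "sqrt (stab_const * T) * D"
 have B0: "?B \<ge> 0" using stab_const_nonneg[OF m] T_pos D by simp
 have "norm (?\<theta> (\<tau> (m - 1))) \<le> 2 * ?B"
 proof (cases "m = 1")
  case True
  then show ?thesis using jump_bound[OF m] B0 unfolding dg_error.jump_def[OF m_error[OF m]] by simp
 next
  case False
  then have m': "m - 1 \<in> {1..N}" using m by auto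
  have "norm (?\<theta> (\<tau> (m - 1)) - vpoly (d (m - 1)) (\<theta> (m - 1)) (\<tau> (m - 1))) \<le> ?B"
   using jump_bound[OF m] False unfolding dg_error.jump_def[OF m_error[OF m]] by simp
  then show ?thesis
   using node_bound[OF m'] norm_triangle_sub[of "?\<theta> (\<tau> (m - 1))" "vpoly (d (m - 1)) (\<theta> (m - 1)) (\<tau> (m - 1))"] by linarith
 qed
 moreover have "norm (?\<theta> (\<tau> m)) \<le> 2 * ?B" using node_bound[OF m] B0 by linarith
 ultimately have "norm (?\<theta> t) \<le> 2 * ?B"
  unfolding d1 using linear_segment_bound[of "\<tau> (m - 1)" "\<tau> m" t "\<theta> m" "2 * ?B"] t by auto
 then show "norm (U t - u t) \<le> (2 * sqrt (stab_const * T) + T powr (- \<alpha> / 2)) * D"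
  using split by (simp add: algebra_simps)
qed

end

section \<open>Graded meshes\<close>

locale graded =
 fixes T \<gamma> :: real and N :: nat
 assumes T: "T > 0" and \<gamma>: "\<gamma> \<ge> 1" and N: "N \<ge> 1"
begin

definition h :: real where "h = T powr (1 / \<gamma>) / real N"

abbreviation \<tau> :: "nat \<Rightarrow> real" where "\<tau> \<equiv> graded_mesh T \<gamma> N"

lemma h_pos: "h > 0" using T N by (simp add: h_def)

lemma h_le: "h \<le> T powr (1 / \<gamma>)"
 using N T by (simp add: h_def divide_le_eq mult_le_cancel_left1)

lemma node_eq: "\<tau> n = (real n * h) powr \<gamma>" by (simp add: graded_mesh_def h_def)

lemma node_0: "\<tau> 0 = 0" by (simp add: node_eq)

lemma node_N: "\<tau> N = T" using T N \<gamma> by (simp add: node_eq h_def powr_powr)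

lemma node_1: "\<tau> 1 = h powr \<gamma>" by (simp add: node_eq)

text \<open>Uses x^\<gamma> = x x^(\<gamma>-1) at both nodes and monotonicity of the second factor,
  which also covers the first cell.\<close>

lemma step_lower: "n \<ge> 1 ==> h * (real n * h) powr (\<gamma> - 1) \<le> \<tau> n - \<tau> (n - 1)"
proof -
 assume n: "n \<ge> 1"
 have split: "x powr \<gamma> = x * x powr (\<gamma> - 1)" if "x \<ge> 0" for x
  using powr_mult_base[OF that, of "\<gamma> - 1"] by simp
 have "(real (n - 1) * h) powr (\<gamma> - 1) \<le> (real n * h) powr (\<gamma> - 1)"
  using h_pos \<gamma> by (intro powr_mono2) auto
 then have "(real (n - 1) * h) * (real (n - 1) * h) powr (\<gamma> - 1) \<le> (real (n - 1) * h) * (real n * h) powr (\<gamma> - 1)"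
  using h_pos by (intro mult_left_mono) auto
 moreover have "real n * h = real (n - 1) * h + h" using n by (simp add: of_nat_diff algebra_simps)
 ultimately show ?thesis
  unfolding node_eq using split[of "real n * h"] split[of "real (n - 1) * h"] h_pos
  by (simp add: distrib_right)
qed

lemma step_pos:
 assumes "n \<ge> 1"
 shows "\<tau> (n - 1) < \<tau> n"
proof -
 have "(real n * h) powr (\<gamma> - 1) > 0" using h_pos assms by simp
 then have "0 < h * (real n * h) powr (\<gamma> - 1)" using h_pos by (rule mult_pos_pos[rotated])
 then show ?thesis using step_lower[OF assms] by linarith
qed

text \<open>With n >= 2 the interval stays away from 0, so the power is differentiable on all of
  it.\<close>

lemma step_mean_value:
 assumes "n \<ge> 2"
 obtains \<xi> where "real (n - 1) * h < \<xi>" "\<xi> < real n * h" "\<tau> n - \<tau> (n - 1) = h * (\<gamma> * \<xi> powr (\<gamma> - 1))"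
proof -
 have lt: "real (n - 1) * h < real n * h" using h_pos assms by simp
 have pos: "real (n - 1) * h > 0" using h_pos assms by simp
 have "\<exists>z>real (n - 1) * h. z < real n * h \<and> (real n * h) powr \<gamma> - (real (n - 1) * h) powr \<gamma>
   = (real n * h - real (n - 1) * h) * (\<gamma> * z powr (\<gamma> - 1))"
 proof (rule MVT2[OF lt])
  fix x assume "real (n - 1) * h \<le> x"
  then have "x > 0" using pos by linarith
  then show "((\<lambda>x. x powr \<gamma>) has_real_derivative \<gamma> * x powr (\<gamma> - 1)) (at x)" by (rule has_real_derivative_powr)
 qed
 then obtain z where z: "real (n - 1) * h < z" "z < real n * h" "(real n * h) powr \<gamma> - (real (n - 1) * h) powr \<gamma>
   = (real n * h - real (n - 1) * h) * (\<gamma> * z powr (\<gamma> - 1))" by blast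
 have "real n * h - real (n - 1) * h = h" using assms by (simp add: of_nat_diff algebra_simps)
 then show ?thesis using that[of z] z unfolding node_eq by simp
qed

lemma step_upper:
 assumes "n \<ge> 1"
 shows "\<tau> n - \<tau> (n - 1) \<le> h * (\<gamma> * (real n * h) powr (\<gamma> - 1))"
proof (cases "n = 1")
 case True
 have "h powr \<gamma> = h * h powr (\<gamma> - 1)" using powr_mult_base[of h "\<gamma> - 1"] h_pos by simp
 moreover have "h powr (\<gamma> - 1) \<le> \<gamma> * h powr (\<gamma> - 1)" using mult_right_mono[OF \<gamma>, of "h powr (\<gamma> - 1)"] by simp
 ultimately show ?thesis using True h_pos by (simp add: node_eq)
next
 case False
 then have "n \<ge> 2" using assms by simp
 then obtain \<xi> where \<xi>: "real (n - 1) * h < \<xi>" "\<xi> < real n * h" "\<tau> n - \<tau> (n - 1) = h * (\<gamma> * \<xi> powr (\<gamma> - 1))"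
  by (rule step_mean_value)
 have "0 \<le> real (n - 1) * h" using h_pos by simp
 then have "0 \<le> \<xi>" using \<xi>(1) by linarith
 then have "\<xi> powr (\<gamma> - 1) \<le> (real n * h) powr (\<gamma> - 1)" using \<xi>(2) \<gamma> by (intro powr_mono2) auto
 then show ?thesis unfolding \<xi>(3) using \<gamma> h_pos by (intro mult_left_mono) auto
qed

lemma step_next: "n \<ge> 1 ==> h * (\<gamma> * (real n * h) powr (\<gamma> - 1)) \<le> \<tau> (n + 1) - \<tau> n"
proof -
 assume n: "n \<ge> 1"
 then obtain \<xi> where \<xi>: "real (n + 1 - 1) * h < \<xi>" "\<xi> < real (n + 1) * h" "\<tau> (n + 1) - \<tau> (n + 1 - 1) = h * (\<gamma> * \<xi> powr (\<gamma> - 1))"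
  using step_mean_value[of "n + 1"] by auto
 have "(real n * h) powr (\<gamma> - 1) \<le> \<xi> powr (\<gamma> - 1)" using \<xi> \<gamma> h_pos by (intro powr_mono2) auto
 then show ?thesis using \<xi>(3) h_pos \<gamma> by simp
qed

lemma step_mono: "n \<ge> 1 ==> \<tau> n - \<tau> (n - 1) \<le> \<tau> (n + 1) - \<tau> n"
 using step_upper[of n] step_next[of n] by linarith

text \<open>The upper bound for the next step and the lower bound for this one are compared through
  (n + 1) h <= 2 n h.\<close>

lemma step_ratio:
 assumes "n \<ge> 1"
 shows "\<tau> (n + 1) - \<tau> n \<le> (\<gamma> * 2 powr (\<gamma> - 1)) * (\<tau> n - \<tau> (n - 1))"
proof -
 have "(real (n + 1) * h) powr (\<gamma> - 1) \<le> (2 * (real n * h)) powr (\<gamma> - 1)"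
 proof (rule powr_mono2)
  have "real (n + 1) * h \<le> (2 * real n) * h" using assms h_pos by (intro mult_right_mono) auto
  then show "real (n + 1) * h \<le> 2 * (real n * h)" by simp
 qed (use \<gamma> h_pos in auto)
 also have "\<dots> = 2 powr (\<gamma> - 1) * (real n * h) powr (\<gamma> - 1)" by (rule powr_mult)
 finally have "(h * \<gamma>) * (real (n + 1) * h) powr (\<gamma> - 1) \<le> (h * \<gamma>) * (2 powr (\<gamma> - 1) * (real n * h) powr (\<gamma> - 1))"
  using h_pos \<gamma> by (intro mult_left_mono) auto
 then have "\<tau> (n + 1) - \<tau> n \<le> (\<gamma> * 2 powr (\<gamma> - 1)) * (h * (real n * h) powr (\<gamma> - 1))"
  using step_upper[of "n + 1"] by (simp add: mult_ac)
 also have "\<dots> \<le> (\<gamma> * 2 powr (\<gamma> - 1)) * (\<tau> n - \<tau> (n - 1))"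
  using step_lower[OF assms] \<gamma> by (intro mult_left_mono) auto
 finally show ?thesis .
qed

text \<open>As n <= N, this is the source of the factor N^(1/2) for p >= 2.\<close>

lemma node_step_ratio:
 assumes "n \<ge> 1"
 shows "\<tau> n / (\<tau> n - \<tau> (n - 1)) \<le> real n"
proof -
 have "\<tau> n = real n * (h * (real n * h) powr (\<gamma> - 1))"
  using powr_mult_base[of "real n * h" "\<gamma> - 1"] h_pos by (simp add: node_eq mult.assoc)
 also have "\<dots> \<le> real n * (\<tau> n - \<tau> (n - 1))" using step_lower[OF assms] by (intro mult_left_mono) auto
 finally show ?thesis using step_pos[OF assms] by (simp add: pos_divide_le_eq)
qed

lemma ratio_ge_1: "\<gamma> * 2 powr (\<gamma> - 1) \<ge> 1"
 using mult_mono[OF \<gamma> ge_one_powr_ge_zero[of 2 "\<gamma> - 1"]] \<gamma> by simp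

text \<open>From (n - 1) / n >= 1/2. On every cell but the first, t is comparable with the right
  node, where negative powers of t may then be evaluated.\<close>

lemma node_half: "n \<ge> 2 ==> 2 powr (- \<gamma>) * \<tau> n \<le> \<tau> (n - 1)"
proof -
 assume n: "n \<ge> 2"
 have "2 powr (- \<gamma>) * \<tau> n = (real n * h / 2) powr \<gamma>"
  by (simp add: node_eq powr_minus_divide powr_divide)
 also have "\<dots> \<le> (real (n - 1) * h) powr \<gamma>"
 proof (rule powr_mono2)
  have "(real n / 2) * h \<le> real (n - 1) * h" using n h_pos by (intro mult_right_mono) (auto simp: of_nat_diff)
  then show "real n * h / 2 \<le> real (n - 1) * h" by simp
 qed (use \<gamma> h_pos in auto)
 finally show ?thesis by (simp add: node_eq)
qed

text \<open>The rate \<open>h\<^sup>q\<close> comes from \<open>h\<^sup>D (n h)\<^sup>e\<^sup>-\<^sup>D\<close>, whose maximum over \<open>1 \<le> n \<le> N\<close> is attained at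
 \<open>n = 1\<close> or \<open>n = N\<close> according to the sign of \<open>e - D\<close>.\<close>

lemma graded_rate:
 assumes D: "D > 0" and n: "n \<in> {1..N}"
 shows "h powr D * (real n * h) powr (e - D) \<le> max 1 (T powr ((e - D) / \<gamma>)) * h powr min e D"
proof (cases "e \<ge> D")
 case True
 have "real n * h \<le> real N * h" using n h_pos by (intro mult_right_mono) auto
 also have "\<dots> = T powr (1 / \<gamma>)" using N by (simp add: h_def)
 finally have "real n * h \<le> T powr (1 / \<gamma>)" .
 then have "(real n * h) powr (e - D) \<le> (T powr (1 / \<gamma>)) powr (e - D)" using True h_pos by (intro powr_mono2) auto
 also have "\<dots> \<le> max 1 (T powr ((e - D) / \<gamma>))" by (simp add: powr_powr)
 finally have "(real n * h) powr (e - D) * h powr D \<le> max 1 (T powr ((e - D) / \<gamma>)) * h powr D" by (intro mult_right_mono) auto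
 then show ?thesis using True by (simp add: min_def mult.commute)
next
 case False
 have "h \<le> real n * h" using n h_pos by simp
 then have "(real n * h) powr (e - D) \<le> h powr (e - D)" using False h_pos by (intro powr_mono2') auto
 then have "h powr D * (real n * h) powr (e - D) \<le> h powr D * h powr (e - D)" by (intro mult_left_mono) auto
 also have "\<dots> = 1 * h powr e" by (simp flip: powr_add)
 also have "\<dots> \<le> max 1 (T powr ((e - D) / \<gamma>)) * h powr e" by (intro mult_right_mono) auto
 finally show ?thesis using False by (simp add: min_def)
qed

text \<open>The excess power of h is absorbed by h <= T^(1/\<gamma>).\<close>

lemma first_cell_rate:
 assumes "q \<le> e"
 shows "h powr e \<le> T powr ((e - q) / \<gamma>) * h powr q"
proof -
 have "h powr e = h powr (e - q) * h powr q" by (simp flip: powr_add)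
 moreover have "h powr (e - q) \<le> (T powr (1 / \<gamma>)) powr (e - q)" using assms h_pos h_le by (intro powr_mono2) auto
 then have "h powr (e - q) * h powr q \<le> T powr ((e - q) / \<gamma>) * h powr q"
  by (intro mult_right_mono) (auto simp: powr_powr)
 ultimately show ?thesis by simp
qed

end

section \<open>Error bounds on graded meshes\<close>

lemma polyhedral_bounded_open: "polyhedral_domain \<Omega> ==> bounded_open_set \<Omega>"
proof -
 assume "polyhedral_domain \<Omega>"
 then obtain \<P> where P: "finite \<P>" "\<forall>P\<in>\<P>. polytope P" "\<Omega> = interior (\<Union>\<P>)"
  unfolding polyhedral_domain_def by blast
 have "bounded (\<Union>\<P>)" by (rule bounded_Union) (use P polytope_imp_bounded in auto)
 then have "bounded \<Omega>" unfolding P(3) by (rule bounded_interior)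
 moreover have "open \<Omega>" unfolding P(3) by (rule open_interior)
 ultimately show "bounded_open_set \<Omega>" by unfold_locales
qed

section \<open>Local approximation of the solution on the graded mesh\<close>

locale graded_problem = mesh: graded T \<gamma> N + dg_problem \<Omega> "graded_mesh T \<gamma> N" N \<alpha> K T M \<sigma> p "graded_degrees p" f u0 u U
 for \<Omega> :: "'a::euclidean_space set" and \<gamma> :: real and N :: nat and \<alpha> K T M \<sigma> :: real and p :: nat
  and f :: "real \<Rightarrow> 'a l2" and u0 :: "'a l2" and u U :: "real \<Rightarrow> 'a l2" +
 assumes p1: "p \<ge> 1"
begin

abbreviation \<tau> :: "nat \<Rightarrow> real" where "\<tau> \<equiv> graded_mesh T \<gamma> N"
abbreviation step :: "nat \<Rightarrow> real" where "step n \<equiv> \<tau> n - \<tau> (n - 1)"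
abbreviation forms :: "('a l2 \<Rightarrow> 'a l2 \<Rightarrow> real) set" where "forms \<equiv> {grad_form, inner}"

lemma forms_psd: "b \<in> forms ==> psd_form b"
 using grad.psd_form_axioms inner_form.psd_form_axioms by auto

lemma forms_increment:
 assumes "b \<in> forms" "w \<in> H10 \<Omega>" "0 < s" "s \<le> t" "t \<le> T"
 shows "\<bar>b (u t - u s) w\<bar> \<le> M / \<sigma> * (t powr \<sigma> - s powr \<sigma>) * psd_form.nrm b w"
proof -
 have "\<bar>inner (u t - u s) w\<bar> \<le> M / \<sigma> * (t powr \<sigma> - s powr \<sigma>) * norm w"
  by (rule regular_increment(1)[OF regular u_H10 \<sigma> M assms(2-5)])
 moreover have "\<bar>grad_form (u t - u s) w\<bar> \<le> M / \<sigma> * (t powr \<sigma> - s powr \<sigma>) * grad.nrm w"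
  by (rule regular_increment(2)[OF regular u_H10 \<sigma> M assms(2-5)])
 ultimately show ?thesis using assms(1) by (auto simp only: nrm_inner insert_iff empty_iff)
qed

lemma forms_taylor:
 assumes "b \<in> forms" "w \<in> H10 \<Omega>" "0 < c" "c \<le> t" "t \<le> T"
  and G: "!!x. x \<in> {c..t} ==> M * x powr (\<sigma> - real (p + 1)) \<le> G" "G \<ge> 0"
 shows "\<bar>b (u t - (\<Sum>i\<le>p. ((t - c) ^ i / fact i) *\<^sub>R time_deriv T i u c)) w\<bar> \<le> (t - c) ^ (p + 1) * G * psd_form.nrm b w"
proof -
 have "\<bar>inner (u t - (\<Sum>i\<le>p. ((t - c) ^ i / fact i) *\<^sub>R time_deriv T i u c)) w\<bar> \<le> (t - c) ^ (p + 1) * G * norm w"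
  by (rule regular_taylor(1)[OF regular u_H10 assms(2-5)]) (use G in auto)
 moreover have "\<bar>grad_form (u t - (\<Sum>i\<le>p. ((t - c) ^ i / fact i) *\<^sub>R time_deriv T i u c)) w\<bar> \<le> (t - c) ^ (p + 1) * G * grad.nrm w"
  by (rule regular_taylor(2)[OF regular u_H10 assms(2-5)]) (use G in auto)
 ultimately show ?thesis using assms(1) by (auto simp: nrm_inner)
qed

text \<open>The rate dictated by the first cell. \<open>order\<close> is the rate of Taylor
  expansion on the other cells, and \<open>rem_exp\<close> the power of t in the bound for the
  derivative of order p + 1.\<close>

definition exponent :: real where "exponent = \<gamma> * (\<sigma> + \<alpha> / 2)"
definition order :: real where "order = real p + 1 + \<alpha> / 2"
definition rem_exp :: real where "rem_exp = \<sigma> - real (p + 1)"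
definition rate :: real where "rate = min exponent order"
text \<open>The first summand belongs to the first cell, the second to all others.\<close>

definition approx_const :: real where
 "approx_const = M / \<sigma> * T powr ((exponent - rate) / \<gamma>)
  + M * 2 powr (\<gamma> * \<bar>rem_exp\<bar>) * \<gamma> powr order * max 1 (T powr ((exponent - order) / \<gamma>))"
definition tolerance :: real where "tolerance = approx_const * mesh.h powr rate"

lemma order_pos: "order > 0" using \<alpha> by (simp add: order_def)

lemma approx_const_pos: "approx_const > 0"
proof -
 have "M / \<sigma> * T powr ((exponent - rate) / \<gamma>) > 0" using M \<sigma> T_pos by simp
 moreover have "M * 2 powr (\<gamma> * \<bar>rem_exp\<bar>) * \<gamma> powr order * max 1 (T powr ((exponent - order) / \<gamma>)) \<ge> 0"
  using M by (intro mult_nonneg_nonneg) auto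
 ultimately show ?thesis unfolding approx_const_def by linarith
qed

lemma tolerance_pos: "tolerance > 0"
 using approx_const_pos mesh.h_pos by (simp add: tolerance_def)

text \<open>The first step is h^\<gamma>, so the power \<sigma> of the first node is h^(\<gamma>
  \<sigma>) = h^\<open>exponent\<close> k_1^(-\<alpha>/2).\<close>

lemma first_cell_tolerance: "M / \<sigma> * \<tau> 1 powr \<sigma> \<le> tolerance * step 1 powr (- \<alpha> / 2)"
proof -
 have s: "step 1 = mesh.h powr \<gamma>" using mesh.node_0 mesh.node_1 by simp
 have "mesh.h powr exponent \<le> T powr ((exponent - rate) / \<gamma>) * mesh.h powr rate"
  by (rule mesh.first_cell_rate) (simp add: rate_def)
 then have "M / \<sigma> * mesh.h powr exponent \<le> M / \<sigma> * (T powr ((exponent - rate) / \<gamma>) * mesh.h powr rate)"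
  using M \<sigma> by (intro mult_left_mono) auto
 also have "\<dots> = M / \<sigma> * T powr ((exponent - rate) / \<gamma>) * mesh.h powr rate" by simp
 also have "\<dots> \<le> tolerance"
  unfolding tolerance_def approx_const_def
  by (rule mult_right_mono) (use M in \<open>auto intro!: mult_nonneg_nonneg\<close>)
 finally have "M / \<sigma> * mesh.h powr exponent * step 1 powr (- \<alpha> / 2) \<le> tolerance * step 1 powr (- \<alpha> / 2)"
  by (rule mult_right_mono) simp
 moreover have "mesh.h powr exponent * step 1 powr (- \<alpha> / 2) = \<tau> 1 powr \<sigma>"
  unfolding s unfolding mesh.node_1 powr_powr powr_add[symmetric] by (rule arg_cong[where f = "\<lambda>x. mesh.h powr x"]) (simp add: exponent_def algebra_simps)
 ultimately show ?thesis by (simp add: mult.assoc)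
qed

text \<open>With x = n h one has t_n = x^\<gamma> and k_n <= \<gamma> h x^(\<gamma>-1). The powers
  of x in k_n^\<open>order\<close> t_n^\<open>rem_exp\<close> then add up to
  \<open>exponent - order\<close>, the form that \<open>graded_rate\<close> bounds.\<close>

lemma later_cell_tolerance:
 assumes n: "n \<in> {1..N}"
 shows "step n ^ (p + 1) * (M * (2 powr (\<gamma> * \<bar>rem_exp\<bar>) * \<tau> n powr rem_exp)) \<le> tolerance * step n powr (- \<alpha> / 2)"
proof -
 have h: "mesh.h > 0" by (rule mesh.h_pos)
 define x where "x = real n * mesh.h"
 have x: "x > 0" using h n by (simp add: x_def)
 have k: "step n > 0" using mesh.step_pos[of n] n by simp
 have up: "step n \<le> \<gamma> * mesh.h * x powr (\<gamma> - 1)" using mesh.step_upper[of n] n by (simp add: x_def mult_ac)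
 have "step n powr order \<le> (\<gamma> * mesh.h * x powr (\<gamma> - 1)) powr order"
  using k up order_pos by (intro powr_mono2) auto
 also have "\<dots> = \<gamma> powr order * mesh.h powr order * x powr ((\<gamma> - 1) * order)"
  using h mesh.\<gamma> by (simp add: powr_mult powr_powr)
 finally have "step n powr order * \<tau> n powr rem_exp
   \<le> \<gamma> powr order * mesh.h powr order * x powr ((\<gamma> - 1) * order) * \<tau> n powr rem_exp"
  by (rule mult_right_mono) simp
 also have "\<tau> n powr rem_exp = x powr (\<gamma> * rem_exp)"
  by (simp add: mesh.node_eq x_def powr_powr)
 also have "\<gamma> powr order * mesh.h powr order * x powr ((\<gamma> - 1) * order) * x powr (\<gamma> * rem_exp)
   = \<gamma> powr order * (mesh.h powr order * (x powr ((\<gamma> - 1) * order) * x powr (\<gamma> * rem_exp)))" by (simp only: mult.assoc)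
 also have "x powr ((\<gamma> - 1) * order) * x powr (\<gamma> * rem_exp) = x powr (exponent - order)"
 proof -
  define a where "a = \<alpha> / 2"
  have "(\<gamma> - 1) * order + \<gamma> * rem_exp = exponent - order"
   unfolding exponent_def order_def rem_exp_def a_def[symmetric] by (simp add: algebra_simps)
  then show ?thesis by (simp only: powr_add[symmetric])
 qed
 also have "\<gamma> powr order * (mesh.h powr order * x powr (exponent - order))
   \<le> \<gamma> powr order * (max 1 (T powr ((exponent - order) / \<gamma>)) * mesh.h powr rate)"
  unfolding rate_def x_def by (rule mult_left_mono[OF mesh.graded_rate[OF order_pos n]]) simp
 finally have r: "step n powr order * x powr (\<gamma> * rem_exp)
   \<le> \<gamma> powr order * (max 1 (T powr ((exponent - order) / \<gamma>)) * mesh.h powr rate)" .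
 have tn: "\<tau> n powr rem_exp = x powr (\<gamma> * rem_exp)"
  by (simp add: mesh.node_eq x_def powr_powr)
 have "order + (- \<alpha> / 2) = real (p + 1)" by (simp add: order_def)
 then have "step n ^ (p + 1) = step n powr (order + (- \<alpha> / 2))" by (simp only: powr_realpow[OF k])
 then have kp: "step n ^ (p + 1) = step n powr order * step n powr (- \<alpha> / 2)" by (simp only: powr_add)
 have "step n ^ (p + 1) * (M * (2 powr (\<gamma> * \<bar>rem_exp\<bar>) * \<tau> n powr rem_exp))
   = (M * 2 powr (\<gamma> * \<bar>rem_exp\<bar>) * step n powr (- \<alpha> / 2)) * (step n powr order * x powr (\<gamma> * rem_exp))"
  unfolding kp tn by (simp only: mult_ac)
 also have "\<dots> \<le> (M * 2 powr (\<gamma> * \<bar>rem_exp\<bar>) * step n powr (- \<alpha> / 2))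
   * (\<gamma> powr order * (max 1 (T powr ((exponent - order) / \<gamma>)) * mesh.h powr rate))"
  by (rule mult_left_mono[OF r]) (use M in auto)
 also have "\<dots> = (M * 2 powr (\<gamma> * \<bar>rem_exp\<bar>) * \<gamma> powr order * max 1 (T powr ((exponent - order) / \<gamma>)) * mesh.h powr rate) * step n powr (- \<alpha> / 2)"
  by (simp only: mult_ac)
 also have "\<dots> \<le> tolerance * step n powr (- \<alpha> / 2)"
  unfolding tolerance_def approx_const_def
  by (intro mult_right_mono) (use M \<sigma> in auto)
 finally show ?thesis .
qed

text \<open>On the first cell a constant is used, because only the increments of \<open>u\<close>
  are controlled down to t = 0. On later cells it is the Taylor polynomial at the left node, with
  the derivative bound moved to the right node by \<open>node_half\<close>.\<close>

lemma approximation: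
 assumes b: "b \<in> forms" and w: "w \<in> H10 \<Omega>" and n: "n \<in> {1..N}"
 shows "\<exists>q. degree q \<le> graded_degrees p n \<and>
  (\<forall>t\<in>{\<tau> (n - 1)<..\<tau> n}. \<bar>b (u t) w - poly q t\<bar> \<le> tolerance * step n powr (- \<alpha> / 2) * psd_form.nrm b w)"
proof -
 interpret b: psd_form b by (rule forms_psd[OF b])
 have tn: "\<tau> n \<le> T" using cell_in[OF n, of "\<tau> n"] mesh.step_pos[of n] n by auto
 show ?thesis
 proof (cases "n = 1")
  case True
  show ?thesis
  proof (intro exI[of _ "[:b (u (\<tau> 1)) w:]"] conjI ballI)
   fix t assume t: "t \<in> {\<tau> (n - 1)<..\<tau> n}"
   have "\<bar>b (u (\<tau> 1) - u t) w\<bar> \<le> M / \<sigma> * (\<tau> 1 powr \<sigma> - t powr \<sigma>) * b.nrm w"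
    by (rule forms_increment[OF b w]) (use t True tn mesh.node_0 in auto)
   also have "\<dots> \<le> M / \<sigma> * \<tau> 1 powr \<sigma> * b.nrm w"
    using M \<sigma> by (intro mult_right_mono mult_left_mono) auto
   also have "\<dots> \<le> tolerance * step 1 powr (- \<alpha> / 2) * b.nrm w"
    by (rule mult_right_mono[OF first_cell_tolerance]) simp
   finally show "\<bar>b (u t) w - poly [:b (u (\<tau> 1)) w:] t\<bar> \<le> tolerance * step n powr (- \<alpha> / 2) * b.nrm w"
    using True by (simp add: b.diff_left abs_minus_commute)
  qed simp
 next
  case False
  then have n2: "n \<ge> 2" using n by auto
  define c where "c = \<tau> (n - 1)"
  have c: "c > 0" using mesh.h_pos n2 by (simp add: c_def mesh.node_eq)
  define q where "q = (\<Sum>i\<le>p. [:b (time_deriv T i u c) w / fact i:] * [:- c, 1:] ^ i)"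
  define G where "G = M * (2 powr (\<gamma> * \<bar>rem_exp\<bar>) * \<tau> n powr rem_exp)"
  have tn0: "\<tau> n > 0" using c mesh.step_pos[of n] n by (simp add: c_def)
  have G0: "G \<ge> 0" using M by (simp add: G_def)
  have Gx: "M * x powr (\<sigma> - real (p + 1)) \<le> G" if x: "x \<in> {c..\<tau> n}" for x
  proof -
   have "x powr rem_exp \<le> 2 powr (\<gamma> * \<bar>rem_exp\<bar>) * \<tau> n powr rem_exp"
   proof (cases "rem_exp \<ge> 0")
    case True
    then have "x powr rem_exp \<le> 1 * \<tau> n powr rem_exp"
     using x c by (simp add: powr_mono2)
    also have "\<dots> \<le> 2 powr (\<gamma> * \<bar>rem_exp\<bar>) * \<tau> n powr rem_exp"
     using mesh.\<gamma> by (intro mult_right_mono ge_one_powr_ge_zero) auto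
    finally show ?thesis .
   next
    case False
    have "2 powr (- \<gamma>) * \<tau> n \<le> x" using mesh.node_half[OF n2] x by (simp add: c_def)
    then have "x powr rem_exp \<le> (2 powr (- \<gamma>) * \<tau> n) powr rem_exp"
     using False tn0 by (intro powr_mono2') auto
    also have "\<dots> = 2 powr (\<gamma> * \<bar>rem_exp\<bar>) * \<tau> n powr rem_exp"
    proof -
     have "- \<gamma> * rem_exp = \<gamma> * \<bar>rem_exp\<bar>" using False by simp
     then show ?thesis unfolding powr_mult powr_powr by simp
    qed
    finally show ?thesis .
   qed
   then show ?thesis unfolding G_def rem_exp_def[symmetric] using M by (intro mult_left_mono) auto
  qed
  show ?thesis
  proof (intro exI[of _ q] conjI ballI)
   have deg: "degree ([:b (time_deriv T i u c) w / fact i:] * [:- c, 1:] ^ i) \<le> p" if "i \<le> p" for i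
    using degree_mult_le[of "[:b (time_deriv T i u c) w / fact i:]" "[:- c, 1:] ^ i"] degree_power_le[of "[:- c, 1:]" i] that by simp
   show "degree q \<le> graded_degrees p n"
    unfolding q_def graded_degrees_def if_not_P[OF False]
    by (rule degree_sum_le) (simp, rule deg, simp)
   fix t assume t: "t \<in> {\<tau> (n - 1)<..\<tau> n}"
   let ?r = "u t - (\<Sum>i\<le>p. ((t - c) ^ i / fact i) *\<^sub>R time_deriv T i u c)"
   have "poly q t = (\<Sum>i\<le>p. ((t - c) ^ i / fact i) * b (time_deriv T i u c) w)"
    unfolding q_def poly_sum by (rule sum.cong) (simp_all add: mult.commute)
   then have e: "b (u t) w - poly q t = b ?r w" by (simp only: b.diff_left b.sum_left b.scale_left)
   have "\<bar>b ?r w\<bar> \<le> (t - c) ^ (p + 1) * G * b.nrm w"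
    by (rule forms_taylor[OF b w c _ _ _ G0]) (use t tn Gx in \<open>auto simp: c_def\<close>)
   also have "\<dots> \<le> step n ^ (p + 1) * G * b.nrm w"
    using t G0 by (intro mult_right_mono power_mono) (auto simp: c_def)
   also have "\<dots> \<le> tolerance * step n powr (- \<alpha> / 2) * b.nrm w"
    unfolding G_def by (rule mult_right_mono[OF later_cell_tolerance[OF n]]) simp
   finally show "\<bar>b (u t) w - poly q t\<bar> \<le> tolerance * step n powr (- \<alpha> / 2) * b.nrm w" unfolding e .
  qed
 qed
qed

text \<open>Quasi-optimality with the local tolerance \<epsilon>: since \<open>\<kappa>\<close> <=
  \<epsilon>, (2 + 2 C) \<epsilon> + C \<kappa> <= (2 + 3 C) \<epsilon>. The polynomial q depends on
  the form and the test vector, the interpolant does not.\<close>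

lemma projection_exists:
 assumes op: "projection_bound TYPE('a l2) d C\<pi>"
  and C\<pi>: "0 \<le> C\<pi>" "C\<pi> \<le> C\<^sub>p" and d: "graded_degrees p n = d" and n: "n \<in> {1..N}"
  and \<kappa>: "\<kappa> > 0" "\<kappa> \<le> tolerance * step n powr (- \<alpha> / 2)"
 shows "\<exists>c. (\<forall>j\<le>graded_degrees p n. c j \<in> H10 \<Omega>) \<and> vpoly (graded_degrees p n) c (\<tau> n) = u (\<tau> n) \<and>
   (\<forall>b\<in>forms. \<forall>w\<in>H10 \<Omega>.
    (\<forall>t\<in>{\<tau> (n - 1)<..\<tau> n}. \<bar>b (vpoly (graded_degrees p n) c t - u t) w\<bar>
     \<le> ((2 + 3 * C\<^sub>p) * tolerance) * step n powr (- \<alpha> / 2) * psd_form.nrm b w) \<and>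
    (\<forall>j<graded_degrees p n. \<bar>integral {0..1} (\<lambda>y. y ^ j * b (vpoly (graded_degrees p n) c (\<tau> (n - 1) + step n * y)
     - u (\<tau> (n - 1) + step n * y)) w)\<bar> \<le> \<kappa> * psd_form.nrm b w))"
proof -
 have step: "\<tau> (n - 1) < \<tau> n" using mesh.step_pos[of n] n by simp
 have n0: "0 \<le> \<tau> (n - 1)" by (simp add: mesh.node_eq)
 have tn: "\<tau> n \<le> T" using cell_in[OF n, of "\<tau> n"] step by auto
 let ?P = "\<lambda>c. (\<forall>j\<le>d. c j \<in> H10 \<Omega>) \<and> vpoly d c (\<tau> n) = u (\<tau> n) \<and>
    (\<forall>b\<in>forms. \<forall>w\<in>H10 \<Omega>.
     (\<forall>q \<epsilon>. degree q \<le> d \<longrightarrow> (\<forall>t\<in>{\<tau> (n - 1)<..\<tau> n}. \<bar>b (u t) w - poly q t\<bar> \<le> \<epsilon>) \<longrightarrow>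
      (\<forall>t\<in>{\<tau> (n - 1)<..\<tau> n}. \<bar>b (vpoly d c t - u t) w\<bar> \<le> (2 + 2 * C\<pi>) * \<epsilon> + C\<pi> * \<kappa> * psd_form.nrm b w)) \<and>
     (\<forall>j<d. \<bar>integral {0..1} (\<lambda>y. y ^ j * b (vpoly d c (\<tau> (n - 1) + step n * y) - u (\<tau> (n - 1) + step n * y)) w)\<bar>
      \<le> \<kappa> * psd_form.nrm b w))"
 have ex: "\<exists>c. ?P c"
 proof (rule op[unfolded projection_bound_def, rule_format])
  show "continuous_on {\<tau> (n - 1)..\<tau> n} (\<lambda>t. M / \<sigma> * t powr \<sigma>)"
   using \<sigma> n0 by (intro continuous_on_mult continuous_on_powr' continuous_intros) auto
  show "mono_on {\<tau> (n - 1)..\<tau> n} (\<lambda>t. M / \<sigma> * t powr \<sigma>)"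
   using \<sigma> M n0 by (intro mono_onI mult_left_mono powr_mono2) auto
  fix b w t t' assume "b \<in> forms" "w \<in> H10 \<Omega>" "\<tau> (n - 1) < t" "t \<le> t'" "t' \<le> \<tau> n"
  then show "\<bar>b (u t' - u t) w\<bar> \<le> (M / \<sigma> * t' powr \<sigma> - M / \<sigma> * t powr \<sigma>) * psd_form.nrm b w"
   using forms_increment[of b w t t'] n0 tn by (simp add: right_diff_distrib)
 qed (use subspace_H10 step u_H10 n0 tn forms_psd \<kappa>(1) in auto)
 obtain c where c: "?P c" using ex by (rule exE)
 note c1 = conjunct1[OF c] and c2 = conjunct1[OF conjunct2[OF c]] and c3 = conjunct2[OF conjunct2[OF c]]
 show ?thesis
  unfolding d
 proof (intro exI[of _ c] conjI ballI)
  show "\<forall>j\<le>d. c j \<in> H10 \<Omega>" by (rule c1)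
  show "vpoly d c (\<tau> n) = u (\<tau> n)" by (rule c2)
  show "\<forall>j<d. \<bar>integral {0..1} (\<lambda>y. y ^ j * b (vpoly d c (\<tau> (n - 1) + step n * y) - u (\<tau> (n - 1) + step n * y)) w)\<bar>
    \<le> \<kappa> * psd_form.nrm b w" if "b \<in> forms" "w \<in> H10 \<Omega>" for b w
   by (rule conjunct2[OF bspec[OF bspec[OF c3 that(1)] that(2)]])
  fix b w t assume b: "b \<in> forms" and w: "w \<in> H10 \<Omega>" and t: "t \<in> {\<tau> (n - 1)<..\<tau> n}"
  interpret b: psd_form b by (rule forms_psd[OF b])
  let ?x = "tolerance * step n powr (- \<alpha> / 2) * b.nrm w"
  have x: "?x \<ge> 0" using tolerance_pos by simp
  obtain q where q: "degree q \<le> d" "\<forall>t\<in>{\<tau> (n - 1)<..\<tau> n}. \<bar>b (u t) w - poly q t\<bar> \<le> ?x"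
   using approximation[OF b w n] unfolding d by blast
  have e1: "\<bar>b (vpoly d c t - u t) w\<bar> \<le> (2 + 2 * C\<pi>) * ?x + C\<pi> * \<kappa> * b.nrm w"
   by (rule bspec[OF mp[OF mp[OF spec[OF spec[OF conjunct1[OF bspec[OF bspec[OF c3 b] w]]]] q(1)] q(2)] t])
  have e2: "C\<pi> * \<kappa> * b.nrm w \<le> C\<pi> * ?x"
   unfolding mult.assoc[of C\<pi> \<kappa>] by (rule mult_left_mono[OF mult_right_mono[OF \<kappa>(2) b.nrm_nonneg] C\<pi>(1)])
  have e3: "(2 + 2 * C\<pi>) * ?x + C\<pi> * ?x = (2 + 3 * C\<pi>) * ?x" by (simp only: distrib_right[symmetric]) simp
  have e4: "(2 + 3 * C\<pi>) * ?x \<le> (2 + 3 * C\<^sub>p) * ?x" by (rule mult_right_mono[OF _ x]) (use C\<pi>(2) in simp)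
  have "\<bar>b (vpoly d c t - u t) w\<bar> \<le> (2 + 3 * C\<^sub>p) * ?x" using e1 e2 e3 e4 by linarith
  then show "\<bar>b (vpoly d c t - u t) w\<bar> \<le> ((2 + 3 * C\<^sub>p) * tolerance) * step n powr (- \<alpha> / 2) * b.nrm w"
   by (simp only: mult.assoc)
 qed
qed

text \<open>All constants enter as hypotheses, so that they can be fixed before N and the solution;
  \<open>A\<close> is the value of \<open>stab_const\<close> for the ratio bound of the graded mesh.
  Only the interpolants and \<open>\<kappa>\<close> are chosen here.\<close>

lemma graded_cell_error:
 assumes inv: "!!(q::real poly) a b t. degree q \<le> p ==> a < b ==> t \<in> {a..b} ==>
   (poly q t)\<^sup>2 \<le> Cp / (b - a) * integral {a..b} (\<lambda>s. (poly q s)\<^sup>2)"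
  and mark: "!!(q::real poly) a b t B. degree q \<le> p ==> a < b ==> t \<in> {a..b} ==>
   (!!s. s \<in> {a..b} ==> \<bar>poly q s\<bar> \<le> B) ==> \<bar>poly (pderiv q) t\<bar> \<le> Cp / (b - a) * B"
  and coefficient: "!!(q::real poly) i B. degree q \<le> p ==> (!!s. s \<in> {0..1} ==> \<bar>poly q s\<bar> \<le> B) ==> \<bar>coeff q i\<bar> \<le> Cp * B"
  and Cp: "Cp > 0" and K: "K > 0" and C\<^sub>\<Omega>: "C\<^sub>\<Omega> \<ge> 0" "!!w. w \<in> H10 \<Omega> ==> norm w \<le> C\<^sub>\<Omega> * grad.nrm w"
  and C1: "C1 \<ge> 0" "projection_bound TYPE('a l2) 1 C1" and C2: "C2 \<ge> 0" "projection_bound TYPE('a l2) p C2"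
  and A: "A = 4 * (real p * C\<^sub>\<Omega> * Cp\<^sup>2 + K * (1 + Cp) * (2 / Gamma (\<alpha> + 1) + 2 powr (\<alpha> + 1) / Gamma (\<alpha> + 2)))\<^sup>2
  * (Cp\<^sup>2 * (1 + \<gamma> * 2 powr (\<gamma> - 1)) powr (1 - \<alpha>) * Gamma (\<alpha> + 1) / (- \<alpha>) + Cp * Gamma (\<alpha> + 1)) / K"
  and m: "m \<in> {1..N}" and t: "t \<in> {\<tau> (m - 1)<..<\<tau> m}"
 shows "norm (U t - u t) \<le> (C\<^sub>\<Omega> * sqrt (Cp * A * Gamma (\<alpha> + 1) * T powr (- \<alpha>) / K)
   * sqrt (\<tau> m / step m) + T powr (- \<alpha> / 2)) * ((2 + 3 * (C1 + C2)) * tolerance)"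
  and "p = 1 ==> norm (U t - u t) \<le> (2 * sqrt (A * T) + T powr (- \<alpha> / 2)) * ((2 + 3 * (C1 + C2)) * tolerance)"
proof -
 obtain c where c: "!!n j. n \<in> {1..N} ==> j \<le> graded_degrees p n ==> c n j \<in> H10 \<Omega>"
  "!!n t. n \<in> {1..N} ==> t \<in> {\<tau> (n - 1)<..<\<tau> n} ==> U t = vpoly (graded_degrees p n) (c n) t"
  by (rule pieces) (rule that)
 let ?k = "step 1" and ?D = "(2 + 3 * (C1 + C2)) * tolerance"
 have N: "N \<ge> 1" using m by auto
 have k: "?k > 0" using mesh.step_pos[of 1] by simp
 have k_le: "?k \<le> step n" if "n \<ge> 1" for n
  using that
 proof (induction n rule: dec_induct)
  case (step n)
  then show ?case using mesh.step_mono[of n] by simp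
 qed simp
 \<comment> \<open>The first term of the minimum serves \<open>projection_exists\<close>, the other
   two the smallness conditions of \<open>dg_projection\<close>. The first step is taken because it
   is the smallest.\<close>
 define \<kappa> where "\<kappa> = tolerance * min (?k powr (- \<alpha> / 2)) (min (?k powr (1 - \<alpha> / 2) / (T * real N)) (?k powr (1 + \<alpha> / 2)))"
 have \<kappa>0: "\<kappa> > 0" unfolding \<kappa>_def using tolerance_pos k T_pos N by simp
 have D: "tolerance \<le> ?D" "?D \<ge> 0"
  using mult_right_mono[of 1 "2 + 3 * (C1 + C2)" tolerance] tolerance_pos C1 C2 by auto
 have \<kappa>1: "\<kappa> \<le> tolerance * ?k powr (- \<alpha> / 2)"
  unfolding \<kappa>_def using tolerance_pos by (intro mult_left_mono) auto
 have "\<kappa> \<le> tolerance * (?k powr (1 - \<alpha> / 2) / (T * real N))"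
  unfolding \<kappa>_def using tolerance_pos by (intro mult_left_mono) auto
 then have "\<kappa> * (T * real N) \<le> tolerance * (?k powr (1 - \<alpha> / 2) / (T * real N)) * (T * real N)"
  using T_pos by (intro mult_right_mono) auto
 also have "\<dots> = tolerance * ?k powr (1 - \<alpha> / 2)" using T_pos N by simp
 also have "\<dots> \<le> ?D * ?k powr (1 - \<alpha> / 2)" by (rule mult_right_mono[OF D(1)]) simp
 finally have \<kappa>2: "\<kappa> * T * real N \<le> ?D * ?k powr (1 - \<alpha> / 2)" by (simp add: mult.assoc)
 have "\<kappa> \<le> tolerance * ?k powr (1 + \<alpha> / 2)"
  unfolding \<kappa>_def using tolerance_pos by (intro mult_left_mono) auto
 also have "\<dots> \<le> ?D * ?k powr (1 + \<alpha> / 2)" by (rule mult_right_mono[OF D(1)]) simp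
 finally have \<kappa>3: "\<kappa> \<le> ?D * ?k powr (1 + \<alpha> / 2)" .
 let ?Q = "\<lambda>n c. (\<forall>j\<le>graded_degrees p n. c j \<in> H10 \<Omega>) \<and> vpoly (graded_degrees p n) c (\<tau> n) = u (\<tau> n) \<and>
   (\<forall>b\<in>forms. \<forall>w\<in>H10 \<Omega>.
    (\<forall>t\<in>{\<tau> (n - 1)<..\<tau> n}. \<bar>b (vpoly (graded_degrees p n) c t - u t) w\<bar>
     \<le> ((2 + 3 * (C1 + C2)) * tolerance) * step n powr (- \<alpha> / 2) * psd_form.nrm b w) \<and>
    (\<forall>j<graded_degrees p n. \<bar>integral {0..1} (\<lambda>y. y ^ j * b (vpoly (graded_degrees p n) c (\<tau> (n - 1) + step n * y)
     - u (\<tau> (n - 1) + step n * y)) w)\<bar> \<le> \<kappa> * psd_form.nrm b w))"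
 have "\<forall>n\<in>{1..N}. \<exists>c. ?Q n c"
 proof
  fix n assume n: "n \<in> {1..N}"
  have "?k powr (- \<alpha> / 2) \<le> step n powr (- \<alpha> / 2)"
   using k k_le[of n] n \<alpha> by (intro powr_mono2) auto
  then have \<kappa>n: "\<kappa> \<le> tolerance * step n powr (- \<alpha> / 2)"
   using \<kappa>1 mult_left_mono[of _ _ tolerance] tolerance_pos by (meson less_imp_le order_trans)
  show "\<exists>c. ?Q n c"
  proof (cases "n = 1")
   case True
   show ?thesis
    by (rule projection_exists[OF C1(2,1) _ _ n \<kappa>0 \<kappa>n]) (use True C2 in \<open>auto simp: graded_degrees_def\<close>)
  next
   case False
   show ?thesis
    by (rule projection_exists[OF C2(2,1) _ _ n \<kappa>0 \<kappa>n]) (use False C1 in \<open>auto simp: graded_degrees_def\<close>)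
  qed
 qed
 then obtain cP where Q: "\<forall>n\<in>{1..N}. ?Q n (cP n)" unfolding bchoice_iff by (rule exE)
 interpret dg_projection \<Omega> \<tau> N \<alpha> K T M \<sigma> p "graded_degrees p" f u0 u U c cP Cp "\<gamma> * 2 powr (\<gamma> - 1)" C\<^sub>\<Omega> ?D \<kappa>
 proof
  show "c n j \<in> H10 \<Omega>" if "n \<in> {1..N}" "j \<le> graded_degrees p n" for n j by (rule c(1)[OF that])
  show "U t = vpoly (graded_degrees p n) (c n) t" if "n \<in> {1..N}" "t \<in> {\<tau> (n - 1)<..<\<tau> n}" for n t by (rule c(2)[OF that])
  fix n assume n: "n \<in> {1..N}"
  note q = bspec[OF Q n]
  show "cP n j \<in> H10 \<Omega>" if "j \<le> graded_degrees p n" for j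
   by (rule mp[OF spec[OF conjunct1[OF q]] that])
  show "vpoly (graded_degrees p n) (cP n) (\<tau> n) = u (\<tau> n)" by (rule conjunct1[OF conjunct2[OF q]])
  fix b w assume b: "b \<in> forms" and w: "w \<in> H10 \<Omega>"
  note qq = bspec[OF bspec[OF conjunct2[OF conjunct2[OF q]] b] w]
  show "\<bar>b (vpoly (graded_degrees p n) (cP n) t - u t) w\<bar> \<le> ?D * step n powr (- \<alpha> / 2) * psd_form.nrm b w"
   if "t \<in> {\<tau> (n - 1)<..\<tau> n}" for t by (rule bspec[OF conjunct1[OF qq] that])
  show "\<bar>integral {0..1} (\<lambda>y. y ^ j * b (vpoly (graded_degrees p n) (cP n) (\<tau> (n - 1) + step n * y)
     - u (\<tau> (n - 1) + step n * y)) w)\<bar> \<le> \<kappa> * psd_form.nrm b w" if "j < graded_degrees p n" for j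
   by (rule mp[OF spec[OF conjunct2[OF qq]] that])
 next
  show "0 \<le> \<kappa>" using \<kappa>0 by simp
  show "\<kappa> * \<tau> N * real N \<le> ?D * (\<tau> 1 - \<tau> 0) powr (1 - \<alpha> / 2)" using \<kappa>2 by (simp add: mesh.node_N)
  show "\<kappa> \<le> ?D * (\<tau> 1 - \<tau> 0) powr (1 + \<alpha> / 2)" using \<kappa>3 by simp
  show "(poly q t)\<^sup>2 \<le> Cp / (b - a) * integral {a..b} (\<lambda>s. (poly q s)\<^sup>2)"
   if "degree q \<le> p" "a < b" "t \<in> {a..b}" for q :: "real poly" and a b t by (rule inv[OF that])
  show "\<bar>poly (pderiv q) t\<bar> \<le> Cp / (b - a) * B"
   if "degree q \<le> p" "a < b" "t \<in> {a..b}" "!!s. s \<in> {a..b} ==> \<bar>poly q s\<bar> \<le> B" for q :: "real poly" and a b t B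
   by (rule mark[OF that])
  show "\<bar>coeff q i\<bar> \<le> Cp * B" if "degree q \<le> p" "!!s. s \<in> {0..1} ==> \<bar>poly q s\<bar> \<le> B" for q :: "real poly" and i B
   by (rule coefficient[OF that])
  show "1 \<le> graded_degrees p n \<and> graded_degrees p n \<le> p" for n using p1 by (simp add: graded_degrees_def)
  show "\<tau> n - \<tau> (n - 1) \<le> \<tau> (n + 1) - \<tau> n" if "n \<in> {1..<N}" for n using mesh.step_mono[of n] that by simp
  show "\<tau> (n + 1) - \<tau> n \<le> \<gamma> * 2 powr (\<gamma> - 1) * (\<tau> n - \<tau> (n - 1))" if "n \<in> {1..<N}" for n
   using mesh.step_ratio[of n] that by simp
  show "norm w \<le> C\<^sub>\<Omega> * grad.nrm w" if "w \<in> H10 \<Omega>" for w by (rule C\<^sub>\<Omega>(2)[OF that])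
 qed (use D K Cp C\<^sub>\<Omega>(1) mesh.ratio_ge_1 in auto)
 have A': "stab_const = A" unfolding stab_const_def[OF m] A ..
 show "norm (U t - u t) \<le> (C\<^sub>\<Omega> * sqrt (Cp * A * Gamma (\<alpha> + 1) * T powr (- \<alpha>) / K)
   * sqrt (\<tau> m / step m) + T powr (- \<alpha> / 2)) * ?D"
  by (rule cell_error(1)[OF m t, unfolded A'])
 show "norm (U t - u t) \<le> (2 * sqrt (A * T) + T powr (- \<alpha> / 2)) * ?D" if "p = 1"
  by (rule cell_error(2)[OF m t, unfolded A']) (use that in \<open>simp add: graded_degrees_def\<close>)
qed

end

text \<open>The bounds of \<open>graded_cell_error\<close> are uniform over the open cells and pass
  to the supremum. The constants of the Poincare inequality, the inverse inequalities and the
  projections are obtained before N and the functions are introduced.\<close>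

theorem theorem5:
  fixes \<Omega> :: "'a::euclidean_space set" and K T \<alpha> \<gamma> \<sigma> M :: real and p :: nat
  assumes "polyhedral_domain \<Omega>" and "K > 0" and "T > 0" and "-1 < \<alpha>" and "\<alpha> < 0"
    and "p \<ge> 1" and "\<gamma> \<ge> 1" and "M > 0" and "\<sigma> > 0"
  shows "\<exists>C::real. \<forall>(N::nat) f u0 u U.
    N \<ge> 1 \<longrightarrow>
    fractional_diffusion_solution \<Omega> K T \<alpha> f u0 u \<longrightarrow>
    regularity \<Omega> T p M \<sigma> u \<longrightarrow>
    dg_solution \<Omega> K \<alpha> (graded_mesh T \<gamma> N) N (graded_degrees p) f u0 U \<longrightarrow>
    (let k = T powr (1 / \<gamma>) / real N in
      Linf_L2_norm (graded_mesh T \<gamma> N) N (\<lambda>t. U t - u t) \<le>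
        C * (if p = 1
             then k powr (min (\<gamma> * (\<sigma> + \<alpha> / 2)) (2 + \<alpha> / 2))
             else k powr (min (\<gamma> * (\<sigma> + \<alpha> / 2)) (real p + 1 + \<alpha> / 2) - 1 / 2)))"
proof -
 interpret bounded_open_set \<Omega> by (rule polyhedral_bounded_open) fact
 obtain C\<^sub>\<Omega> where C\<^sub>\<Omega>: "C\<^sub>\<Omega> > 0" "!!w. w \<in> H10 \<Omega> ==> norm w \<le> C\<^sub>\<Omega> * grad.nrm w"
  by (rule poincare) (rule that)
 obtain Cp where Cp: "Cp > 0"
  "!!(q::real poly) a b t. degree q \<le> p ==> a < b ==> t \<in> {a..b} ==>
   (poly q t)\<^sup>2 \<le> Cp / (b - a) * integral {a..b} (\<lambda>s. (poly q s)\<^sup>2)"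
  "!!(q::real poly) a b t B. degree q \<le> p ==> a < b ==> t \<in> {a..b} ==>
   (!!s. s \<in> {a..b} ==> \<bar>poly q s\<bar> \<le> B) ==> \<bar>poly (pderiv q) t\<bar> \<le> Cp / (b - a) * B"
  "!!(q::real poly) i B. degree q \<le> p ==>
   (!!s. s \<in> {0..1} ==> \<bar>poly q s\<bar> \<le> B) ==> \<bar>coeff q i\<bar> \<le> Cp * B"
 proof (rule poly_inverse_inequality[of p])
  fix C :: real
  assume C: "C > 0"
   "!!(q::real poly) a b t. degree q \<le> p ==> a < b ==> t \<in> {a..b} ==>
    (poly q t)\<^sup>2 \<le> C / (b - a) * integral {a..b} (\<lambda>s. (poly q s)\<^sup>2)"
   "!!(q::real poly) a b t B. degree q \<le> p ==> a < b ==> t \<in> {a..b} ==>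
    (!!s. s \<in> {a..b} ==> \<bar>poly q s\<bar> \<le> B) ==> \<bar>poly (pderiv q) t\<bar> \<le> C / (b - a) * B"
   "!!(q::real poly) i B. degree q \<le> p ==>
    (!!s. s \<in> {0..1} ==> \<bar>poly q s\<bar> \<le> B) ==> \<bar>coeff q i\<bar> \<le> C * B"
  show thesis
  proof (rule that[OF C(1,2)])
   show "\<bar>poly (pderiv q) t\<bar> \<le> C / (b - a) * B"
    if "degree q \<le> p" "a < b" "t \<in> {a..b}" "!!s. s \<in> {a..b} ==> \<bar>poly q s\<bar> \<le> B" for q :: "real poly" and a b t B
    by (rule C(3)[OF that])
   show "\<bar>coeff q i\<bar> \<le> C * B" if "degree q \<le> p" "!!s. s \<in> {0..1} ==> \<bar>poly q s\<bar> \<le> B" for q :: "real poly" and i B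
    by (rule C(4)[OF that])
  qed
 qed
 \<comment> \<open>Degree 1 is for the first cell, degree p for the others.\<close>
 obtain C1 where C1: "C1 \<ge> 0" "projection_bound TYPE('a l2) 1 C1" by (rule projection_operator)
 obtain C2 where C2: "C2 \<ge> 0" "projection_bound TYPE('a l2) p C2" by (rule projection_operator)
 define A where "A = 4 * (real p * C\<^sub>\<Omega> * Cp\<^sup>2 + K * (1 + Cp) * (2 / Gamma (\<alpha> + 1) + 2 powr (\<alpha> + 1) / Gamma (\<alpha> + 2)))\<^sup>2
  * (Cp\<^sup>2 * (1 + \<gamma> * 2 powr (\<gamma> - 1)) powr (1 - \<alpha>) * Gamma (\<alpha> + 1) / (- \<alpha>) + Cp * Gamma (\<alpha> + 1)) / K"
 define q where "q = min (\<gamma> * (\<sigma> + \<alpha> / 2)) (real p + 1 + \<alpha> / 2)"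
 define Ca where "Ca = M / \<sigma> * T powr ((\<gamma> * (\<sigma> + \<alpha> / 2) - q) / \<gamma>)
  + M * 2 powr (\<gamma> * \<bar>\<sigma> - real (p + 1)\<bar>) * \<gamma> powr (real p + 1 + \<alpha> / 2)
   * max 1 (T powr ((\<gamma> * (\<sigma> + \<alpha> / 2) - (real p + 1 + \<alpha> / 2)) / \<gamma>))"
 define S where "S = C\<^sub>\<Omega> * sqrt (Cp * A * Gamma (\<alpha> + 1) * T powr (- \<alpha>) / K)"
 define R where "R = T powr (- \<alpha> / 2)"
 \<comment> \<open>Only domain data, exponents, \<open>M\<close> and \<open>p\<close> enter. For p
   >= 2 the factor sqrt (T^(1/\<gamma>)) appears when N^(1/2) is expressed by the mesh parameter
   k.\<close>
 define C where "C = (if p = 1 then 2 * sqrt (A * T) + R else (S + R) * sqrt (T powr (1 / \<gamma>))) * ((2 + 3 * (C1 + C2)) * Ca)"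
 have R0: "R \<ge> 0" by (simp add: R_def)
 have "Cp\<^sup>2 * (1 + \<gamma> * 2 powr (\<gamma> - 1)) powr (1 - \<alpha>) * Gamma (\<alpha> + 1) / (- \<alpha>) \<ge> 0" "Cp * Gamma (\<alpha> + 1) \<ge> 0" "Gamma (\<alpha> + 1) \<ge> 0"
  using assms Cp(1) by (auto intro!: divide_nonneg_nonneg mult_nonneg_nonneg Gamma_real_nonneg simp del: divide_minus_right)
 then have A0: "A \<ge> 0" unfolding A_def using assms Cp(1) by (intro divide_nonneg_nonneg mult_nonneg_nonneg add_nonneg_nonneg) auto
 then have S0: "S \<ge> 0" unfolding S_def using C\<^sub>\<Omega>(1) Cp(1) assms \<open>Gamma (\<alpha> + 1) \<ge> 0\<close> by simp
 show ?thesis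
 proof (intro exI[of _ C] allI impI)
  fix N :: nat and f u0 and u U :: "real \<Rightarrow> 'a l2"
  assume N: "N \<ge> 1" and sol: "fractional_diffusion_solution \<Omega> K T \<alpha> f u0 u" and reg: "regularity \<Omega> T p M \<sigma> u"
   and dg: "dg_solution \<Omega> K \<alpha> (graded_mesh T \<gamma> N) N (graded_degrees p) f u0 U"
  interpret mesh: graded T \<gamma> N by unfold_locales (use assms N in auto)
  interpret g: graded_problem \<Omega> \<gamma> N \<alpha> K T M \<sigma> p f u0 u U
   by unfold_locales (use assms N sol reg dg mesh.step_pos mesh.node_0 mesh.node_N in auto)
  let ?h = "T powr (1 / \<gamma>) / real N"
  have h: "mesh.h = ?h" "?h > 0" using mesh.h_pos by (simp_all add: mesh.h_def)
  have tol: "g.tolerance = Ca * ?h powr q"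
   unfolding g.tolerance_def g.approx_const_def g.exponent_def g.rate_def g.order_def
    g.rem_exp_def Ca_def q_def h(1) ..
  have tol0: "0 \<le> (2 + 3 * (C1 + C2)) * g.tolerance" using g.tolerance_pos C1 C2 by simp
  have bound: "norm (U t - u t) \<le> C * (if p = 1 then ?h powr q else ?h powr (q - 1 / 2))"
   if m: "m \<in> {1..N}" and t: "t \<in> mesh_interval (graded_mesh T \<gamma> N) m" for m t
  proof -
   have t': "t \<in> {graded_mesh T \<gamma> N (m - 1)<..<graded_mesh T \<gamma> N m}" using t by (simp add: mesh_interval_def)
   show ?thesis
   proof (cases "p = 1")
    case True
    have "norm (U t - u t) \<le> (2 * sqrt (A * T) + T powr (- \<alpha> / 2)) * ((2 + 3 * (C1 + C2)) * g.tolerance)"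
     by (rule g.graded_cell_error(2)[OF Cp(2,3,4,1) assms(2) _ C\<^sub>\<Omega>(2) C1 C2 A_def m t' True])
      (use C\<^sub>\<Omega>(1) in \<open>simp_all\<close>)
    then show ?thesis unfolding C_def R_def if_P[OF True] tol by (simp only: mult.assoc)
   next
    case False
    have "norm (U t - u t) \<le> (C\<^sub>\<Omega> * sqrt (Cp * A * Gamma (\<alpha> + 1) * T powr (- \<alpha>) / K)
      * sqrt (graded_mesh T \<gamma> N m / (graded_mesh T \<gamma> N m - graded_mesh T \<gamma> N (m - 1))) + T powr (- \<alpha> / 2))
      * ((2 + 3 * (C1 + C2)) * g.tolerance)"
     by (rule g.graded_cell_error(1)[OF Cp(2,3,4,1) assms(2) _ C\<^sub>\<Omega>(2) C1 C2 A_def m t'])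
      (use C\<^sub>\<Omega>(1) in \<open>simp_all\<close>)
    also have "\<dots> \<le> ((S + R) * sqrt (real N)) * ((2 + 3 * (C1 + C2)) * g.tolerance)"
    proof (rule mult_right_mono[OF _ tol0])
     have "graded_mesh T \<gamma> N m / (graded_mesh T \<gamma> N m - graded_mesh T \<gamma> N (m - 1)) \<le> real m"
      by (rule mesh.node_step_ratio) (use m in simp)
     then have "graded_mesh T \<gamma> N m / (graded_mesh T \<gamma> N m - graded_mesh T \<gamma> N (m - 1)) \<le> real N"
      using m by auto
     then have "S * sqrt (graded_mesh T \<gamma> N m / (graded_mesh T \<gamma> N m - graded_mesh T \<gamma> N (m - 1))) \<le> S * sqrt (real N)"
      using S0 by (intro mult_left_mono real_sqrt_le_mono)
     moreover have "R * 1 \<le> R * sqrt (real N)" using R0 N by (intro mult_left_mono) auto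
     ultimately show "C\<^sub>\<Omega> * sqrt (Cp * A * Gamma (\<alpha> + 1) * T powr (- \<alpha>) / K)
      * sqrt (graded_mesh T \<gamma> N m / (graded_mesh T \<gamma> N m - graded_mesh T \<gamma> N (m - 1))) + T powr (- \<alpha> / 2)
      \<le> (S + R) * sqrt (real N)"
      unfolding S_def[symmetric] R_def[symmetric] by (simp add: distrib_right)
    qed
    \<comment> \<open>N = T^(1/\<gamma>) / k, so a loss of N^(1/2) lowers the power of k by
      1/2.\<close>
    also have "sqrt (real N) = sqrt (T powr (1 / \<gamma>)) * ?h powr (- (1 / 2))"
    proof -
     have "?h powr (- (1 / 2)) = 1 / sqrt ?h" using h(2) by (simp add: powr_minus_divide powr_half_sqrt)
     also have "\<dots> = sqrt (real N) / sqrt (T powr (1 / \<gamma>))" by (simp add: real_sqrt_divide)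
     finally show ?thesis using assms(3) by simp
    qed
    also have "((S + R) * (sqrt (T powr (1 / \<gamma>)) * ?h powr (- (1 / 2)))) * ((2 + 3 * (C1 + C2)) * g.tolerance)
      = ((S + R) * sqrt (T powr (1 / \<gamma>))) * ((2 + 3 * (C1 + C2)) * Ca) * (?h powr q * ?h powr (- (1 / 2)))"
     unfolding tol by (simp only: mult_ac)
    also have "?h powr q * ?h powr (- (1 / 2)) = ?h powr (q - 1 / 2)" by (simp flip: powr_add)
    finally show ?thesis unfolding C_def if_not_P[OF False] .
   qed
  qed
  have "Linf_L2_norm (graded_mesh T \<gamma> N) N (\<lambda>t. U t - u t) \<le> C * (if p = 1 then ?h powr q else ?h powr (q - 1 / 2))"
   unfolding Linf_L2_norm_def
  proof (rule Max.boundedI)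
   fix a assume "a \<in> (\<lambda>n. SUP t\<in>mesh_interval (graded_mesh T \<gamma> N) n. norm (U t - u t)) ` {1..N}"
   then obtain m where m: "m \<in> {1..N}" and a: "a = (SUP t\<in>mesh_interval (graded_mesh T \<gamma> N) m. norm (U t - u t))" by blast
   have "graded_mesh T \<gamma> N (m - 1) < graded_mesh T \<gamma> N m" by (rule mesh.step_pos) (use m in simp)
   then have "mesh_interval (graded_mesh T \<gamma> N) m \<noteq> {}" by (simp add: mesh_interval_def)
   then show "a \<le> C * (if p = 1 then ?h powr q else ?h powr (q - 1 / 2))"
    unfolding a by (rule cSUP_least) (rule bound[OF m])
  qed (use N in auto)
  then show "let k = ?h in Linf_L2_norm (graded_mesh T \<gamma> N) N (\<lambda>t. U t - u t) \<le>
    C * (if p = 1 then k powr (min (\<gamma> * (\<sigma> + \<alpha> / 2)) (2 + \<alpha> / 2))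
       else k powr (min (\<gamma> * (\<sigma> + \<alpha> / 2)) (real p + 1 + \<alpha> / 2) - 1 / 2))"
   unfolding Let_def q_def by (cases "p = 1") simp_all
 qed
qed

end
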